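(* Let $k$ be a field, let $\mathcal{C}\to\mathcal{B}=\mathcal{C}/G$ be a Galois covering of $k$-categories with group $G$, and let $\mathcal{M}$ be a $\mathcal{B}$-bimodule. Then there is a first quadrant (homological) spectral sequence converging to $H_n(\mathcal{B},\mathcal{M})$ with level $2$ term $$E^2_{p,q}=H_p\bigl(G,\,H_q(\mathcal{C},L\mathcal{M})\bigr),$$ where $H_p(G,X)$ denotes the usual group homology of $G$ with coefficients in a $kG$-module $X$.
   Context: $k$-categories and bimodules. A $k$-category is a small category whose morphism sets are $k$-vector spaces and whose composition is $k$-bilinear. $\mathcal{C}_0$ is the set of objects and ${}_y\mathcal{C}_x$ is the space of morphisms from $x$ to $y$, so composition is ${}_z\mathcal{C}_y\otimes_k{}_y\mathcal{C}_x\to{}_z\mathcal{C}_x$. A $\mathcal{C}$-bimodule $\mathcal{M}$ is a family of vector spaces $\{{}_y\mathcal{M}_x\}_{x,y\in\mathcal{C}_0}$ with $k$-bilinear left and right actions ${}_z\mathcal{C}_y\otimes{}_y\mathcal{M}_x\to{}_z\mathcal{M}_x$ and ${}_y\mathcal{M}_x\otimes{}_x\mathcal{C}_u\to{}_y\mathcal{M}_u$ that are associative, unital and commute with each other. Hochschild-Mitchell homology. $H_*(\mathcal{C},\mathcal{M})$ is the homology of the chain complex with $C_0(\mathcal{C},\mathcal{M})=\bigoplus_x{}_x\mathcal{M}_x$ and, for $n\ge1$, $$C_n(\mathcal{C},\mathcal{M})=\bigoplus_{(x_{n+1},\dots,x_1)}{}_{x_1}\mathcal{M}_{x_{n+1}}\otimes_k{}_{x_{n+1}}\mathcal{C}_{x_n}\otimes_k\cdots\otimes_k{}_{x_2}\mathcal{C}_{x_1},$$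 with the usual Hochschild boundary $d(m,c_n,\dots,c_1)=(mc_n,c_{n-1},\dots,c_1)+\sum_{i=1}^{n-1}(-1)^i(m,c_n,\dots,c_{n-i+1}c_{n-i},\dots,c_1)+(-1)^n(c_1m,c_n,\dots,c_2)$. Galois coverings. A group $G$ acts freely on $\mathcal{C}$ if $G$ acts on $\mathcal{C}_0$ with $sx=x$ for some $x$ only when $s=1$, and acts on morphisms by $k$-linear maps $s:{}_y\mathcal{C}_x\to{}_{sy}\mathcal{C}_{sx}$ with $s(dc)=(sd)(sc)$ and $s(tc)=(st)c$. For a $kG$-module $X$, $X/G$ denotes the coinvariants $X/(\operatorname{Ker}\epsilon)X$, where $\epsilon:kG\to k$ is the augmentation. The quotient category $\mathcal{C}/G$ has as objects the $G$-orbits of objects of $\mathcal{C}$, and for orbits $u,v$, ${}_v(\mathcal{C}/G)_u=\bigl(\bigoplus_{x\in u,\,y\in v}{}_y\mathcal{C}_x\bigr)/G$. The composition of the class of $d\in{}_z\mathcal{C}_{y'}$ with the class of $c\in{}_y\mathcal{C}_x$ ($y,y'$ in the same orbit) is the class of $(sd)c$, where $s$ is the unique element of $G$ with $sy'=y$. A Galois covering with group $G$ is the projection functor $\mathcal{C}\to\mathcal{B}=\mathcal{C}/G$ for a free action of $G$ on $\mathcal{C}$. Write $\overline{x}$ for the orbit of $x$ and $\overline{c}$ for the class of $c$. Lifted bimodule. For a $\mathcal{B}$-bimodule $\mathcal{M}$, the $\mathcal{C}$-bimodule $L\mathcal{M}$ is ${}_y(L\mathcal{M})_x={}_{\overline{y}}\mathcal{M}_{\overline{x}}$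 with actions $c\cdot m=\overline{c}\,m$, $m\cdot c=m\,\overline{c}$. Action of $G$ on homology. $G$ acts on $C_*(\mathcal{C},L\mathcal{M})$, hence on $H_*(\mathcal{C},L\mathcal{M})$, by $s(m,c_n,\dots,c_1)=(m,sc_n,\dots,sc_1)$, where on the right $m$ is regarded as an element of ${}_{sx_1}(L\mathcal{M})_{sx_{n+1}}={}_{\overline{x_1}}\mathcal{M}_{\overline{x_{n+1}}}={}_{x_1}(L\mathcal{M})_{x_{n+1}}$. *)

theory Defs
  imports "HOL-Algebra.Module" "HOL-Algebra.AbelCoset" "HOL-Algebra.Group_Action"
begin

text \<open>
  Vector spaces over a field \<open>K\<close> are modules over \<open>K\<close> in the sense of \<^locale>\<open>module\<close>. The fields
  \<^const>\<open>monoid.mult\<close> and \<^const>\<open>monoid.one\<close>, which the record type inherits from rings, play no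
  role and are left \<^const>\<open>undefined\<close> in the constructions below.
\<close>

section \<open>Linear algebra\<close>

definition mod_hom ::
  "('k, 'z) ring_scheme \<Rightarrow> ('k, 'a) module \<Rightarrow> ('k, 'b) module \<Rightarrow> ('a \<Rightarrow> 'b) set" where
  "mod_hom K M N = {h. h \<in> carrier M \<rightarrow> carrier N \<and>
     (\<forall>x\<in>carrier M. \<forall>y\<in>carrier M. h (x \<oplus>\<^bsub>M\<^esub> y) = h x \<oplus>\<^bsub>N\<^esub> h y) \<and>
     (\<forall>a\<in>carrier K. \<forall>x\<in>carrier M. h (a \<odot>\<^bsub>M\<^esub> x) = a \<odot>\<^bsub>N\<^esub> h x)}"

definition mod_isomorphic ::
  "('k, 'z) ring_scheme \<Rightarrow> ('k, 'a) module \<Rightarrow> ('k, 'b) module \<Rightarrow> bool" where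
  "mod_isomorphic K M N \<longleftrightarrow> (\<exists>h\<in>mod_hom K M N. bij_betw h (carrier M) (carrier N))"

definition bilinear_map ::
  "('k, 'z) ring_scheme \<Rightarrow> ('k, 'a) module \<Rightarrow> ('k, 'b) module \<Rightarrow> ('k, 'c) module
    \<Rightarrow> ('a \<Rightarrow> 'b \<Rightarrow> 'c) \<Rightarrow> bool" where
  "bilinear_map K U V W f \<longleftrightarrow>
     (\<forall>u\<in>carrier U. f u \<in> mod_hom K V W) \<and> (\<forall>v\<in>carrier V. (\<lambda>u. f u v) \<in> mod_hom K U W)"

definition mod_span ::
  "('k, 'z) ring_scheme \<Rightarrow> ('k, 'a) module \<Rightarrow> 'a set \<Rightarrow> 'a set" where
  "mod_span K M S = \<Inter>{N. submodule N K M \<and> S \<subseteq> N}"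

text \<open>
  A map \<open>h\<close> that is constant on the coset \<open>A\<close> has a value at \<open>A\<close>: this is how maps out of a quotient
  are defined by their values on representatives.
\<close>

definition quot_lift :: "('a \<Rightarrow> 'b) \<Rightarrow> 'a set \<Rightarrow> 'b" where
  "quot_lift h A = the_elem (h ` A)"

definition quot_mod :: "('k, 'a) module \<Rightarrow> 'a set \<Rightarrow> ('k, 'a set) module" where
  "quot_mod M N = \<lparr>carrier = a_rcosets\<^bsub>M\<^esub> N, mult = undefined, one = undefined,
     zero = N, add = set_add M, smult = (\<lambda>a. quot_lift (\<lambda>x. N +>\<^bsub>M\<^esub> (a \<odot>\<^bsub>M\<^esub> x)))\<rparr>"

definition dsum :: "'i set \<Rightarrow> ('i \<Rightarrow> ('k, 'a) module) \<Rightarrow> ('k, 'i \<Rightarrow> 'a) module" where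
  "dsum I X = \<lparr>carrier = {f \<in> (\<Pi>\<^sub>E i\<in>I. carrier (X i)). finite {i \<in> I. f i \<noteq> \<zero>\<^bsub>X i\<^esub>}},
     mult = undefined, one = undefined, zero = (\<lambda>i\<in>I. \<zero>\<^bsub>X i\<^esub>),
     add = (\<lambda>f g. \<lambda>i\<in>I. f i \<oplus>\<^bsub>X i\<^esub> g i), smult = (\<lambda>a f. \<lambda>i\<in>I. a \<odot>\<^bsub>X i\<^esub> f i)\<rparr>"

definition dsum_inj :: "'i set \<Rightarrow> ('i \<Rightarrow> ('k, 'a) module) \<Rightarrow> 'i \<Rightarrow> 'a \<Rightarrow> ('i \<Rightarrow> 'a)" where
  "dsum_inj I X i x = (\<lambda>j\<in>I. if j = i then x else \<zero>\<^bsub>X j\<^esub>)"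

text \<open>The map from the direct sum to \<open>N\<close> whose restriction to the summand with index \<open>i\<close> is \<open>h i\<close>.\<close>

definition dsum_lift ::
  "'i set \<Rightarrow> ('i \<Rightarrow> ('k, 'a) module) \<Rightarrow> ('k, 'b) module \<Rightarrow> ('i \<Rightarrow> 'a \<Rightarrow> 'b)
    \<Rightarrow> ('i \<Rightarrow> 'a) \<Rightarrow> 'b" where
  "dsum_lift I X N h f = (\<Oplus>\<^bsub>N\<^esub>i\<in>{i \<in> I. f i \<noteq> \<zero>\<^bsub>X i\<^esub>}. h i (f i))"

definition regular_mod :: "('k, 'z) ring_scheme \<Rightarrow> ('k, 'k) module" where
  "regular_mod K = \<lparr>carrier = carrier K, mult = mult K, one = one K,
     zero = zero K, add = add K, smult = mult K\<rparr>"

definition free_mod :: "('k, 'z) ring_scheme \<Rightarrow> 's set \<Rightarrow> ('k, 's \<Rightarrow> 'k) module" where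
  "free_mod K S = dsum S (\<lambda>_. regular_mod K)"

definition free_gen :: "('k, 'z) ring_scheme \<Rightarrow> 's set \<Rightarrow> 's \<Rightarrow> ('s \<Rightarrow> 'k)" where
  "free_gen K S s = dsum_inj S (\<lambda>_. regular_mod K) s \<one>\<^bsub>K\<^esub>"

definition free_lift ::
  "('k, 'z) ring_scheme \<Rightarrow> 's set \<Rightarrow> ('k, 'b) module \<Rightarrow> ('s \<Rightarrow> 'b) \<Rightarrow> ('s \<Rightarrow> 'k) \<Rightarrow> 'b" where
  "free_lift K S N h = dsum_lift S (\<lambda>_. regular_mod K) N (\<lambda>s a. a \<odot>\<^bsub>N\<^esub> h s)"

definition alt_sum :: "('k, 'a) module \<Rightarrow> nat \<Rightarrow> (nat \<Rightarrow> 'a) \<Rightarrow> 'a" where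
  "alt_sum M n x = (\<Oplus>\<^bsub>M\<^esub>i\<in>{..n}. if even i then x i else \<ominus>\<^bsub>M\<^esub> x i)"

text \<open>
  The tensor product over \<open>K\<close> of \<open>M\<close> and the modules in the list \<open>Ns\<close>: the free module on the
  tuples \<open>(m, cs)\<close>, where \<open>cs\<close> lists one element of each module in \<open>Ns\<close>, modulo multilinearity.
\<close>

definition tuples :: "('k, 'm) module \<Rightarrow> ('k, 'c) module list \<Rightarrow> ('m \<times> 'c list) set" where
  "tuples M Ns = carrier M \<times> listset (map carrier Ns)"

definition tensor_rel ::
  "('k, 'z) ring_scheme \<Rightarrow> ('k, 'm) module \<Rightarrow> ('k, 'c) module list
    \<Rightarrow> ('m \<times> 'c list \<Rightarrow> 'k) set" where
  "tensor_rel K M Ns =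
    (let F = free_mod K (tuples M Ns); e = (\<lambda>m cs. free_gen K (tuples M Ns) (m, cs)) in
     mod_span K F
      ({e (m \<oplus>\<^bsub>M\<^esub> m') cs \<ominus>\<^bsub>F\<^esub> (e m cs \<oplus>\<^bsub>F\<^esub> e m' cs) | m m' cs.
          m \<in> carrier M \<and> m' \<in> carrier M \<and> cs \<in> listset (map carrier Ns)}
       \<union> {e (a \<odot>\<^bsub>M\<^esub> m) cs \<ominus>\<^bsub>F\<^esub> a \<odot>\<^bsub>F\<^esub> e m cs | a m cs.
          a \<in> carrier K \<and> m \<in> carrier M \<and> cs \<in> listset (map carrier Ns)}
       \<union> {e m (cs[i := c \<oplus>\<^bsub>Ns ! i\<^esub> c']) \<ominus>\<^bsub>F\<^esub> (e m (cs[i := c]) \<oplus>\<^bsub>F\<^esub> e m (cs[i := c'])) | m cs i c c'.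
          m \<in> carrier M \<and> cs \<in> listset (map carrier Ns) \<and> i < length Ns \<and>
          c \<in> carrier (Ns ! i) \<and> c' \<in> carrier (Ns ! i)}
       \<union> {e m (cs[i := a \<odot>\<^bsub>Ns ! i\<^esub> c]) \<ominus>\<^bsub>F\<^esub> a \<odot>\<^bsub>F\<^esub> e m (cs[i := c]) | a m cs i c.
          a \<in> carrier K \<and> m \<in> carrier M \<and> cs \<in> listset (map carrier Ns) \<and> i < length Ns \<and>
          c \<in> carrier (Ns ! i)}))"

definition tensor ::
  "('k, 'z) ring_scheme \<Rightarrow> ('k, 'm) module \<Rightarrow> ('k, 'c) module list
    \<Rightarrow> ('k, ('m \<times> 'c list \<Rightarrow> 'k) set) module" where
  "tensor K M Ns = quot_mod (free_mod K (tuples M Ns)) (tensor_rel K M Ns)"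

definition pure_tensor ::
  "('k, 'z) ring_scheme \<Rightarrow> ('k, 'm) module \<Rightarrow> ('k, 'c) module list
    \<Rightarrow> 'm \<Rightarrow> 'c list \<Rightarrow> ('m \<times> 'c list \<Rightarrow> 'k) set" where
  "pure_tensor K M Ns m cs =
     tensor_rel K M Ns +>\<^bsub>free_mod K (tuples M Ns)\<^esub> free_gen K (tuples M Ns) (m, cs)"

text \<open>The linear map from the tensor product to \<open>N\<close> induced by a multilinear map \<open>h\<close>.\<close>

definition tensor_lift ::
  "('k, 'z) ring_scheme \<Rightarrow> ('k, 'm) module \<Rightarrow> ('k, 'c) module list \<Rightarrow> ('k, 'b) module
    \<Rightarrow> ('m \<Rightarrow> 'c list \<Rightarrow> 'b) \<Rightarrow> ('m \<times> 'c list \<Rightarrow> 'k) set \<Rightarrow> 'b" where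
  "tensor_lift K M Ns N h = quot_lift (free_lift K (tuples M Ns) N (\<lambda>(m, cs). h m cs))"

section \<open>Homology of chain complexes in nonnegative degrees\<close>

definition cycles ::
  "(nat \<Rightarrow> ('k, 'a) module) \<Rightarrow> (nat \<Rightarrow> 'a \<Rightarrow> 'a) \<Rightarrow> nat \<Rightarrow> 'a set" where
  "cycles X d n = (if n = 0 then carrier (X 0) else a_kernel (X n) (X (n - 1)) (d n))"

definition boundaries ::
  "(nat \<Rightarrow> ('k, 'a) module) \<Rightarrow> (nat \<Rightarrow> 'a \<Rightarrow> 'a) \<Rightarrow> nat \<Rightarrow> 'a set" where
  "boundaries X d n = d (Suc n) ` carrier (X (Suc n))"

definition homology ::
  "(nat \<Rightarrow> ('k, 'a) module) \<Rightarrow> (nat \<Rightarrow> 'a \<Rightarrow> 'a) \<Rightarrow> nat \<Rightarrow> ('k, 'a set) module" where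
  "homology X d n = quot_mod ((X n)\<lparr>carrier := cycles X d n\<rparr>) (boundaries X d n)"

definition homology_map ::
  "(nat \<Rightarrow> ('k, 'a) module) \<Rightarrow> (nat \<Rightarrow> 'a \<Rightarrow> 'a) \<Rightarrow> nat \<Rightarrow> ('a \<Rightarrow> 'a) \<Rightarrow> 'a set \<Rightarrow> 'a set" where
  "homology_map X d n h = quot_lift (\<lambda>x. boundaries X d n +>\<^bsub>X n\<^esub> h x)"

section \<open>Group homology and coinvariants\<close>

text \<open>
  A \<open>KG\<close>-module is a \<open>K\<close>-module \<open>X\<close> with a linear action \<open>\<rho>\<close> of \<open>G\<close> from the left. Its homology is
  computed by the bar complex, that is \<open>P \<otimes> X\<close> over \<open>KG\<close>, where \<open>P\<close> is the bar resolution of the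
  trivial module by free right \<open>KG\<close>-modules. In degree \<open>p\<close> it is the direct sum of copies of \<open>X\<close>
  indexed by the symbols \<open>[g\<^sub>1|...|g\<^sub>p]\<close>; the \<open>i\<close>-th face of \<open>[g\<^sub>1|...|g\<^sub>p]x\<close> is
  \<open>[g\<^sub>2|...|g\<^sub>p]x\<close> for \<open>i = 0\<close>, \<open>[g\<^sub>1|...|g\<^sub>p\<^sub>-\<^sub>1](g\<^sub>p x)\<close> for \<open>i = p\<close>, and otherwise multiplies
  \<open>g\<^sub>i\<close> and \<open>g\<^sub>i\<^sub>+\<^sub>1\<close>.
\<close>

definition bar_words :: "('g, 'y) monoid_scheme \<Rightarrow> nat \<Rightarrow> 'g list set" where
  "bar_words G p = {gs. set gs \<subseteq> carrier G \<and> length gs = p}"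

definition bar_chain ::
  "('g, 'y) monoid_scheme \<Rightarrow> ('k, 'x) module \<Rightarrow> nat \<Rightarrow> ('k, 'g list \<Rightarrow> 'x) module" where
  "bar_chain G X p = dsum (bar_words G p) (\<lambda>_. X)"

definition bar_face ::
  "('g, 'y) monoid_scheme \<Rightarrow> ('g \<Rightarrow> 'x \<Rightarrow> 'x) \<Rightarrow> nat \<Rightarrow> nat \<Rightarrow> 'g list \<Rightarrow> 'x \<Rightarrow> 'g list \<times> 'x" where
  "bar_face G \<rho> p i gs x =
     (if i = 0 then (tl gs, x)
      else if i = p then (butlast gs, \<rho> (last gs) x)
      else (take (i - 1) gs @ [gs ! (i - 1) \<otimes>\<^bsub>G\<^esub> gs ! i] @ drop (Suc i) gs, x))"

definition bar_boundary ::
  "('g, 'y) monoid_scheme \<Rightarrow> ('k, 'x) module \<Rightarrow> ('g \<Rightarrow> 'x \<Rightarrow> 'x) \<Rightarrow> nat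
    \<Rightarrow> ('g list \<Rightarrow> 'x) \<Rightarrow> ('g list \<Rightarrow> 'x)" where
  "bar_boundary G X \<rho> p =
     dsum_lift (bar_words G p) (\<lambda>_. X) (bar_chain G X (p - 1))
       (\<lambda>gs x. alt_sum (bar_chain G X (p - 1)) p
          (\<lambda>i. case bar_face G \<rho> p i gs x of
                 (gs', x') \<Rightarrow> dsum_inj (bar_words G (p - 1)) (\<lambda>_. X) gs' x'))"

definition group_homology ::
  "('g, 'y) monoid_scheme \<Rightarrow> ('k, 'x) module \<Rightarrow> ('g \<Rightarrow> 'x \<Rightarrow> 'x) \<Rightarrow> nat
    \<Rightarrow> ('k, ('g list \<Rightarrow> 'x) set) module" where
  "group_homology G X \<rho> = homology (bar_chain G X) (bar_boundary G X \<rho>)"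

text \<open>The group algebra \<open>KG\<close> is the free module on \<open>G\<close>; only its module structure is needed here.\<close>

definition augmentation ::
  "('k, 'z) ring_scheme \<Rightarrow> ('g, 'y) monoid_scheme \<Rightarrow> ('g \<Rightarrow> 'k) \<Rightarrow> 'k" where
  "augmentation K G a = (\<Oplus>\<^bsub>K\<^esub>g\<in>{g \<in> carrier G. a g \<noteq> \<zero>\<^bsub>K\<^esub>}. a g)"

definition group_alg_act ::
  "('k, 'z) ring_scheme \<Rightarrow> ('g, 'y) monoid_scheme \<Rightarrow> ('k, 'x) module \<Rightarrow> ('g \<Rightarrow> 'x \<Rightarrow> 'x)
    \<Rightarrow> ('g \<Rightarrow> 'k) \<Rightarrow> 'x \<Rightarrow> 'x" where
  "group_alg_act K G X \<rho> a x = free_lift K (carrier G) X (\<lambda>g. \<rho> g x) a"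

definition aug_ideal_mult ::
  "('k, 'z) ring_scheme \<Rightarrow> ('g, 'y) monoid_scheme \<Rightarrow> ('k, 'x) module \<Rightarrow> ('g \<Rightarrow> 'x \<Rightarrow> 'x)
    \<Rightarrow> 'x set" where
  "aug_ideal_mult K G X \<rho> = mod_span K X
     {group_alg_act K G X \<rho> a x | a x.
        a \<in> carrier (free_mod K (carrier G)) \<and> augmentation K G a = \<zero>\<^bsub>K\<^esub> \<and> x \<in> carrier X}"

definition coinvariants ::
  "('k, 'z) ring_scheme \<Rightarrow> ('g, 'y) monoid_scheme \<Rightarrow> ('k, 'x) module \<Rightarrow> ('g \<Rightarrow> 'x \<Rightarrow> 'x)
    \<Rightarrow> ('k, 'x set) module" where
  "coinvariants K G X \<rho> = quot_mod X (aug_ideal_mult K G X \<rho>)"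

section \<open>Linear categories and bimodules\<close>

text \<open>
  \<open>Hom C y x\<close> is the space of morphisms from \<open>x\<close> to \<open>y\<close>. The spaces for different pairs of objects
  need not be disjoint, so the operations take the objects involved as arguments:
  \<open>Cmp C z y x d c\<close> is the composite of \<open>c\<close> from \<open>x\<close> to \<open>y\<close> followed by \<open>d\<close> from \<open>y\<close> to \<open>z\<close>.
\<close>

record ('o, 'k, 'c) kcat =
  Ob :: "'o set"
  Hom :: "'o \<Rightarrow> 'o \<Rightarrow> ('k, 'c) module"
  Cmp :: "'o \<Rightarrow> 'o \<Rightarrow> 'o \<Rightarrow> 'c \<Rightarrow> 'c \<Rightarrow> 'c"
  Idn :: "'o \<Rightarrow> 'c"

locale k_category =
  fixes K :: "('k, 'z) ring_scheme" and C :: "('o, 'k, 'c) kcat"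
  assumes Hom_module: "\<And>y x. \<lbrakk>y \<in> Ob C; x \<in> Ob C\<rbrakk> \<Longrightarrow> module K (Hom C y x)"
    and Cmp_bilinear: "\<And>z y x. \<lbrakk>z \<in> Ob C; y \<in> Ob C; x \<in> Ob C\<rbrakk>
      \<Longrightarrow> bilinear_map K (Hom C z y) (Hom C y x) (Hom C z x) (Cmp C z y x)"
    and Cmp_assoc: "\<And>w z y x e d c. \<lbrakk>w \<in> Ob C; z \<in> Ob C; y \<in> Ob C; x \<in> Ob C;
        e \<in> carrier (Hom C w z); d \<in> carrier (Hom C z y); c \<in> carrier (Hom C y x)\<rbrakk>
      \<Longrightarrow> Cmp C w y x (Cmp C w z y e d) c = Cmp C w z x e (Cmp C z y x d c)"
    and Idn_closed: "\<And>x. x \<in> Ob C \<Longrightarrow> Idn C x \<in> carrier (Hom C x x)"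
    and Cmp_Idn_left: "\<And>y x c. \<lbrakk>y \<in> Ob C; x \<in> Ob C; c \<in> carrier (Hom C y x)\<rbrakk>
      \<Longrightarrow> Cmp C y y x (Idn C y) c = c"
    and Cmp_Idn_right: "\<And>y x c. \<lbrakk>y \<in> Ob C; x \<in> Ob C; c \<in> carrier (Hom C y x)\<rbrakk>
      \<Longrightarrow> Cmp C y x x c (Idn C x) = c"

text \<open>
  \<open>Lact M z y x c m\<close> is \<open>cm\<close> for \<open>c\<close> in \<open>Hom C z y\<close> and \<open>m\<close> in \<open>Bim M y x\<close>;
  \<open>Ract M y x u m c\<close> is \<open>mc\<close> for \<open>m\<close> in \<open>Bim M y x\<close> and \<open>c\<close> in \<open>Hom C x u\<close>.
\<close>

record ('o, 'k, 'c, 'm) bimod =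
  Bim :: "'o \<Rightarrow> 'o \<Rightarrow> ('k, 'm) module"
  Lact :: "'o \<Rightarrow> 'o \<Rightarrow> 'o \<Rightarrow> 'c \<Rightarrow> 'm \<Rightarrow> 'm"
  Ract :: "'o \<Rightarrow> 'o \<Rightarrow> 'o \<Rightarrow> 'm \<Rightarrow> 'c \<Rightarrow> 'm"

locale bimodule =
  fixes K :: "('k, 'z) ring_scheme" and C :: "('o, 'k, 'c) kcat" and M :: "('o, 'k, 'c, 'm) bimod"
  assumes Bim_module: "\<And>y x. \<lbrakk>y \<in> Ob C; x \<in> Ob C\<rbrakk> \<Longrightarrow> module K (Bim M y x)"
    and Lact_bilinear: "\<And>z y x. \<lbrakk>z \<in> Ob C; y \<in> Ob C; x \<in> Ob C\<rbrakk>
      \<Longrightarrow> bilinear_map K (Hom C z y) (Bim M y x) (Bim M z x) (Lact M z y x)"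
    and Ract_bilinear: "\<And>y x u. \<lbrakk>y \<in> Ob C; x \<in> Ob C; u \<in> Ob C\<rbrakk>
      \<Longrightarrow> bilinear_map K (Bim M y x) (Hom C x u) (Bim M y u) (Ract M y x u)"
    and Lact_assoc: "\<And>w z y x d c m. \<lbrakk>w \<in> Ob C; z \<in> Ob C; y \<in> Ob C; x \<in> Ob C;
        d \<in> carrier (Hom C w z); c \<in> carrier (Hom C z y); m \<in> carrier (Bim M y x)\<rbrakk>
      \<Longrightarrow> Lact M w y x (Cmp C w z y d c) m = Lact M w z x d (Lact M z y x c m)"
    and Ract_assoc: "\<And>y x u v m c d. \<lbrakk>y \<in> Ob C; x \<in> Ob C; u \<in> Ob C; v \<in> Ob C;
        m \<in> carrier (Bim M y x); c \<in> carrier (Hom C x u); d \<in> carrier (Hom C u v)\<rbrakk>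
      \<Longrightarrow> Ract M y x v m (Cmp C x u v c d) = Ract M y u v (Ract M y x u m c) d"
    and Lact_Idn: "\<And>y x m. \<lbrakk>y \<in> Ob C; x \<in> Ob C; m \<in> carrier (Bim M y x)\<rbrakk>
      \<Longrightarrow> Lact M y y x (Idn C y) m = m"
    and Ract_Idn: "\<And>y x m. \<lbrakk>y \<in> Ob C; x \<in> Ob C; m \<in> carrier (Bim M y x)\<rbrakk>
      \<Longrightarrow> Ract M y x x m (Idn C x) = m"
    and Lact_Ract: "\<And>z y x u c m d. \<lbrakk>z \<in> Ob C; y \<in> Ob C; x \<in> Ob C; u \<in> Ob C;
        c \<in> carrier (Hom C z y); m \<in> carrier (Bim M y x); d \<in> carrier (Hom C x u)\<rbrakk>
      \<Longrightarrow> Ract M z x u (Lact M z y x c m) d = Lact M z y u c (Ract M y x u m d)"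

section \<open>Hochschild-Mitchell homology\<close>

text \<open>
  A sequence of objects \<open>(x\<^sub>n\<^sub>+\<^sub>1, ..., x\<^sub>1)\<close> is the list \<open>xs\<close> of length \<open>n + 1\<close> in this order, and
  \<open>(c\<^sub>n, ..., c\<^sub>1)\<close> is a list \<open>cs\<close>, so that \<open>cs ! i\<close> is in \<open>Hom C (xs ! i) (xs ! Suc i)\<close> and the
  coefficient is in \<open>Bim M (last xs) (hd xs)\<close>. For \<open>n = 0\<close> the tensor product has the single factor
  \<open>Bim M x x\<close>, to which it is canonically isomorphic.
\<close>

definition HM_seqs :: "('o, 'k, 'c) kcat \<Rightarrow> nat \<Rightarrow> 'o list set" where
  "HM_seqs C n = {xs. set xs \<subseteq> Ob C \<and> length xs = Suc n}"

definition HM_coeff :: "('o, 'k, 'c, 'm) bimod \<Rightarrow> 'o list \<Rightarrow> ('k, 'm) module" where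
  "HM_coeff M xs = Bim M (last xs) (hd xs)"

definition HM_homs :: "('o, 'k, 'c) kcat \<Rightarrow> 'o list \<Rightarrow> ('k, 'c) module list" where
  "HM_homs C xs = map (\<lambda>i. Hom C (xs ! i) (xs ! Suc i)) [0..<length xs - 1]"

definition HM_summand ::
  "('k, 'z) ring_scheme \<Rightarrow> ('o, 'k, 'c) kcat \<Rightarrow> ('o, 'k, 'c, 'm) bimod \<Rightarrow> 'o list
    \<Rightarrow> ('k, ('m \<times> 'c list \<Rightarrow> 'k) set) module" where
  "HM_summand K C M xs = tensor K (HM_coeff M xs) (HM_homs C xs)"

type_synonym ('o, 'k, 'c, 'm) hm_chain = "'o list \<Rightarrow> ('m \<times> 'c list \<Rightarrow> 'k) set"

definition HM_chain ::
  "('k, 'z) ring_scheme \<Rightarrow> ('o, 'k, 'c) kcat \<Rightarrow> ('o, 'k, 'c, 'm) bimod \<Rightarrow> nat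
    \<Rightarrow> ('k, ('o, 'k, 'c, 'm) hm_chain) module" where
  "HM_chain K C M n = dsum (HM_seqs C n) (HM_summand K C M)"

definition HM_gen ::
  "('k, 'z) ring_scheme \<Rightarrow> ('o, 'k, 'c) kcat \<Rightarrow> ('o, 'k, 'c, 'm) bimod \<Rightarrow> nat
    \<Rightarrow> 'o list \<times> 'm \<times> 'c list \<Rightarrow> ('o, 'k, 'c, 'm) hm_chain" where
  "HM_gen K C M n = (\<lambda>(xs, m, cs). dsum_inj (HM_seqs C n) (HM_summand K C M) xs
     (pure_tensor K (HM_coeff M xs) (HM_homs C xs) m cs))"

text \<open>The linear map given on generators \<open>(m, c\<^sub>n, ..., c\<^sub>1)\<close> by \<open>h\<close>.\<close>

definition HM_lift ::
  "('k, 'z) ring_scheme \<Rightarrow> ('o, 'k, 'c) kcat \<Rightarrow> ('o, 'k, 'c, 'm) bimod \<Rightarrow> nat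
    \<Rightarrow> ('k, 'b) module \<Rightarrow> ('o list \<times> 'm \<times> 'c list \<Rightarrow> 'b) \<Rightarrow> ('o, 'k, 'c, 'm) hm_chain \<Rightarrow> 'b" where
  "HM_lift K C M n N h = dsum_lift (HM_seqs C n) (HM_summand K C M) N
     (\<lambda>xs. tensor_lift K (HM_coeff M xs) (HM_homs C xs) N (\<lambda>m cs. h (xs, m, cs)))"

definition HM_face ::
  "('o, 'k, 'c) kcat \<Rightarrow> ('o, 'k, 'c, 'm) bimod \<Rightarrow> nat \<Rightarrow> nat
    \<Rightarrow> 'o list \<times> 'm \<times> 'c list \<Rightarrow> 'o list \<times> 'm \<times> 'c list" where
  "HM_face C M n i = (\<lambda>(xs, m, cs).
     if i = 0 then (tl xs, Ract M (last xs) (xs ! 0) (xs ! 1) m (hd cs), tl cs)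
     else if i = n then
       (butlast xs, Lact M (xs ! (n - 1)) (xs ! n) (hd xs) (last cs) m, butlast cs)
     else
       (take i xs @ drop (Suc i) xs, m,
        take (i - 1) cs
          @ [Cmp C (xs ! (i - 1)) (xs ! i) (xs ! Suc i) (cs ! (i - 1)) (cs ! i)]
          @ drop (Suc i) cs))"

definition HM_boundary ::
  "('k, 'z) ring_scheme \<Rightarrow> ('o, 'k, 'c) kcat \<Rightarrow> ('o, 'k, 'c, 'm) bimod \<Rightarrow> nat
    \<Rightarrow> ('o, 'k, 'c, 'm) hm_chain \<Rightarrow> ('o, 'k, 'c, 'm) hm_chain" where
  "HM_boundary K C M n = HM_lift K C M n (HM_chain K C M (n - 1))
     (\<lambda>t. alt_sum (HM_chain K C M (n - 1)) n (\<lambda>i. HM_gen K C M (n - 1) (HM_face C M n i t)))"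

definition HM_homology ::
  "('k, 'z) ring_scheme \<Rightarrow> ('o, 'k, 'c) kcat \<Rightarrow> ('o, 'k, 'c, 'm) bimod \<Rightarrow> nat
    \<Rightarrow> ('k, ('o, 'k, 'c, 'm) hm_chain set) module" where
  "HM_homology K C M = homology (HM_chain K C M) (HM_boundary K C M)"

section \<open>Galois coverings\<close>

text \<open>\<open>\<psi> s y x\<close> is the action of \<open>s\<close> on the morphisms from \<open>x\<close> to \<open>y\<close>.\<close>

locale free_category_action =
  group G + group_action G "Ob C" \<phi>
  for K :: "('k, 'z) ring_scheme" and G :: "('g, 'y) monoid_scheme" (structure)
    and C :: "('o, 'k, 'c) kcat" and \<phi> :: "'g \<Rightarrow> 'o \<Rightarrow> 'o"
    and \<psi> :: "'g \<Rightarrow> 'o \<Rightarrow> 'o \<Rightarrow> 'c \<Rightarrow> 'c" +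
  assumes free: "\<And>s x. \<lbrakk>s \<in> carrier G; x \<in> Ob C; \<phi> s x = x\<rbrakk> \<Longrightarrow> s = \<one>"
    and mor_linear: "\<And>s y x. \<lbrakk>s \<in> carrier G; y \<in> Ob C; x \<in> Ob C\<rbrakk>
      \<Longrightarrow> \<psi> s y x \<in> mod_hom K (Hom C y x) (Hom C (\<phi> s y) (\<phi> s x))"
    and mor_Cmp: "\<And>s z y x d c. \<lbrakk>s \<in> carrier G; z \<in> Ob C; y \<in> Ob C; x \<in> Ob C;
        d \<in> carrier (Hom C z y); c \<in> carrier (Hom C y x)\<rbrakk>
      \<Longrightarrow> \<psi> s z x (Cmp C z y x d c) = Cmp C (\<phi> s z) (\<phi> s y) (\<phi> s x) (\<psi> s z y d) (\<psi> s y x c)"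
    and mor_mult: "\<And>s t y x c. \<lbrakk>s \<in> carrier G; t \<in> carrier G; y \<in> Ob C; x \<in> Ob C;
        c \<in> carrier (Hom C y x)\<rbrakk>
      \<Longrightarrow> \<psi> s (\<phi> t y) (\<phi> t x) (\<psi> t y x c) = \<psi> (s \<otimes> t) y x c"
    and mor_one: "\<And>y x c. \<lbrakk>y \<in> Ob C; x \<in> Ob C; c \<in> carrier (Hom C y x)\<rbrakk> \<Longrightarrow> \<psi> \<one> y x c = c"

text \<open>
  For orbits \<open>v\<close> and \<open>u\<close>: the \<open>KG\<close>-module whose coinvariants are the morphisms from \<open>u\<close> to \<open>v\<close> in the
  quotient category.
\<close>

definition orbit_hom ::
  "('o, 'k, 'c) kcat \<Rightarrow> 'o set \<Rightarrow> 'o set \<Rightarrow> ('k, 'o \<times> 'o \<Rightarrow> 'c) module" where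
  "orbit_hom C v u = dsum (v \<times> u) (\<lambda>(y, x). Hom C y x)"

definition orbit_inj ::
  "('o, 'k, 'c) kcat \<Rightarrow> 'o set \<Rightarrow> 'o set \<Rightarrow> 'o \<Rightarrow> 'o \<Rightarrow> 'c \<Rightarrow> ('o \<times> 'o \<Rightarrow> 'c)" where
  "orbit_inj C v u y x = dsum_inj (v \<times> u) (\<lambda>(y, x). Hom C y x) (y, x)"

definition orbit_hom_act ::
  "('o, 'k, 'c) kcat \<Rightarrow> ('g \<Rightarrow> 'o \<Rightarrow> 'o) \<Rightarrow> ('g \<Rightarrow> 'o \<Rightarrow> 'o \<Rightarrow> 'c \<Rightarrow> 'c)
    \<Rightarrow> 'o set \<Rightarrow> 'o set \<Rightarrow> 'g \<Rightarrow> ('o \<times> 'o \<Rightarrow> 'c) \<Rightarrow> ('o \<times> 'o \<Rightarrow> 'c)" where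
  "orbit_hom_act C \<phi> \<psi> v u s =
     dsum_lift (v \<times> u) (\<lambda>(y, x). Hom C y x) (orbit_hom C v u)
       (\<lambda>(y, x) c. orbit_inj C v u (\<phi> s y) (\<phi> s x) (\<psi> s y x c))"

definition orbit_class ::
  "('k, 'z) ring_scheme \<Rightarrow> ('g, 'y) monoid_scheme \<Rightarrow> ('o, 'k, 'c) kcat \<Rightarrow> ('g \<Rightarrow> 'o \<Rightarrow> 'o)
    \<Rightarrow> ('g \<Rightarrow> 'o \<Rightarrow> 'o \<Rightarrow> 'c \<Rightarrow> 'c) \<Rightarrow> 'o set \<Rightarrow> 'o set \<Rightarrow> ('o \<times> 'o \<Rightarrow> 'c) \<Rightarrow> ('o \<times> 'o \<Rightarrow> 'c) set" where
  "orbit_class K G C \<phi> \<psi> v u f =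
     aug_ideal_mult K G (orbit_hom C v u) (orbit_hom_act C \<phi> \<psi> v u) +>\<^bsub>orbit_hom C v u\<^esub> f"

text \<open>The class of a morphism \<open>c\<close> from \<open>x\<close> to \<open>y\<close>, i.e. its image under the covering functor.\<close>

definition mor_class ::
  "('k, 'z) ring_scheme \<Rightarrow> ('g, 'y) monoid_scheme \<Rightarrow> ('o, 'k, 'c) kcat \<Rightarrow> ('g \<Rightarrow> 'o \<Rightarrow> 'o)
    \<Rightarrow> ('g \<Rightarrow> 'o \<Rightarrow> 'o \<Rightarrow> 'c \<Rightarrow> 'c) \<Rightarrow> 'o \<Rightarrow> 'o \<Rightarrow> 'c \<Rightarrow> ('o \<times> 'o \<Rightarrow> 'c) set" where
  "mor_class K G C \<phi> \<psi> y x c =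
     orbit_class K G C \<phi> \<psi> (orbit G \<phi> y) (orbit G \<phi> x)
       (orbit_inj C (orbit G \<phi> y) (orbit G \<phi> x) y x c)"

text \<open>
  Bilinear extension of \<open>(d, c) \<mapsto> (sd)c\<close>, for \<open>d\<close> from \<open>y'\<close> to \<open>z\<close> and \<open>c\<close> from \<open>x\<close> to \<open>y\<close>, where
  \<open>s\<close> is the unique group element taking \<open>y'\<close> to \<open>y\<close>.
\<close>

definition orbit_comp ::
  "('g, 'y) monoid_scheme \<Rightarrow> ('o, 'k, 'c) kcat \<Rightarrow> ('g \<Rightarrow> 'o \<Rightarrow> 'o)
    \<Rightarrow> ('g \<Rightarrow> 'o \<Rightarrow> 'o \<Rightarrow> 'c \<Rightarrow> 'c) \<Rightarrow> 'o set \<Rightarrow> 'o set \<Rightarrow> 'o set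
    \<Rightarrow> ('o \<times> 'o \<Rightarrow> 'c) \<Rightarrow> ('o \<times> 'o \<Rightarrow> 'c) \<Rightarrow> ('o \<times> 'o \<Rightarrow> 'c)" where
  "orbit_comp G C \<phi> \<psi> w v u f g =
     dsum_lift (w \<times> v) (\<lambda>(y, x). Hom C y x) (orbit_hom C w u)
       (\<lambda>(z, y') d. dsum_lift (v \<times> u) (\<lambda>(y, x). Hom C y x) (orbit_hom C w u)
         (\<lambda>(y, x) c. let s = (THE s. s \<in> carrier G \<and> \<phi> s y' = y)
            in orbit_inj C w u (\<phi> s z) x (Cmp C (\<phi> s z) y x (\<psi> s z y' d) c)) g) f"

definition quot_cat ::
  "('k, 'z) ring_scheme \<Rightarrow> ('g, 'y) monoid_scheme \<Rightarrow> ('o, 'k, 'c) kcat \<Rightarrow> ('g \<Rightarrow> 'o \<Rightarrow> 'o)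
    \<Rightarrow> ('g \<Rightarrow> 'o \<Rightarrow> 'o \<Rightarrow> 'c \<Rightarrow> 'c) \<Rightarrow> ('o set, 'k, ('o \<times> 'o \<Rightarrow> 'c) set) kcat" where
  "quot_cat K G C \<phi> \<psi> =
     \<lparr>Ob = orbits G (Ob C) \<phi>,
      Hom = (\<lambda>v u. coinvariants K G (orbit_hom C v u) (orbit_hom_act C \<phi> \<psi> v u)),
      Cmp = (\<lambda>w v u A B. quot_lift (\<lambda>f. quot_lift (\<lambda>g.
               orbit_class K G C \<phi> \<psi> w u (orbit_comp G C \<phi> \<psi> w v u f g)) B) A),
      Idn = quot_lift (\<lambda>x. mor_class K G C \<phi> \<psi> x x (Idn C x))\<rparr>"

definition lift_bimod ::
  "('k, 'z) ring_scheme \<Rightarrow> ('g, 'y) monoid_scheme \<Rightarrow> ('o, 'k, 'c) kcat \<Rightarrow> ('g \<Rightarrow> 'o \<Rightarrow> 'o)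
    \<Rightarrow> ('g \<Rightarrow> 'o \<Rightarrow> 'o \<Rightarrow> 'c \<Rightarrow> 'c) \<Rightarrow> ('o set, 'k, ('o \<times> 'o \<Rightarrow> 'c) set, 'm) bimod
    \<Rightarrow> ('o, 'k, 'c, 'm) bimod" where
  "lift_bimod K G C \<phi> \<psi> M =
     \<lparr>Bim = (\<lambda>y x. Bim M (orbit G \<phi> y) (orbit G \<phi> x)),
      Lact = (\<lambda>z y x c. Lact M (orbit G \<phi> z) (orbit G \<phi> y) (orbit G \<phi> x)
                (mor_class K G C \<phi> \<psi> z y c)),
      Ract = (\<lambda>y x u m c. Ract M (orbit G \<phi> y) (orbit G \<phi> x) (orbit G \<phi> u) m
                (mor_class K G C \<phi> \<psi> x u c))\<rparr>"

text \<open>The action of \<open>s\<close> on chains and homology, for \<open>N\<close> a lifted bimodule.\<close>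

definition HM_chain_act ::
  "('k, 'z) ring_scheme \<Rightarrow> ('o, 'k, 'c) kcat \<Rightarrow> ('o, 'k, 'c, 'm) bimod \<Rightarrow> ('g \<Rightarrow> 'o \<Rightarrow> 'o)
    \<Rightarrow> ('g \<Rightarrow> 'o \<Rightarrow> 'o \<Rightarrow> 'c \<Rightarrow> 'c) \<Rightarrow> nat \<Rightarrow> 'g
    \<Rightarrow> ('o, 'k, 'c, 'm) hm_chain \<Rightarrow> ('o, 'k, 'c, 'm) hm_chain" where
  "HM_chain_act K C N \<phi> \<psi> n s = HM_lift K C N n (HM_chain K C N n)
     (\<lambda>(xs, m, cs). HM_gen K C N n
        (map (\<phi> s) xs, m, map (\<lambda>i. \<psi> s (xs ! i) (xs ! Suc i) (cs ! i)) [0..<n]))"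

definition HM_homology_act ::
  "('k, 'z) ring_scheme \<Rightarrow> ('o, 'k, 'c) kcat \<Rightarrow> ('o, 'k, 'c, 'm) bimod \<Rightarrow> ('g \<Rightarrow> 'o \<Rightarrow> 'o)
    \<Rightarrow> ('g \<Rightarrow> 'o \<Rightarrow> 'o \<Rightarrow> 'c \<Rightarrow> 'c) \<Rightarrow> nat \<Rightarrow> 'g
    \<Rightarrow> ('o, 'k, 'c, 'm) hm_chain set \<Rightarrow> ('o, 'k, 'c, 'm) hm_chain set" where
  "HM_homology_act K C N \<phi> \<psi> n s =
     homology_map (HM_chain K C N) (HM_boundary K C N) n (HM_chain_act K C N \<phi> \<psi> n s)"

section \<open>Spectral sequences\<close>

locale spectral_sequence =
  fixes K :: "('k, 'z) ring_scheme" and E :: "nat \<Rightarrow> int \<Rightarrow> int \<Rightarrow> ('k, 'e) module"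
    and d :: "nat \<Rightarrow> int \<Rightarrow> int \<Rightarrow> 'e \<Rightarrow> 'e"
  assumes page_module: "\<And>r p q. 2 \<le> r \<Longrightarrow> module K (E r p q)"
    and diff_hom: "\<And>r p q. 2 \<le> r
      \<Longrightarrow> d r p q \<in> mod_hom K (E r p q) (E r (p - int r) (q + int r - 1))"
    and diff_diff: "\<And>r p q x. \<lbrakk>2 \<le> r; x \<in> carrier (E r p q)\<rbrakk>
      \<Longrightarrow> d r (p - int r) (q + int r - 1) (d r p q x)
            = \<zero>\<^bsub>E r (p - 2 * int r) (q + 2 * int r - 2)\<^esub>"
    and next_page: "\<And>r p q. 2 \<le> r \<Longrightarrow> mod_isomorphic K (E (Suc r) p q)
      (quot_mod
        ((E r p q)\<lparr>carrier := a_kernel (E r p q) (E r (p - int r) (q + int r - 1)) (d r p q)\<rparr>)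
        (d r (p + int r) (q - int r + 1) ` carrier (E r (p + int r) (q - int r + 1))))"

definition first_quadrant :: "(nat \<Rightarrow> int \<Rightarrow> int \<Rightarrow> ('k, 'e) module) \<Rightarrow> bool" where
  "first_quadrant E \<longleftrightarrow>
     (\<forall>r\<ge>2. \<forall>p q. p < 0 \<or> q < 0 \<longrightarrow> carrier (E r p q) = {\<zero>\<^bsub>E r p q\<^esub>})"

text \<open>
  Convergence of a first quadrant spectral sequence. All differentials from and to the position
  \<open>(p, q)\<close> vanish on page \<open>r\<close> as soon as \<open>r > p\<close> and \<open>r > q + 1\<close>, so these pages are the limit term
  at \<open>(p, q)\<close>.
\<close>

definition converges_to ::
  "('k, 'z) ring_scheme \<Rightarrow> (nat \<Rightarrow> int \<Rightarrow> int \<Rightarrow> ('k, 'e) module) \<Rightarrow> (nat \<Rightarrow> ('k, 'h) module)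
    \<Rightarrow> bool" where
  "converges_to K E H \<longleftrightarrow>
     (\<forall>n. \<exists>F :: int \<Rightarrow> 'h set.
        (\<forall>p. submodule (F p) K (H n)) \<and> mono F \<and>
        F (- 1) = {\<zero>\<^bsub>H n\<^esub>} \<and> F (int n) = carrier (H n) \<and>
        (\<forall>p q. 0 \<le> p \<and> 0 \<le> q \<and> p + q = int n \<longrightarrow>
           (\<forall>r\<ge>2. int r > p \<and> int r > q + 1 \<longrightarrow>
              mod_isomorphic K (E r p q) (quot_mod ((H n)\<lparr>carrier := F p\<rparr>) (F (p - 1))))))"

text \<open>
  Every page of a spectral sequence is a subquotient of the second one, and hence can be
  realised up to isomorphism on the same type. The pages below are therefore taken on the type of
  the classes in group homology with coefficients in Hochschild-Mitchell homology.
\<close>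

type_synonym ('g, 'o, 'k, 'c, 'm) page_elem =
  "('g list \<Rightarrow> ('o, 'k, 'c, 'm) hm_chain set) set"

end

theory Submission
  imports Defs
begin

text \<open>
  Let \<open>X\<^sub>q\<close> be the module of Hochschild-Mitchell \<open>q\<close>-chains of \<open>C\<close> with coefficients in the lifted
  bimodule. The bar complexes of the \<open>KG\<close>-modules \<open>X\<^sub>q\<close> form a first quadrant double complex, and
  filtering its total complex by columns gives a spectral sequence. Bar chains are an exact functor of
  the coefficients, so that the second page is the homology of \<open>G\<close> with coefficients in the homology
  of \<open>X\<close>. On the other hand, \<open>G\<close> acts freely on the objects, and therefore \<open>X\<^sub>q\<close> is the direct sum
  of the translates of the submodule of chains that start at a chosen representative of each orbit.
  If \<open>e\<close> is the projection onto this submodule, then \<open>\<Sum>\<^sub>g g e g\<^sup>-\<^sup>1 = 1\<close>, which contracts the bar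
  complex of \<open>X\<^sub>q\<close> onto the coinvariants. A chain of the quotient category lifts uniquely once a lift
  of its first object is chosen, so these coinvariants are the chains of the quotient category, and
  the total complex computes its homology.
\<close>

section \<open>Modules and linear maps\<close>

text \<open>Coinvariants of the chain modules are never formed. The boundary of the sum of all
  \<open>[g] e(g\<^sup>-\<^sup>1 x)\<close> is
  \<open>(\<Sum>\<^sub>g e(g\<^sup>-\<^sup>1 x)) - x\<close>, so in degree zero \<open>x\<close> is
  homologous to its orbit sum. The orbit sum replaces a generator by its translate that starts at a
  representative, and this translate can be recovered from the image in the quotient category. Hence
  orbit sums factor through the projection \<open>eps\<close>, and what \<open>eps\<close> kills is
  a boundary. Surjectivity of \<open>eps\<close>, in turn, makes the boundary over the quotient
  category square to zero. The statement wants the pages on the type of group homology classes,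
  while a filtered total complex has pages made of families of bar chains. Choosing representatives
  embeds each page in the one before, so an injection of the second page carries the whole sequence
  over; that injection is the identification of the second page itself. Isomorphisms with
  subquotients are always obtained from a surjection with the right kernel.\<close>

lemma mod_homI:
  assumes "\<And>x. x \<in> carrier M \<Longrightarrow> h x \<in> carrier N"
    and "\<And>x y. \<lbrakk>x \<in> carrier M; y \<in> carrier M\<rbrakk> \<Longrightarrow> h (x \<oplus>\<^bsub>M\<^esub> y) = h x \<oplus>\<^bsub>N\<^esub> h y"
    and "\<And>a x. \<lbrakk>a \<in> carrier K; x \<in> carrier M\<rbrakk> \<Longrightarrow> h (a \<odot>\<^bsub>M\<^esub> x) = a \<odot>\<^bsub>N\<^esub> h x"
  shows "h \<in> mod_hom K M N"
  using assms unfolding mod_hom_def by auto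

lemma mod_hom_closed: "\<lbrakk>h \<in> mod_hom K M N; x \<in> carrier M\<rbrakk> \<Longrightarrow> h x \<in> carrier N"
  unfolding mod_hom_def by auto

lemma mod_hom_add:
  "\<lbrakk>h \<in> mod_hom K M N; x \<in> carrier M; y \<in> carrier M\<rbrakk> \<Longrightarrow> h (x \<oplus>\<^bsub>M\<^esub> y) = h x \<oplus>\<^bsub>N\<^esub> h y"
  unfolding mod_hom_def by auto

lemma mod_hom_smult:
  "\<lbrakk>h \<in> mod_hom K M N; a \<in> carrier K; x \<in> carrier M\<rbrakk> \<Longrightarrow> h (a \<odot>\<^bsub>M\<^esub> x) = a \<odot>\<^bsub>N\<^esub> h x"
  unfolding mod_hom_def by auto

lemma mod_hom_zero:
  assumes "module K M" "module K N" "h \<in> mod_hom K M N"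
  shows "h \<zero>\<^bsub>M\<^esub> = \<zero>\<^bsub>N\<^esub>"
proof -
  interpret M: module K M by fact
  interpret N: module K N by fact
  have "h \<zero>\<^bsub>M\<^esub> = h \<zero>\<^bsub>M\<^esub> \<oplus>\<^bsub>N\<^esub> h \<zero>\<^bsub>M\<^esub>"
    using mod_hom_add[OF assms(3), of "\<zero>\<^bsub>M\<^esub>" "\<zero>\<^bsub>M\<^esub>"] by simp
  then show ?thesis using mod_hom_closed[OF assms(3)]
    by (metis M.M.zero_closed N.M.add.l_cancel_one')
qed

lemma mod_hom_uminus:
  assumes "module K M" "module K N" "h \<in> mod_hom K M N" "x \<in> carrier M"
  shows "h (\<ominus>\<^bsub>M\<^esub> x) = \<ominus>\<^bsub>N\<^esub> h x"
proof -
  interpret M: module K M by fact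
  interpret N: module K N by fact
  have "h (\<ominus>\<^bsub>M\<^esub> x) \<oplus>\<^bsub>N\<^esub> h x = \<zero>\<^bsub>N\<^esub>"
    using mod_hom_add[OF assms(3), of "\<ominus>\<^bsub>M\<^esub> x" x] assms mod_hom_zero[OF assms(1-3)]
    by (simp add: M.M.l_neg)
  then show ?thesis using mod_hom_closed[OF assms(3)] assms(4)
    by (metis M.M.a_inv_closed N.M.minus_equality)
qed

lemma mod_hom_minus:
  assumes "module K M" "module K N" "h \<in> mod_hom K M N" "x \<in> carrier M" "y \<in> carrier M"
  shows "h (x \<ominus>\<^bsub>M\<^esub> y) = h x \<ominus>\<^bsub>N\<^esub> h y"
proof -
  interpret M: module K M by fact
  show ?thesis using assms
    by (simp add: a_minus_def mod_hom_add mod_hom_uminus)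
qed

lemma mod_hom_finsum:
  assumes "module K M" "module K N" "h \<in> mod_hom K M N" "finite I" "f \<in> I \<rightarrow> carrier M"
  shows "h (\<Oplus>\<^bsub>M\<^esub>i\<in>I. f i) = (\<Oplus>\<^bsub>N\<^esub>i\<in>I. h (f i))"
proof -
  interpret M: module K M by fact
  interpret N: module K N by fact
  show ?thesis using assms(4,5)
  proof (induction I rule: finite_induct)
    case empty then show ?case using mod_hom_zero[OF assms(1-3)] by simp
  next
    case (insert i I)
    then show ?case using mod_hom_closed[OF assms(3)]
      by (auto simp: Pi_def mod_hom_add[OF assms(3)])
  qed
qed

lemma alt_sum_closed:
  assumes "module K M" "\<And>i. i \<le> n \<Longrightarrow> x i \<in> carrier M"
  shows "alt_sum M n x \<in> carrier M"
proof -
  interpret M: module K M by fact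
  show ?thesis unfolding alt_sum_def using assms(2) by (intro M.M.finsum_closed) auto
qed

lemma alt_sum_cong:
  assumes "module K M" "\<And>i. i \<le> n \<Longrightarrow> x i = y i" "\<And>i. i \<le> n \<Longrightarrow> y i \<in> carrier M"
  shows "alt_sum M n x = alt_sum M n y"
proof -
  interpret M: module K M by fact
  show ?thesis unfolding alt_sum_def using assms(2,3) by (intro M.M.finsum_cong') auto
qed

lemma mod_hom_alt_sum:
  assumes "module K M" "module K N" "h \<in> mod_hom K M N" "\<And>i. i \<le> n \<Longrightarrow> x i \<in> carrier M"
  shows "h (alt_sum M n x) = alt_sum N n (\<lambda>i. h (x i))"
proof -
  interpret M: module K M by fact
  interpret N: module K N by fact
  have "h (alt_sum M n x) = (\<Oplus>\<^bsub>N\<^esub>i\<in>{..n}. h (if even i then x i else \<ominus>\<^bsub>M\<^esub> x i))"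
    unfolding alt_sum_def using assms(4) by (intro mod_hom_finsum[OF assms(1-3)]) auto
  also have "\<dots> = alt_sum N n (\<lambda>i. h (x i))"
    unfolding alt_sum_def using assms(4) mod_hom_closed[OF assms(3)]
    by (intro N.M.finsum_cong') (auto simp: mod_hom_uminus[OF assms(1-3)])
  finally show ?thesis .
qed

lemma mod_hom_cong:
  assumes "module K M" "\<And>x. x \<in> carrier M \<Longrightarrow> h x = g x" "g \<in> mod_hom K M N"
  shows "h \<in> mod_hom K M N"
proof -
  interpret M: module K M by fact
  show ?thesis using assms(2,3) by (auto simp: mod_hom_def Pi_def)
qed

lemma mod_hom_comp:
  "\<lbrakk>h \<in> mod_hom K M N; g \<in> mod_hom K N P\<rbrakk> \<Longrightarrow> (\<lambda>x. g (h x)) \<in> mod_hom K M P"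
  by (auto simp: mod_hom_def Pi_def)

lemma mod_hom_id: "(\<lambda>x. x) \<in> mod_hom K M M"
  by (auto simp: mod_hom_def)

lemma mod_hom_const_zero:
  assumes "module K M" "module K N"
  shows "(\<lambda>x. \<zero>\<^bsub>N\<^esub>) \<in> mod_hom K M N"
proof -
  interpret N: module K N by fact
  show ?thesis by (auto simp: mod_hom_def)
qed

lemma mod_hom_add_fun:
  assumes "module K M" "module K N" "h \<in> mod_hom K M N" "g \<in> mod_hom K M N"
  shows "(\<lambda>x. h x \<oplus>\<^bsub>N\<^esub> g x) \<in> mod_hom K M N"
proof -
  interpret M: module K M by fact
  interpret N: module K N by fact
  show ?thesis
    using mod_hom_closed[OF assms(3)] mod_hom_closed[OF assms(4)]
    by (intro mod_homI) (simp_all add: mod_hom_add[OF assms(3)] mod_hom_add[OF assms(4)]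
        mod_hom_smult[OF assms(3)] mod_hom_smult[OF assms(4)] N.smult_r_distr N.M.a_ac)
qed

lemma mod_hom_uminus_fun:
  assumes "module K M" "module K N" "h \<in> mod_hom K M N"
  shows "(\<lambda>x. \<ominus>\<^bsub>N\<^esub> h x) \<in> mod_hom K M N"
proof -
  interpret M: module K M by fact
  interpret N: module K N by fact
  show ?thesis
    using mod_hom_closed[OF assms(3)]
    by (intro mod_homI) (simp_all add: mod_hom_add[OF assms(3)] mod_hom_smult[OF assms(3)]
        N.M.minus_add N.smult_r_minus)
qed

lemma mod_hom_finsum_fun:
  assumes "module K M" "module K N" "finite I" "\<And>i. i \<in> I \<Longrightarrow> h i \<in> mod_hom K M N"
  shows "(\<lambda>x. \<Oplus>\<^bsub>N\<^esub>i\<in>I. h i x) \<in> mod_hom K M N"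
proof -
  interpret M: module K M by fact
  interpret N: module K N by fact
  show ?thesis using assms(3,4)
  proof (induction I rule: finite_induct)
    case empty then show ?case using mod_hom_const_zero[OF assms(1,2)] by simp
  next
    case (insert i I)
    have "(\<lambda>x. h i x \<oplus>\<^bsub>N\<^esub> (\<Oplus>\<^bsub>N\<^esub>i\<in>I. h i x)) \<in> mod_hom K M N"
      using insert by (intro mod_hom_add_fun[OF assms(1,2)]) auto
    then show ?case
    proof (rule mod_hom_cong[OF assms(1), rotated])
      fix x assume x: "x \<in> carrier M"
      have "\<And>j. j \<in> insert i I \<Longrightarrow> h j x \<in> carrier N"
        using insert.prems mod_hom_closed[OF _ x] by blast
      then show "(\<Oplus>\<^bsub>N\<^esub>i\<in>insert i I. h i x) = h i x \<oplus>\<^bsub>N\<^esub> (\<Oplus>\<^bsub>N\<^esub>i\<in>I. h i x)"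
        using insert.hyps by (intro N.M.finsum_insert) auto
    qed
  qed
qed

lemma mod_hom_alt_sum_fun:
  assumes "module K M" "module K N" "\<And>i. i \<le> n \<Longrightarrow> h i \<in> mod_hom K M N"
  shows "(\<lambda>x. alt_sum N n (\<lambda>i. h i x)) \<in> mod_hom K M N"
  unfolding alt_sum_def
proof (rule mod_hom_finsum_fun[OF assms(1,2)])
  fix i assume "i \<in> {..n}"
  then show "(\<lambda>x. if even i then h i x else \<ominus>\<^bsub>N\<^esub> h i x) \<in> mod_hom K M N"
    using assms(3) mod_hom_uminus_fun[OF assms(1,2)] by (cases "even i") simp_all
qed simp

lemma mod_hom_smult_left:
  assumes "module K N" "x \<in> carrier N"
  shows "(\<lambda>a. a \<odot>\<^bsub>N\<^esub> x) \<in> mod_hom K (regular_mod K) N"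
proof -
  interpret N: module K N by fact
  show ?thesis
    using assms(2) by (intro mod_homI) (auto simp: regular_mod_def N.smult_l_distr N.smult_assoc1)
qed

lemma a_minus_eq_zero_iff:
  assumes "module K M" "x \<in> carrier M" "y \<in> carrier M"
  shows "x \<ominus>\<^bsub>M\<^esub> y = \<zero>\<^bsub>M\<^esub> \<longleftrightarrow> x = y"
proof -
  interpret M: module K M by fact
  show ?thesis
    using assms(2,3) M.M.minus_equality[of x "\<ominus>\<^bsub>M\<^esub> y"] by (auto simp: a_minus_def M.M.r_neg)
qed

subsection \<open>Submodules and spans\<close>

lemma submodule_iff:
  assumes "module K M"
  shows "submodule H K M \<longleftrightarrow> H \<subseteq> carrier M \<and> \<zero>\<^bsub>M\<^esub> \<in> H \<and>
     (\<forall>x\<in>H. \<forall>y\<in>H. x \<oplus>\<^bsub>M\<^esub> y \<in> H) \<and> (\<forall>a\<in>carrier K. \<forall>x\<in>H. a \<odot>\<^bsub>M\<^esub> x \<in> H)" (is "_ \<longleftrightarrow> ?R")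
proof -
  interpret M: module K M by fact
  show ?thesis
  proof
    assume H: "submodule H K M"
    show ?R using M.submoduleE[OF H] by (metis M.M.r_neg ex_in_conv subset_iff)
  next
    assume R: ?R
    show "submodule H K M"
    proof (rule M.submoduleI)
      fix a assume a: "a \<in> H"
      have "\<ominus>\<^bsub>M\<^esub> a = (\<ominus>\<^bsub>K\<^esub> \<one>\<^bsub>K\<^esub>) \<odot>\<^bsub>M\<^esub> a"
        using a R M.smult_l_minus[of "\<one>\<^bsub>K\<^esub>" a] by auto
      then show "\<ominus>\<^bsub>M\<^esub> a \<in> H" using R a by simp
    qed (use R in auto)
  qed
qed

lemma submodule_subset: "submodule H K M \<Longrightarrow> H \<subseteq> carrier M"
  using subgroup.subset[OF submodule.axioms(1), of H K M] by simp

lemma submodule_zero: "submodule H K M \<Longrightarrow> \<zero>\<^bsub>M\<^esub> \<in> H"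
  using subgroup.one_closed[OF submodule.axioms(1), of H K M] by simp

lemma submodule_add: "\<lbrakk>submodule H K M; x \<in> H; y \<in> H\<rbrakk> \<Longrightarrow> x \<oplus>\<^bsub>M\<^esub> y \<in> H"
  using subgroup.m_closed[OF submodule.axioms(1), of H K M] by simp

lemma submodule_smult: "\<lbrakk>submodule H K M; a \<in> carrier K; x \<in> H\<rbrakk> \<Longrightarrow> a \<odot>\<^bsub>M\<^esub> x \<in> H"
  by (rule submodule.smult_closed)

lemma submodule_uminus: "\<lbrakk>submodule H K M; x \<in> H\<rbrakk> \<Longrightarrow> \<ominus>\<^bsub>M\<^esub> x \<in> H"
  using subgroup.m_inv_closed[OF submodule.axioms(1), of H K M] by (simp add: a_inv_def)

lemma submodule_minus: "\<lbrakk>submodule H K M; x \<in> H; y \<in> H\<rbrakk> \<Longrightarrow> x \<ominus>\<^bsub>M\<^esub> y \<in> H"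
  by (simp add: a_minus_def submodule_add submodule_uminus)

lemma submodule_module: "\<lbrakk>module K M; submodule H K M\<rbrakk> \<Longrightarrow> module K (M\<lparr>carrier := H\<rparr>)"
  by (rule submodule.submodule_is_module)

lemma submodule_submodule:
  assumes "module K M" "submodule H K M" "submodule L K M" "L \<subseteq> H"
  shows "submodule L K (M\<lparr>carrier := H\<rparr>)"
  using assms(3,4) submodule_iff[OF assms(1)] submodule_iff[OF submodule_module[OF assms(1,2)]]
  by auto

lemma submodule_inclusion: "submodule H K M \<Longrightarrow> (\<lambda>x. x) \<in> mod_hom K (M\<lparr>carrier := H\<rparr>) M"
  using submodule_subset by (auto simp: mod_hom_def)

lemma uminus_submodule:
  fixes M :: "('k, 'a) module"
  assumes "module K M" "submodule H K M" "x \<in> H"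
  shows "\<ominus>\<^bsub>M\<lparr>carrier := H\<rparr>\<^esub> x = \<ominus>\<^bsub>M\<^esub> x"
  using mod_hom_uminus[OF submodule_module[OF assms(1,2)] assms(1) submodule_inclusion[OF assms(2)]]
    assms(3) by simp

lemma minus_submodule:
  fixes M :: "('k, 'a) module"
  assumes "module K M" "submodule H K M" "y \<in> H"
  shows "x \<ominus>\<^bsub>M\<lparr>carrier := H\<rparr>\<^esub> y = x \<ominus>\<^bsub>M\<^esub> y"
  using uminus_submodule[OF assms] by (simp add: a_minus_def)

lemma mod_hom_restrict_dom:
  "\<lbrakk>h \<in> mod_hom K M N; submodule H K M\<rbrakk> \<Longrightarrow> h \<in> mod_hom K (M\<lparr>carrier := H\<rparr>) N"
  using submodule_subset[of H K M] by (auto simp: mod_hom_def Pi_def subset_iff)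

lemma mod_hom_restrict_cod:
  "\<lbrakk>h \<in> mod_hom K M N; \<And>x. x \<in> carrier M \<Longrightarrow> h x \<in> L\<rbrakk> \<Longrightarrow> h \<in> mod_hom K M (N\<lparr>carrier := L\<rparr>)"
  by (auto simp: mod_hom_def)

lemma submodule_preimage:
  assumes "module K M" "module K N" "h \<in> mod_hom K M N" "submodule L K N"
  shows "submodule {x \<in> carrier M. h x \<in> L} K M"
proof -
  interpret M: module K M by fact
  show ?thesis
    unfolding submodule_iff[OF assms(1)]
    using assms(4) mod_hom_zero[OF assms(1-3)]
    by (auto simp: mod_hom_add[OF assms(3)] mod_hom_smult[OF assms(3)]
        submodule_zero submodule_add submodule_smult)
qed

lemma submodule_zero_set: "module K M \<Longrightarrow> submodule {\<zero>\<^bsub>M\<^esub>} K M"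
proof -
  assume "module K M"
  then interpret M: module K M .
  show ?thesis by (simp add: submodule_iff[OF \<open>module K M\<close>])
qed

lemma submodule_kernel:
  assumes "module K M" "module K N" "h \<in> mod_hom K M N"
  shows "submodule {x \<in> carrier M. h x = \<zero>\<^bsub>N\<^esub>} K M"
  using submodule_preimage[OF assms submodule_zero_set[OF assms(2)]] by simp

lemma submodule_image:
  assumes "module K M" "module K N" "h \<in> mod_hom K M N" "submodule L K M"
  shows "submodule (h ` L) K N"
proof -
  interpret M: module K M by fact
  have L: "\<And>x. x \<in> L \<Longrightarrow> x \<in> carrier M" using submodule_subset[OF assms(4)] by auto
  show ?thesis
    unfolding submodule_iff[OF assms(2)]
  proof (intro conjI ballI)
    show "h ` L \<subseteq> carrier N" using L mod_hom_closed[OF assms(3)] by auto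
    show "\<zero>\<^bsub>N\<^esub> \<in> h ` L"
      using mod_hom_zero[OF assms(1-3)] submodule_zero[OF assms(4)] by (metis imageI)
  next
    fix x y assume "x \<in> h ` L" "y \<in> h ` L"
    then obtain a b where "a \<in> L" "b \<in> L" "x = h a" "y = h b" by auto
    then show "x \<oplus>\<^bsub>N\<^esub> y \<in> h ` L"
      using mod_hom_add[OF assms(3)] L submodule_add[OF assms(4)] by (metis imageI)
  next
    fix a x assume "a \<in> carrier K" "x \<in> h ` L"
    then obtain b where "b \<in> L" "x = h b" by auto
    then show "a \<odot>\<^bsub>N\<^esub> x \<in> h ` L"
      using mod_hom_smult[OF assms(3) \<open>a \<in> carrier K\<close>] L submodule_smult[OF assms(4) \<open>a \<in> carrier K\<close>]
      by (metis imageI)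
  qed
qed

lemma submodule_carrier: "module K M \<Longrightarrow> submodule (carrier M) K M"
  by (rule module.carrier_is_submodule)

lemma submodule_Int:
  assumes "module K M" "submodule A K M" "submodule B K M"
  shows "submodule (A \<inter> B) K M"
  using assms(2,3) by (auto simp: submodule_iff[OF assms(1)])

lemma submodule_Inter:
  assumes "module K M" "\<A> \<noteq> {}" "\<And>A. A \<in> \<A> \<Longrightarrow> submodule A K M"
  shows "submodule (\<Inter>\<A>) K M"
proof -
  obtain A where "A \<in> \<A>" using assms(2) by auto
  then show ?thesis
    using assms(3) unfolding submodule_iff[OF assms(1)] by blast
qed

lemma submodule_equalizer:
  assumes "module K M" "module K N" "h \<in> mod_hom K M N" "g \<in> mod_hom K M N"
  shows "submodule {x \<in> carrier M. h x = g x} K M"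
proof -
  interpret M: module K M by fact
  show ?thesis
    unfolding submodule_iff[OF assms(1)]
    using mod_hom_zero[OF assms(1-3)] mod_hom_zero[OF assms(1,2,4)]
    by (auto simp: mod_hom_add[OF assms(3)] mod_hom_smult[OF assms(3)]
         mod_hom_add[OF assms(4)] mod_hom_smult[OF assms(4)])
qed

section \<open>Spans and generating sets\<close>

lemma
  assumes "module K M" "S \<subseteq> carrier M"
  shows submodule_mod_span: "submodule (mod_span K M S) K M"
    and mod_span_superset: "S \<subseteq> mod_span K M S"
    and mod_span_least: "\<And>N. \<lbrakk>submodule N K M; S \<subseteq> N\<rbrakk> \<Longrightarrow> mod_span K M S \<subseteq> N"
proof -
  show "submodule (mod_span K M S) K M"
    unfolding mod_span_def using submodule_carrier[OF assms(1)] assms(2)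
    by (intro submodule_Inter[OF assms(1)]) auto
qed (auto simp: mod_span_def)

text \<open>Phrased by submodules instead of linear combinations: a property that cuts out a
  submodule then holds everywhere as soon as it holds on the generators, and no finite sums have to
  be handled.\<close>

definition spanning :: "('k, 'z) ring_scheme \<Rightarrow> ('k, 'a) module \<Rightarrow> 'a set \<Rightarrow> bool" where
  "spanning K M S \<longleftrightarrow> S \<subseteq> carrier M \<and> (\<forall>N. submodule N K M \<longrightarrow> S \<subseteq> N \<longrightarrow> carrier M \<subseteq> N)"

text \<open>The equalizer of two linear maps is a submodule. Most identities between linear maps
  below are reduced to generators in this way.\<close>

lemma spanning_hom_eq:
  assumes "spanning K M S" "module K M" "module K N" "h \<in> mod_hom K M N" "g \<in> mod_hom K M N"
    and "\<And>x. x \<in> S \<Longrightarrow> h x = g x" "x \<in> carrier M"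
  shows "h x = g x"
  using submodule_equalizer[OF assms(2-5)] assms(1,6,7) unfolding spanning_def by blast

lemma spanning_hom_surj:
  assumes "spanning K N S" "module K M" "module K N" "h \<in> mod_hom K M N" "S \<subseteq> h ` carrier M"
  shows "h ` carrier M = carrier N"
  using submodule_image[OF assms(2-4) submodule_carrier[OF assms(2)]] assms(1,5) mod_hom_closed[OF assms(4)]
  unfolding spanning_def by blast

lemma spanning_image:
  assumes "spanning K M S" "module K M" "module K N" "h \<in> mod_hom K M N" "h ` carrier M = carrier N"
  shows "spanning K N (h ` S)"
  unfolding spanning_def
proof (intro conjI allI impI)
  show "h ` S \<subseteq> carrier N" using assms(1,5) unfolding spanning_def by auto
  fix L assume L: "submodule L K N" "h ` S \<subseteq> L"
  have "carrier M \<subseteq> {x \<in> carrier M. h x \<in> L}"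
    using assms(1) L submodule_preimage[OF assms(2-4) L(1)] unfolding spanning_def by blast
  then show "carrier N \<subseteq> L" unfolding assms(5)[symmetric] by blast
qed

lemma spanning_mono: "\<lbrakk>spanning K M S; S \<subseteq> T; T \<subseteq> carrier M\<rbrakk> \<Longrightarrow> spanning K M T"
  unfolding spanning_def by (meson order_trans)

lemma spanningD: "\<lbrakk>spanning K M S; submodule N K M; S \<subseteq> N\<rbrakk> \<Longrightarrow> carrier M \<subseteq> N"
  unfolding spanning_def by blast

text \<open>Elements with finite support form a submodule, since supports at most unite under
  addition. This is how a family of maps that is understood only on generators is seen to land in a
  direct sum.\<close>

lemma spanning_finite_support:
  assumes S: "spanning K X S" and X: "module K X" and N: "\<And>i. i \<in> I \<Longrightarrow> module K (N i)"
    and h: "\<And>i. i \<in> I \<Longrightarrow> h i \<in> mod_hom K X (N i)"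
    and fin: "\<And>x. x \<in> S \<Longrightarrow> finite {i \<in> I. h i x \<noteq> \<zero>\<^bsub>N i\<^esub>}" and x: "x \<in> carrier X"
  shows "finite {i \<in> I. h i x \<noteq> \<zero>\<^bsub>N i\<^esub>}"
proof -
  interpret X: module K X by (rule X)
  let ?F = "{x \<in> carrier X. finite {i \<in> I. h i x \<noteq> \<zero>\<^bsub>N i\<^esub>}}"
  have z: "\<zero>\<^bsub>N i\<^esub> \<oplus>\<^bsub>N i\<^esub> \<zero>\<^bsub>N i\<^esub> = \<zero>\<^bsub>N i\<^esub>" "a \<in> carrier K \<Longrightarrow> a \<odot>\<^bsub>N i\<^esub> \<zero>\<^bsub>N i\<^esub> = \<zero>\<^bsub>N i\<^esub>" if "i \<in> I" for i a
  proof -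
    interpret N: module K "N i" by (rule N[OF that])
    show "\<zero>\<^bsub>N i\<^esub> \<oplus>\<^bsub>N i\<^esub> \<zero>\<^bsub>N i\<^esub> = \<zero>\<^bsub>N i\<^esub>" "a \<in> carrier K \<Longrightarrow> a \<odot>\<^bsub>N i\<^esub> \<zero>\<^bsub>N i\<^esub> = \<zero>\<^bsub>N i\<^esub>" by simp_all
  qed
  have "submodule ?F K X"
    unfolding submodule_iff[OF X]
  proof (intro conjI ballI)
    have "{i \<in> I. h i \<zero>\<^bsub>X\<^esub> \<noteq> \<zero>\<^bsub>N i\<^esub>} = {}" using mod_hom_zero[OF X N h] by auto
    then have "finite {i \<in> I. h i \<zero>\<^bsub>X\<^esub> \<noteq> \<zero>\<^bsub>N i\<^esub>}" by (simp only: finite.emptyI)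
    then show "\<zero>\<^bsub>X\<^esub> \<in> ?F" by (intro CollectI conjI X.M.zero_closed)
  next
    fix x y assume xy: "x \<in> ?F" "y \<in> ?F"
    have "{i \<in> I. h i (x \<oplus>\<^bsub>X\<^esub> y) \<noteq> \<zero>\<^bsub>N i\<^esub>} \<subseteq> {i \<in> I. h i x \<noteq> \<zero>\<^bsub>N i\<^esub>} \<union> {i \<in> I. h i y \<noteq> \<zero>\<^bsub>N i\<^esub>}"
      using xy z mod_hom_add[OF h] by auto
    then have "finite {i \<in> I. h i (x \<oplus>\<^bsub>X\<^esub> y) \<noteq> \<zero>\<^bsub>N i\<^esub>}" using xy by (auto intro: finite_subset)
    then show "x \<oplus>\<^bsub>X\<^esub> y \<in> ?F" using xy by simp
  next
    fix a x assume ax: "a \<in> carrier K" "x \<in> ?F"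
    have "{i \<in> I. h i (a \<odot>\<^bsub>X\<^esub> x) \<noteq> \<zero>\<^bsub>N i\<^esub>} \<subseteq> {i \<in> I. h i x \<noteq> \<zero>\<^bsub>N i\<^esub>}"
      using ax z mod_hom_smult[OF h] by auto
    then have "finite {i \<in> I. h i (a \<odot>\<^bsub>X\<^esub> x) \<noteq> \<zero>\<^bsub>N i\<^esub>}" using ax by (auto intro: finite_subset)
    then show "a \<odot>\<^bsub>X\<^esub> x \<in> ?F" using ax by simp
  qed auto
  moreover have "S \<subseteq> ?F" using S fin unfolding spanning_def by blast
  ultimately have "carrier X \<subseteq> ?F" by (rule spanningD[OF S])
  then show ?thesis using x by blast
qed

subsection \<open>Quotients\<close>

lemma a_r_coset_carrier_update [simp]: "a_r_coset (M\<lparr>carrier := H\<rparr>) = a_r_coset M"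
  by (simp add: a_r_coset_def r_coset_def fun_eq_iff)

lemma submodule_abelian_subgroup:
  assumes "module K M" "submodule N K M"
  shows "abelian_subgroup N M"
proof -
  interpret M: module K M by fact
  show ?thesis
    using assms(2) by (intro abelian_subgroupI3 additive_subgroupI) (auto simp: submodule_def M.M.abelian_group_axioms)
qed

context
  fixes K :: "('k, 'z) ring_scheme" and M :: "('k, 'a) module" and N :: "'a set"
  assumes M: "module K M" and N: "submodule N K M"
begin

interpretation M: module K M by (rule M)
interpretation N: abelian_subgroup N M by (rule submodule_abelian_subgroup[OF M N])

lemma quot_mod_carrier: "carrier (quot_mod M N) = (\<lambda>x. N +>\<^bsub>M\<^esub> x) ` carrier M"
  by (auto simp: quot_mod_def A_RCOSETS_def')

lemma coset_self: "x \<in> carrier M \<Longrightarrow> x \<in> N +>\<^bsub>M\<^esub> x"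
  by (rule N.a_rcos_self)

lemma coset_eq_iff:
  assumes "x \<in> carrier M" "y \<in> carrier M"
  shows "N +>\<^bsub>M\<^esub> x = N +>\<^bsub>M\<^esub> y \<longleftrightarrow> x \<ominus>\<^bsub>M\<^esub> y \<in> N"
proof
  assume "N +>\<^bsub>M\<^esub> x = N +>\<^bsub>M\<^esub> y"
  then have "x \<in> N +>\<^bsub>M\<^esub> y" using N.a_rcos_self[OF assms(1)] by simp
  then show "x \<ominus>\<^bsub>M\<^esub> y \<in> N"
    using N.a_rcos_module_imp[of y x] assms by (simp add: a_minus_def)
next
  assume *: "x \<ominus>\<^bsub>M\<^esub> y \<in> N"
  have "x \<in> N +>\<^bsub>M\<^esub> y"
    by (rule N.a_rcos_module_rev) (use assms * in \<open>auto simp: a_minus_def\<close>)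
  then show "N +>\<^bsub>M\<^esub> x = N +>\<^bsub>M\<^esub> y"
    using N.a_repr_independence'[of x y] assms by simp
qed

lemma coset_eq_zero_iff:
  assumes "x \<in> carrier M"
  shows "N +>\<^bsub>M\<^esub> x = N \<longleftrightarrow> x \<in> N"
proof -
  have "x \<ominus>\<^bsub>M\<^esub> \<zero>\<^bsub>M\<^esub> = x" using assms by (simp add: a_minus_def)
  moreover have "N +>\<^bsub>M\<^esub> \<zero>\<^bsub>M\<^esub> = N" using N.a_subset by simp
  ultimately show ?thesis using coset_eq_iff[OF assms M.M.zero_closed] by simp
qed

lemma coset_rep: "\<lbrakk>x \<in> carrier M; y \<in> N +>\<^bsub>M\<^esub> x\<rbrakk> \<Longrightarrow> y \<in> carrier M \<and> N +>\<^bsub>M\<^esub> y = N +>\<^bsub>M\<^esub> x"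
  using N.a_repr_independence' N.a_elemrcos_carrier by metis

lemma quot_lift_coset:
  assumes "x \<in> carrier M" "\<And>y. \<lbrakk>y \<in> carrier M; y \<ominus>\<^bsub>M\<^esub> x \<in> N\<rbrakk> \<Longrightarrow> h y = h x"
  shows "quot_lift h (N +>\<^bsub>M\<^esub> x) = h x"
proof -
  have "h y = h x" if y: "y \<in> N +>\<^bsub>M\<^esub> x" for y
    using coset_rep[OF assms(1) y] coset_eq_iff[of y x] assms by blast
  then have "h ` (N +>\<^bsub>M\<^esub> x) = {h x}"
    using coset_self[OF assms(1)] by blast
  then show ?thesis by (simp add: quot_lift_def)
qed

lemma quot_mod_zero [simp]: "\<zero>\<^bsub>quot_mod M N\<^esub> = N"
  by (simp add: quot_mod_def)

lemma quot_mod_add: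
  assumes "x \<in> carrier M" "y \<in> carrier M"
  shows "(N +>\<^bsub>M\<^esub> x) \<oplus>\<^bsub>quot_mod M N\<^esub> (N +>\<^bsub>M\<^esub> y) = N +>\<^bsub>M\<^esub> (x \<oplus>\<^bsub>M\<^esub> y)"
  using N.a_rcos_sum[OF assms] by (simp add: quot_mod_def)

lemma quot_mod_smult:
  assumes "a \<in> carrier K" "x \<in> carrier M"
  shows "a \<odot>\<^bsub>quot_mod M N\<^esub> (N +>\<^bsub>M\<^esub> x) = N +>\<^bsub>M\<^esub> (a \<odot>\<^bsub>M\<^esub> x)"
proof -
  have "quot_lift (\<lambda>x. N +>\<^bsub>M\<^esub> (a \<odot>\<^bsub>M\<^esub> x)) (N +>\<^bsub>M\<^esub> x) = N +>\<^bsub>M\<^esub> (a \<odot>\<^bsub>M\<^esub> x)"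
  proof (rule quot_lift_coset[OF assms(2)])
    fix y assume y: "y \<in> carrier M" "y \<ominus>\<^bsub>M\<^esub> x \<in> N"
    have "a \<odot>\<^bsub>M\<^esub> y \<ominus>\<^bsub>M\<^esub> a \<odot>\<^bsub>M\<^esub> x = a \<odot>\<^bsub>M\<^esub> (y \<ominus>\<^bsub>M\<^esub> x)"
      using y assms by (simp add: a_minus_def M.smult_r_distr M.smult_r_minus)
    then show "N +>\<^bsub>M\<^esub> (a \<odot>\<^bsub>M\<^esub> y) = N +>\<^bsub>M\<^esub> (a \<odot>\<^bsub>M\<^esub> x)"
      using y assms submodule_smult[OF N] by (subst coset_eq_iff) auto
  qed
  then show ?thesis by (simp add: quot_mod_def)
qed

lemma quot_mod_module: "module K (quot_mod M N)"
proof -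
  let ?Q = "quot_mod M N"
  have ab: "abelian_group ?Q"
  proof (rule abelian_groupI, goal_cases)
    case (1 x y) then show ?case by (auto simp: quot_mod_carrier quot_mod_add)
  next
    case 2 then show ?case
      using coset_eq_zero_iff[OF M.M.zero_closed] submodule_zero[OF N]
      by (auto simp: quot_mod_carrier image_iff intro!: bexI[of _ "\<zero>\<^bsub>M\<^esub>"])
  next
    case (3 x y z) then show ?case
      by (auto simp: quot_mod_carrier quot_mod_add M.M.a_assoc)
  next
    case (4 x y) then show ?case by (auto simp: quot_mod_carrier quot_mod_add M.M.a_comm)
  next
    case (5 x)
    then obtain a where a: "a \<in> carrier M" "x = N +>\<^bsub>M\<^esub> a" by (auto simp: quot_mod_carrier)
    have "\<zero>\<^bsub>?Q\<^esub> = N +>\<^bsub>M\<^esub> \<zero>\<^bsub>M\<^esub>"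
      using coset_eq_zero_iff[OF M.M.zero_closed] submodule_zero[OF N] by simp
    then show ?case using a by (simp only: quot_mod_add M.M.zero_closed M.M.l_zero)
  next
    case (6 x)
    then obtain a where a: "a \<in> carrier M" "x = N +>\<^bsub>M\<^esub> a" by (auto simp: quot_mod_carrier)
    have "(N +>\<^bsub>M\<^esub> (\<ominus>\<^bsub>M\<^esub> a)) \<oplus>\<^bsub>?Q\<^esub> x = \<zero>\<^bsub>?Q\<^esub>"
      using a coset_eq_zero_iff[OF M.M.zero_closed] submodule_zero[OF N]
      by (simp add: quot_mod_add M.M.l_neg)
    then show ?case using a by (auto simp: quot_mod_carrier)
  qed
  show ?thesis
  proof (rule moduleI[OF M.is_cring ab], goal_cases)
    case (1 a x) then show ?case by (auto simp: quot_mod_carrier quot_mod_smult)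
  next
    case (2 a b x) then show ?case
      by (auto simp: quot_mod_carrier quot_mod_smult quot_mod_add M.smult_l_distr)
  next
    case (3 a x y) then show ?case
      by (auto simp: quot_mod_carrier quot_mod_smult quot_mod_add M.smult_r_distr)
  next
    case (4 a b x) then show ?case by (auto simp: quot_mod_carrier quot_mod_smult M.smult_assoc1)
  next
    case (5 x) then show ?case by (auto simp: quot_mod_carrier quot_mod_smult)
  qed
qed

lemma quot_mod_proj: "(\<lambda>x. N +>\<^bsub>M\<^esub> x) \<in> mod_hom K M (quot_mod M N)"
  by (rule mod_homI) (auto simp: quot_mod_carrier quot_mod_add quot_mod_smult)

context
  fixes P :: "('k, 'b) module" and h
  assumes P: "module K P" and h: "h \<in> mod_hom K M P" and hN: "\<And>x. x \<in> N \<Longrightarrow> h x = \<zero>\<^bsub>P\<^esub>"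
begin

interpretation P: module K P by (rule P)

lemma quot_lift_hom_coset:
  assumes "x \<in> carrier M"
  shows "quot_lift h (N +>\<^bsub>M\<^esub> x) = h x"
proof (rule quot_lift_coset[OF assms])
  fix y assume *: "y \<in> carrier M" "y \<ominus>\<^bsub>M\<^esub> x \<in> N"
  then have "h y \<ominus>\<^bsub>P\<^esub> h x = \<zero>\<^bsub>P\<^esub>" using hN mod_hom_minus[OF M P h] assms by metis
  then show "h y = h x" using * assms mod_hom_closed[OF h] a_minus_eq_zero_iff[OF P] by blast
qed

lemma quot_lift_hom: "quot_lift h \<in> mod_hom K (quot_mod M N) P"
  by (rule mod_homI)
     (auto simp: quot_mod_carrier quot_mod_add quot_mod_smult quot_lift_hom_coset
        mod_hom_closed[OF h] mod_hom_add[OF h] mod_hom_smult[OF h])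

end

end

text \<open>All the isomorphisms of the spectral sequence are obtained in this way.\<close>

lemma mod_isomorphic_same_kernel:
  assumes M: "module K M" and P: "module K P" and Q: "module K Q"
    and h: "h \<in> mod_hom K M P" "h ` carrier M = carrier P"
    and g: "g \<in> mod_hom K M Q" "g ` carrier M = carrier Q"
    and ker: "\<And>x. x \<in> carrier M \<Longrightarrow> h x = \<zero>\<^bsub>P\<^esub> \<longleftrightarrow> g x = \<zero>\<^bsub>Q\<^esub>"
  shows "mod_isomorphic K P Q"
proof -
  interpret M: module K M by fact
  have eq: "h x = h y \<longleftrightarrow> g x = g y" if "x \<in> carrier M" "y \<in> carrier M" for x y
    using ker[of "x \<ominus>\<^bsub>M\<^esub> y"] that mod_hom_minus[OF M P h(1)] mod_hom_minus[OF M Q g(1)]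
      a_minus_eq_zero_iff[OF P] a_minus_eq_zero_iff[OF Q] mod_hom_closed[OF h(1)] mod_hom_closed[OF g(1)]
    by simp
  \<comment> \<open>Any preimage may be chosen: \<open>h\<close> and \<open>g\<close> have the same
    kernel, hence identify the same pairs, which is \<open>eq\<close>.\<close>
  define f where "f = (\<lambda>p. g (SOME x. x \<in> carrier M \<and> h x = p))"
  have f: "f (h x) = g x" if "x \<in> carrier M" for x
  proof -
    have "(SOME y. y \<in> carrier M \<and> h y = h x) \<in> carrier M \<and> h (SOME y. y \<in> carrier M \<and> h y = h x) = h x"
      by (rule someI[where x = x]) (simp add: that)
    then show ?thesis using eq that unfolding f_def by blast
  qed
  have surj: "\<exists>x\<in>carrier M. p = h x" if "p \<in> carrier P" for p using that h(2) by auto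
  have "f \<in> mod_hom K P Q"
  proof (rule mod_homI)
    fix p assume "p \<in> carrier P"
    then show "f p \<in> carrier Q" using surj f mod_hom_closed[OF g(1)] by metis
  next
    fix p q assume "p \<in> carrier P" "q \<in> carrier P"
    then obtain x y where xy: "x \<in> carrier M" "y \<in> carrier M" "p = h x" "q = h y" using surj by metis
    then show "f (p \<oplus>\<^bsub>P\<^esub> q) = f p \<oplus>\<^bsub>Q\<^esub> f q"
      using f[of "x \<oplus>\<^bsub>M\<^esub> y"] f[of x] f[of y] by (simp add: mod_hom_add[OF h(1)] mod_hom_add[OF g(1)])
  next
    fix a p assume "a \<in> carrier K" "p \<in> carrier P"
    then obtain x where x: "x \<in> carrier M" "p = h x" using surj by metis
    then show "f (a \<odot>\<^bsub>P\<^esub> p) = a \<odot>\<^bsub>Q\<^esub> f p"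
      using f[of "a \<odot>\<^bsub>M\<^esub> x"] f[of x] \<open>a \<in> carrier K\<close>
      by (simp add: mod_hom_smult[OF h(1)] mod_hom_smult[OF g(1)])
  qed
  moreover have "bij_betw f (carrier P) (carrier Q)"
  proof (rule bij_betw_imageI)
    show "inj_on f (carrier P)"
      by (rule inj_onI) (metis surj f eq)
    show "f ` carrier P = carrier Q"
      using f unfolding h(2)[symmetric] g(2)[symmetric] image_image by (intro image_cong) auto
  qed
  ultimately show ?thesis unfolding mod_isomorphic_def by blast
qed

lemma mod_isomorphic_sym:
  assumes "module K M" "module K N" "mod_isomorphic K M N"
  shows "mod_isomorphic K N M"
proof -
  obtain h where h: "h \<in> mod_hom K M N" "bij_betw h (carrier M) (carrier N)"
    using assms(3) unfolding mod_isomorphic_def by auto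
  interpret M: module K M by fact
  show ?thesis
  proof (rule mod_isomorphic_same_kernel[OF assms(1,2,1) h(1) _ mod_hom_id])
    fix x assume "x \<in> carrier M"
    then show "h x = \<zero>\<^bsub>N\<^esub> \<longleftrightarrow> x = \<zero>\<^bsub>M\<^esub>"
      using mod_hom_zero[OF assms(1,2) h(1)] inj_on_eq_iff[OF bij_betw_imp_inj_on[OF h(2)], of x "\<zero>\<^bsub>M\<^esub>"]
      by simp
  qed (use h(2) in \<open>auto simp: bij_betw_def\<close>)
qed

lemma mod_isomorphic_trans:
  assumes "mod_isomorphic K M N" "mod_isomorphic K N P"
  shows "mod_isomorphic K M P"
proof -
  obtain h where h: "h \<in> mod_hom K M N" "bij_betw h (carrier M) (carrier N)"
    using assms(1) unfolding mod_isomorphic_def by auto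
  obtain g where g: "g \<in> mod_hom K N P" "bij_betw g (carrier N) (carrier P)"
    using assms(2) unfolding mod_isomorphic_def by auto
  have "g \<circ> h \<in> mod_hom K M P" using mod_hom_comp[OF h(1) g(1)] by (simp add: comp_def)
  then show ?thesis using bij_betw_trans[OF h(2) g(2)] unfolding mod_isomorphic_def by blast
qed

section \<open>Subquotients of a module\<close>

context
  fixes K :: "('k, 'z) ring_scheme" and M :: "('k, 'a) module" and Z B :: "'a set"
  assumes M: "module K M" and Z: "submodule Z K M" and B: "submodule B K M" and BZ: "B \<subseteq> Z"
begin

private lemma B': "submodule B K (M\<lparr>carrier := Z\<rparr>)"
  by (rule submodule_submodule[OF M Z B BZ])

lemma subquot_module: "module K (quot_mod (M\<lparr>carrier := Z\<rparr>) B)"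
  by (rule quot_mod_module[OF submodule_module[OF M Z] B'])

lemma subquot_proj: "(\<lambda>x. B +>\<^bsub>M\<^esub> x) \<in> mod_hom K (M\<lparr>carrier := Z\<rparr>) (quot_mod (M\<lparr>carrier := Z\<rparr>) B)"
  using quot_mod_proj[OF submodule_module[OF M Z] B'] by simp

lemma subquot_carrier: "carrier (quot_mod (M\<lparr>carrier := Z\<rparr>) B) = (\<lambda>x. B +>\<^bsub>M\<^esub> x) ` Z"
  using quot_mod_carrier[OF submodule_module[OF M Z] B'] by simp

lemma subquot_zero: "\<zero>\<^bsub>quot_mod (M\<lparr>carrier := Z\<rparr>) B\<^esub> = B"
  by (simp add: quot_mod_def)

lemma subquot_eq_iff: "\<lbrakk>x \<in> Z; y \<in> Z\<rbrakk> \<Longrightarrow> B +>\<^bsub>M\<^esub> x = B +>\<^bsub>M\<^esub> y \<longleftrightarrow> x \<ominus>\<^bsub>M\<^esub> y \<in> B"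
  using coset_eq_iff[OF submodule_module[OF M Z] B'] minus_submodule[OF M Z] by simp

lemma subquot_eq_zero_iff: "x \<in> Z \<Longrightarrow> B +>\<^bsub>M\<^esub> x = B \<longleftrightarrow> x \<in> B"
  using coset_eq_zero_iff[OF submodule_module[OF M Z] B'] by simp

lemma subquot_lift:
  assumes "module K P" "h \<in> mod_hom K (M\<lparr>carrier := Z\<rparr>) P" "\<And>x. x \<in> B \<Longrightarrow> h x = \<zero>\<^bsub>P\<^esub>"
  shows "quot_lift h \<in> mod_hom K (quot_mod (M\<lparr>carrier := Z\<rparr>) B) P"
    and "x \<in> Z \<Longrightarrow> quot_lift h (B +>\<^bsub>M\<^esub> x) = h x"
  using quot_lift_hom[OF submodule_module[OF M Z] B' assms]
    quot_lift_hom_coset[OF submodule_module[OF M Z] B' assms] by simp_all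

text \<open>To identify \<open>Z / B\<close> with \<open>P\<close> it thus suffices to give a
  surjection from \<open>Z\<close> with kernel \<open>B\<close>; the induced map on cosets is never
  written down. The comparisons of pages below go through this rule.\<close>

lemma mod_isomorphic_subquot:
  assumes "module K P" "h \<in> mod_hom K (M\<lparr>carrier := Z\<rparr>) P" "h ` Z = carrier P"
    "\<And>x. x \<in> Z \<Longrightarrow> h x = \<zero>\<^bsub>P\<^esub> \<longleftrightarrow> x \<in> B"
  shows "mod_isomorphic K (quot_mod (M\<lparr>carrier := Z\<rparr>) B) P"
  by (rule mod_isomorphic_same_kernel[OF submodule_module[OF M Z] subquot_module assms(1) subquot_proj _ assms(2)])
     (auto simp: subquot_carrier assms(3,4) subquot_eq_zero_iff subquot_zero)

end

subsection \<open>Direct sums\<close>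

context
  fixes K :: "('k, 'z) ring_scheme" and I :: "'i set" and X :: "'i \<Rightarrow> ('k, 'a) module"
  assumes K: "cring K" and X: "\<And>i. i \<in> I \<Longrightarrow> module K (X i)"
begin

lemma dsum_carrier_iff:
  "f \<in> carrier (dsum I X) \<longleftrightarrow>
     f \<in> extensional I \<and> (\<forall>i\<in>I. f i \<in> carrier (X i)) \<and> finite {i \<in> I. f i \<noteq> \<zero>\<^bsub>X i\<^esub>}"
  by (auto simp: dsum_def PiE_iff)

lemma dsum_apply_closed: "\<lbrakk>f \<in> carrier (dsum I X); i \<in> I\<rbrakk> \<Longrightarrow> f i \<in> carrier (X i)"
  by (auto simp: dsum_carrier_iff)

lemma dsum_ext:
  "\<lbrakk>f \<in> carrier (dsum I X); g \<in> carrier (dsum I X); \<And>i. i \<in> I \<Longrightarrow> f i = g i\<rbrakk> \<Longrightarrow> f = g"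
  by (rule extensionalityI[of _ I]) (auto simp: dsum_carrier_iff)

lemma dsum_add_apply: "i \<in> I \<Longrightarrow> (f \<oplus>\<^bsub>dsum I X\<^esub> g) i = f i \<oplus>\<^bsub>X i\<^esub> g i"
  by (simp add: dsum_def)

lemma dsum_smult_apply: "i \<in> I \<Longrightarrow> (a \<odot>\<^bsub>dsum I X\<^esub> f) i = a \<odot>\<^bsub>X i\<^esub> f i"
  by (simp add: dsum_def)

lemma dsum_zero_apply: "i \<in> I \<Longrightarrow> \<zero>\<^bsub>dsum I X\<^esub> i = \<zero>\<^bsub>X i\<^esub>"
  by (simp add: dsum_def)

private lemma X_facts:
  assumes "i \<in> I"
  shows "\<zero>\<^bsub>X i\<^esub> \<in> carrier (X i)"
    and "\<And>x y. \<lbrakk>x \<in> carrier (X i); y \<in> carrier (X i)\<rbrakk> \<Longrightarrow> x \<oplus>\<^bsub>X i\<^esub> y \<in> carrier (X i)"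
    and "\<And>x y. \<lbrakk>x \<in> carrier (X i); y \<in> carrier (X i)\<rbrakk> \<Longrightarrow> x \<oplus>\<^bsub>X i\<^esub> y = y \<oplus>\<^bsub>X i\<^esub> x"
    and "\<And>x y z. \<lbrakk>x \<in> carrier (X i); y \<in> carrier (X i); z \<in> carrier (X i)\<rbrakk>
      \<Longrightarrow> x \<oplus>\<^bsub>X i\<^esub> y \<oplus>\<^bsub>X i\<^esub> z = x \<oplus>\<^bsub>X i\<^esub> (y \<oplus>\<^bsub>X i\<^esub> z)"
    and "\<And>x. x \<in> carrier (X i) \<Longrightarrow> \<zero>\<^bsub>X i\<^esub> \<oplus>\<^bsub>X i\<^esub> x = x"
    and "\<And>x. x \<in> carrier (X i) \<Longrightarrow> \<ominus>\<^bsub>X i\<^esub> x \<in> carrier (X i)"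
    and "\<And>x. x \<in> carrier (X i) \<Longrightarrow> \<ominus>\<^bsub>X i\<^esub> x \<oplus>\<^bsub>X i\<^esub> x = \<zero>\<^bsub>X i\<^esub>"
    and "\<And>a x. \<lbrakk>a \<in> carrier K; x \<in> carrier (X i)\<rbrakk> \<Longrightarrow> a \<odot>\<^bsub>X i\<^esub> x \<in> carrier (X i)"
    and "\<And>a. a \<in> carrier K \<Longrightarrow> a \<odot>\<^bsub>X i\<^esub> \<zero>\<^bsub>X i\<^esub> = \<zero>\<^bsub>X i\<^esub>"
    and "\<ominus>\<^bsub>X i\<^esub> \<zero>\<^bsub>X i\<^esub> = \<zero>\<^bsub>X i\<^esub>"
proof -
  interpret module K "X i" by (rule X[OF assms])
  show "\<zero>\<^bsub>X i\<^esub> \<in> carrier (X i)"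
    "\<And>x y. \<lbrakk>x \<in> carrier (X i); y \<in> carrier (X i)\<rbrakk> \<Longrightarrow> x \<oplus>\<^bsub>X i\<^esub> y \<in> carrier (X i)"
    "\<And>x y. \<lbrakk>x \<in> carrier (X i); y \<in> carrier (X i)\<rbrakk> \<Longrightarrow> x \<oplus>\<^bsub>X i\<^esub> y = y \<oplus>\<^bsub>X i\<^esub> x"
    "\<And>x y z. \<lbrakk>x \<in> carrier (X i); y \<in> carrier (X i); z \<in> carrier (X i)\<rbrakk>
      \<Longrightarrow> x \<oplus>\<^bsub>X i\<^esub> y \<oplus>\<^bsub>X i\<^esub> z = x \<oplus>\<^bsub>X i\<^esub> (y \<oplus>\<^bsub>X i\<^esub> z)"
    "\<And>x. x \<in> carrier (X i) \<Longrightarrow> \<zero>\<^bsub>X i\<^esub> \<oplus>\<^bsub>X i\<^esub> x = x"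
    "\<And>x. x \<in> carrier (X i) \<Longrightarrow> \<ominus>\<^bsub>X i\<^esub> x \<in> carrier (X i)"
    "\<And>x. x \<in> carrier (X i) \<Longrightarrow> \<ominus>\<^bsub>X i\<^esub> x \<oplus>\<^bsub>X i\<^esub> x = \<zero>\<^bsub>X i\<^esub>"
    "\<And>a x. \<lbrakk>a \<in> carrier K; x \<in> carrier (X i)\<rbrakk> \<Longrightarrow> a \<odot>\<^bsub>X i\<^esub> x \<in> carrier (X i)"
    "\<And>a. a \<in> carrier K \<Longrightarrow> a \<odot>\<^bsub>X i\<^esub> \<zero>\<^bsub>X i\<^esub> = \<zero>\<^bsub>X i\<^esub>"
    "\<ominus>\<^bsub>X i\<^esub> \<zero>\<^bsub>X i\<^esub> = \<zero>\<^bsub>X i\<^esub>"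
    by (simp_all add: M.a_ac M.r_neg)
qed

lemma dsum_add_closed:
  assumes "f \<in> carrier (dsum I X)" "g \<in> carrier (dsum I X)"
  shows "f \<oplus>\<^bsub>dsum I X\<^esub> g \<in> carrier (dsum I X)"
proof -
  have "finite ({i \<in> I. f i \<noteq> \<zero>\<^bsub>X i\<^esub>} \<union> {i \<in> I. g i \<noteq> \<zero>\<^bsub>X i\<^esub>})"
    using assms by (simp add: dsum_carrier_iff)
  then have "finite {i \<in> I. (f \<oplus>\<^bsub>dsum I X\<^esub> g) i \<noteq> \<zero>\<^bsub>X i\<^esub>}"
    by (rule rev_finite_subset) (auto simp: dsum_add_apply X_facts(1,5))
  then show ?thesis
    using assms by (simp add: dsum_carrier_iff dsum_add_apply X_facts) (simp add: dsum_def)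
qed

lemma dsum_smult_closed:
  assumes "a \<in> carrier K" "f \<in> carrier (dsum I X)"
  shows "a \<odot>\<^bsub>dsum I X\<^esub> f \<in> carrier (dsum I X)"
proof -
  have "finite {i \<in> I. f i \<noteq> \<zero>\<^bsub>X i\<^esub>}"
    using assms by (simp add: dsum_carrier_iff)
  then have "finite {i \<in> I. (a \<odot>\<^bsub>dsum I X\<^esub> f) i \<noteq> \<zero>\<^bsub>X i\<^esub>}"
    by (rule rev_finite_subset) (auto simp: dsum_smult_apply X_facts(9) assms(1))
  then show ?thesis
    using assms by (simp add: dsum_carrier_iff dsum_smult_apply X_facts) (simp add: dsum_def)
qed

lemma dsum_zero_closed: "\<zero>\<^bsub>dsum I X\<^esub> \<in> carrier (dsum I X)"
  by (simp add: dsum_carrier_iff dsum_zero_apply X_facts) (simp add: dsum_def)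

lemma dsum_module: "module K (dsum I X)"
proof -
  let ?D = "dsum I X"
  have ab: "abelian_group ?D"
  proof (rule abelian_groupI, goal_cases)
    case (1 x y) then show ?case by (rule dsum_add_closed)
  next
    case 2 then show ?case by (rule dsum_zero_closed)
  next
    case (3 x y z) then show ?case
      by (intro dsum_ext dsum_add_closed) (auto simp: dsum_add_apply X_facts(4) dsum_apply_closed)
  next
    case (4 x y) then show ?case
      by (intro dsum_ext dsum_add_closed) (auto simp: dsum_add_apply X_facts(3) dsum_apply_closed)
  next
    case (5 x) then show ?case
      by (intro dsum_ext dsum_add_closed dsum_zero_closed)
         (auto simp: dsum_add_apply dsum_zero_apply X_facts(5) dsum_apply_closed)
  next
    case (6 x)
    let ?y = "\<lambda>i\<in>I. \<ominus>\<^bsub>X i\<^esub> x i"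
    have "finite {i \<in> I. x i \<noteq> \<zero>\<^bsub>X i\<^esub>}" using 6 by (simp add: dsum_carrier_iff)
    then have "finite {i \<in> I. ?y i \<noteq> \<zero>\<^bsub>X i\<^esub>}"
      by (rule rev_finite_subset) (auto simp: X_facts(10))
    then have y: "?y \<in> carrier ?D" using 6 by (simp add: dsum_carrier_iff X_facts)
    have "?y \<oplus>\<^bsub>?D\<^esub> x = \<zero>\<^bsub>?D\<^esub>"
      by (rule dsum_ext[OF dsum_add_closed[OF y 6] dsum_zero_closed])
         (use 6 in \<open>auto simp: dsum_add_apply dsum_zero_apply X_facts(7) dsum_apply_closed\<close>)
    then show ?case using y by blast
  qed
  show ?thesis
  proof (rule moduleI[OF K ab], goal_cases)
    case (1 a x) then show ?case by (rule dsum_smult_closed)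
  next
    case (2 a b x)
    interpret cring K by (rule K)
    show ?case using 2
      by (intro dsum_ext dsum_add_closed dsum_smult_closed)
         (auto simp: dsum_add_apply dsum_smult_apply module.smult_l_distr[OF X] dsum_apply_closed)
  next
    case (3 a x y) then show ?case
      by (intro dsum_ext dsum_add_closed dsum_smult_closed)
         (auto simp: dsum_add_apply dsum_smult_apply module.smult_r_distr[OF X] dsum_apply_closed)
  next
    case (4 a b x)
    interpret cring K by (rule K)
    show ?case using 4
      by (intro dsum_ext dsum_add_closed dsum_smult_closed)
         (auto simp: dsum_smult_apply module.smult_assoc1[OF X] dsum_apply_closed)
  next
    case (5 x)
    interpret cring K by (rule K)
    show ?case using 5
      by (intro dsum_ext dsum_smult_closed)
         (auto simp: dsum_smult_apply module.smult_one[OF X] dsum_apply_closed)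
  qed
qed

interpretation D: module K "dsum I X" by (rule dsum_module)

lemma dsum_apply_hom: "i \<in> I \<Longrightarrow> (\<lambda>f. f i) \<in> mod_hom K (dsum I X) (X i)"
  by (intro mod_homI) (auto simp: dsum_apply_closed dsum_add_apply dsum_smult_apply)

lemma mod_hom_dsumI:
  assumes "\<And>x. x \<in> carrier P \<Longrightarrow> h x \<in> carrier (dsum I X)"
    and "\<And>i. i \<in> I \<Longrightarrow> (\<lambda>x. h x i) \<in> mod_hom K P (X i)" and P: "module K P"
  shows "h \<in> mod_hom K P (dsum I X)"
proof (rule mod_homI)
  interpret P: module K P by (rule P)
  fix x y assume xy: "x \<in> carrier P" "y \<in> carrier P"
  show "h (x \<oplus>\<^bsub>P\<^esub> y) = h x \<oplus>\<^bsub>dsum I X\<^esub> h y"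
    using xy assms(1) by (intro dsum_ext) (auto simp: dsum_add_apply mod_hom_add[OF assms(2)])
next
  interpret P: module K P by (rule P)
  fix a x assume ax: "a \<in> carrier K" "x \<in> carrier P"
  show "h (a \<odot>\<^bsub>P\<^esub> x) = a \<odot>\<^bsub>dsum I X\<^esub> h x"
    using ax assms(1) by (intro dsum_ext) (auto simp: dsum_smult_apply mod_hom_smult[OF assms(2)])
qed (rule assms(1))

lemma dsum_inj_apply: "j \<in> I \<Longrightarrow> dsum_inj I X i x j = (if j = i then x else \<zero>\<^bsub>X j\<^esub>)"
  by (simp add: dsum_inj_def)

lemma dsum_inj_closed:
  assumes "i \<in> I" "x \<in> carrier (X i)"
  shows "dsum_inj I X i x \<in> carrier (dsum I X)"
proof -
  have "finite {j \<in> I. dsum_inj I X i x j \<noteq> \<zero>\<^bsub>X j\<^esub>}"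
    by (rule finite_subset[of _ "{i}"]) (auto simp: dsum_inj_apply split: if_splits)
  then show ?thesis using assms
    by (simp add: dsum_carrier_iff dsum_inj_apply X_facts) (simp add: dsum_inj_def)
qed

lemma dsum_inj_hom: "i \<in> I \<Longrightarrow> dsum_inj I X i \<in> mod_hom K (X i) (dsum I X)"
proof (rule mod_hom_dsumI)
  fix j assume ij: "i \<in> I" "j \<in> I"
  show "(\<lambda>x. dsum_inj I X i x j) \<in> mod_hom K (X i) (X j)"
    using ij mod_hom_const_zero[OF X X] mod_hom_id
    by (cases "j = i") (simp_all add: dsum_inj_apply)
qed (auto intro: dsum_inj_closed X)

text \<open>Coordinates are split off one at a time: an element of finite support is a finite sum of
  elements of single summands.\<close>

lemma dsum_spanning: "spanning K (dsum I X) {dsum_inj I X i x | i x. i \<in> I \<and> x \<in> carrier (X i)}"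
  unfolding spanning_def
proof (intro conjI allI impI)
  fix P assume P: "submodule P K (dsum I X)" and S: "{dsum_inj I X i x | i x. i \<in> I \<and> x \<in> carrier (X i)} \<subseteq> P"
  \<comment> \<open>The induction runs over any finite set that contains the support, so that
    removing an index \<open>j\<close> is harmless also if \<open>j\<close> lies outside
    \<open>I\<close> or carries a zero coordinate.\<close>
  have "f \<in> carrier (dsum I X) \<longrightarrow> {i \<in> I. f i \<noteq> \<zero>\<^bsub>X i\<^esub>} \<subseteq> J \<longrightarrow> f \<in> P" if "finite J" for f J
    using that
  proof (induction J arbitrary: f rule: finite_induct)
    case empty
    show ?case
    proof (intro impI)
      assume "f \<in> carrier (dsum I X)" "{i \<in> I. f i \<noteq> \<zero>\<^bsub>X i\<^esub>} \<subseteq> {}"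
      then have "f = \<zero>\<^bsub>dsum I X\<^esub>" by (intro dsum_ext) (auto simp: dsum_zero_apply)
      then show "f \<in> P" using submodule_zero[OF P] by simp
    qed
  next
    case (insert j J)
    show ?case
    proof (intro impI)
      assume f: "f \<in> carrier (dsum I X)" and sub: "{i \<in> I. f i \<noteq> \<zero>\<^bsub>X i\<^esub>} \<subseteq> insert j J"
      show "f \<in> P"
      proof (cases "j \<in> I")
        case True
        let ?e = "dsum_inj I X j (f j)" and ?g = "\<lambda>i\<in>I. if i = j then \<zero>\<^bsub>X i\<^esub> else f i"
        have e: "?e \<in> carrier (dsum I X)" using f True by (intro dsum_inj_closed dsum_apply_closed)
        have "finite {i \<in> I. ?g i \<noteq> \<zero>\<^bsub>X i\<^esub>}"
          by (rule finite_subset[of _ "{i \<in> I. f i \<noteq> \<zero>\<^bsub>X i\<^esub>}"]) (use f in \<open>auto simp: dsum_carrier_iff\<close>)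
        then have g: "?g \<in> carrier (dsum I X)"
          using f by (auto simp: dsum_carrier_iff X_facts)
        moreover have "{i \<in> I. ?g i \<noteq> \<zero>\<^bsub>X i\<^esub>} \<subseteq> J" using sub by auto
        ultimately have gP: "?g \<in> P" using insert.IH by blast
        have "f = ?e \<oplus>\<^bsub>dsum I X\<^esub> ?g"
        proof (rule dsum_ext[OF f D.a_closed[OF e g]])
          fix i assume i: "i \<in> I"
          then have "f i \<in> carrier (X i)" using f by (rule dsum_apply_closed[rotated])
          then show "f i = (?e \<oplus>\<^bsub>dsum I X\<^esub> ?g) i"
            using X_facts(5)[OF i] X_facts(3)[OF i _ X_facts(1)[OF i]] i
            by (auto simp: dsum_add_apply dsum_inj_apply)
        qed
        moreover have "?e \<in> P" using S True f dsum_apply_closed by blast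
        ultimately show ?thesis using gP submodule_add[OF P] by metis
      next
        case False
        then have "{i \<in> I. f i \<noteq> \<zero>\<^bsub>X i\<^esub>} \<subseteq> J" using sub by auto
        then show ?thesis using insert.IH f by blast
      qed
    qed
  qed
  then show "carrier (dsum I X) \<subseteq> P" by (auto simp: dsum_carrier_iff)
qed (auto intro: dsum_inj_closed)

context
  fixes N :: "('k, 'b) module" and h :: "'i \<Rightarrow> 'a \<Rightarrow> 'b"
  assumes N: "module K N" and h: "\<And>i. i \<in> I \<Longrightarrow> h i \<in> mod_hom K (X i) N"
begin

interpretation N: module K N by (rule N)

text \<open>The defining sum runs over the support of \<open>f\<close>, which changes under addition
  and scaling. Enlarging it to a common finite index set makes linearity a termwise
  computation.\<close>

private lemma dsum_lift_finsum:
  assumes "f \<in> carrier (dsum I X)" "finite J" "J \<subseteq> I" "{i \<in> I. f i \<noteq> \<zero>\<^bsub>X i\<^esub>} \<subseteq> J"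
  shows "dsum_lift I X N h f = (\<Oplus>\<^bsub>N\<^esub>i\<in>J. h i (f i))"
  unfolding dsum_lift_def
proof (rule N.M.add.finprod_mono_neutral_cong_left[OF assms(2,4)])
  fix i assume "i \<in> J - {i \<in> I. f i \<noteq> \<zero>\<^bsub>X i\<^esub>}"
  then have "i \<in> I" "f i = \<zero>\<^bsub>X i\<^esub>" using assms(3) by auto
  then show "h i (f i) = \<zero>\<^bsub>N\<^esub>" using mod_hom_zero[OF X N h] by simp
qed (use assms in \<open>auto intro!: mod_hom_closed[OF h] dsum_apply_closed\<close>)

lemma dsum_lift_hom: "dsum_lift I X N h \<in> mod_hom K (dsum I X) N"
proof (rule mod_homI)
  fix f assume f: "f \<in> carrier (dsum I X)"
  then show "dsum_lift I X N h f \<in> carrier N"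
    unfolding dsum_lift_def by (intro N.M.finsum_closed) (auto intro!: mod_hom_closed[OF h] dsum_apply_closed)
next
  fix f g assume f: "f \<in> carrier (dsum I X)" and g: "g \<in> carrier (dsum I X)"
  let ?J = "{i \<in> I. f i \<noteq> \<zero>\<^bsub>X i\<^esub>} \<union> {i \<in> I. g i \<noteq> \<zero>\<^bsub>X i\<^esub>}"
  have J: "finite ?J" "?J \<subseteq> I" using f g by (auto simp: dsum_carrier_iff)
  have "dsum_lift I X N h (f \<oplus>\<^bsub>dsum I X\<^esub> g) = (\<Oplus>\<^bsub>N\<^esub>i\<in>?J. h i ((f \<oplus>\<^bsub>dsum I X\<^esub> g) i))"
    by (rule dsum_lift_finsum[OF dsum_add_closed[OF f g] J])
       (auto simp: dsum_add_apply X_facts(1,5))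
  also have "\<dots> = (\<Oplus>\<^bsub>N\<^esub>i\<in>?J. h i (f i) \<oplus>\<^bsub>N\<^esub> h i (g i))"
    using f g by (intro N.M.finsum_cong')
      (auto simp: dsum_add_apply mod_hom_add[OF h] dsum_apply_closed intro!: N.M.a_closed mod_hom_closed[OF h])
  also have "\<dots> = (\<Oplus>\<^bsub>N\<^esub>i\<in>?J. h i (f i)) \<oplus>\<^bsub>N\<^esub> (\<Oplus>\<^bsub>N\<^esub>i\<in>?J. h i (g i))"
    using f g by (intro N.M.finsum_addf) (auto intro!: mod_hom_closed[OF h] dsum_apply_closed)
  also have "\<dots> = dsum_lift I X N h f \<oplus>\<^bsub>N\<^esub> dsum_lift I X N h g"
    using dsum_lift_finsum[OF f J] dsum_lift_finsum[OF g J] by simp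
  finally show "dsum_lift I X N h (f \<oplus>\<^bsub>dsum I X\<^esub> g) = dsum_lift I X N h f \<oplus>\<^bsub>N\<^esub> dsum_lift I X N h g" .
next
  fix a f assume a: "a \<in> carrier K" and f: "f \<in> carrier (dsum I X)"
  let ?J = "{i \<in> I. f i \<noteq> \<zero>\<^bsub>X i\<^esub>}"
  have J: "finite ?J" "?J \<subseteq> I" using f by (auto simp: dsum_carrier_iff)
  have "dsum_lift I X N h (a \<odot>\<^bsub>dsum I X\<^esub> f) = (\<Oplus>\<^bsub>N\<^esub>i\<in>?J. h i ((a \<odot>\<^bsub>dsum I X\<^esub> f) i))"
    by (rule dsum_lift_finsum[OF dsum_smult_closed[OF a f] J])
       (auto simp: dsum_smult_apply X_facts(9) a)
  also have "\<dots> = (\<Oplus>\<^bsub>N\<^esub>i\<in>?J. a \<odot>\<^bsub>N\<^esub> h i (f i))"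
    using f a by (intro N.M.finsum_cong')
      (auto simp: dsum_smult_apply mod_hom_smult[OF h] dsum_apply_closed intro!: N.smult_closed mod_hom_closed[OF h])
  also have "\<dots> = a \<odot>\<^bsub>N\<^esub> (\<Oplus>\<^bsub>N\<^esub>i\<in>?J. h i (f i))"
    using f J a by (intro N.finsum_smult_ldistr[symmetric]) (auto intro!: mod_hom_closed[OF h] dsum_apply_closed)
  also have "\<dots> = a \<odot>\<^bsub>N\<^esub> dsum_lift I X N h f"
    by (simp add: dsum_lift_def)
  finally show "dsum_lift I X N h (a \<odot>\<^bsub>dsum I X\<^esub> f) = a \<odot>\<^bsub>N\<^esub> dsum_lift I X N h f" .
qed

lemma dsum_lift_inj:
  assumes "i \<in> I" "x \<in> carrier (X i)"
  shows "dsum_lift I X N h (dsum_inj I X i x) = h i x"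
proof -
  have "dsum_lift I X N h (dsum_inj I X i x) = (\<Oplus>\<^bsub>N\<^esub>j\<in>{i}. h j (dsum_inj I X i x j))"
    using assms by (intro dsum_lift_finsum dsum_inj_closed) (auto simp: dsum_inj_apply split: if_splits)
  then show ?thesis
    using assms mod_hom_closed[OF h] by (simp add: dsum_inj_apply)
qed

end

lemma dsum_hom_eq:
  assumes "module K N" "h \<in> mod_hom K (dsum I X) N" "g \<in> mod_hom K (dsum I X) N"
    and "\<And>i x. \<lbrakk>i \<in> I; x \<in> carrier (X i)\<rbrakk> \<Longrightarrow> h (dsum_inj I X i x) = g (dsum_inj I X i x)"
    and "f \<in> carrier (dsum I X)"
  shows "h f = g f"
  by (rule spanning_hom_eq[OF dsum_spanning dsum_module assms(1-3)]) (use assms(4,5) in auto)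

lemma dsum_spanning_gens:
  assumes "\<And>i. i \<in> I \<Longrightarrow> spanning K (X i) (S i)"
  shows "spanning K (dsum I X) {dsum_inj I X i x | i x. i \<in> I \<and> x \<in> S i}"
  unfolding spanning_def
proof (intro conjI allI impI)
  show "{dsum_inj I X i x | i x. i \<in> I \<and> x \<in> S i} \<subseteq> carrier (dsum I X)"
    using assms dsum_inj_closed unfolding spanning_def by blast
  fix P assume P: "submodule P K (dsum I X)" and S: "{dsum_inj I X i x | i x. i \<in> I \<and> x \<in> S i} \<subseteq> P"
  have "dsum_inj I X i x \<in> P" if i: "i \<in> I" and x: "x \<in> carrier (X i)" for i x
  proof -
    have "submodule {x \<in> carrier (X i). dsum_inj I X i x \<in> P} K (X i)"
      by (rule submodule_preimage[OF X[OF i] dsum_module dsum_inj_hom[OF i] P])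
    moreover have "S i \<subseteq> {x \<in> carrier (X i). dsum_inj I X i x \<in> P}"
      using S assms[OF i] i unfolding spanning_def by blast
    ultimately show ?thesis using assms[OF i] x unfolding spanning_def by blast
  qed
  then show "carrier (dsum I X) \<subseteq> P"
    using dsum_spanning P unfolding spanning_def by blast
qed

end

subsection \<open>Free modules and tensor products\<close>

lemma regular_mod_module:
  assumes "cring K" shows "module K (regular_mod K)"
proof -
  interpret K: cring K by fact
  have "abelian_group (regular_mod K)"
    by (rule abelian_groupI) (auto simp: regular_mod_def K.a_ac intro: K.l_neg K.a_inv_closed
        intro!: bexI[of _ "\<ominus>\<^bsub>K\<^esub> x" for x])
  then show ?thesis
    by (rule moduleI[OF assms]) (auto simp: regular_mod_def K.l_distr K.r_distr K.m_assoc)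
qed

context
  fixes K :: "('k, 'z) ring_scheme" and S :: "'s set"
  assumes K: "cring K"
begin

interpretation K: cring K by (rule K)

lemma free_mod_module: "module K (free_mod K S)"
  unfolding free_mod_def by (rule dsum_module[OF K regular_mod_module[OF K]])

lemma free_gen_closed: "s \<in> S \<Longrightarrow> free_gen K S s \<in> carrier (free_mod K S)"
  unfolding free_mod_def free_gen_def
  by (rule dsum_inj_closed[OF K regular_mod_module[OF K]]) (auto simp: regular_mod_def)

lemma free_spanning: "spanning K (free_mod K S) (free_gen K S ` S)"
proof -
  have "spanning K (regular_mod K) {\<one>\<^bsub>K\<^esub>}"
    unfolding spanning_def
  proof (intro conjI allI impI)
    fix N assume N: "submodule N K (regular_mod K)" "{\<one>\<^bsub>K\<^esub>} \<subseteq> N"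
    have "a \<in> N" if "a \<in> carrier K" for a
      using submodule_smult[OF N(1) that, of "\<one>\<^bsub>K\<^esub>"] N(2) that by (simp add: regular_mod_def)
    then show "carrier (regular_mod K) \<subseteq> N" by (auto simp: regular_mod_def)
  qed (auto simp: regular_mod_def)
  from dsum_spanning_gens[OF K regular_mod_module[OF K] this, of S]
  have "spanning K (free_mod K S) {dsum_inj S (\<lambda>_. regular_mod K) i x |i x. i \<in> S \<and> x \<in> {\<one>\<^bsub>K\<^esub>}}"
    by (simp add: free_mod_def)
  moreover have "{dsum_inj S (\<lambda>_. regular_mod K) i x |i x. i \<in> S \<and> x \<in> {\<one>\<^bsub>K\<^esub>}} = free_gen K S ` S"
    by (auto simp: free_gen_def)
  ultimately show ?thesis by simp
qed

context
  fixes N :: "('k, 'b) module" and h :: "'s \<Rightarrow> 'b"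
  assumes N: "module K N" and h: "\<And>s. s \<in> S \<Longrightarrow> h s \<in> carrier N"
begin

lemma free_lift_hom: "free_lift K S N h \<in> mod_hom K (free_mod K S) N"
  unfolding free_mod_def free_lift_def
  by (rule dsum_lift_hom[OF K regular_mod_module[OF K] N]) (auto intro: mod_hom_smult_left[OF N] h)

lemma free_lift_gen: "s \<in> S \<Longrightarrow> free_lift K S N h (free_gen K S s) = h s"
proof -
  assume s: "s \<in> S"
  have "\<one>\<^bsub>K\<^esub> \<in> carrier (regular_mod K)" by (simp add: regular_mod_def)
  then show ?thesis
    unfolding free_gen_def free_lift_def
    by (subst dsum_lift_inj[OF K regular_mod_module[OF K] N])
       (auto intro: mod_hom_smult_left[OF N] h simp: s module.smult_one[OF N h])
qed

end

end

lemma listset_iff: "xs \<in> listset As \<longleftrightarrow> length xs = length As \<and> (\<forall>i<length As. xs ! i \<in> As ! i)"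
proof (induction As arbitrary: xs)
  case (Cons A As)
  show ?case
    by (cases xs) (auto simp: set_Cons_def Cons.IH nth_Cons split: nat.splits)
qed simp

lemma listset_update:
  "\<lbrakk>xs \<in> listset (map carrier Ns); i < length Ns \<Longrightarrow> c \<in> carrier (Ns ! i)\<rbrakk>
    \<Longrightarrow> xs[i := c] \<in> listset (map carrier Ns)"
  by (cases "i < length Ns") (auto simp: listset_iff nth_list_update)

text \<open>Linearity in slot \<open>i\<close> is stated for updates \<open>cs[i := c]\<close> of a
  full list, exactly as in the relations of \<open>tensor_rel\<close>, so that the two match without
  regrouping lists.\<close>

definition multilin ::
  "('k, 'z) ring_scheme \<Rightarrow> ('k, 'm) module \<Rightarrow> ('k, 'c) module list \<Rightarrow> ('k, 'b) module
    \<Rightarrow> ('m \<Rightarrow> 'c list \<Rightarrow> 'b) \<Rightarrow> bool" where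
  "multilin K M Ns N h \<longleftrightarrow>
     (\<forall>cs\<in>listset (map carrier Ns). (\<lambda>m. h m cs) \<in> mod_hom K M N) \<and>
     (\<forall>m\<in>carrier M. \<forall>cs\<in>listset (map carrier Ns). \<forall>i<length Ns.
        (\<lambda>c. h m (cs[i := c])) \<in> mod_hom K (Ns ! i) N)"

lemma multilinI:
  assumes "\<And>cs. cs \<in> listset (map carrier Ns) \<Longrightarrow> (\<lambda>m. h m cs) \<in> mod_hom K M N"
    and "\<And>m cs i. \<lbrakk>m \<in> carrier M; cs \<in> listset (map carrier Ns); i < length Ns\<rbrakk>
      \<Longrightarrow> (\<lambda>c. h m (cs[i := c])) \<in> mod_hom K (Ns ! i) N"
  shows "multilin K M Ns N h"
  using assms unfolding multilin_def by blast

lemma multilin_left: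
  "\<lbrakk>multilin K M Ns N h; cs \<in> listset (map carrier Ns)\<rbrakk> \<Longrightarrow> (\<lambda>m. h m cs) \<in> mod_hom K M N"
  unfolding multilin_def by blast

lemma multilin_right:
  "\<lbrakk>multilin K M Ns N h; m \<in> carrier M; cs \<in> listset (map carrier Ns); i < length Ns\<rbrakk>
    \<Longrightarrow> (\<lambda>c. h m (cs[i := c])) \<in> mod_hom K (Ns ! i) N"
  unfolding multilin_def by blast

lemma multilin_closed:
  "\<lbrakk>multilin K M Ns N h; m \<in> carrier M; cs \<in> listset (map carrier Ns)\<rbrakk> \<Longrightarrow> h m cs \<in> carrier N"
  using mod_hom_closed[OF multilin_left] by fastforce

context
  fixes K :: "('k, 'z) ring_scheme" and M :: "('k, 'm) module" and Ns :: "('k, 'c) module list"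
  assumes K: "cring K" and M: "module K M" and Ns: "\<And>i. i < length Ns \<Longrightarrow> module K (Ns ! i)"
begin

interpretation K: cring K by (rule K)
interpretation M: module K M by (rule M)

private abbreviation "F \<equiv> free_mod K (tuples M Ns)"
private abbreviation "e \<equiv> (\<lambda>m cs. free_gen K (tuples M Ns) (m, cs))"

interpretation F: module K F by (rule free_mod_module[OF K])

private lemma e_closed: "\<lbrakk>m \<in> carrier M; cs \<in> listset (map carrier Ns)\<rbrakk> \<Longrightarrow> e m cs \<in> carrier F"
  by (rule free_gen_closed[OF K]) (simp add: tuples_def)

private lemma Ns_closed:
  assumes "i < length Ns"
  shows "\<lbrakk>c \<in> carrier (Ns ! i); c' \<in> carrier (Ns ! i)\<rbrakk> \<Longrightarrow> c \<oplus>\<^bsub>Ns ! i\<^esub> c' \<in> carrier (Ns ! i)"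
    and "\<lbrakk>a \<in> carrier K; c \<in> carrier (Ns ! i)\<rbrakk> \<Longrightarrow> a \<odot>\<^bsub>Ns ! i\<^esub> c \<in> carrier (Ns ! i)"
proof -
  interpret module K "Ns ! i" by (rule Ns[OF assms])
  show "\<lbrakk>c \<in> carrier (Ns ! i); c' \<in> carrier (Ns ! i)\<rbrakk> \<Longrightarrow> c \<oplus>\<^bsub>Ns ! i\<^esub> c' \<in> carrier (Ns ! i)"
    and "\<lbrakk>a \<in> carrier K; c \<in> carrier (Ns ! i)\<rbrakk> \<Longrightarrow> a \<odot>\<^bsub>Ns ! i\<^esub> c \<in> carrier (Ns ! i)" by auto
qed

text \<open>The generating relations of \<open>tensor_rel\<close> under a name. The rules
  \<open>rels_cases\<close> and \<open>rels_intros\<close> then replace repeated unfolding of a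
  union of four comprehensions.\<close>

private definition "rels = ({e (m \<oplus>\<^bsub>M\<^esub> m') cs \<ominus>\<^bsub>F\<^esub> (e m cs \<oplus>\<^bsub>F\<^esub> e m' cs) | m m' cs.
          m \<in> carrier M \<and> m' \<in> carrier M \<and> cs \<in> listset (map carrier Ns)}
       \<union> {e (a \<odot>\<^bsub>M\<^esub> m) cs \<ominus>\<^bsub>F\<^esub> a \<odot>\<^bsub>F\<^esub> e m cs | a m cs.
          a \<in> carrier K \<and> m \<in> carrier M \<and> cs \<in> listset (map carrier Ns)}
       \<union> {e m (cs[i := c \<oplus>\<^bsub>Ns ! i\<^esub> c']) \<ominus>\<^bsub>F\<^esub> (e m (cs[i := c]) \<oplus>\<^bsub>F\<^esub> e m (cs[i := c'])) | m cs i c c'.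
          m \<in> carrier M \<and> cs \<in> listset (map carrier Ns) \<and> i < length Ns \<and>
          c \<in> carrier (Ns ! i) \<and> c' \<in> carrier (Ns ! i)}
       \<union> {e m (cs[i := a \<odot>\<^bsub>Ns ! i\<^esub> c]) \<ominus>\<^bsub>F\<^esub> a \<odot>\<^bsub>F\<^esub> e m (cs[i := c]) | a m cs i c.
          a \<in> carrier K \<and> m \<in> carrier M \<and> cs \<in> listset (map carrier Ns) \<and> i < length Ns \<and>
          c \<in> carrier (Ns ! i)})"

private lemma tensor_rel_eq: "tensor_rel K M Ns = mod_span K F rels"
  unfolding tensor_rel_def rels_def Let_def ..

private lemma rels_cases:
  assumes "x \<in> rels"
  obtains (add_left) m m' cs where "x = e (m \<oplus>\<^bsub>M\<^esub> m') cs \<ominus>\<^bsub>F\<^esub> (e m cs \<oplus>\<^bsub>F\<^esub> e m' cs)"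
      "m \<in> carrier M" "m' \<in> carrier M" "cs \<in> listset (map carrier Ns)"
  | (smult_left) a m cs where "x = e (a \<odot>\<^bsub>M\<^esub> m) cs \<ominus>\<^bsub>F\<^esub> a \<odot>\<^bsub>F\<^esub> e m cs"
      "a \<in> carrier K" "m \<in> carrier M" "cs \<in> listset (map carrier Ns)"
  | (add_right) m cs i c c' where
      "x = e m (cs[i := c \<oplus>\<^bsub>Ns ! i\<^esub> c']) \<ominus>\<^bsub>F\<^esub> (e m (cs[i := c]) \<oplus>\<^bsub>F\<^esub> e m (cs[i := c']))"
      "m \<in> carrier M" "cs \<in> listset (map carrier Ns)" "i < length Ns"
      "c \<in> carrier (Ns ! i)" "c' \<in> carrier (Ns ! i)"
  | (smult_right) a m cs i c where
      "x = e m (cs[i := a \<odot>\<^bsub>Ns ! i\<^esub> c]) \<ominus>\<^bsub>F\<^esub> a \<odot>\<^bsub>F\<^esub> e m (cs[i := c])"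
      "a \<in> carrier K" "m \<in> carrier M" "cs \<in> listset (map carrier Ns)" "i < length Ns" "c \<in> carrier (Ns ! i)"
  using assms unfolding rels_def Un_iff mem_Collect_eq
  apply (elim disjE exE conjE)
  subgoal by (rule add_left)
  subgoal by (rule smult_left)
  subgoal by (rule add_right)
  subgoal by (rule smult_right)
  done

private lemma rels_intros:
  assumes "m \<in> carrier M" "cs \<in> listset (map carrier Ns)"
  shows "m' \<in> carrier M \<Longrightarrow> e (m \<oplus>\<^bsub>M\<^esub> m') cs \<ominus>\<^bsub>F\<^esub> (e m cs \<oplus>\<^bsub>F\<^esub> e m' cs) \<in> rels"
    and "a \<in> carrier K \<Longrightarrow> e (a \<odot>\<^bsub>M\<^esub> m) cs \<ominus>\<^bsub>F\<^esub> a \<odot>\<^bsub>F\<^esub> e m cs \<in> rels"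
    and "\<lbrakk>i < length Ns; c \<in> carrier (Ns ! i); c' \<in> carrier (Ns ! i)\<rbrakk>
      \<Longrightarrow> e m (cs[i := c \<oplus>\<^bsub>Ns ! i\<^esub> c']) \<ominus>\<^bsub>F\<^esub> (e m (cs[i := c]) \<oplus>\<^bsub>F\<^esub> e m (cs[i := c'])) \<in> rels"
    and "\<lbrakk>a \<in> carrier K; i < length Ns; c \<in> carrier (Ns ! i)\<rbrakk>
      \<Longrightarrow> e m (cs[i := a \<odot>\<^bsub>Ns ! i\<^esub> c]) \<ominus>\<^bsub>F\<^esub> a \<odot>\<^bsub>F\<^esub> e m (cs[i := c]) \<in> rels"
  unfolding rels_def
  subgoal by (rule UnI1, rule UnI1, rule UnI1, intro CollectI exI conjI, rule refl, (rule assms | assumption)+)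
  subgoal by (rule UnI1, rule UnI1, rule UnI2, intro CollectI exI conjI, rule refl, (rule assms | assumption)+)
  subgoal by (rule UnI1, rule UnI2, intro CollectI exI conjI, rule refl, (rule assms | assumption)+)
  subgoal by (rule UnI2, intro CollectI exI conjI, rule refl, (rule assms | assumption)+)
  done

private lemma rels_closed: "rels \<subseteq> carrier F"
proof
  fix x assume "x \<in> rels"
  then show "x \<in> carrier F"
    by (cases rule: rels_cases) (auto intro!: F.M.minus_closed F.a_closed F.smult_closed e_closed listset_update Ns_closed)
qed

private lemma tensor_rel_submodule: "submodule (tensor_rel K M Ns) K F"
  unfolding tensor_rel_eq by (rule submodule_mod_span[OF free_mod_module[OF K] rels_closed])

private lemma rels_in: "x \<in> rels \<Longrightarrow> x \<in> tensor_rel K M Ns"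
  unfolding tensor_rel_eq using mod_span_superset[OF free_mod_module[OF K] rels_closed] by blast

lemma tensor_module: "module K (tensor K M Ns)"
  unfolding tensor_def by (rule quot_mod_module[OF free_mod_module[OF K] tensor_rel_submodule])

private lemma proj: "(\<lambda>x. tensor_rel K M Ns +>\<^bsub>F\<^esub> x) \<in> mod_hom K F (tensor K M Ns)"
  unfolding tensor_def by (rule quot_mod_proj[OF free_mod_module[OF K] tensor_rel_submodule])

lemma pure_tensor_closed:
  "\<lbrakk>m \<in> carrier M; cs \<in> listset (map carrier Ns)\<rbrakk> \<Longrightarrow> pure_tensor K M Ns m cs \<in> carrier (tensor K M Ns)"
  unfolding pure_tensor_def by (rule mod_hom_closed[OF proj e_closed])

private lemma tensor_eqI:
  "\<lbrakk>x \<in> carrier F; y \<in> carrier F; x \<ominus>\<^bsub>F\<^esub> y \<in> rels\<rbrakk>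
    \<Longrightarrow> tensor_rel K M Ns +>\<^bsub>F\<^esub> x = tensor_rel K M Ns +>\<^bsub>F\<^esub> y"
  using coset_eq_iff[OF free_mod_module[OF K] tensor_rel_submodule] rels_in by blast

lemma pure_tensor_multilin: "multilin K M Ns (tensor K M Ns) (pure_tensor K M Ns)"
proof (rule multilinI)
  fix cs assume cs: "cs \<in> listset (map carrier Ns)"
  show "(\<lambda>m. pure_tensor K M Ns m cs) \<in> mod_hom K M (tensor K M Ns)"
  proof (rule mod_homI)
    fix m m' assume m: "m \<in> carrier M" "m' \<in> carrier M"
    have "tensor_rel K M Ns +>\<^bsub>F\<^esub> e (m \<oplus>\<^bsub>M\<^esub> m') cs = tensor_rel K M Ns +>\<^bsub>F\<^esub> (e m cs \<oplus>\<^bsub>F\<^esub> e m' cs)"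
    proof (rule tensor_eqI)
      show "e (m \<oplus>\<^bsub>M\<^esub> m') cs \<ominus>\<^bsub>F\<^esub> (e m cs \<oplus>\<^bsub>F\<^esub> e m' cs) \<in> rels"
        by (rule rels_intros) (use m cs in auto)
    qed (use m cs in \<open>auto intro!: F.a_closed e_closed\<close>)
    then show "pure_tensor K M Ns (m \<oplus>\<^bsub>M\<^esub> m') cs = pure_tensor K M Ns m cs \<oplus>\<^bsub>tensor K M Ns\<^esub> pure_tensor K M Ns m' cs"
      using m cs by (simp add: pure_tensor_def mod_hom_add[OF proj] e_closed)
  next
    fix a m assume m: "a \<in> carrier K" "m \<in> carrier M"
    have "tensor_rel K M Ns +>\<^bsub>F\<^esub> e (a \<odot>\<^bsub>M\<^esub> m) cs = tensor_rel K M Ns +>\<^bsub>F\<^esub> (a \<odot>\<^bsub>F\<^esub> e m cs)"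
    proof (rule tensor_eqI)
      show "e (a \<odot>\<^bsub>M\<^esub> m) cs \<ominus>\<^bsub>F\<^esub> a \<odot>\<^bsub>F\<^esub> e m cs \<in> rels"
        by (rule rels_intros) (use m cs in auto)
    qed (use m cs in \<open>auto intro!: F.smult_closed e_closed\<close>)
    then show "pure_tensor K M Ns (a \<odot>\<^bsub>M\<^esub> m) cs = a \<odot>\<^bsub>tensor K M Ns\<^esub> pure_tensor K M Ns m cs"
      using m cs by (simp add: pure_tensor_def mod_hom_smult[OF proj] e_closed)
  qed (rule pure_tensor_closed[OF _ cs])
next
  fix m cs i assume m: "m \<in> carrier M" and cs: "cs \<in> listset (map carrier Ns)" and i: "i < length Ns"
  show "(\<lambda>c. pure_tensor K M Ns m (cs[i := c])) \<in> mod_hom K (Ns ! i) (tensor K M Ns)"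
  proof (rule mod_homI)
    fix c c' assume c: "c \<in> carrier (Ns ! i)" "c' \<in> carrier (Ns ! i)"
    have "tensor_rel K M Ns +>\<^bsub>F\<^esub> e m (cs[i := c \<oplus>\<^bsub>Ns ! i\<^esub> c'])
      = tensor_rel K M Ns +>\<^bsub>F\<^esub> (e m (cs[i := c]) \<oplus>\<^bsub>F\<^esub> e m (cs[i := c']))"
    proof (rule tensor_eqI)
      show "e m (cs[i := c \<oplus>\<^bsub>Ns ! i\<^esub> c']) \<ominus>\<^bsub>F\<^esub> (e m (cs[i := c]) \<oplus>\<^bsub>F\<^esub> e m (cs[i := c'])) \<in> rels"
        by (rule rels_intros) (use m cs i c in auto)
    qed (use m cs c i in \<open>auto intro!: F.a_closed e_closed listset_update Ns_closed\<close>)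
    then show "pure_tensor K M Ns m (cs[i := c \<oplus>\<^bsub>Ns ! i\<^esub> c'])
      = pure_tensor K M Ns m (cs[i := c]) \<oplus>\<^bsub>tensor K M Ns\<^esub> pure_tensor K M Ns m (cs[i := c'])"
      using m cs c by (simp add: pure_tensor_def mod_hom_add[OF proj] e_closed listset_update)
  next
    fix a c assume c: "a \<in> carrier K" "c \<in> carrier (Ns ! i)"
    have "tensor_rel K M Ns +>\<^bsub>F\<^esub> e m (cs[i := a \<odot>\<^bsub>Ns ! i\<^esub> c])
      = tensor_rel K M Ns +>\<^bsub>F\<^esub> (a \<odot>\<^bsub>F\<^esub> e m (cs[i := c]))"
    proof (rule tensor_eqI)
      show "e m (cs[i := a \<odot>\<^bsub>Ns ! i\<^esub> c]) \<ominus>\<^bsub>F\<^esub> a \<odot>\<^bsub>F\<^esub> e m (cs[i := c]) \<in> rels"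
        by (rule rels_intros) (use m cs i c in auto)
    qed (use m cs c i in \<open>auto intro!: F.smult_closed e_closed listset_update Ns_closed\<close>)
    then show "pure_tensor K M Ns m (cs[i := a \<odot>\<^bsub>Ns ! i\<^esub> c])
      = a \<odot>\<^bsub>tensor K M Ns\<^esub> pure_tensor K M Ns m (cs[i := c])"
      using m cs c by (simp add: pure_tensor_def mod_hom_smult[OF proj] e_closed listset_update)
  qed (use m cs in \<open>auto intro!: pure_tensor_closed listset_update\<close>)
qed

lemma tensor_spanning:
  "spanning K (tensor K M Ns) {pure_tensor K M Ns m cs | m cs. m \<in> carrier M \<and> cs \<in> listset (map carrier Ns)}"
proof -
  have "spanning K (tensor K M Ns) ((\<lambda>x. tensor_rel K M Ns +>\<^bsub>F\<^esub> x) ` free_gen K (tuples M Ns) ` tuples M Ns)"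
    by (rule spanning_image[OF free_spanning[OF K] free_mod_module[OF K] tensor_module proj])
       (simp add: tensor_def quot_mod_carrier[OF free_mod_module[OF K] tensor_rel_submodule])
  moreover have "(\<lambda>x. tensor_rel K M Ns +>\<^bsub>F\<^esub> x) ` free_gen K (tuples M Ns) ` tuples M Ns
    = {pure_tensor K M Ns m cs | m cs. m \<in> carrier M \<and> cs \<in> listset (map carrier Ns)}"
    unfolding image_image tuples_def pure_tensor_def by auto
  ultimately show ?thesis by simp
qed

context
  fixes N :: "('k, 'b) module" and h :: "'m \<Rightarrow> 'c list \<Rightarrow> 'b"
  assumes N: "module K N" and h: "multilin K M Ns N h"
begin

interpretation N: module K N by (rule N)

private abbreviation "l \<equiv> free_lift K (tuples M Ns) N (\<lambda>(m, cs). h m cs)"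

private lemma l_hom: "l \<in> mod_hom K F N"
  by (rule free_lift_hom[OF K N]) (auto simp: tuples_def multilin_closed[OF h])

private lemma l_e: "\<lbrakk>m \<in> carrier M; cs \<in> listset (map carrier Ns)\<rbrakk> \<Longrightarrow> l (e m cs) = h m cs"
  by (subst free_lift_gen[OF K N]) (auto simp: tuples_def multilin_closed[OF h])

private lemma l_minus:
  assumes "x \<in> carrier F" "y \<in> carrier F" "l x = l y" shows "l (x \<ominus>\<^bsub>F\<^esub> y) = \<zero>\<^bsub>N\<^esub>"
  using assms mod_hom_minus[OF free_mod_module[OF K] N l_hom] a_minus_eq_zero_iff[OF N] mod_hom_closed[OF l_hom]
  by simp

text \<open>The kernel of the extension to the free module is a submodule; multilinearity puts the
  four kinds of generating relations into it, hence also their span.\<close>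

private lemma l_rel: "x \<in> tensor_rel K M Ns \<Longrightarrow> l x = \<zero>\<^bsub>N\<^esub>"
proof -
  have "rels \<subseteq> {x \<in> carrier F. l x = \<zero>\<^bsub>N\<^esub>}"
  proof
    fix x assume x: "x \<in> rels"
    then have "l x = \<zero>\<^bsub>N\<^esub>"
    proof (cases rule: rels_cases)
      case (add_left m m' cs)
      then show ?thesis
        by (auto intro!: l_minus e_closed F.a_closed
          simp: l_e mod_hom_add[OF l_hom] e_closed mod_hom_add[OF multilin_left[OF h]])
    next
      case (smult_left a m cs)
      then show ?thesis
        by (auto intro!: l_minus e_closed F.smult_closed
          simp: l_e mod_hom_smult[OF l_hom] e_closed mod_hom_smult[OF multilin_left[OF h]])
    next
      case (add_right m cs i c c')
      then show ?thesis
        by (auto intro!: l_minus e_closed F.a_closed listset_update Ns_closed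
          simp: l_e mod_hom_add[OF l_hom] e_closed listset_update Ns_closed mod_hom_add[OF multilin_right[OF h]])
    next
      case (smult_right a m cs i c)
      then show ?thesis
        by (auto intro!: l_minus e_closed F.smult_closed listset_update Ns_closed
          simp: l_e mod_hom_smult[OF l_hom] e_closed listset_update Ns_closed mod_hom_smult[OF multilin_right[OF h]])
    qed
    then show "x \<in> {x \<in> carrier F. l x = \<zero>\<^bsub>N\<^esub>}" using x rels_closed by auto
  qed
  then have "tensor_rel K M Ns \<subseteq> {x \<in> carrier F. l x = \<zero>\<^bsub>N\<^esub>}"
    unfolding tensor_rel_eq
    by (rule mod_span_least[OF free_mod_module[OF K] rels_closed submodule_kernel[OF free_mod_module[OF K] N l_hom]])
  then show "x \<in> tensor_rel K M Ns \<Longrightarrow> l x = \<zero>\<^bsub>N\<^esub>" by auto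
qed

lemma tensor_lift_hom: "tensor_lift K M Ns N h \<in> mod_hom K (tensor K M Ns) N"
  unfolding tensor_lift_def tensor_def
  by (rule quot_lift_hom[OF free_mod_module[OF K] tensor_rel_submodule N l_hom l_rel])

lemma tensor_lift_pure:
  "\<lbrakk>m \<in> carrier M; cs \<in> listset (map carrier Ns)\<rbrakk> \<Longrightarrow> tensor_lift K M Ns N h (pure_tensor K M Ns m cs) = h m cs"
  unfolding tensor_lift_def pure_tensor_def
  by (subst quot_lift_hom_coset[OF free_mod_module[OF K] tensor_rel_submodule N l_hom l_rel])
     (auto intro: e_closed simp: l_e)

end

end

section \<open>The spectral sequence of a filtered complex\<close>

lemma a_minus_eq_iff:
  assumes "module K M" "x \<in> carrier M" "y \<in> carrier M" "w \<in> carrier M"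
  shows "x \<ominus>\<^bsub>M\<^esub> y = w \<longleftrightarrow> x = w \<oplus>\<^bsub>M\<^esub> y"
proof -
  interpret M: module K M by fact
  show ?thesis
    using assms(2-4) by (auto simp: a_minus_def M.M.a_assoc M.M.l_neg M.M.r_neg)
qed

lemma a_minus_minus:
  assumes "module K M" "x \<in> carrier M" "y \<in> carrier M"
  shows "x \<ominus>\<^bsub>M\<^esub> (x \<ominus>\<^bsub>M\<^esub> y) = y"
proof -
  interpret M: module K M by fact
  show ?thesis
    using assms(2,3) by (simp add: a_minus_def M.M.minus_add M.M.a_assoc[symmetric] M.M.r_neg)
qed

text \<open>Degrees and filtration indices run over all integers, which keeps the shifts of the
  differentials free of side conditions. In degree \<open>n\<close> the filtration jumps only at
  indices from \<open>0\<close> to \<open>n\<close>; for \<open>n < 0\<close> the assumptions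
  \<open>F_zero\<close> and \<open>F_full\<close> together force \<open>A n\<close> to be
  zero.\<close>

locale filtered_complex =
  fixes K :: "('k, 'z) ring_scheme" and A :: "int \<Rightarrow> ('k, 'a) module"
    and d :: "int \<Rightarrow> 'a \<Rightarrow> 'a" and F :: "int \<Rightarrow> int \<Rightarrow> 'a set"
  assumes A_module: "module K (A n)"
    and d_hom: "d n \<in> mod_hom K (A n) (A (n - 1))"
    and d_d: "x \<in> carrier (A n) \<Longrightarrow> d (n - 1) (d n x) = \<zero>\<^bsub>A (n - 1 - 1)\<^esub>"
    and F_submodule: "submodule (F p n) K (A n)"
    and F_step: "F p n \<subseteq> F (p + 1) n"
    and F_zero: "p < 0 \<Longrightarrow> F p n = {\<zero>\<^bsub>A n\<^esub>}"
    and F_full: "n \<le> p \<Longrightarrow> F p n = carrier (A n)"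
    and d_F: "x \<in> F p n \<Longrightarrow> d n x \<in> F p (n - 1)"
begin

sublocale A: module K "A n" for n by (rule A_module)

lemma F_mono: "p \<le> p' \<Longrightarrow> F p n \<subseteq> F p' n"
  by (induction p' rule: int_ge_induct) (use F_step in auto)

lemma F_carrier: "x \<in> F p n \<Longrightarrow> x \<in> carrier (A n)"
  using submodule_subset[OF F_submodule] by auto

lemma d_closed: "x \<in> carrier (A n) \<Longrightarrow> d n x \<in> carrier (A (n - 1))"
  by (rule mod_hom_closed[OF d_hom])

lemma d_Suc_closed: "x \<in> carrier (A (n + 1)) \<Longrightarrow> d (n + 1) x \<in> carrier (A n)"
  using d_closed[of x "n + 1"] by simp

lemma d_d_Suc: "x \<in> carrier (A (n + 1)) \<Longrightarrow> d n (d (n + 1) x) = \<zero>\<^bsub>A (n - 1)\<^esub>"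
  using d_d[of x "n + 1"] by simp

lemma d_zero: "d n \<zero>\<^bsub>A n\<^esub> = \<zero>\<^bsub>A (n - 1)\<^esub>"
  by (rule mod_hom_zero[OF A_module A_module d_hom])

lemma d_Suc_zero: "d (n + 1) \<zero>\<^bsub>A (n + 1)\<^esub> = \<zero>\<^bsub>A n\<^esub>"
  using d_zero[of "n + 1"] by simp

lemma d_Suc_hom: "d (n + 1) \<in> mod_hom K (A (n + 1)) (A n)"
  using d_hom[of "n + 1"] by simp

section \<open>Approximate cycles and boundaries\<close>

definition cyc :: "int \<Rightarrow> 'a set" where
  "cyc n = {x \<in> carrier (A n). d n x = \<zero>\<^bsub>A (n - 1)\<^esub>}"

definition appr_cyc :: "int \<Rightarrow> int \<Rightarrow> int \<Rightarrow> 'a set" where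
  "appr_cyc r p n = {x \<in> F p n. d n x \<in> F (p - r) (n - 1)}"

text \<open>With \<open>Z(r,p)\<close> for the approximate cycles, this is the usual denominator
  \<open>d Z(r-1,p+r-1) + Z(r-1,p-1)\<close> of page \<open>r\<close>. For
  \<open>x = d z + f\<close> in \<open>appr_cyc r p n\<close> the missing conditions on
  \<open>z\<close> and \<open>f\<close> are automatic: \<open>d f = d x\<close> lies in filtration
  \<open>p - r\<close>, and \<open>d z = x - f\<close> in filtration \<open>p\<close>.\<close>

definition appr_bd :: "int \<Rightarrow> int \<Rightarrow> int \<Rightarrow> 'a set" where
  "appr_bd r p n = {x \<in> appr_cyc r p n. \<exists>z\<in>F (p + r - 1) (n + 1). \<exists>f\<in>F (p - 1) n. x = d (n + 1) z \<oplus>\<^bsub>A n\<^esub> f}"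

lemma appr_cycI: "\<lbrakk>x \<in> F p n; d n x \<in> F (p - r) (n - 1)\<rbrakk> \<Longrightarrow> x \<in> appr_cyc r p n"
  by (simp add: appr_cyc_def)

lemma appr_cyc_F: "x \<in> appr_cyc r p n \<Longrightarrow> x \<in> F p n"
  by (simp add: appr_cyc_def)

lemma appr_cyc_carrier: "x \<in> appr_cyc r p n \<Longrightarrow> x \<in> carrier (A n)"
  using appr_cyc_F F_carrier by blast

lemma appr_cyc_d: "x \<in> appr_cyc r p n \<Longrightarrow> d n x \<in> F (p - r) (n - 1)"
  by (simp add: appr_cyc_def)

lemma appr_bdI:
  "\<lbrakk>x \<in> appr_cyc r p n; z \<in> F (p + r - 1) (n + 1); f \<in> F (p - 1) n; x = d (n + 1) z \<oplus>\<^bsub>A n\<^esub> f\<rbrakk>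
    \<Longrightarrow> x \<in> appr_bd r p n"
  unfolding appr_bd_def by blast

lemma appr_bdE:
  assumes "x \<in> appr_bd r p n"
  obtains z f where "x \<in> appr_cyc r p n" "z \<in> F (p + r - 1) (n + 1)" "f \<in> F (p - 1) n"
    "x = d (n + 1) z \<oplus>\<^bsub>A n\<^esub> f"
  using assms unfolding appr_bd_def by blast

lemma appr_cyc_submodule: "submodule (appr_cyc r p n) K (A n)"
proof -
  have "appr_cyc r p n = F p n \<inter> {x \<in> carrier (A n). d n x \<in> F (p - r) (n - 1)}"
    using F_carrier by (auto simp: appr_cyc_def)
  then show ?thesis
    using submodule_Int[OF A_module F_submodule
        submodule_preimage[OF A_module A_module d_hom F_submodule]] by simp
qed

text \<open>Take \<open>z = 0\<close>. Elements of lower filtration are zero on the page, which is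
  how correction terms are discarded below.\<close>

lemma appr_bd_low: "\<lbrakk>x \<in> F (p - 1) n; d n x \<in> F (p - r) (n - 1)\<rbrakk> \<Longrightarrow> x \<in> appr_bd r p n"
proof (rule appr_bdI[where z = "\<zero>\<^bsub>A (n + 1)\<^esub>" and f = x])
  assume x: "x \<in> F (p - 1) n" "d n x \<in> F (p - r) (n - 1)"
  show "x \<in> appr_cyc r p n" using x F_mono[of "p - 1" p n] by (auto intro: appr_cycI)
  show "x = d (n + 1) \<zero>\<^bsub>A (n + 1)\<^esub> \<oplus>\<^bsub>A n\<^esub> x" using F_carrier[OF x(1)] by (simp add: d_Suc_zero)
qed (auto intro: submodule_zero[OF F_submodule])

lemma appr_bd_submodule: "submodule (appr_bd r p n) K (A n)"
  unfolding submodule_iff[OF A_module]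
proof (intro conjI ballI)
  show "appr_bd r p n \<subseteq> carrier (A n)" using appr_cyc_carrier by (auto simp: appr_bd_def)
  show "\<zero>\<^bsub>A n\<^esub> \<in> appr_bd r p n"
    by (rule appr_bd_low) (auto intro: submodule_zero[OF F_submodule] simp: d_zero)
next
  fix x y assume "x \<in> appr_bd r p n" "y \<in> appr_bd r p n"
  then obtain z f w g where x: "x \<in> appr_cyc r p n" "z \<in> F (p + r - 1) (n + 1)" "f \<in> F (p - 1) n"
      "x = d (n + 1) z \<oplus>\<^bsub>A n\<^esub> f"
    and y: "y \<in> appr_cyc r p n" "w \<in> F (p + r - 1) (n + 1)" "g \<in> F (p - 1) n"
      "y = d (n + 1) w \<oplus>\<^bsub>A n\<^esub> g" by (auto elim!: appr_bdE)
  note c = x(2,3)[THEN F_carrier] y(2,3)[THEN F_carrier]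
  show "x \<oplus>\<^bsub>A n\<^esub> y \<in> appr_bd r p n"
  proof (rule appr_bdI)
    show "z \<oplus>\<^bsub>A (n + 1)\<^esub> w \<in> F (p + r - 1) (n + 1)" using x y by (intro submodule_add[OF F_submodule])
    show "f \<oplus>\<^bsub>A n\<^esub> g \<in> F (p - 1) n" using x y by (intro submodule_add[OF F_submodule])
    show "x \<oplus>\<^bsub>A n\<^esub> y = d (n + 1) (z \<oplus>\<^bsub>A (n + 1)\<^esub> w) \<oplus>\<^bsub>A n\<^esub> (f \<oplus>\<^bsub>A n\<^esub> g)"
      using c by (simp add: x(4) y(4) mod_hom_add[OF d_Suc_hom] d_Suc_closed A.M.a_ac)
  qed (use x y in \<open>intro submodule_add[OF appr_cyc_submodule]\<close>)
next
  fix a x assume a: "a \<in> carrier K" and "x \<in> appr_bd r p n"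
  then obtain z f where x: "x \<in> appr_cyc r p n" "z \<in> F (p + r - 1) (n + 1)" "f \<in> F (p - 1) n"
      "x = d (n + 1) z \<oplus>\<^bsub>A n\<^esub> f" by (auto elim!: appr_bdE)
  note c = x(2,3)[THEN F_carrier]
  show "a \<odot>\<^bsub>A n\<^esub> x \<in> appr_bd r p n"
  proof (rule appr_bdI)
    show "a \<odot>\<^bsub>A (n + 1)\<^esub> z \<in> F (p + r - 1) (n + 1)" using x a by (intro submodule_smult[OF F_submodule])
    show "a \<odot>\<^bsub>A n\<^esub> f \<in> F (p - 1) n" using x a by (intro submodule_smult[OF F_submodule])
    show "a \<odot>\<^bsub>A n\<^esub> x = d (n + 1) (a \<odot>\<^bsub>A (n + 1)\<^esub> z) \<oplus>\<^bsub>A n\<^esub> (a \<odot>\<^bsub>A n\<^esub> f)"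
      using c a by (simp add: x(4) mod_hom_smult[OF d_Suc_hom] d_Suc_closed A.smult_r_distr)
  qed (use x a in \<open>intro submodule_smult[OF appr_cyc_submodule]\<close>)
qed

lemma appr_bd_subset: "appr_bd r p n \<subseteq> appr_cyc r p n"
  by (auto simp: appr_bd_def)

text \<open>The page \<open>r\<close> is indexed by filtration degree and total degree here.\<close>

definition pg :: "int \<Rightarrow> int \<Rightarrow> int \<Rightarrow> ('k, 'a set) module" where
  "pg r p n = quot_mod ((A n)\<lparr>carrier := appr_cyc r p n\<rparr>) (appr_bd r p n)"

definition pg_d :: "int \<Rightarrow> int \<Rightarrow> int \<Rightarrow> 'a set \<Rightarrow> 'a set" where
  "pg_d r p n = quot_lift (\<lambda>x. appr_bd r (p - r) (n - 1) +>\<^bsub>A (n - 1)\<^esub> d n x)"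

lemmas pg_facts = A_module appr_cyc_submodule appr_bd_submodule appr_bd_subset

lemma pg_module: "module K (pg r p n)"
  unfolding pg_def by (rule subquot_module[OF pg_facts])

lemma pg_carrier: "carrier (pg r p n) = (\<lambda>x. appr_bd r p n +>\<^bsub>A n\<^esub> x) ` appr_cyc r p n"
  unfolding pg_def by (rule subquot_carrier[OF pg_facts])

lemma pg_zero: "\<zero>\<^bsub>pg r p n\<^esub> = appr_bd r p n"
  by (simp add: pg_def quot_mod_def)

lemma pg_proj: "(\<lambda>x. appr_bd r p n +>\<^bsub>A n\<^esub> x) \<in> mod_hom K ((A n)\<lparr>carrier := appr_cyc r p n\<rparr>) (pg r p n)"
  unfolding pg_def by (rule subquot_proj[OF pg_facts])

lemmas pg_eq_iff = subquot_eq_iff[OF pg_facts]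
lemmas pg_eq_zero_iff = subquot_eq_zero_iff[OF pg_facts]

lemma d_appr_cyc: "x \<in> appr_cyc r p n \<Longrightarrow> d n x \<in> appr_cyc r (p - r) (n - 1)"
  using appr_cyc_d[of x r p n] appr_cyc_carrier[of x r p n] submodule_zero[OF F_submodule[where p = "p - r - r" and n = "n - 1 - 1"]]
  by (intro appr_cycI) (simp_all only: d_d)

text \<open>For \<open>x = d z + f\<close> the differential is \<open>d f\<close>. As
  \<open>p - 1 = (p - r) + r - 1\<close>, the term \<open>f\<close> takes over the role of
  \<open>z\<close> at the target, with zero in the role of \<open>f\<close>.\<close>

lemma d_appr_bd:
  assumes "x \<in> appr_bd r p n" shows "d n x \<in> appr_bd r (p - r) (n - 1)"
proof -
  obtain z f where x: "x \<in> appr_cyc r p n" "z \<in> F (p + r - 1) (n + 1)" "f \<in> F (p - 1) n"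
      "x = d (n + 1) z \<oplus>\<^bsub>A n\<^esub> f" using assms by (rule appr_bdE)
  note c = x(2,3)[THEN F_carrier]
  show ?thesis
  proof (rule appr_bdI)
    show "d n x \<in> appr_cyc r (p - r) (n - 1)" by (rule d_appr_cyc[OF x(1)])
    show "f \<in> F (p - r + r - 1) (n - 1 + 1)" using x(3) by simp
    show "\<zero>\<^bsub>A (n - 1)\<^esub> \<in> F (p - r - 1) (n - 1)" by (rule submodule_zero[OF F_submodule])
    show "d n x = d (n - 1 + 1) f \<oplus>\<^bsub>A (n - 1)\<^esub> \<zero>\<^bsub>A (n - 1)\<^esub>"
      using c by (simp add: x(4) mod_hom_add[OF d_hom] d_Suc_closed d_d_Suc d_closed)
  qed
qed

lemma d_pg_hom:
  "(\<lambda>x. appr_bd r (p - r) (n - 1) +>\<^bsub>A (n - 1)\<^esub> d n x)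
     \<in> mod_hom K ((A n)\<lparr>carrier := appr_cyc r p n\<rparr>) (pg r (p - r) (n - 1))"
proof -
  have "d n \<in> mod_hom K ((A n)\<lparr>carrier := appr_cyc r p n\<rparr>) ((A (n - 1))\<lparr>carrier := appr_cyc r (p - r) (n - 1)\<rparr>)"
    by (rule mod_hom_restrict_cod[OF mod_hom_restrict_dom[OF d_hom appr_cyc_submodule]]) (simp add: d_appr_cyc)
  from mod_hom_comp[OF this pg_proj] show ?thesis .
qed

lemma d_pg_zero: "x \<in> appr_bd r p n \<Longrightarrow> appr_bd r (p - r) (n - 1) +>\<^bsub>A (n - 1)\<^esub> d n x = \<zero>\<^bsub>pg r (p - r) (n - 1)\<^esub>"
  using d_appr_bd[of x r p n] pg_eq_zero_iff[of "d n x" r "p - r" "n - 1"] appr_bd_subset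
  unfolding pg_zero by blast

lemma pg_d_hom: "pg_d r p n \<in> mod_hom K (pg r p n) (pg r (p - r) (n - 1))"
  unfolding pg_d_def pg_def[of r p n]
  by (rule subquot_lift(1)[OF pg_facts pg_module d_pg_hom d_pg_zero])

lemma pg_d_coset:
  "x \<in> appr_cyc r p n \<Longrightarrow>
     pg_d r p n (appr_bd r p n +>\<^bsub>A n\<^esub> x) = appr_bd r (p - r) (n - 1) +>\<^bsub>A (n - 1)\<^esub> d n x"
  unfolding pg_d_def
  by (rule subquot_lift(2)[OF pg_facts pg_module d_pg_hom d_pg_zero])

lemma pg_d_pg_d:
  assumes "X \<in> carrier (pg r p n)"
  shows "pg_d r (p - r) (n - 1) (pg_d r p n X) = \<zero>\<^bsub>pg r (p - r - r) (n - 1 - 1)\<^esub>"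
proof -
  obtain x where x: "x \<in> appr_cyc r p n" "X = appr_bd r p n +>\<^bsub>A n\<^esub> x"
    using assms by (auto simp: pg_carrier)
  have "pg_d r (p - r) (n - 1) (pg_d r p n X)
    = appr_bd r (p - r - r) (n - 1 - 1) +>\<^bsub>A (n - 1 - 1)\<^esub> \<zero>\<^bsub>A (n - 1 - 1)\<^esub>"
    using x appr_cyc_carrier[OF x(1)] by (simp only: pg_d_coset d_appr_cyc d_d)
  also have "\<dots> = \<zero>\<^bsub>pg r (p - r - r) (n - 1 - 1)\<^esub>"
    unfolding pg_zero
    by (subst pg_eq_zero_iff) (auto intro: submodule_zero[OF appr_cyc_submodule] submodule_zero[OF appr_bd_submodule])
  finally show ?thesis .
qed

definition pg_ker :: "int \<Rightarrow> int \<Rightarrow> int \<Rightarrow> 'a set set" where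
  "pg_ker r p n = a_kernel (pg r p n) (pg r (p - r) (n - 1)) (pg_d r p n)"

definition pg_im :: "int \<Rightarrow> int \<Rightarrow> int \<Rightarrow> 'a set set" where
  "pg_im r p n = pg_d r (p + r) (n + 1) ` carrier (pg r (p + r) (n + 1))"

lemma pg_ker_eq: "pg_ker r p n = {X \<in> carrier (pg r p n). pg_d r p n X = \<zero>\<^bsub>pg r (p - r) (n - 1)\<^esub>}"
  by (simp add: pg_ker_def a_kernel_def')

lemma pg_ker_submodule: "submodule (pg_ker r p n) K (pg r p n)"
  unfolding pg_ker_eq by (rule submodule_kernel[OF pg_module pg_module pg_d_hom])

lemma pg_im_submodule: "submodule (pg_im r p n) K (pg r p n)"
  using submodule_image[OF pg_module pg_module pg_d_hom submodule_carrier[OF pg_module], of r "p + r" "n + 1"]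
  by (simp add: pg_im_def)

lemma pg_im_subset: "pg_im r p n \<subseteq> pg_ker r p n"
  using pg_d_pg_d[of _ r "p + r" "n + 1"] submodule_subset[OF pg_im_submodule[of r p n]]
  by (auto simp: pg_ker_eq pg_im_def)

lemmas pg_homology_facts = pg_module pg_ker_submodule pg_im_submodule pg_im_subset

lemma appr_cyc_Suc: "x \<in> appr_cyc (r + 1) p n \<Longrightarrow> x \<in> appr_cyc r p n"
  using F_mono[of "p - (r + 1)" "p - r" "n - 1"] by (auto simp: appr_cyc_def)

text \<open>Map \<open>appr_cyc (r + 1) p n\<close> to the homology of page \<open>r\<close> by
  taking classes twice. The map is onto because a class killed by the differential has a
  representative that is a cycle to order \<open>r + 1\<close>; its kernel turns out to be
  \<open>appr_bd (r + 1) p n\<close>.\<close>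

lemma pg_next:
  "mod_isomorphic K (pg (r + 1) p n) (quot_mod ((pg r p n)\<lparr>carrier := pg_ker r p n\<rparr>) (pg_im r p n))"
proof -
  let ?c = "\<lambda>x. appr_bd r p n +>\<^bsub>A n\<^esub> x"
  have c_ker: "?c x \<in> pg_ker r p n" if "x \<in> appr_cyc (r + 1) p n" for x
  proof -
    have x: "x \<in> appr_cyc r p n" using appr_cyc_Suc[OF that] .
    have "d n x \<in> appr_bd r (p - r) (n - 1)"
    proof (rule appr_bd_low)
      show "d n x \<in> F (p - r - 1) (n - 1)" using appr_cyc_d[OF that] by (simp add: algebra_simps)
      show "d (n - 1) (d n x) \<in> F (p - r - r) (n - 1 - 1)"
        using submodule_zero[OF F_submodule] by (simp add: d_d appr_cyc_carrier[OF x])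
    qed
    then have "pg_d r p n (?c x) = \<zero>\<^bsub>pg r (p - r) (n - 1)\<^esub>"
      unfolding pg_d_coset[OF x] pg_zero by (subst pg_eq_zero_iff[OF d_appr_cyc[OF x]])
    then show ?thesis using x by (auto simp: pg_ker_eq pg_carrier)
  qed
  have "?c \<in> mod_hom K ((A n)\<lparr>carrier := appr_cyc (r + 1) p n\<rparr>) ((pg r p n)\<lparr>carrier := pg_ker r p n\<rparr>)"
  proof (rule mod_hom_restrict_cod)
    show "?c \<in> mod_hom K ((A n)\<lparr>carrier := appr_cyc (r + 1) p n\<rparr>) (pg r p n)"
      using mod_hom_restrict_dom[OF pg_proj[where r = r and p = p and n = n], of "appr_cyc (r + 1) p n"]
        submodule_submodule[OF A_module appr_cyc_submodule appr_cyc_submodule] appr_cyc_Suc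
      by (simp add: subset_iff)
  qed (simp add: c_ker)
  note hom = mod_hom_comp[OF this subquot_proj[OF pg_homology_facts]]
  show ?thesis
    unfolding pg_def[of "r + 1"]
  proof (rule mod_isomorphic_subquot[OF pg_facts subquot_module[OF pg_homology_facts] hom])
    show "(\<lambda>x. pg_im r p n +>\<^bsub>pg r p n\<^esub> ?c x) ` appr_cyc (r + 1) p n
      = carrier (quot_mod ((pg r p n)\<lparr>carrier := pg_ker r p n\<rparr>) (pg_im r p n))"
      unfolding subquot_carrier[OF pg_homology_facts]
    proof (intro equalityI subsetI)
      fix Y assume "Y \<in> (\<lambda>X. pg_im r p n +>\<^bsub>pg r p n\<^esub> X) ` pg_ker r p n"
      then obtain x where x: "x \<in> appr_cyc r p n" "?c x \<in> pg_ker r p n" "Y = pg_im r p n +>\<^bsub>pg r p n\<^esub> ?c x"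
        by (auto simp: pg_ker_eq pg_carrier)
      have "d n x \<in> appr_bd r (p - r) (n - 1)"
        using x(2) pg_eq_zero_iff[OF d_appr_cyc[OF x(1)]] by (simp add: pg_ker_eq pg_d_coset[OF x(1)] pg_zero)
      then obtain z f where z: "z \<in> F (p - 1) n" and f: "f \<in> F (p - r - 1) (n - 1)"
        and dx: "d n x = d n z \<oplus>\<^bsub>A (n - 1)\<^esub> f" by (elim appr_bdE) auto
      note c = appr_cyc_carrier[OF x(1)] F_carrier[OF z] F_carrier[OF f] d_closed
      have zp: "z \<in> F p n" using z F_mono[of "p - 1" p] by auto
      have d1: "d n (x \<ominus>\<^bsub>A n\<^esub> z) = f"
        using c by (simp add: mod_hom_minus[OF A_module A_module d_hom] a_minus_eq_iff[OF A_module] dx A.M.a_comm)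
      \<comment> \<open>The differential of \<open>x\<close> is \<open>d z + f\<close> with
        \<open>z\<close> of filtration \<open>p - 1\<close>. Subtracting \<open>z\<close> leaves the
        class on page \<open>r\<close> unchanged and pushes the differential one step further down,
        to \<open>f\<close>.\<close>
      have "x \<ominus>\<^bsub>A n\<^esub> z \<in> appr_cyc (r + 1) p n"
        using d1 f by (intro appr_cycI submodule_minus[OF F_submodule] zp appr_cyc_F[OF x(1)]) (simp add: algebra_simps)
      moreover have "?c (x \<ominus>\<^bsub>A n\<^esub> z) = ?c x"
      proof -
        have fF: "f \<in> F (p - r) (n - 1)" using f F_mono[of "p - r - 1" "p - r"] by auto
        have "d n z = d n x \<ominus>\<^bsub>A (n - 1)\<^esub> f"
          using c dx a_minus_eq_iff[OF A_module, of "d n x" "n - 1" f "d n z"] by simp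
        then have dz: "d n z \<in> F (p - r) (n - 1)"
          using submodule_minus[OF F_submodule appr_cyc_d[OF x(1)] fF] by simp
        have "x \<ominus>\<^bsub>A n\<^esub> (x \<ominus>\<^bsub>A n\<^esub> z) = z" using c by (simp add: a_minus_minus[OF A_module])
        then have "?c x = ?c (x \<ominus>\<^bsub>A n\<^esub> z)"
          using appr_bd_low[OF z dz] appr_cyc_Suc[OF calculation] x(1) by (subst pg_eq_iff) auto
        then show ?thesis by simp
      qed
      ultimately show "Y \<in> (\<lambda>x. pg_im r p n +>\<^bsub>pg r p n\<^esub> ?c x) ` appr_cyc (r + 1) p n"
        using x(3) by (metis (mono_tags, lifting) imageI)
    qed (use c_ker in auto)
  next
    fix x assume x: "x \<in> appr_cyc (r + 1) p n"
    note x' = appr_cyc_Suc[OF x]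
    have "pg_im r p n +>\<^bsub>pg r p n\<^esub> ?c x = pg_im r p n \<longleftrightarrow> ?c x \<in> pg_im r p n"
      by (rule subquot_eq_zero_iff[OF pg_homology_facts c_ker[OF x]])
    also have "\<dots> \<longleftrightarrow> (\<exists>w\<in>appr_cyc r (p + r) (n + 1). ?c x = ?c (d (n + 1) w))"
      unfolding pg_im_def pg_carrier image_image using pg_d_coset[of _ r "p + r" "n + 1"]
      by (auto simp: image_iff)
    also have "\<dots> \<longleftrightarrow> (\<exists>w\<in>appr_cyc r (p + r) (n + 1). x \<ominus>\<^bsub>A n\<^esub> d (n + 1) w \<in> appr_bd r p n)"
      using d_appr_cyc[of _ r "p + r" "n + 1"] by (intro bex_cong refl pg_eq_iff[OF x']) simp
    \<comment> \<open>Forwards, the bounding chains \<open>w\<close> of filtration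
      \<open>p + r\<close> and \<open>z\<close> of filtration \<open>p + r - 1\<close> add up to one
      chain. Backwards, the single chain serves as \<open>w\<close>, and the remainder
      \<open>f\<close> is an approximate boundary by \<open>appr_bd_low\<close>.\<close>
    also have "\<dots> \<longleftrightarrow> x \<in> appr_bd (r + 1) p n"
    proof
      assume "\<exists>w\<in>appr_cyc r (p + r) (n + 1). x \<ominus>\<^bsub>A n\<^esub> d (n + 1) w \<in> appr_bd r p n"
      then obtain w z f where w: "w \<in> appr_cyc r (p + r) (n + 1)" and z: "z \<in> F (p + r - 1) (n + 1)"
        and f: "f \<in> F (p - 1) n" and eq: "x \<ominus>\<^bsub>A n\<^esub> d (n + 1) w = d (n + 1) z \<oplus>\<^bsub>A n\<^esub> f"
        by (auto elim!: appr_bdE)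
      note c = appr_cyc_carrier[OF x] appr_cyc_carrier[OF w] F_carrier[OF z] F_carrier[OF f] d_Suc_closed
      show "x \<in> appr_bd (r + 1) p n"
      proof (rule appr_bdI[OF x _ f])
        show "z \<oplus>\<^bsub>A (n + 1)\<^esub> w \<in> F (p + (r + 1) - 1) (n + 1)"
          using z appr_cyc_F[OF w] F_mono[of "p + r - 1" "p + r"]
          by (intro submodule_add[OF F_submodule]) auto
        show "x = d (n + 1) (z \<oplus>\<^bsub>A (n + 1)\<^esub> w) \<oplus>\<^bsub>A n\<^esub> f"
          using eq c by (simp add: a_minus_eq_iff[OF A_module] mod_hom_add[OF d_Suc_hom] A.M.a_ac)
      qed
    next
      assume "x \<in> appr_bd (r + 1) p n"
      then obtain z f where z: "z \<in> F (p + r) (n + 1)" and f: "f \<in> F (p - 1) n"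
        and eq: "x = d (n + 1) z \<oplus>\<^bsub>A n\<^esub> f" by (auto elim!: appr_bdE)
      note c = appr_cyc_carrier[OF x] F_carrier[OF z] F_carrier[OF f] d_Suc_closed
      have fp: "f \<in> F p n" using f F_mono[of "p - 1" p] by auto
      have dz: "d (n + 1) z = x \<ominus>\<^bsub>A n\<^esub> f"
        using a_minus_eq_iff[OF A_module, of x n f "d (n + 1) z"] eq c by simp
      have "z \<in> appr_cyc r (p + r) (n + 1)"
        using z submodule_minus[OF F_submodule appr_cyc_F[OF x] fp] dz by (intro appr_cycI) auto
      moreover have "x \<ominus>\<^bsub>A n\<^esub> d (n + 1) z = f"
        using eq c by (simp add: a_minus_eq_iff[OF A_module] A.M.a_comm)
      moreover have "d n f = d n x"
        using c by (simp add: eq mod_hom_add[OF d_hom] d_d_Suc d_closed)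
      then have "f \<in> appr_bd r p n"
        using appr_cyc_d[OF x'] by (intro appr_bd_low[OF f]) simp
      ultimately show "\<exists>w\<in>appr_cyc r (p + r) (n + 1). x \<ominus>\<^bsub>A n\<^esub> d (n + 1) w \<in> appr_bd r p n" by auto
    qed
    finally show "pg_im r p n +>\<^bsub>pg r p n\<^esub> ?c x = \<zero>\<^bsub>quot_mod ((pg r p n)\<lparr>carrier := pg_ker r p n\<rparr>) (pg_im r p n)\<^esub>
      \<longleftrightarrow> x \<in> appr_bd (r + 1) p n"
      unfolding subquot_zero[OF pg_homology_facts] .
  qed
qed

section \<open>The pages in bidegrees, and their convergence\<close>

definition page :: "nat \<Rightarrow> int \<Rightarrow> int \<Rightarrow> ('k, 'a set) module" where
  "page r p q = pg (int r) p (p + q)"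

definition page_d :: "nat \<Rightarrow> int \<Rightarrow> int \<Rightarrow> 'a set \<Rightarrow> 'a set" where
  "page_d r p q = pg_d (int r) p (p + q)"

lemma spectral_sequence_page: "spectral_sequence K page page_d"
proof (rule spectral_sequence.intro)
  fix r :: nat and p q :: int
  show "module K (page r p q)" unfolding page_def by (rule pg_module)
  have n: "p - int r + (q + int r - 1) = p + q - 1" by simp
  show "page_d r p q \<in> mod_hom K (page r p q) (page r (p - int r) (q + int r - 1))"
    unfolding page_def page_d_def n by (rule pg_d_hom)
  have n2: "p - int r - int r + (q + 2 * int r - 2) = p + q - 1 - 1" "p - 2 * int r = p - int r - int r" by simp_all
  fix X assume "X \<in> carrier (page r p q)"
  then show "page_d r (p - int r) (q + int r - 1) (page_d r p q X)
      = \<zero>\<^bsub>page r (p - 2 * int r) (q + 2 * int r - 2)\<^esub>"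
    unfolding page_def page_d_def n n2(2) unfolding n2(1) by (rule pg_d_pg_d)
next
  fix r :: nat and p q :: int
  have n: "p - int r + (q + int r - 1) = p + q - 1" "p + int r + (q - int r + 1) = p + q + 1" "int (Suc r) = int r + 1"
    by simp_all
  show "mod_isomorphic K (page (Suc r) p q) (quot_mod ((page r p q)
      \<lparr>carrier := a_kernel (page r p q) (page r (p - int r) (q + int r - 1)) (page_d r p q)\<rparr>)
     (page_d r (p + int r) (q - int r + 1) ` carrier (page r (p + int r) (q - int r + 1))))"
    using pg_next[of "int r" p "p + q"] unfolding page_def page_d_def n pg_ker_def pg_im_def .
qed

text \<open>If \<open>p < 0\<close> the filtration is zero; if \<open>q < 0\<close> the degree
  \<open>p + q\<close> is at most \<open>p - 1\<close>, and filtration \<open>p - 1\<close> is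
  already everything. Either way an approximate cycle lies in filtration \<open>p - 1\<close>, so
  its class vanishes.\<close>

lemma first_quadrant_page: "first_quadrant page"
  unfolding first_quadrant_def
proof (intro allI impI)
  fix r :: nat and p q :: int assume pq: "p < 0 \<or> q < 0"
  have "x \<in> appr_bd (int r) p (p + q)" if x: "x \<in> appr_cyc (int r) p (p + q)" for x
  proof (rule appr_bd_low[OF _ appr_cyc_d[OF x]])
    show "x \<in> F (p - 1) (p + q)"
      using pq appr_cyc_F[OF x] appr_cyc_carrier[OF x] F_zero[of p "p + q"] F_zero[of "p - 1" "p + q"] F_full[of "p + q" "p - 1"]
      by auto
  qed
  then show "carrier (page r p q) = {\<zero>\<^bsub>page r p q\<^esub>}"
    using submodule_zero[OF appr_cyc_submodule[of "int r" p "p + q"]]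
      subquot_eq_zero_iff[OF pg_facts, of _ "int r" p "p + q"]
    unfolding page_def pg_carrier pg_zero by auto
qed

lemma cyc_submodule: "submodule (cyc n) K (A n)"
  unfolding cyc_def by (rule submodule_kernel[OF A_module A_module d_hom])

text \<open>Any model of the homology will do, given as a surjection \<open>\<theta>\<close> from
  the cycles that kills exactly the boundaries. The filtration on it consists of the images of the
  cycles of filtration \<open>p\<close>.\<close>

lemma converges_page:
  fixes H :: "nat \<Rightarrow> ('k, 'h) module" and \<theta> :: "nat \<Rightarrow> 'a \<Rightarrow> 'h"
  assumes H: "\<And>n. module K (H n)"
    and hom: "\<And>n. \<theta> n \<in> mod_hom K ((A (int n))\<lparr>carrier := cyc (int n)\<rparr>) (H n)"
    and surj: "\<And>n. \<theta> n ` cyc (int n) = carrier (H n)"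
    and ker: "\<And>n x. x \<in> cyc (int n) \<Longrightarrow> \<theta> n x = \<zero>\<^bsub>H n\<^esub> \<longleftrightarrow> x \<in> d (int n + 1) ` carrier (A (int n + 1))"
  shows "converges_to K page H"
  unfolding converges_to_def
proof
  fix n :: nat
  define FH where "FH p = \<theta> n ` (cyc (int n) \<inter> F p (int n))" for p
  note cm = submodule_module[OF A_module cyc_submodule, of "int n"]
  have sub: "submodule (cyc (int n) \<inter> F p (int n)) K (A (int n))" for p
    by (rule submodule_Int[OF A_module cyc_submodule F_submodule])
  have sub': "submodule (cyc (int n) \<inter> F p (int n)) K ((A (int n))\<lparr>carrier := cyc (int n)\<rparr>)" for p
    by (rule submodule_submodule[OF A_module cyc_submodule sub]) auto
  have FH_sub: "submodule (FH p) K (H n)" for p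
    unfolding FH_def by (rule submodule_image[OF cm H hom sub'])
  have FH_mono: "FH p \<subseteq> FH p'" if "p \<le> p'" for p p'
    using F_mono[OF that, of "int n"] unfolding FH_def by blast
  have zc: "\<zero>\<^bsub>A (int n)\<^esub> \<in> cyc (int n)" by (rule submodule_zero[OF cyc_submodule])
  have "\<theta> n \<zero>\<^bsub>A (int n)\<^esub> = \<zero>\<^bsub>H n\<^esub>" using mod_hom_zero[OF cm H hom] by simp
  then have FH_m1: "FH (- 1) = {\<zero>\<^bsub>H n\<^esub>}"
    using zc unfolding FH_def by (subst F_zero) auto
  have FH_n: "FH (int n) = carrier (H n)"
    unfolding FH_def surj[symmetric] by (subst F_full) (auto simp: cyc_def)
  have iso: "mod_isomorphic K (page r p q) (quot_mod ((H n)\<lparr>carrier := FH p\<rparr>) (FH (p - 1)))"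
    if pq: "p + q = int n" "int r > p" "int r > q + 1" for p q r
  proof -
    note facts = H FH_sub FH_sub FH_mono[of "p - 1" p, simplified]
    \<comment> \<open>By \<open>r > p\<close> the differential of an approximate cycle lies in
      negative filtration, hence is zero.\<close>
    have cyc: "appr_cyc (int r) p (int n) = cyc (int n) \<inter> F p (int n)"
      using pq F_zero[of "p - int r" "int n - 1"] F_carrier by (auto simp: appr_cyc_def cyc_def)
    have "\<theta> n \<in> mod_hom K ((A (int n))\<lparr>carrier := appr_cyc (int r) p (int n)\<rparr>) ((H n)\<lparr>carrier := FH p\<rparr>)"
      unfolding cyc
      using mod_hom_restrict_dom[OF hom sub'[of p]] by (intro mod_hom_restrict_cod) (auto simp: FH_def)
    note hom' = mod_hom_comp[OF this subquot_proj[OF facts]]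
    show ?thesis
      unfolding page_def pq(1) pg_def
    proof (rule mod_isomorphic_subquot[OF pg_facts subquot_module[OF facts] hom'])
      show "(\<lambda>x. FH (p - 1) +>\<^bsub>H n\<^esub> \<theta> n x) ` appr_cyc (int r) p (int n)
        = carrier (quot_mod ((H n)\<lparr>carrier := FH p\<rparr>) (FH (p - 1)))"
        by (subst subquot_carrier[OF facts]) (simp only: cyc FH_def[of p] image_image)
    next
      fix x assume x: "x \<in> appr_cyc (int r) p (int n)"
      then have xc: "x \<in> cyc (int n)" and xF: "x \<in> F p (int n)" by (auto simp: cyc)
      have "FH (p - 1) +>\<^bsub>H n\<^esub> \<theta> n x = FH (p - 1) \<longleftrightarrow> \<theta> n x \<in> FH (p - 1)"
        using x by (intro subquot_eq_zero_iff[OF facts]) (auto simp: FH_def cyc)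
      also have "\<dots> \<longleftrightarrow> (\<exists>f\<in>cyc (int n) \<inter> F (p - 1) (int n). \<theta> n (x \<ominus>\<^bsub>A (int n)\<^esub> f) = \<zero>\<^bsub>H n\<^esub>)"
      proof -
        have "\<theta> n (x \<ominus>\<^bsub>A (int n)\<^esub> f) = \<zero>\<^bsub>H n\<^esub> \<longleftrightarrow> \<theta> n x = \<theta> n f" if "f \<in> cyc (int n)" for f
          using mod_hom_minus[OF cm H hom, of x f] minus_submodule[OF A_module cyc_submodule that, of x]
            a_minus_eq_zero_iff[OF H] mod_hom_closed[OF hom] xc that by simp
        then show ?thesis by (auto simp: FH_def)
      qed
      also have "\<dots> \<longleftrightarrow> x \<in> appr_bd (int r) p (int n)"
      proof
        assume "\<exists>f\<in>cyc (int n) \<inter> F (p - 1) (int n). \<theta> n (x \<ominus>\<^bsub>A (int n)\<^esub> f) = \<zero>\<^bsub>H n\<^esub>"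
        then obtain f where f: "f \<in> cyc (int n)" "f \<in> F (p - 1) (int n)" "\<theta> n (x \<ominus>\<^bsub>A (int n)\<^esub> f) = \<zero>\<^bsub>H n\<^esub>" by auto
        then obtain z where z: "z \<in> carrier (A (int n + 1))" "x \<ominus>\<^bsub>A (int n)\<^esub> f = d (int n + 1) z"
          using ker[of "x \<ominus>\<^bsub>A (int n)\<^esub> f"] submodule_minus[OF cyc_submodule xc f(1)] by auto
        show "x \<in> appr_bd (int r) p (int n)"
        proof (rule appr_bdI[OF x _ f(2)])
          \<comment> \<open>By \<open>r > q + 1\<close> this filtration index is at least
            \<open>p + q + 1\<close>, the degree of \<open>z\<close>, where the filtration is
            exhausted.\<close>
          show "z \<in> F (p + int r - 1) (int n + 1)" using z(1) pq by (subst F_full) auto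
          show "x = d (int n + 1) z \<oplus>\<^bsub>A (int n)\<^esub> f"
            using a_minus_eq_iff[OF A_module, of x "int n" f "d (int n + 1) z"] z F_carrier[OF f(2)] F_carrier[OF xF]
              d_Suc_closed by simp
        qed
      next
        assume "x \<in> appr_bd (int r) p (int n)"
        then obtain z f where z: "z \<in> F (p + int r - 1) (int n + 1)" and f: "f \<in> F (p - 1) (int n)"
          and eq: "x = d (int n + 1) z \<oplus>\<^bsub>A (int n)\<^esub> f" by (auto elim!: appr_bdE)
        note c = F_carrier[OF z] F_carrier[OF f] F_carrier[OF xF] d_Suc_closed d_closed
        have "d (int n) f = d (int n) x"
          using c by (simp add: eq mod_hom_add[OF d_hom] d_d_Suc)
        then have fc: "f \<in> cyc (int n)" using xc c by (simp add: cyc_def)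
        have "x \<ominus>\<^bsub>A (int n)\<^esub> f = d (int n + 1) z"
          using a_minus_eq_iff[OF A_module, of x "int n" f "d (int n + 1) z"] c eq by simp
        then have "\<theta> n (x \<ominus>\<^bsub>A (int n)\<^esub> f) = \<zero>\<^bsub>H n\<^esub>"
          using ker[of "x \<ominus>\<^bsub>A (int n)\<^esub> f"] submodule_minus[OF cyc_submodule xc fc] c by auto
        then show "\<exists>f\<in>cyc (int n) \<inter> F (p - 1) (int n). \<theta> n (x \<ominus>\<^bsub>A (int n)\<^esub> f) = \<zero>\<^bsub>H n\<^esub>" using fc f by auto
      qed
      finally show "FH (p - 1) +>\<^bsub>H n\<^esub> \<theta> n x = \<zero>\<^bsub>quot_mod ((H n)\<lparr>carrier := FH p\<rparr>) (FH (p - 1))\<^esub>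
        \<longleftrightarrow> x \<in> appr_bd (int r) p (int n)"
        unfolding subquot_zero[OF facts] .
    qed
  qed
  show "\<exists>F :: int \<Rightarrow> 'h set. (\<forall>p. submodule (F p) K (H n)) \<and> mono F \<and> F (- 1) = {\<zero>\<^bsub>H n\<^esub>} \<and> F (int n) = carrier (H n) \<and>
        (\<forall>p q. 0 \<le> p \<and> 0 \<le> q \<and> p + q = int n \<longrightarrow>
           (\<forall>r\<ge>2. int r > p \<and> int r > q + 1 \<longrightarrow>
              mod_isomorphic K (page r p q) (quot_mod ((H n)\<lparr>carrier := F p\<rparr>) (F (p - 1)))))"
    using FH_sub FH_mono FH_m1 FH_n iso by (intro exI[of _ FH]) (auto simp: mono_def)
qed

end

section \<open>Transport of spectral sequences along injections\<close>

definition transport_mod :: "('a \<Rightarrow> 'e) \<Rightarrow> ('k, 'a) module \<Rightarrow> ('k, 'e) module" where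
  "transport_mod f M = \<lparr>carrier = f ` carrier M, mult = undefined, one = undefined, zero = f \<zero>\<^bsub>M\<^esub>,
     add = (\<lambda>x y. f (the_inv_into (carrier M) f x \<oplus>\<^bsub>M\<^esub> the_inv_into (carrier M) f y)),
     smult = (\<lambda>a x. f (a \<odot>\<^bsub>M\<^esub> the_inv_into (carrier M) f x))\<rparr>"

context
  fixes K :: "('k, 'z) ring_scheme" and M :: "('k, 'a) module" and f :: "'a \<Rightarrow> 'e"
  assumes M: "module K M" and inj: "inj_on f (carrier M)"
begin

interpretation M: module K M by (rule M)

lemma transport_carrier: "carrier (transport_mod f M) = f ` carrier M"
  by (simp add: transport_mod_def)

lemma transport_zero: "\<zero>\<^bsub>transport_mod f M\<^esub> = f \<zero>\<^bsub>M\<^esub>"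
  by (simp add: transport_mod_def)

lemma transport_add:
  "\<lbrakk>x \<in> carrier M; y \<in> carrier M\<rbrakk> \<Longrightarrow> f x \<oplus>\<^bsub>transport_mod f M\<^esub> f y = f (x \<oplus>\<^bsub>M\<^esub> y)"
  by (simp add: transport_mod_def the_inv_into_f_f[OF inj])

lemma transport_smult:
  "\<lbrakk>a \<in> carrier K; x \<in> carrier M\<rbrakk> \<Longrightarrow> a \<odot>\<^bsub>transport_mod f M\<^esub> f x = f (a \<odot>\<^bsub>M\<^esub> x)"
  by (simp add: transport_mod_def the_inv_into_f_f[OF inj])

lemma transport_hom: "f \<in> mod_hom K M (transport_mod f M)"
  by (rule mod_homI) (auto simp: transport_carrier transport_add transport_smult)

lemma transport_inv_hom: "the_inv_into (carrier M) f \<in> mod_hom K (transport_mod f M) M"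
  by (rule mod_homI)
     (auto simp: transport_carrier transport_add transport_smult the_inv_into_f_f[OF inj])

lemma transport_module: "module K (transport_mod f M)"
proof -
  have "abelian_group (transport_mod f M)"
  proof (rule abelian_groupI, goal_cases)
    case (1 x y) then show ?case by (auto simp: transport_carrier transport_add)
  next
    case 2 then show ?case by (auto simp: transport_carrier transport_zero)
  next
    case (3 x y z) then show ?case by (auto simp: transport_carrier transport_add M.M.a_assoc)
  next
    case (4 x y) then show ?case by (auto simp: transport_carrier transport_add M.M.a_comm)
  next
    case (5 x) then show ?case by (auto simp: transport_carrier transport_add transport_zero)
  next
    case (6 x)
    then obtain a where a: "a \<in> carrier M" "x = f a" by (auto simp: transport_carrier)
    then have "f (\<ominus>\<^bsub>M\<^esub> a) \<oplus>\<^bsub>transport_mod f M\<^esub> x = \<zero>\<^bsub>transport_mod f M\<^esub>"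
      by (simp add: transport_add transport_zero M.M.l_neg)
    then show ?case using a by (auto simp: transport_carrier)
  qed
  then show ?thesis
    by (rule moduleI[OF M.is_cring])
       (auto simp: transport_carrier transport_add transport_smult M.smult_l_distr M.smult_r_distr M.smult_assoc1)
qed

lemma transport_isomorphic: "mod_isomorphic K M (transport_mod f M)"
  unfolding mod_isomorphic_def bij_betw_def using transport_hom inj transport_carrier by blast

end

lemma mod_isomorphic_trivial:
  assumes "module K M" "module K N" "mod_isomorphic K M N" "carrier M = {\<zero>\<^bsub>M\<^esub>}"
  shows "carrier N = {\<zero>\<^bsub>N\<^esub>}"
proof -
  obtain h where h: "h \<in> mod_hom K M N" "h ` carrier M = carrier N"
    using assms(3) unfolding mod_isomorphic_def bij_betw_def by auto
  then show ?thesis using mod_hom_zero[OF assms(1,2) h(1)] assms(4) by auto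
qed

text \<open>Picking a representative of each class embeds page \<open>r + 1\<close>, as a set, into
  page \<open>r\<close>. An injection of the second page into the target type therefore yields one
  for every later page.\<close>

lemma spectral_sequence_embedding:
  fixes E :: "nat \<Rightarrow> int \<Rightarrow> int \<Rightarrow> ('k, 'a) module"
  assumes "spectral_sequence K E d" and 2: "\<And>p q. \<exists>f :: 'a \<Rightarrow> 'e. inj_on f (carrier (E 2 p q))" and "2 \<le> r"
  shows "\<exists>f :: 'a \<Rightarrow> 'e. inj_on f (carrier (E r p q))"
  using assms(3)
proof (induction r rule: nat_induct_at_least)
  case base then show ?case by (rule 2)
next
  case (Suc r)
  interpret spectral_sequence K E d by fact
  obtain f :: "'a \<Rightarrow> 'e" where f: "inj_on f (carrier (E r p q))" using Suc.IH by blast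
  let ?Z = "a_kernel (E r p q) (E r (p - int r) (q + int r - 1)) (d r p q)"
  let ?B = "d r (p + int r) (q - int r + 1) ` carrier (E r (p + int r) (q - int r + 1))"
  let ?Q = "quot_mod ((E r p q)\<lparr>carrier := ?Z\<rparr>) ?B"
  obtain h where h: "inj_on h (carrier (E (Suc r) p q))" "h ` carrier (E (Suc r) p q) = carrier ?Q"
    using next_page[OF Suc.hyps, of p q] unfolding mod_isomorphic_def bij_betw_def by blast
  define g where "g X = (SOME x. x \<in> ?Z \<and> X = ?B +>\<^bsub>E r p q\<^esub> x)" for X
  have g: "g X \<in> ?Z \<and> X = ?B +>\<^bsub>E r p q\<^esub> g X" if "X \<in> carrier ?Q" for X
  proof -
    have "\<exists>x. x \<in> ?Z \<and> X = ?B +>\<^bsub>E r p q\<^esub> x"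
      using that by (auto simp: quot_mod_def A_RCOSETS_def')
    then show ?thesis unfolding g_def by (rule someI_ex)
  qed
  have "inj_on g (carrier ?Q)" by (rule inj_onI) (metis g)
  moreover have "g ` carrier ?Q \<subseteq> carrier (E r p q)" using g by (auto simp: a_kernel_def')
  ultimately have "inj_on (f \<circ> (g \<circ> h)) (carrier (E (Suc r) p q))"
    using inj_on_subset[OF f] h unfolding comp_def
    by (intro comp_inj_on[unfolded comp_def, of h _ "\<lambda>x. f (g x)"] comp_inj_on[unfolded comp_def, of g _ f]) simp_all
  then show ?case by (auto simp: comp_def)
qed

text \<open>A filtered total complex has pages that are sets of total chains, whereas the pages
  wanted are sets of bar chains over homology classes. Only the second page has to be compared with
  the new type.\<close>

lemma spectral_sequence_transport:
  fixes E :: "nat \<Rightarrow> int \<Rightarrow> int \<Rightarrow> ('k, 'a) module"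
  assumes ss: "spectral_sequence K E d" and 2: "\<And>p q. \<exists>f :: 'a \<Rightarrow> 'e. inj_on f (carrier (E 2 p q))"
  obtains E' :: "nat \<Rightarrow> int \<Rightarrow> int \<Rightarrow> ('k, 'e) module" and d'
  where "spectral_sequence K E' d'" "\<And>r p q. 2 \<le> r \<Longrightarrow> mod_isomorphic K (E r p q) (E' r p q)"
proof -
  interpret spectral_sequence K E d by fact
  \<comment> \<open>The injections at different positions and on different pages are unrelated; each
    differential is conjugated by the two that belong to its source and its target.\<close>
  define f :: "nat \<Rightarrow> int \<Rightarrow> int \<Rightarrow> 'a \<Rightarrow> 'e" where "f r p q = (SOME f. inj_on f (carrier (E r p q)))" for r p q
  have inj: "inj_on (f r p q) (carrier (E r p q))" if "2 \<le> r" for r p q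
    unfolding f_def by (rule someI_ex[OF spectral_sequence_embedding[OF ss 2 that]])
  define E' where "E' r p q = transport_mod (f r p q) (E r p q)" for r p q
  define d' where "d' r p q x = f r (p - int r) (q + int r - 1) (d r p q (the_inv_into (carrier (E r p q)) (f r p q) x))"
    for r p q x
  have hom: "f r p q \<in> mod_hom K (E r p q) (E' r p q)" and module': "module K (E' r p q)"
    and carrier': "carrier (E' r p q) = f r p q ` carrier (E r p q)" and zero': "\<zero>\<^bsub>E' r p q\<^esub> = f r p q \<zero>\<^bsub>E r p q\<^esub>"
    if "2 \<le> r" for r p q
    using transport_hom[OF page_module[OF that] inj[OF that]] transport_module[OF page_module[OF that] inj[OF that]]
      transport_carrier[OF page_module[OF that] inj[OF that]] transport_zero[OF page_module[OF that] inj[OF that]]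
    unfolding E'_def by simp_all
  have d'_f: "d' r p q (f r p q x) = f r (p - int r) (q + int r - 1) (d r p q x)"
    if "2 \<le> r" "x \<in> carrier (E r p q)" for r p q x
    by (simp add: d'_def the_inv_into_f_f[OF inj[OF that(1)] that(2)])
  have d_closed: "d r p q x \<in> carrier (E r (p - int r) (q + int r - 1))" if "2 \<le> r" "x \<in> carrier (E r p q)" for r p q x
    by (rule mod_hom_closed[OF diff_hom[OF that(1)] that(2)])
  have iso: "mod_isomorphic K (E r p q) (E' r p q)" if "2 \<le> r" for r p q
    using transport_isomorphic[OF page_module[OF that] inj[OF that]] unfolding E'_def .
  have eq0: "f r p q x = \<zero>\<^bsub>E' r p q\<^esub> \<longleftrightarrow> x = \<zero>\<^bsub>E r p q\<^esub>" if "2 \<le> r" "x \<in> carrier (E r p q)" for r p q x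
    using inj_on_eq_iff[OF inj[OF that(1)] that(2) abelian_monoid.zero_closed] module.axioms(2)[OF page_module[OF that(1)]]
    by (auto simp: zero'[OF that(1)] abelian_group_def)
  have "spectral_sequence K E' d'"
  proof (rule spectral_sequence.intro)
    fix r :: nat and p q :: int assume r: "2 \<le> r"
    show "module K (E' r p q)" by (rule module'[OF r])
    show "d' r p q \<in> mod_hom K (E' r p q) (E' r (p - int r) (q + int r - 1))"
      unfolding d'_def
      using mod_hom_comp[OF mod_hom_comp[OF transport_inv_hom[OF page_module[OF r] inj[OF r]] diff_hom[OF r]] hom[OF r]]
      unfolding E'_def by simp
  next
    fix r :: nat and p q :: int and y assume r: "2 \<le> r" and "y \<in> carrier (E' r p q)"
    then obtain x where x: "x \<in> carrier (E r p q)" "y = f r p q x" using r by (auto simp: carrier'[OF r])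
    have idx: "p - int r - int r = p - 2 * int r" "q + int r - 1 + int r - 1 = q + 2 * int r - 2" by simp_all
    show "d' r (p - int r) (q + int r - 1) (d' r p q y) = \<zero>\<^bsub>E' r (p - 2 * int r) (q + 2 * int r - 2)\<^esub>"
      unfolding x(2) d'_f[OF r x(1)] d'_f[OF r d_closed[OF r x(1)]] idx diff_diff[OF r x(1)] zero'[OF r] ..
  next
    fix r :: nat and p q :: int assume r: "2 \<le> r"
    let ?Z = "a_kernel (E r p q) (E r (p - int r) (q + int r - 1)) (d r p q)"
    let ?B = "d r (p + int r) (q - int r + 1) ` carrier (E r (p + int r) (q - int r + 1))"
    let ?Z' = "a_kernel (E' r p q) (E' r (p - int r) (q + int r - 1)) (d' r p q)"
    let ?B' = "d' r (p + int r) (q - int r + 1) ` carrier (E' r (p + int r) (q - int r + 1))"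
    have idx: "p + int r - int r = p" "q - int r + 1 + int r - 1 = q" by simp_all
    have Z': "?Z' = f r p q ` ?Z"
      using d_closed[OF r] by (auto simp: a_kernel_def' carrier'[OF r] zero'[OF r] d'_f[OF r] eq0[OF r, unfolded zero'[OF r]])
    have B': "?B' = f r p q ` ?B"
      by (auto simp: carrier'[OF r] image_image d'_f[OF r] idx intro!: image_cong)
    have B_carrier: "?B \<subseteq> carrier (E r p q)"
      using d_closed[OF r, of _ "p + int r" "q - int r + 1"] by (auto simp: idx)
    have Z: "submodule ?Z K (E r p q)"
      using submodule_kernel[OF page_module[OF r] page_module[OF r] diff_hom[OF r]] by (simp add: a_kernel_def')
    have B: "submodule ?B K (E r p q)"
      using submodule_image[OF page_module[OF r] page_module[OF r] diff_hom[OF r] submodule_carrier[OF page_module[OF r]],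
          of "p + int r" "q - int r + 1"] by (simp add: idx)
    have BZ: "?B \<subseteq> ?Z"
      using B_carrier diff_diff[OF r, of _ "p + int r" "q - int r + 1"] by (auto simp: a_kernel_def' algebra_simps)
    have fB: "submodule (f r p q ` ?B) K (E' r p q)" and fZ: "submodule (f r p q ` ?Z) K (E' r p q)"
      using submodule_image[OF page_module[OF r] module'[OF r] hom[OF r]] B Z by auto
    note facts = page_module[OF r] Z B BZ
    note facts' = module'[OF r] fZ fB image_mono[OF BZ]
    have "f r p q \<in> mod_hom K ((E r p q)\<lparr>carrier := ?Z\<rparr>) ((E' r p q)\<lparr>carrier := f r p q ` ?Z\<rparr>)"
      by (rule mod_hom_restrict_cod[OF mod_hom_restrict_dom[OF hom[OF r] Z]]) simp
    note hom' = mod_hom_comp[OF this subquot_proj[OF facts']]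
    have "mod_isomorphic K (quot_mod ((E r p q)\<lparr>carrier := ?Z\<rparr>) ?B) (quot_mod ((E' r p q)\<lparr>carrier := ?Z'\<rparr>) ?B')"
      unfolding Z' B'
    proof (rule mod_isomorphic_subquot[OF facts subquot_module[OF facts'] hom'])
      show "(\<lambda>x. f r p q ` ?B +>\<^bsub>E' r p q\<^esub> f r p q x) ` ?Z
        = carrier (quot_mod ((E' r p q)\<lparr>carrier := f r p q ` ?Z\<rparr>) (f r p q ` ?B))"
        unfolding subquot_carrier[OF facts'] by (rule image_image[symmetric])
      fix x assume x: "x \<in> ?Z"
      have "f r p q ` ?B +>\<^bsub>E' r p q\<^esub> f r p q x = f r p q ` ?B \<longleftrightarrow> f r p q x \<in> f r p q ` ?B"
        by (rule subquot_eq_zero_iff[OF facts']) (rule imageI[OF x])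
      also have "\<dots> \<longleftrightarrow> x \<in> ?B"
        using inj_on_image_mem_iff[OF inj[OF r] _ B_carrier] x by (simp add: a_kernel_def')
      finally show "f r p q ` ?B +>\<^bsub>E' r p q\<^esub> f r p q x
        = \<zero>\<^bsub>quot_mod ((E' r p q)\<lparr>carrier := f r p q ` ?Z\<rparr>) (f r p q ` ?B)\<^esub> \<longleftrightarrow> x \<in> ?B"
        by (simp only: subquot_zero[OF facts'])
    qed
    note iso_quot = this
    have r': "2 \<le> Suc r" using r by simp
    show "mod_isomorphic K (E' (Suc r) p q) (quot_mod ((E' r p q)\<lparr>carrier := ?Z'\<rparr>) ?B')"
      by (rule mod_isomorphic_trans[OF mod_isomorphic_sym[OF page_module[OF r'] module'[OF r'] iso[OF r']]
            mod_isomorphic_trans[OF next_page[OF r] iso_quot]])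
  qed
  then show thesis using that iso by blast
qed

lemma converges_to_isomorphic:
  assumes "spectral_sequence K E d" "spectral_sequence K E' d'"
    "\<And>r p q. 2 \<le> r \<Longrightarrow> mod_isomorphic K (E r p q) (E' r p q)" "converges_to K E H"
  shows "converges_to K E' H"
proof -
  have "mod_isomorphic K (E' r p q) N" if "2 \<le> r" "mod_isomorphic K (E r p q) N" for r p q N
    using mod_isomorphic_trans[OF mod_isomorphic_sym that(2)] assms(3)[OF that(1)]
      spectral_sequence.page_module[OF assms(1) that(1)] spectral_sequence.page_module[OF assms(2) that(1)] by blast
  then show ?thesis using assms(4) unfolding converges_to_def by meson
qed

lemma first_quadrant_isomorphic:
  assumes "spectral_sequence K E d" "spectral_sequence K E' d'"
    "\<And>r p q. 2 \<le> r \<Longrightarrow> mod_isomorphic K (E r p q) (E' r p q)" "first_quadrant E"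
  shows "first_quadrant E'"
  unfolding first_quadrant_def
proof (intro allI impI)
  fix r :: nat and p q :: int assume r: "2 \<le> r" and pq: "(p::int) < 0 \<or> (q::int) < 0"
  show "carrier (E' r p q) = {\<zero>\<^bsub>E' r p q\<^esub>}"
    using assms(4) r pq
    by (intro mod_isomorphic_trivial[OF spectral_sequence.page_module[OF assms(1) r]
        spectral_sequence.page_module[OF assms(2) r] assms(3)[OF r]]) (auto simp: first_quadrant_def)
qed

section \<open>Double complexes\<close>

text \<open>The squares anticommute, so that the total differential is the plain sum of
  \<open>dh\<close> and \<open>dv\<close>; commuting squares need a sign before they fit.\<close>

locale double_complex =
  fixes K :: "('k, 'z) ring_scheme" and D :: "nat \<Rightarrow> nat \<Rightarrow> ('k, 'a) module"
    and dh dv :: "nat \<Rightarrow> nat \<Rightarrow> 'a \<Rightarrow> 'a"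
  assumes D_module: "module K (D p q)"
    and dh_hom: "dh (Suc p) q \<in> mod_hom K (D (Suc p) q) (D p q)"
    and dv_hom: "dv p (Suc q) \<in> mod_hom K (D p (Suc q)) (D p q)"
    and dh_dh: "x \<in> carrier (D (Suc (Suc p)) q) \<Longrightarrow> dh (Suc p) q (dh (Suc (Suc p)) q x) = \<zero>\<^bsub>D p q\<^esub>"
    and dv_dv: "x \<in> carrier (D p (Suc (Suc q))) \<Longrightarrow> dv p (Suc q) (dv p (Suc (Suc q)) x) = \<zero>\<^bsub>D p q\<^esub>"
    and dh_dv: "x \<in> carrier (D (Suc p) (Suc q)) \<Longrightarrow>
      dh (Suc p) q (dv (Suc p) (Suc q) x) \<oplus>\<^bsub>D p q\<^esub> dv p (Suc q) (dh (Suc p) (Suc q) x) = \<zero>\<^bsub>D p q\<^esub>"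
begin

sublocale D: module K "D p q" for p q by (rule D_module)

lemmas dh_closed [intro, simp] = mod_hom_closed[OF dh_hom]
lemmas dv_closed [intro, simp] = mod_hom_closed[OF dv_hom]
lemmas dh_zero [simp] = mod_hom_zero[OF D_module D_module dh_hom]
lemmas dv_zero [simp] = mod_hom_zero[OF D_module D_module dv_hom]

text \<open>The columns that meet total degree \<open>n\<close>. Total degrees are integers to match
  filtered complexes; for \<open>n < 0\<close> there are no columns and the total complex is
  zero.\<close>

definition idx :: "int \<Rightarrow> nat set" where
  "idx n = {p. int p \<le> n}"

definition term_mod :: "int \<Rightarrow> nat \<Rightarrow> ('k, 'a) module" where
  "term_mod n p = D p (nat (n - int p))"

definition Tot :: "int \<Rightarrow> ('k, nat \<Rightarrow> 'a) module" where
  "Tot n = dsum (idx n) (term_mod n)"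

definition tot_d :: "int \<Rightarrow> (nat \<Rightarrow> 'a) \<Rightarrow> (nat \<Rightarrow> 'a)" where
  "tot_d n f = (\<lambda>p\<in>idx (n - 1). dh (Suc p) (nat (n - 1 - int p)) (f (Suc p))
     \<oplus>\<^bsub>term_mod (n - 1) p\<^esub> dv p (nat (n - int p)) (f p))"

definition tot_F :: "int \<Rightarrow> int \<Rightarrow> (nat \<Rightarrow> 'a) set" where
  "tot_F p n = {f \<in> carrier (Tot n). \<forall>i\<in>idx n. p < int i \<longrightarrow> f i = \<zero>\<^bsub>term_mod n i\<^esub>}"

text \<open>Total degrees get rewritten as \<open>int p + int q\<close> plus a small constant; the
  simplification rules that follow then evaluate the truncating \<open>nat (n - int p)\<close> to
  \<open>q\<close>, \<open>Suc q\<close> and so on.\<close>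

lemma idxE:
  assumes "p \<in> idx n" obtains q where "n = int p + int q"
  using assms zle_iff_zadd[of "int p" n] by (auto simp: idx_def)

lemma idx_simps [simp]:
  "p \<in> idx (int p + int q)" "p \<in> idx (int p + int q + 1)" "Suc p \<in> idx (int p + int q + 1)"
  by (auto simp: idx_def)

lemma nat_simps [simp]:
  "nat (int p + int q - int p) = q" "nat (int p + int q + 1 - int p) = Suc q"
  "nat (int p + int q + 1 - int (Suc p)) = q" "nat (int p + int q + 1 + 1 - int (Suc (Suc p))) = q"
  "nat (int q + 1) = Suc q" "nat (1 + int q) = Suc q"
  "nat (int p + int q + 1 + 1 - int (Suc p)) = Suc q" "nat (int p + int q + 1 + 1 - int p) = Suc (Suc q)"
  by linarith+

lemma term_mod_simps [simp]:
  "term_mod (int p + int q) p = D p q" "term_mod (int p + int q + 1) p = D p (Suc q)"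
  "term_mod (int p + int q + 1) (Suc p) = D (Suc p) q"
  by (simp_all only: term_mod_def nat_simps)

lemma term_mod_module: "module K (term_mod n p)"
  unfolding term_mod_def by (rule D_module)

sublocale T: module K "term_mod n p" for n p by (rule term_mod_module)

lemma Tot_module: "module K (Tot n)"
  unfolding Tot_def by (rule dsum_module[OF D.R.is_cring term_mod_module])

sublocale Tot: module K "Tot n" for n by (rule Tot_module)

lemma finite_idx: "finite (idx n)"
  by (rule finite_subset[of _ "{..nat n}"]) (auto simp: idx_def)

lemma Tot_carrier_iff: "f \<in> carrier (Tot n) \<longleftrightarrow> f \<in> extensional (idx n) \<and> (\<forall>i\<in>idx n. f i \<in> carrier (term_mod n i))"
  unfolding Tot_def dsum_carrier_iff[OF D.R.is_cring term_mod_module] using finite_idx by auto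

lemma Tot_apply: "\<lbrakk>f \<in> carrier (Tot n); i \<in> idx n\<rbrakk> \<Longrightarrow> f i \<in> carrier (term_mod n i)"
  by (simp add: Tot_carrier_iff)

lemma Tot_apply_hom: "i \<in> idx n \<Longrightarrow> (\<lambda>f. f i) \<in> mod_hom K (Tot n) (term_mod n i)"
  unfolding Tot_def by (rule dsum_apply_hom[OF D.R.is_cring term_mod_module])

lemma Tot_ext: "\<lbrakk>f \<in> carrier (Tot n); g \<in> carrier (Tot n); \<And>i. i \<in> idx n \<Longrightarrow> f i = g i\<rbrakk> \<Longrightarrow> f = g"
  unfolding Tot_def by (rule dsum_ext[OF D.R.is_cring term_mod_module])

lemma Tot_add: "i \<in> idx n \<Longrightarrow> (f \<oplus>\<^bsub>Tot n\<^esub> g) i = f i \<oplus>\<^bsub>term_mod n i\<^esub> g i"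
  unfolding Tot_def by (simp add: dsum_def)

lemma Tot_zero: "i \<in> idx n \<Longrightarrow> \<zero>\<^bsub>Tot n\<^esub> i = \<zero>\<^bsub>term_mod n i\<^esub>"
  unfolding Tot_def by (simp add: dsum_def)

lemma Tot_minus:
  assumes "f \<in> carrier (Tot n)" "g \<in> carrier (Tot n)" "i \<in> idx n"
  shows "(f \<ominus>\<^bsub>Tot n\<^esub> g) i = f i \<ominus>\<^bsub>term_mod n i\<^esub> g i"
  using mod_hom_minus[OF Tot_module term_mod_module Tot_apply_hom[OF assms(3)] assms(1,2)] .

definition inj :: "int \<Rightarrow> nat \<Rightarrow> 'a \<Rightarrow> (nat \<Rightarrow> 'a)" where
  "inj n p x = dsum_inj (idx n) (term_mod n) p x"

lemma inj_closed: "\<lbrakk>p \<in> idx n; x \<in> carrier (term_mod n p)\<rbrakk> \<Longrightarrow> inj n p x \<in> carrier (Tot n)"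
  unfolding inj_def Tot_def by (rule dsum_inj_closed[OF D.R.is_cring term_mod_module])

lemma inj_apply: "i \<in> idx n \<Longrightarrow> inj n p x i = (if i = p then x else \<zero>\<^bsub>term_mod n i\<^esub>)"
  by (simp add: inj_def dsum_inj_def)

lemma tot_d_apply: "tot_d (int p + int q + 1) f p = dh (Suc p) q (f (Suc p)) \<oplus>\<^bsub>D p q\<^esub> dv p (Suc q) (f p)"
  by (simp add: tot_d_def)

lemma tot_d_closed:
  assumes "f \<in> carrier (Tot n)" shows "tot_d n f \<in> carrier (Tot (n - 1))"
  unfolding Tot_carrier_iff
proof (intro conjI ballI)
  show "tot_d n f \<in> extensional (idx (n - 1))" by (simp add: tot_d_def)
  fix p assume "p \<in> idx (n - 1)"
  then obtain q where q: "n - 1 = int p + int q" by (rule idxE)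
  then have n: "n = int p + int q + 1" by simp
  show "tot_d n f p \<in> carrier (term_mod (n - 1) p)"
    using Tot_apply[OF assms, of p] Tot_apply[OF assms, of "Suc p"] unfolding q unfolding n by (simp add: tot_d_apply)
qed

lemma tot_d_hom: "tot_d n \<in> mod_hom K (Tot n) (Tot (n - 1))"
  unfolding Tot_def[of "n - 1"]
proof (rule mod_hom_dsumI[OF D.R.is_cring term_mod_module])
  fix p assume p: "p \<in> idx (n - 1)"
  then obtain q where q: "n - 1 = int p + int q" by (rule idxE)
  then have n: "n = int p + int q + 1" by simp
  have "(\<lambda>f. dh (Suc p) q (f (Suc p)) \<oplus>\<^bsub>D p q\<^esub> dv p (Suc q) (f p)) \<in> mod_hom K (Tot n) (D p q)"
    using mod_hom_comp[OF Tot_apply_hom[of "Suc p" n], of "dh (Suc p) q" "D p q"]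
      mod_hom_comp[OF Tot_apply_hom[of p n], of "dv p (Suc q)" "D p q"] dh_hom dv_hom
    unfolding n by (intro mod_hom_add_fun D_module Tot_module) auto
  then show "(\<lambda>f. tot_d n f p) \<in> mod_hom K (Tot n) (term_mod (n - 1) p)"
    unfolding q unfolding n by (simp add: tot_d_apply)
qed (use tot_d_closed in \<open>auto simp: Tot_def[symmetric] intro: Tot_module\<close>)

lemma tot_d_zero: "\<lbrakk>i \<in> idx (n - 1); f (Suc i) = \<zero>\<^bsub>term_mod n (Suc i)\<^esub>; f i = \<zero>\<^bsub>term_mod n i\<^esub>\<rbrakk>
   \<Longrightarrow> tot_d n f i = \<zero>\<^bsub>term_mod (n - 1) i\<^esub>"
proof (elim idxE)
  fix q assume f: "f (Suc i) = \<zero>\<^bsub>term_mod n (Suc i)\<^esub>" "f i = \<zero>\<^bsub>term_mod n i\<^esub>" and q: "n - 1 = int i + int q"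
  then have n: "n = int i + int q + 1" by simp
  show ?thesis using f unfolding q unfolding n by (simp add: tot_d_apply)
qed

lemma tot_d_d:
  assumes f: "f \<in> carrier (Tot n)" shows "tot_d (n - 1) (tot_d n f) = \<zero>\<^bsub>Tot (n - 1 - 1)\<^esub>"
proof (rule Tot_ext)
  fix p assume "p \<in> idx (n - 1 - 1)"
  then obtain q where q: "n - 1 - 1 = int p + int q" by (rule idxE)
  then have n1: "n - 1 = int p + int q + 1" and n: "n = int p + int q + 1 + 1" by auto
  let ?a = "f (Suc (Suc p))" and ?b = "f (Suc p)" and ?c = "f p"
  have c: "?a \<in> carrier (D (Suc (Suc p)) q)" "?b \<in> carrier (D (Suc p) (Suc q))" "?c \<in> carrier (D p (Suc (Suc q)))"
    using Tot_apply[OF f, of "Suc (Suc p)"] Tot_apply[OF f, of "Suc p"] Tot_apply[OF f, of p]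
    unfolding n term_mod_def nat_simps by (auto simp: idx_def)
  have e1: "tot_d n f (Suc p) = dh (Suc (Suc p)) q ?a \<oplus>\<^bsub>D (Suc p) q\<^esub> dv (Suc p) (Suc q) ?b"
    using tot_d_apply[of "Suc p" q f] n by (simp add: algebra_simps)
  have e2: "tot_d n f p = dh (Suc p) (Suc q) ?b \<oplus>\<^bsub>D p (Suc q)\<^esub> dv p (Suc (Suc q)) ?c"
    using tot_d_apply[of p "Suc q" f] n by (simp add: algebra_simps)
  have "tot_d (n - 1) (tot_d n f) p
    = dh (Suc p) q (dh (Suc (Suc p)) q ?a \<oplus>\<^bsub>D (Suc p) q\<^esub> dv (Suc p) (Suc q) ?b)
      \<oplus>\<^bsub>D p q\<^esub> dv p (Suc q) (dh (Suc p) (Suc q) ?b \<oplus>\<^bsub>D p (Suc q)\<^esub> dv p (Suc (Suc q)) ?c)"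
    unfolding n1 tot_d_apply e1 e2 ..
  also have "\<dots> = \<zero>\<^bsub>D p q\<^esub>"
    using c by (simp add: mod_hom_add[OF dh_hom] mod_hom_add[OF dv_hom] dh_dh dv_dv dh_dv)
  finally show "tot_d (n - 1) (tot_d n f) p = \<zero>\<^bsub>Tot (n - 1 - 1)\<^esub> p"
    unfolding q by (simp add: Tot_zero)
qed (rule tot_d_closed[OF tot_d_closed[OF f]], rule Tot.zero_closed)

lemma tot_F_iff: "f \<in> tot_F p n \<longleftrightarrow> f \<in> carrier (Tot n) \<and> (\<forall>i\<in>idx n. p < int i \<longrightarrow> f i = \<zero>\<^bsub>term_mod n i\<^esub>)"
  by (simp add: tot_F_def)

sublocale Tot: filtered_complex K Tot tot_d tot_F
proof (rule filtered_complex.intro)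
  fix n p
  show "module K (Tot n)" by (rule Tot_module)
  show "tot_d n \<in> mod_hom K (Tot n) (Tot (n - 1))" by (rule tot_d_hom)
  show "submodule (tot_F p n) K (Tot n)"
    unfolding submodule_iff[OF Tot_module] by (auto simp: tot_F_iff Tot_zero Tot_add) (simp add: Tot_def dsum_def)
  show "tot_F p n \<subseteq> tot_F (p + 1) n" by (auto simp: tot_F_iff)
  show "tot_F p n = {\<zero>\<^bsub>Tot n\<^esub>}" if "p < 0"
    using that by (auto simp: tot_F_iff Tot_zero intro!: Tot_ext)
  show "tot_F p n = carrier (Tot n)" if "n \<le> p"
    using that by (auto simp: tot_F_iff idx_def)
next
  fix f p n assume f: "f \<in> tot_F p n"
  show "tot_d n f \<in> tot_F p (n - 1)"
    unfolding tot_F_iff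
  proof (intro conjI ballI impI)
    fix i assume i: "i \<in> idx (n - 1)" "p < int i"
    then have "Suc i \<in> idx n" "i \<in> idx n" by (auto simp: idx_def)
    then show "tot_d n f i = \<zero>\<^bsub>term_mod (n - 1) i\<^esub>"
      using f i by (intro tot_d_zero) (auto simp: tot_F_iff)
  qed (use f tot_d_closed in \<open>auto simp: tot_F_iff\<close>)
qed (rule tot_d_d)

lemma tot_d_inj:
  assumes "p \<in> idx n" "i \<in> idx (n - 1)" "x \<in> carrier (term_mod n p)"
  shows "tot_d n (inj n p x) i =
    (if Suc i = p then dh p (nat (n - int p)) x else if i = p then dv p (nat (n - int p)) x
     else \<zero>\<^bsub>term_mod (n - 1) i\<^esub>)"
proof -
  obtain q where q: "n - 1 = int i + int q" using assms(2) by (rule idxE)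
  then have n: "n = int i + int q + 1" by simp
  have "tot_d n (inj n p x) i = dh (Suc i) q (inj n p x (Suc i)) \<oplus>\<^bsub>D i q\<^esub> dv i (Suc q) (inj n p x i)"
    unfolding n tot_d_apply ..
  then show ?thesis
    using assms(3) unfolding q unfolding n by (auto simp: inj_apply)
qed

end

subsection \<open>Resolutions by exact rows\<close>

text \<open>Every row \<open>D 0 q\<close>, \<open>D 1 q\<close>, ... is a resolution of
  \<open>Y q\<close> with augmentation \<open>\<epsilon>\<close>. Consequently
  \<open>f \<mapsto> \<epsilon> (f 0)\<close> from the total complex to \<open>Y\<close> is an
  isomorphism on homology, which is proved here one column at a time.\<close>

locale augmented_double_complex = double_complex K D dh dv
  for K :: "('k, 'z) ring_scheme" and D :: "nat \<Rightarrow> nat \<Rightarrow> ('k, 'a) module"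
    and dh dv :: "nat \<Rightarrow> nat \<Rightarrow> 'a \<Rightarrow> 'a" +
  fixes Y :: "nat \<Rightarrow> ('k, 'b) module" and dY :: "nat \<Rightarrow> 'b \<Rightarrow> 'b" and \<epsilon> :: "nat \<Rightarrow> 'a \<Rightarrow> 'b"
  assumes Y_module: "module K (Y n)"
    and dY_hom: "dY (Suc n) \<in> mod_hom K (Y (Suc n)) (Y n)"
    and \<epsilon>_hom: "\<epsilon> q \<in> mod_hom K (D 0 q) (Y q)"
    and \<epsilon>_surj: "\<epsilon> q ` carrier (D 0 q) = carrier (Y q)"
    and \<epsilon>_dv: "x \<in> carrier (D 0 (Suc q)) \<Longrightarrow> \<epsilon> q (dv 0 (Suc q) x) = dY (Suc q) (\<epsilon> (Suc q) x)"
    and \<epsilon>_dh: "x \<in> carrier (D (Suc 0) q) \<Longrightarrow> \<epsilon> q (dh (Suc 0) q x) = \<zero>\<^bsub>Y q\<^esub>"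
    and exact_zero: "\<lbrakk>x \<in> carrier (D 0 q); \<epsilon> q x = \<zero>\<^bsub>Y q\<^esub>\<rbrakk> \<Longrightarrow> x \<in> dh (Suc 0) q ` carrier (D (Suc 0) q)"
    and exact_Suc: "\<lbrakk>x \<in> carrier (D (Suc p) q); dh (Suc p) q x = \<zero>\<^bsub>D p q\<^esub>\<rbrakk>
      \<Longrightarrow> x \<in> dh (Suc (Suc p)) q ` carrier (D (Suc (Suc p)) q)"
begin

sublocale Y: module K "Y n" for n by (rule Y_module)

text \<open>Inherited from \<open>dv\<close>, as every element of \<open>Y\<close> is a value of
  \<open>\<epsilon>\<close>.\<close>

lemma dY_dY:
  assumes "y \<in> carrier (Y (Suc (Suc n)))"
  shows "dY (Suc n) (dY (Suc (Suc n)) y) = \<zero>\<^bsub>Y n\<^esub>"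
proof -
  obtain x where x: "x \<in> carrier (D 0 (Suc (Suc n)))" "y = \<epsilon> (Suc (Suc n)) x"
    using assms unfolding \<epsilon>_surj[symmetric] by auto
  then show ?thesis
    using \<epsilon>_dv[of x "Suc n"] \<epsilon>_dv[of "dv 0 (Suc (Suc n)) x" n] dv_dv[of x 0 n] mod_hom_zero[OF D_module Y_module \<epsilon>_hom]
    by simp
qed

lemma cycles_Y: "cycles Y dY n = {y \<in> carrier (Y n). n = 0 \<or> dY n y = \<zero>\<^bsub>Y (n - 1)\<^esub>}"
  by (auto simp: cycles_def a_kernel_def')

lemma cycles_Y_submodule: "submodule (cycles Y dY n) K (Y n)"
  using submodule_kernel[OF Y_module Y_module dY_hom] submodule_carrier[OF Y_module]
  unfolding cycles_Y by (cases n) auto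

lemma boundaries_Y_submodule: "submodule (boundaries Y dY n) K (Y n)"
  unfolding boundaries_def by (rule submodule_image[OF Y_module Y_module dY_hom submodule_carrier[OF Y_module]])

lemma boundaries_Y_subset: "boundaries Y dY n \<subseteq> cycles Y dY n"
  unfolding cycles_Y boundaries_def using mod_hom_closed[OF dY_hom] dY_dY by (cases n) auto

lemmas Y_facts = Y_module cycles_Y_submodule boundaries_Y_submodule boundaries_Y_subset

text \<open>The kernel condition in the augmented row, where \<open>\<epsilon>\<close> is the map
  that follows \<open>D 0 q\<close>. It merges \<open>exact_zero\<close> and
  \<open>exact_Suc\<close> into the single rule \<open>exact_atE\<close>.\<close>

definition exact_at :: "nat \<Rightarrow> nat \<Rightarrow> 'a \<Rightarrow> bool" where
  "exact_at p q x \<longleftrightarrow> (case p of 0 \<Rightarrow> \<epsilon> q x = \<zero>\<^bsub>Y q\<^esub> | Suc p' \<Rightarrow> dh p q x = \<zero>\<^bsub>D p' q\<^esub>)"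

lemma exact_atE:
  assumes "x \<in> carrier (D p q)" "exact_at p q x"
  obtains y where "y \<in> carrier (D (Suc p) q)" "dh (Suc p) q y = x"
proof -
  have "x \<in> dh (Suc p) q ` carrier (D (Suc p) q)"
    using assms exact_zero exact_Suc by (cases p) (auto simp: exact_at_def)
  then show ?thesis using that by auto
qed

lemma zero_idx [simp]: "0 \<in> idx (int n)"
  by (simp add: idx_def)

lemma term_mod_0 [simp]: "term_mod (int n) 0 = D 0 n" "term_mod (int n + 1) 0 = D 0 (Suc n)"
  by (simp_all add: term_mod_def nat_add_distrib)

lemma Tot_apply_0: "f \<in> carrier (Tot (int n)) \<Longrightarrow> f 0 \<in> carrier (D 0 n)"
  using Tot_apply[of f "int n" 0] by simp

lemma cycD: "\<lbrakk>f \<in> Tot.cyc n; i \<in> idx (n - 1)\<rbrakk> \<Longrightarrow> tot_d n f i = \<zero>\<^bsub>term_mod (n - 1) i\<^esub>"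
  by (simp add: Tot.cyc_def Tot_zero)

lemma cyc_carrier: "f \<in> Tot.cyc n \<Longrightarrow> f \<in> carrier (Tot n)"
  by (simp add: Tot.cyc_def)

lemma cyc_minus_d:
  assumes "f \<in> Tot.cyc n" "z \<in> carrier (Tot (n + 1))"
  shows "f \<ominus>\<^bsub>Tot n\<^esub> tot_d (n + 1) z \<in> Tot.cyc n"
  by (rule submodule_minus[OF Tot.cyc_submodule assms(1)])
     (simp add: Tot.cyc_def Tot.d_Suc_closed Tot.d_d_Suc assms(2))

lemma d_imageI:
  assumes "f \<in> carrier (Tot n)" "z \<in> carrier (Tot (n + 1))" "f \<ominus>\<^bsub>Tot n\<^esub> tot_d (n + 1) z \<in> tot_d (n + 1) ` carrier (Tot (n + 1))"
  shows "f \<in> tot_d (n + 1) ` carrier (Tot (n + 1))"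
proof -
  obtain w where w: "w \<in> carrier (Tot (n + 1))" "f \<ominus>\<^bsub>Tot n\<^esub> tot_d (n + 1) z = tot_d (n + 1) w" using assms(3) by auto
  then have "f = tot_d (n + 1) w \<oplus>\<^bsub>Tot n\<^esub> tot_d (n + 1) z"
    using a_minus_eq_iff[OF Tot_module assms(1) Tot.d_Suc_closed[OF assms(2)] Tot.d_Suc_closed[OF w(1)]] by simp
  also have "\<dots> = tot_d (n + 1) (w \<oplus>\<^bsub>Tot (n + 1)\<^esub> z)"
    using w(1) assms(2) by (simp add: mod_hom_add[OF Tot.d_Suc_hom])
  finally show ?thesis using w(1) assms(2) by auto
qed

text \<open>Exactness of the row through \<open>f j\<close> yields the boundary that clears this component.\<close>

lemma push_cycle:
  assumes f: "f \<in> Tot.cyc n" and j: "j \<in> idx n" and low: "\<And>i. i \<in> idx n \<Longrightarrow> i < j \<Longrightarrow> f i = \<zero>\<^bsub>term_mod n i\<^esub>"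
    and ex: "j = 0 \<Longrightarrow> \<epsilon> (nat n) (f 0) = \<zero>\<^bsub>Y (nat n)\<^esub>"
  shows "\<exists>z\<in>carrier (Tot (n + 1)). \<forall>i\<in>idx n. i < Suc j \<longrightarrow> (f \<ominus>\<^bsub>Tot n\<^esub> tot_d (n + 1) z) i = \<zero>\<^bsub>term_mod n i\<^esub>"
proof -
  obtain q where n: "n = int j + int q" using j by (rule idxE)
  have fj: "f j \<in> carrier (D j q)" using Tot_apply[OF cyc_carrier[OF f] j] by (simp add: n)
  have ex': "exact_at j q (f j)"
  proof (cases j)
    case 0 then show ?thesis using ex by (simp add: exact_at_def n)
  next
    case (Suc k)
    have n': "n = int k + int q + 1" "n - 1 = int k + int q" using n Suc by auto
    have "f k = \<zero>\<^bsub>D k (Suc q)\<^esub>" using low[of k] Suc unfolding n' by simp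
    moreover have "tot_d n f k = \<zero>\<^bsub>D k q\<^esub>" using cycD[OF f, of k] unfolding n'(2) by simp
    ultimately show ?thesis using fj Suc unfolding n'(1) by (simp add: tot_d_apply exact_at_def)
  qed
  obtain y where y: "y \<in> carrier (D (Suc j) q)" "dh (Suc j) q y = f j" by (rule exact_atE[OF fj ex'])
  have j1: "Suc j \<in> idx (n + 1)" by (simp add: n)
  have yc: "y \<in> carrier (term_mod (n + 1) (Suc j))" using y by (simp add: n)
  let ?z = "inj (n + 1) (Suc j) y"
  have z: "?z \<in> carrier (Tot (n + 1))" by (rule inj_closed[OF j1 yc])
  show ?thesis
  proof (intro bexI[OF _ z] ballI impI)
    fix i assume i: "i \<in> idx n" "i < Suc j"
    have "tot_d (n + 1) ?z i = (if i = j then f j else \<zero>\<^bsub>term_mod n i\<^esub>)"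
      using tot_d_inj[OF j1 _ yc, of i] i y by (simp add: n)
    moreover have "f i = (if i = j then f j else \<zero>\<^bsub>term_mod n i\<^esub>)" using low i by auto
    ultimately have "f i = tot_d (n + 1) ?z i" by simp
    then show "(f \<ominus>\<^bsub>Tot n\<^esub> tot_d (n + 1) ?z) i = \<zero>\<^bsub>term_mod n i\<^esub>"
      using Tot_apply[OF cyc_carrier[OF f] i(1)] a_minus_eq_zero_iff[OF term_mod_module]
      by (simp add: Tot_minus[OF cyc_carrier[OF f] Tot.d_Suc_closed[OF z] i(1)])
  qed
qed

text \<open>The components of the cycle are cleared from left to right, each at the price of
  changing only the next one; beyond column \<open>n\<close> nothing is left. Starting at
  \<open>0 < j\<close> avoids the condition on \<open>\<epsilon>\<close>.\<close>

lemma cycle_bounds_high: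
  assumes "f \<in> Tot.cyc (int n)" "\<And>i. i \<in> idx (int n) \<Longrightarrow> i < j \<Longrightarrow> f i = \<zero>\<^bsub>term_mod (int n) i\<^esub>" "0 < j"
  shows "f \<in> tot_d (int n + 1) ` carrier (Tot (int n + 1))"
  using assms
proof (induction "Suc n - j" arbitrary: f j)
  case 0
  have "f = \<zero>\<^bsub>Tot (int n)\<^esub>"
    using 0 by (intro Tot_ext[OF cyc_carrier[OF 0(2)]]) (auto simp: Tot_zero idx_def)
  then show ?case using Tot.d_Suc_zero[of "int n"] by (metis Tot.zero_closed imageI)
next
  case (Suc k)
  then have j: "j \<in> idx (int n)" by (auto simp: idx_def)
  obtain z where z: "z \<in> carrier (Tot (int n + 1))"
    "\<forall>i\<in>idx (int n). i < Suc j \<longrightarrow> (f \<ominus>\<^bsub>Tot (int n)\<^esub> tot_d (int n + 1) z) i = \<zero>\<^bsub>term_mod (int n) i\<^esub>"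
    using push_cycle[OF Suc.prems(1) j Suc.prems(2)] Suc.prems(3) by blast
  show ?case
  proof (rule d_imageI[OF cyc_carrier[OF Suc.prems(1)] z(1)], rule Suc.hyps(1))
    show "k = Suc n - Suc j" using Suc.hyps(2) by simp
    show "f \<ominus>\<^bsub>Tot (int n)\<^esub> tot_d (int n + 1) z \<in> Tot.cyc (int n)" by (rule cyc_minus_d[OF Suc.prems(1) z(1)])
  qed (use z(2) in auto)
qed

text \<open>Lift the chain of \<open>Y\<close> that bounds \<open>\<epsilon> n (f 0)\<close> to
  column zero and subtract its boundary. The new zeroth component is killed by
  \<open>\<epsilon>\<close> and can be cleared by exactness; the other columns follow by
  \<open>cycle_bounds_high\<close>.\<close>

lemma cycle_bounds:
  assumes f: "f \<in> Tot.cyc (int n)" and b: "\<epsilon> n (f 0) \<in> boundaries Y dY n"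
  shows "f \<in> tot_d (int n + 1) ` carrier (Tot (int n + 1))"
proof -
  obtain y where y: "y \<in> carrier (Y (Suc n))" "\<epsilon> n (f 0) = dY (Suc n) y"
    using b unfolding boundaries_def by auto
  then obtain x where x: "x \<in> carrier (D 0 (Suc n))" "y = \<epsilon> (Suc n) x" using \<epsilon>_surj by blast
  let ?z = "inj (int n + 1) 0 x"
  have i0: "0 \<in> idx (int n + 1)" by (simp add: idx_def)
  have z: "?z \<in> carrier (Tot (int n + 1))" by (rule inj_closed[OF i0]) (simp add: x)
  let ?g = "f \<ominus>\<^bsub>Tot (int n)\<^esub> tot_d (int n + 1) ?z"
  have g: "?g \<in> Tot.cyc (int n)" by (rule cyc_minus_d[OF f z])
  have "tot_d (int n + 1) ?z 0 = dv 0 (Suc n) x"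
    using tot_d_inj[OF i0, of 0 x] x by (simp add: nat_add_distrib)
  then have "?g 0 = f 0 \<ominus>\<^bsub>D 0 n\<^esub> dv 0 (Suc n) x"
    using Tot_minus[OF cyc_carrier[OF f] Tot.d_Suc_closed[OF z], of 0] by simp
  then have e0: "\<epsilon> n (?g 0) = \<zero>\<^bsub>Y n\<^esub>"
    using Tot_apply_0[OF cyc_carrier[OF f]] x y mod_hom_closed[OF \<epsilon>_hom]
    by (simp add: mod_hom_minus[OF D_module Y_module \<epsilon>_hom] \<epsilon>_dv a_minus_eq_zero_iff[OF Y_module] mod_hom_closed[OF dY_hom])
  obtain w where w: "w \<in> carrier (Tot (int n + 1))"
    "\<forall>i\<in>idx (int n). i < Suc 0 \<longrightarrow> (?g \<ominus>\<^bsub>Tot (int n)\<^esub> tot_d (int n + 1) w) i = \<zero>\<^bsub>term_mod (int n) i\<^esub>"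
    using push_cycle[OF g, of 0] e0 by auto
  show ?thesis
    using w by (intro d_imageI[OF cyc_carrier[OF f] z] d_imageI[OF cyc_carrier[OF g] w(1)]
      cycle_bounds_high[where j = "Suc 0"] cyc_minus_d[OF g w(1)]) auto
qed

text \<open>A cycle over \<open>y\<close> is built column by column. The first possibly nonzero
  component of the total differential, in column \<open>j\<close>, is killed by the next map of its
  row, so it is \<open>dh\<close> of something in column \<open>Suc j\<close>; subtracting that does
  not touch \<open>f 0\<close>.\<close>

lemma lift_cycle_low:
  assumes y: "y \<in> cycles Y dY n" and "j \<le> n"
  shows "\<exists>f\<in>carrier (Tot (int n)). \<epsilon> n (f 0) = y \<and> (\<forall>i\<in>idx (int n - 1). i < j \<longrightarrow> tot_d (int n) f i = \<zero>\<^bsub>term_mod (int n - 1) i\<^esub>)"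
  using assms(2)
proof (induction j)
  case 0
  have "y \<in> carrier (Y n)" using y unfolding cycles_Y by simp
  then obtain x where x: "x \<in> carrier (D 0 n)" "y = \<epsilon> n x" unfolding \<epsilon>_surj[symmetric] by (elim imageE)
  have "inj (int n) 0 x \<in> carrier (Tot (int n))" "inj (int n) 0 x 0 = x"
    using inj_closed[of 0 "int n" x] inj_apply[of 0 "int n" 0 x] x(1) by simp_all
  then show ?case using x(2) by (intro bexI[of _ "inj (int n) 0 x"]) simp_all
next
  case (Suc j)
  then obtain f where f: "f \<in> carrier (Tot (int n))" "\<epsilon> n (f 0) = y"
    "\<And>i. i \<in> idx (int n - 1) \<Longrightarrow> i < j \<Longrightarrow> tot_d (int n) f i = \<zero>\<^bsub>term_mod (int n - 1) i\<^esub>" by auto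
  define q where "q = n - Suc j"
  have n: "int n - 1 = int j + int q" "int n = int j + int q + 1" "n = Suc (j + q)"
    using Suc.prems by (auto simp: q_def)
  have j: "j \<in> idx (int n - 1)" unfolding n by simp
  let ?g = "tot_d (int n) f j"
  have gc: "?g \<in> carrier (D j q)" using Tot_apply[OF tot_d_closed[OF f(1)] j] unfolding n(1) by simp
  have ex: "exact_at j q ?g"
  \<comment> \<open>In column zero the next map is \<open>\<epsilon>\<close>, and the component dies
    because \<open>y\<close> is a cycle; in later columns it dies because the total differential
    squares to zero.\<close>
  proof (cases j)
    case 0
    then have nq: "n = Suc q" using n by simp
    have c: "f (Suc 0) \<in> carrier (D (Suc 0) q)" "f 0 \<in> carrier (D 0 (Suc q))"
      using Tot_apply[OF f(1), of "Suc 0"] Tot_apply[OF f(1), of 0]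
      by (simp_all add: nq idx_def term_mod_def nat_add_distrib)
    have "?g = dh (Suc 0) q (f (Suc 0)) \<oplus>\<^bsub>D 0 q\<^esub> dv 0 (Suc q) (f 0)"
      unfolding 0 using tot_d_apply[of 0 q f] by (simp add: nq algebra_simps)
    moreover have "y \<in> carrier (Y (Suc q))" using y nq unfolding cycles_Y by simp
    ultimately have "\<epsilon> q ?g = dY (Suc q) y"
      using c f(2) nq mod_hom_closed[OF dY_hom[of q], of y]
      by (simp add: mod_hom_add[OF \<epsilon>_hom] \<epsilon>_dh \<epsilon>_dv)
    also have "\<dots> = \<zero>\<^bsub>Y q\<^esub>" using y unfolding cycles_Y nq by simp
    finally show ?thesis by (simp add: exact_at_def 0)
  next
    case (Suc k)
    have n': "int n - 1 - 1 = int k + int q" "int n - 1 = int k + int q + 1" using n Suc by auto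
    have "tot_d (int n - 1) (tot_d (int n) f) k = \<zero>\<^bsub>D k q\<^esub>"
      using tot_d_d[OF f(1)] Tot_zero[of k "int n - 1 - 1"] unfolding n'(1) by simp
    moreover have "tot_d (int n) f k = \<zero>\<^bsub>D k (Suc q)\<^esub>"
      using f(3)[of k] Suc unfolding n'(2) by simp
    ultimately show ?thesis using gc Suc unfolding n'(2) by (simp add: tot_d_apply exact_at_def)
  qed
  obtain x where x: "x \<in> carrier (D (Suc j) q)" "dh (Suc j) q x = ?g" by (rule exact_atE[OF gc ex])
  have j1: "Suc j \<in> idx (int n)" and xc: "x \<in> carrier (term_mod (int n) (Suc j))" unfolding n(2) using x by auto
  let ?e = "inj (int n) (Suc j) x"
  have e: "?e \<in> carrier (Tot (int n))" by (rule inj_closed[OF j1 xc])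
  show ?case
  proof (intro bexI[of _ "f \<ominus>\<^bsub>Tot (int n)\<^esub> ?e"] conjI ballI impI)
    show "f \<ominus>\<^bsub>Tot (int n)\<^esub> ?e \<in> carrier (Tot (int n))" using f(1) e by simp
    have "(f \<ominus>\<^bsub>Tot (int n)\<^esub> ?e) 0 = f 0"
      using Tot_minus[OF f(1) e, of 0] Tot_apply_0[OF f(1)] by (simp add: inj_apply a_minus_def)
    then show "\<epsilon> n ((f \<ominus>\<^bsub>Tot (int n)\<^esub> ?e) 0) = y" using f(2) by simp
    fix i assume i: "i \<in> idx (int n - 1)" "i < Suc j"
    have "tot_d (int n) ?e i = (if i = j then ?g else \<zero>\<^bsub>term_mod (int n - 1) i\<^esub>)"
      using tot_d_inj[OF j1 i(1) xc] i x unfolding n(2) by simp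
    moreover have "tot_d (int n) f i = (if i = j then ?g else \<zero>\<^bsub>term_mod (int n - 1) i\<^esub>)"
      using f(3)[OF i(1)] i by auto
    ultimately have "tot_d (int n) f i = tot_d (int n) ?e i" by simp
    then show "tot_d (int n) (f \<ominus>\<^bsub>Tot (int n)\<^esub> ?e) i = \<zero>\<^bsub>term_mod (int n - 1) i\<^esub>"
      using Tot_minus[OF tot_d_closed[OF f(1)] tot_d_closed[OF e] i(1)]
        Tot_apply[OF tot_d_closed[OF e] i(1)] a_minus_eq_zero_iff[OF term_mod_module]
      by (simp add: mod_hom_minus[OF Tot_module Tot_module tot_d_hom f(1) e])
  qed
qed

lemma lift_cycle:
  assumes y: "y \<in> cycles Y dY n"
  obtains f where "f \<in> Tot.cyc (int n)" "\<epsilon> n (f 0) = y"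
proof -
  obtain f where f: "f \<in> carrier (Tot (int n))" "\<epsilon> n (f 0) = y"
    "\<And>i. i \<in> idx (int n - 1) \<Longrightarrow> i < n \<Longrightarrow> tot_d (int n) f i = \<zero>\<^bsub>term_mod (int n - 1) i\<^esub>"
    using lift_cycle_low[OF y order_refl] by auto
  have "tot_d (int n) f = \<zero>\<^bsub>Tot (int n - 1)\<^esub>"
    using f(3) by (intro Tot_ext[OF tot_d_closed[OF f(1)]]) (auto simp: Tot_zero idx_def)
  then show ?thesis using f that by (simp add: Tot.cyc_def)
qed

lemma cyc_\<epsilon>:
  assumes f: "f \<in> Tot.cyc (int n)" shows "\<epsilon> n (f 0) \<in> cycles Y dY n"
proof (cases n)
  case 0 then show ?thesis using mod_hom_closed[OF \<epsilon>_hom] Tot_apply_0[OF cyc_carrier[OF f]] by (simp add: cycles_Y)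
next
  case (Suc q)
  have c: "f (Suc 0) \<in> carrier (D (Suc 0) q)" "f 0 \<in> carrier (D 0 (Suc q))"
    using Tot_apply[OF cyc_carrier[OF f], of "Suc 0"] Tot_apply[OF cyc_carrier[OF f], of 0]
    by (simp_all add: Suc idx_def term_mod_def nat_add_distrib)
  have "dh (Suc 0) q (f (Suc 0)) \<oplus>\<^bsub>D 0 q\<^esub> dv 0 (Suc q) (f 0) = \<zero>\<^bsub>D 0 q\<^esub>"
    using cycD[OF f, of 0] tot_d_apply[of 0 q f] by (simp add: Suc algebra_simps)
  then have "\<epsilon> q (dh (Suc 0) q (f (Suc 0)) \<oplus>\<^bsub>D 0 q\<^esub> dv 0 (Suc q) (f 0)) = \<zero>\<^bsub>Y q\<^esub>"
    by (simp add: mod_hom_zero[OF D_module Y_module \<epsilon>_hom])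
  then show ?thesis
    using c mod_hom_closed[OF \<epsilon>_hom] mod_hom_closed[OF dY_hom mod_hom_closed[OF \<epsilon>_hom]]
    by (simp add: cycles_Y Suc mod_hom_add[OF \<epsilon>_hom] \<epsilon>_dh \<epsilon>_dv)
qed

lemma converges_Tot: "converges_to K Tot.page (homology Y dY)"
proof (rule Tot.converges_page[where \<theta> = "\<lambda>n f. boundaries Y dY n +>\<^bsub>Y n\<^esub> \<epsilon> n (f 0)"])
  fix n
  show "module K (homology Y dY n)"
    unfolding homology_def by (rule subquot_module[OF Y_facts])
  have "(\<lambda>f. \<epsilon> n (f 0)) \<in> mod_hom K (Tot (int n)) (Y n)"
    using mod_hom_comp[OF Tot_apply_hom[of 0 "int n"], of "\<epsilon> n"] \<epsilon>_hom by simp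
  then have "(\<lambda>f. \<epsilon> n (f 0)) \<in> mod_hom K ((Tot (int n))\<lparr>carrier := Tot.cyc (int n)\<rparr>) ((Y n)\<lparr>carrier := cycles Y dY n\<rparr>)"
    using cyc_\<epsilon> by (intro mod_hom_restrict_cod mod_hom_restrict_dom Tot.cyc_submodule) auto
  from mod_hom_comp[OF this subquot_proj[OF Y_facts]]
  show "(\<lambda>f. boundaries Y dY n +>\<^bsub>Y n\<^esub> \<epsilon> n (f 0))
      \<in> mod_hom K ((Tot (int n))\<lparr>carrier := Tot.cyc (int n)\<rparr>) (homology Y dY n)"
    unfolding homology_def .
  have "cycles Y dY n = (\<lambda>f. \<epsilon> n (f 0)) ` Tot.cyc (int n)"
    using cyc_\<epsilon> lift_cycle by (auto simp: image_iff) metis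
  then show "(\<lambda>f. boundaries Y dY n +>\<^bsub>Y n\<^esub> \<epsilon> n (f 0)) ` Tot.cyc (int n) = carrier (homology Y dY n)"
    unfolding homology_def subquot_carrier[OF Y_facts] by (simp only: image_image)
next
  fix n f assume f: "f \<in> Tot.cyc (int n)"
  have "boundaries Y dY n +>\<^bsub>Y n\<^esub> \<epsilon> n (f 0) = boundaries Y dY n \<longleftrightarrow> \<epsilon> n (f 0) \<in> boundaries Y dY n"
    by (rule subquot_eq_zero_iff[OF Y_facts cyc_\<epsilon>[OF f]])
  also have "\<dots> \<longleftrightarrow> f \<in> tot_d (int n + 1) ` carrier (Tot (int n + 1))"
  proof
    assume "f \<in> tot_d (int n + 1) ` carrier (Tot (int n + 1))"
    then obtain z where z: "z \<in> carrier (Tot (int n + 1))" "f = tot_d (int n + 1) z" by auto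
    have c: "z (Suc 0) \<in> carrier (D (Suc 0) n)" "z 0 \<in> carrier (D 0 (Suc n))"
      using Tot_apply[OF z(1), of "Suc 0"] Tot_apply[OF z(1), of 0]
      by (simp_all add: idx_def term_mod_def nat_add_distrib)
    have "f 0 = dh (Suc 0) n (z (Suc 0)) \<oplus>\<^bsub>D 0 n\<^esub> dv 0 (Suc n) (z 0)"
      using tot_d_apply[of 0 n z] by (simp add: z(2))
    then have "\<epsilon> n (f 0) = dY (Suc n) (\<epsilon> (Suc n) (z 0))"
      using c mod_hom_closed[OF dY_hom mod_hom_closed[OF \<epsilon>_hom]] by (simp add: mod_hom_add[OF \<epsilon>_hom] \<epsilon>_dh \<epsilon>_dv)
    then show "\<epsilon> n (f 0) \<in> boundaries Y dY n"
      unfolding boundaries_def using c mod_hom_closed[OF \<epsilon>_hom] by auto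
  qed (rule cycle_bounds[OF f])
  finally show "boundaries Y dY n +>\<^bsub>Y n\<^esub> \<epsilon> n (f 0) = \<zero>\<^bsub>homology Y dY n\<^esub> \<longleftrightarrow> f \<in> tot_d (int n + 1) ` carrier (Tot (int n + 1))"
    unfolding homology_def subquot_zero[OF Y_facts] .
qed

end

subsection \<open>The second page\<close>

context double_complex
begin

lemma vcycles: "cycles (D p) (dv p) q = {x \<in> carrier (D p q). q = 0 \<or> dv p q x = \<zero>\<^bsub>D p (q - 1)\<^esub>}"
  by (auto simp: cycles_def a_kernel_def')

lemma vcycles_submodule: "submodule (cycles (D p) (dv p) q) K (D p q)"
  using submodule_kernel[OF D_module D_module dv_hom] submodule_carrier[OF D_module]
  unfolding vcycles by (cases q) auto

lemma dh_vcycles: "x \<in> cycles (D (Suc p)) (dv (Suc p)) q \<Longrightarrow> dh (Suc p) q x \<in> cycles (D p) (dv p) q"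
  using dh_dv[of x p "q - 1"] by (cases q) (auto simp: vcycles)

lemma vboundaries_subset: "boundaries (D p) (dv p) q \<subseteq> cycles (D p) (dv p) q"
  unfolding boundaries_def vcycles using dv_dv by (cases q) auto

text \<open>The vertical homology enters through any model \<open>V\<close> with class maps
  \<open>c\<close>. An element of \<open>appr_cyc 2 p n\<close> has components in columns up to
  \<open>p\<close>, and its total differential lives in columns up to \<open>p - 2\<close>; the
  class of its component in column \<open>p\<close> is all that the second page retains.\<close>

lemma second_page:
  fixes V :: "nat \<Rightarrow> nat \<Rightarrow> ('k, 'v) module" and c :: "nat \<Rightarrow> nat \<Rightarrow> 'a \<Rightarrow> 'v" and \<delta> :: "nat \<Rightarrow> nat \<Rightarrow> 'v \<Rightarrow> 'v"
  assumes V_module: "\<And>p q. module K (V p q)"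
    and c_hom: "\<And>p q. c p q \<in> mod_hom K ((D p q)\<lparr>carrier := cycles (D p) (dv p) q\<rparr>) (V p q)"
    and c_surj: "\<And>p q. c p q ` cycles (D p) (dv p) q = carrier (V p q)"
    and c_ker: "\<And>p q x. x \<in> cycles (D p) (dv p) q \<Longrightarrow> c p q x = \<zero>\<^bsub>V p q\<^esub> \<longleftrightarrow> x \<in> boundaries (D p) (dv p) q"
    and \<delta>_hom: "\<And>p q. \<delta> (Suc p) q \<in> mod_hom K (V (Suc p) q) (V p q)"
    and \<delta>_c: "\<And>p q x. x \<in> cycles (D (Suc p)) (dv (Suc p)) q \<Longrightarrow> \<delta> (Suc p) q (c (Suc p) q x) = c p q (dh (Suc p) q x)"
  shows "mod_isomorphic K (Tot.page 2 (int p) (int q)) (homology (\<lambda>p. V p q) (\<lambda>p. \<delta> p q) p)"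
proof -
  let ?Z = "cycles (\<lambda>p. V p q) (\<lambda>p. \<delta> p q)" and ?B = "boundaries (\<lambda>p. V p q) (\<lambda>p. \<delta> p q)"
  have c_closed: "c p q x \<in> carrier (V p q)" if "x \<in> cycles (D p) (dv p) q" for p q x
    using mod_hom_closed[OF c_hom] that by simp
  have c_add: "c p q (x \<oplus>\<^bsub>D p q\<^esub> y) = c p q x \<oplus>\<^bsub>V p q\<^esub> c p q y"
    if "x \<in> cycles (D p) (dv p) q" "y \<in> cycles (D p) (dv p) q" for p q x y
    using mod_hom_add[OF c_hom] that by simp
  have c_minus: "c p q (x \<ominus>\<^bsub>D p q\<^esub> y) = c p q x \<ominus>\<^bsub>V p q\<^esub> c p q y"
    if "x \<in> cycles (D p) (dv p) q" "y \<in> cycles (D p) (dv p) q" for p q x y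
    using mod_hom_minus[OF submodule_module[OF D_module vcycles_submodule] V_module c_hom[of p q], of x y] that
    unfolding minus_submodule[OF D_module vcycles_submodule that(2)] by simp
  have zc: "\<zero>\<^bsub>D p q\<^esub> \<in> cycles (D p) (dv p) q" for p q by (rule submodule_zero[OF vcycles_submodule])
  have c_zero: "c p q \<zero>\<^bsub>D p q\<^esub> = \<zero>\<^bsub>V p q\<^esub>" for p q
    using mod_hom_zero[OF submodule_module[OF D_module vcycles_submodule] V_module c_hom] by simp
  have cyc_iff: "v \<in> ?Z p \<longleftrightarrow> v \<in> carrier (V p q) \<and> (p = 0 \<or> \<delta> p q v = \<zero>\<^bsub>V (p - 1) q\<^esub>)" for v p
    by (auto simp: cycles_def a_kernel_def')
  have \<delta>\<delta>: "\<delta> (Suc p) q (\<delta> (Suc (Suc p)) q v) = \<zero>\<^bsub>V p q\<^esub>" if v: "v \<in> carrier (V (Suc (Suc p)) q)" for p v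
  proof -
    obtain x where x: "x \<in> cycles (D (Suc (Suc p))) (dv (Suc (Suc p))) q" "v = c (Suc (Suc p)) q x"
      using v c_surj by blast
    then have "x \<in> carrier (D (Suc (Suc p)) q)" by (simp add: vcycles)
    then show ?thesis using x by (simp add: \<delta>_c dh_vcycles dh_dh c_zero)
  qed
  have Z_sub: "submodule (?Z p) K (V p q)" for p
    using submodule_kernel[OF V_module V_module \<delta>_hom] submodule_carrier[OF V_module]
    by (cases p) (auto simp: cycles_def a_kernel_def')
  have B_sub: "submodule (?B p) K (V p q)" for p
    unfolding boundaries_def by (rule submodule_image[OF V_module V_module \<delta>_hom submodule_carrier[OF V_module]])
  have BZ: "?B p \<subseteq> ?Z p" for p
    using \<delta>\<delta> mod_hom_closed[OF \<delta>_hom] by (cases p) (auto simp: cyc_iff boundaries_def)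
  note facts = V_module Z_sub B_sub BZ
  define n where "n = int p + int q"
  have pn: "p \<in> idx n" by (simp add: n_def)
  let ?A = "Tot.appr_cyc 2 (int p) n"
  have n1: "n + 1 = int p + int q + 1" by (simp add: n_def)
  have A_c: "f \<in> carrier (Tot n)" if "f \<in> ?A" for f using Tot.appr_cyc_carrier[OF that] .
  \<comment> \<open>Column \<open>p\<close> of the total differential vanishes and column
    \<open>p + 1\<close> of \<open>f\<close> is zero, so \<open>f p\<close> is a vertical
    cycle.\<close>
  have A_p: "f p \<in> cycles (D p) (dv p) q" if f: "f \<in> ?A" for f
  proof -
    have fp: "f p \<in> carrier (D p q)" using Tot_apply[OF A_c[OF f] pn] by (simp add: n_def)
    show ?thesis
    proof (cases q)
      case 0 then show ?thesis using fp by (simp add: vcycles)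
    next
      case (Suc q')
      have n': "n = int p + int q' + 1" "n - 1 = int p + int q'" using Suc by (auto simp: n_def)
      have "tot_d n f p = \<zero>\<^bsub>D p q'\<^esub>"
        using Tot.appr_cyc_d[OF f] unfolding tot_F_iff n'(2) by (auto dest!: bspec[of _ _ p])
      moreover have "f (Suc p) = \<zero>\<^bsub>D (Suc p) q'\<^esub>"
        using Tot.appr_cyc_F[OF f] unfolding tot_F_iff n'(1) by (auto dest!: bspec[of _ _ "Suc p"])
      ultimately show ?thesis using fp Suc unfolding n'(1) by (simp add: tot_d_apply vcycles)
    qed
  qed
  \<comment> \<open>Column \<open>p - 1\<close> of the total differential vanishes:
    \<open>dh\<close> of \<open>f p\<close> is, up to sign, the vertical boundary of the
    neighbouring component, hence zero in \<open>V\<close>.\<close>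
  have A_Z: "c p q (f p) \<in> ?Z p" if f: "f \<in> ?A" for f
  proof (cases p)
    case 0 then show ?thesis using c_closed[OF A_p[OF f]] by (simp add: cyc_iff)
  next
    case (Suc p')
    have n': "n = int p' + int q + 1" "n - 1 = int p' + int q" using Suc by (auto simp: n_def)
    have fp: "f (Suc p') \<in> cycles (D (Suc p')) (dv (Suc p')) q" "f (Suc p') \<in> carrier (D (Suc p') q)" "f p' \<in> carrier (D p' (Suc q))"
      using A_p[OF f] Tot_apply[OF A_c[OF f], of p'] by (auto simp: Suc n' vcycles)
    have "tot_d n f p' = \<zero>\<^bsub>D p' q\<^esub>"
      using Tot.appr_cyc_d[OF f] unfolding tot_F_iff n'(2) Suc by (auto dest!: bspec[of _ _ p'])
    then have eq: "dh (Suc p') q (f (Suc p')) \<oplus>\<^bsub>D p' q\<^esub> dv p' (Suc q) (f p') = \<zero>\<^bsub>D p' q\<^esub>"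
      unfolding n'(1) tot_d_apply .
    have b: "dv p' (Suc q) (f p') \<in> boundaries (D p') (dv p') q" using fp by (simp add: boundaries_def)
    then have bc: "dv p' (Suc q) (f p') \<in> cycles (D p') (dv p') q" using vboundaries_subset by blast
    have "c p' q (dh (Suc p') q (f (Suc p'))) \<oplus>\<^bsub>V p' q\<^esub> c p' q (dv p' (Suc q) (f p')) = \<zero>\<^bsub>V p' q\<^esub>"
      using eq c_zero c_add[OF dh_vcycles[OF fp(1)] bc] by simp
    moreover interpret V: module K "V p' q" by (rule V_module)
    have "c p' q (dv p' (Suc q) (f p')) = \<zero>\<^bsub>V p' q\<^esub>" using c_ker[OF bc] b by simp
    ultimately have "c p' q (dh (Suc p') q (f (Suc p'))) = \<zero>\<^bsub>V p' q\<^esub>"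
      using c_closed[OF dh_vcycles[OF fp(1)]] by simp
    then show ?thesis using c_closed[OF fp(1)] by (simp add: cyc_iff Suc \<delta>_c[OF fp(1)])
  qed
  have "(\<lambda>f. f p) \<in> mod_hom K (Tot n) (D p q)"
    using Tot_apply_hom[OF pn] by (simp add: n_def)
  then have "(\<lambda>f. f p) \<in> mod_hom K ((Tot n)\<lparr>carrier := ?A\<rparr>) ((D p q)\<lparr>carrier := cycles (D p) (dv p) q\<rparr>)"
    using A_p by (intro mod_hom_restrict_cod mod_hom_restrict_dom Tot.appr_cyc_submodule) auto
  from mod_hom_comp[OF this c_hom]
  have "(\<lambda>f. c p q (f p)) \<in> mod_hom K ((Tot n)\<lparr>carrier := ?A\<rparr>) ((V p q)\<lparr>carrier := ?Z p\<rparr>)"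
    using A_Z by (intro mod_hom_restrict_cod) auto
  note hom = mod_hom_comp[OF this subquot_proj[OF facts]]
  show ?thesis
    unfolding Tot.page_def Tot.pg_def homology_def n_def[symmetric] of_nat_numeral
  proof (rule mod_isomorphic_subquot[OF Tot.pg_facts subquot_module[OF facts] hom])
    have "?Z p = (\<lambda>f. c p q (f p)) ` ?A"
    proof (intro equalityI subsetI)
      fix v assume v: "v \<in> ?Z p"
      then obtain x where x: "x \<in> cycles (D p) (dv p) q" "v = c p q x" using c_surj[of p q] by (auto simp: cyc_iff)
      then have xc: "x \<in> carrier (D p q)" by (simp add: vcycles)
      have xt: "x \<in> carrier (term_mod n p)" using xc by (simp add: n_def)
      have ex: "inj n p x \<in> carrier (Tot n)" by (rule inj_closed[OF pn xt])
      have dx: "tot_d n (inj n p x) i = \<zero>\<^bsub>term_mod (n - 1) i\<^esub>" if "i \<in> idx (n - 1)" "Suc i \<noteq> p" for i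
      proof -
        have "dv p q x = \<zero>\<^bsub>term_mod (n - 1) p\<^esub>" if "p \<in> idx (n - 1)"
        proof -
          obtain q' where "n - 1 = int p + int q'" using \<open>p \<in> idx (n - 1)\<close> by (rule idxE)
          then have "q = Suc q'" "n - 1 = int p + int q'" by (auto simp: n_def)
          then show ?thesis using x(1) by (simp add: vcycles)
        qed
        then show ?thesis using tot_d_inj[OF pn that(1) xt] that by (auto simp: n_def)
      qed
      show "v \<in> (\<lambda>f. c p q (f p)) ` ?A"
      proof (cases p)
        case 0
        have "inj n p x \<in> ?A"
          using ex dx 0 tot_d_closed[OF ex]
          by (intro Tot.appr_cycI) (auto simp: tot_F_iff inj_apply)
        then show ?thesis using x by (intro image_eqI[of _ _ "inj n p x"]) (simp_all add: inj_apply pn)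
      next
        case (Suc p')
        have n': "n = int p' + int q + 1" "n - 1 = int p' + int q" using Suc by (auto simp: n_def)
        have "c p' q (dh (Suc p') q x) = \<zero>\<^bsub>V p' q\<^esub>"
          using v x(2) \<delta>_c[of x p' q] x(1) unfolding cyc_iff Suc by simp
        then have "dh (Suc p') q x \<in> boundaries (D p') (dv p') q"
          using c_ker[OF dh_vcycles[of x p' q]] x(1) Suc by simp
        then obtain y where y: "y \<in> carrier (D p' (Suc q))" "dh (Suc p') q x = dv p' (Suc q) y"
          unfolding boundaries_def by auto
        have p'n: "p' \<in> idx n" and yt: "y \<in> carrier (term_mod n p')" using y unfolding n' by auto
        have ey: "inj n p' y \<in> carrier (Tot n)" by (rule inj_closed[OF p'n yt])
        \<comment> \<open>Conversely, a vertical cycle \<open>x\<close> whose \<open>dh\<close> is a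
          vertical boundary \<open>dv y\<close> extends by the component \<open>- y\<close> in
          column \<open>p - 1\<close>, which cancels the differential there.\<close>
        let ?f = "inj n p x \<ominus>\<^bsub>Tot n\<^esub> inj n p' y"
        have f: "?f \<in> carrier (Tot n)" using ex ey by simp
        have fi: "?f i = inj n p x i \<ominus>\<^bsub>term_mod n i\<^esub> inj n p' y i" if "i \<in> idx n" for i
          using Tot_minus[OF ex ey that] .
        have "?f \<in> ?A"
        proof (rule Tot.appr_cycI)
          show "?f \<in> tot_F (int p) n"
            using f fi Suc by (auto simp: tot_F_iff inj_apply a_minus_def)
          show "tot_d n ?f \<in> tot_F (int p - 2) (n - 1)"
            unfolding tot_F_iff
          proof (intro conjI ballI impI tot_d_closed[OF f])
            fix i assume i: "i \<in> idx (n - 1)" "int p - 2 < int i"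
            have "tot_d n (inj n p x) i = tot_d n (inj n p' y) i"
            proof (cases "i = p'")
              case True
              then show ?thesis
                using tot_d_inj[OF pn i(1) xt] tot_d_inj[OF p'n i(1) yt] y(2) Suc by (simp add: n')
            next
              case False
              then show ?thesis using dx[OF i(1)] tot_d_inj[OF p'n i(1) yt] i(2) Suc by simp
            qed
            then show "tot_d n ?f i = \<zero>\<^bsub>term_mod (n - 1) i\<^esub>"
              using Tot_minus[OF tot_d_closed[OF ex] tot_d_closed[OF ey] i(1)] Tot_apply[OF tot_d_closed[OF ey] i(1)]
                a_minus_eq_zero_iff[OF term_mod_module]
              by (simp add: mod_hom_minus[OF Tot_module Tot_module tot_d_hom ex ey])
          qed
        qed
        moreover have "p \<noteq> p'" using Suc by simp
        then have "?f p = x"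
          using fi[OF pn] xt by (simp add: inj_apply[OF pn] a_minus_def)
        ultimately show ?thesis using x(2) by (intro image_eqI[of _ _ ?f]) auto
      qed
    qed (use A_Z in auto)
    then show "(\<lambda>f. ?B p +>\<^bsub>V p q\<^esub> c p q (f p)) ` ?A = carrier (quot_mod ((V p q)\<lparr>carrier := ?Z p\<rparr>) (?B p))"
      unfolding subquot_carrier[OF facts] by (simp only: image_image)
  next
    fix f assume f: "f \<in> ?A"
    have "?B p +>\<^bsub>V p q\<^esub> c p q (f p) = ?B p \<longleftrightarrow> c p q (f p) \<in> ?B p"
      by (rule subquot_eq_zero_iff[OF facts A_Z[OF f]])
    also have "\<dots> \<longleftrightarrow> f \<in> Tot.appr_bd 2 (int p) n"
    proof
      assume "c p q (f p) \<in> ?B p"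
      then obtain v where v: "v \<in> carrier (V (Suc p) q)" "c p q (f p) = \<delta> (Suc p) q v" unfolding boundaries_def by auto
      then obtain x where x: "x \<in> cycles (D (Suc p)) (dv (Suc p)) q" "v = c (Suc p) q x" using c_surj[of "Suc p" q] by blast
      have xc: "x \<in> carrier (D (Suc p) q)" using x by (simp add: vcycles)
      have fpc: "f p \<in> carrier (D p q)" using A_p[OF f] by (simp add: vcycles)
      have "c p q (f p \<ominus>\<^bsub>D p q\<^esub> dh (Suc p) q x) = \<zero>\<^bsub>V p q\<^esub>"
        using v x c_closed[OF dh_vcycles[OF x(1)]] a_minus_eq_zero_iff[OF V_module]
        by (simp add: c_minus[OF A_p[OF f] dh_vcycles[OF x(1)]] \<delta>_c)
      then have "f p \<ominus>\<^bsub>D p q\<^esub> dh (Suc p) q x \<in> boundaries (D p) (dv p) q"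
        using c_ker submodule_minus[OF vcycles_submodule A_p[OF f] dh_vcycles[OF x(1)]] by blast
      then obtain y where y: "y \<in> carrier (D p (Suc q))" "f p \<ominus>\<^bsub>D p q\<^esub> dh (Suc p) q x = dv p (Suc q) y"
        unfolding boundaries_def by auto
      have fp: "f p = dh (Suc p) q x \<oplus>\<^bsub>D p q\<^esub> dv p (Suc q) y"
        using a_minus_eq_iff[OF D_module fpc, of "dh (Suc p) q x" "dv p (Suc q) y"] xc y by (simp add: D.M.a_comm)
      have pi: "Suc p \<in> idx (n + 1)" "p \<in> idx (n + 1)" unfolding n1 by auto
      have xt: "x \<in> carrier (term_mod (n + 1) (Suc p))" and yt: "y \<in> carrier (term_mod (n + 1) p)"
        unfolding n1 using xc y(1) by auto
      \<comment> \<open>The bounding chain has filtration \<open>p + 1\<close>: \<open>x\<close> in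
        column \<open>p + 1\<close> represents \<open>v\<close>, and \<open>y\<close> in column
        \<open>p\<close> accounts for the difference of \<open>f p\<close> and \<open>dh x\<close>,
        which is a vertical boundary.\<close>
      let ?z = "inj (n + 1) (Suc p) x \<oplus>\<^bsub>Tot (n + 1)\<^esub> inj (n + 1) p y"
      note e = inj_closed[OF pi(1) xt] inj_closed[OF pi(2) yt]
      have z: "?z \<in> carrier (Tot (n + 1))" using e by simp
      have dz: "tot_d (n + 1) ?z i = tot_d (n + 1) (inj (n + 1) (Suc p) x) i \<oplus>\<^bsub>term_mod n i\<^esub> tot_d (n + 1) (inj (n + 1) p y) i"
        if "i \<in> idx n" for i
        using Tot_add[OF that] by (simp add: mod_hom_add[OF Tot.d_Suc_hom e])
      have dz_p: "tot_d (n + 1) ?z p = f p"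
        using dz[OF pn] tot_d_inj[OF pi(1) _ xt, of p] tot_d_inj[OF pi(2) _ yt, of p] pn fp
        by (simp add: n_def)
      have dz_high: "tot_d (n + 1) ?z i = \<zero>\<^bsub>term_mod n i\<^esub>" if i: "i \<in> idx n" "p < i" for i
      proof -
        have "dv (Suc p) q x = \<zero>\<^bsub>term_mod n (Suc p)\<^esub>" if "Suc p \<in> idx n"
        proof -
          obtain q' where "n = int (Suc p) + int q'" using \<open>Suc p \<in> idx n\<close> by (rule idxE)
          then have "q = Suc q'" "n = int p + int q' + 1" by (auto simp: n_def)
          then show ?thesis using x(1) by (simp add: vcycles)
        qed
        moreover have nq: "nat (n + 1 - int (Suc p)) = q" by (simp add: n_def)
        ultimately have "tot_d (n + 1) (inj (n + 1) (Suc p) x) i = \<zero>\<^bsub>term_mod n i\<^esub>"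
          using tot_d_inj[OF pi(1) _ xt, of i] i by (auto simp: nq)
        moreover have "tot_d (n + 1) (inj (n + 1) p y) i = \<zero>\<^bsub>term_mod n i\<^esub>"
          using tot_d_inj[OF pi(2) _ yt, of i] i by simp
        ultimately show ?thesis using dz[OF i(1)] by simp
      qed
      have dzc: "tot_d (n + 1) ?z \<in> carrier (Tot n)" by (rule Tot.d_Suc_closed[OF z])
      show "f \<in> Tot.appr_bd 2 (int p) n"
      proof (rule Tot.appr_bdI[OF f])
        show "?z \<in> tot_F (int p + 2 - 1) (n + 1)"
          using z by (auto simp: tot_F_iff Tot_add inj_apply)
        show "f \<ominus>\<^bsub>Tot n\<^esub> tot_d (n + 1) ?z \<in> tot_F (int p - 1) n"
          unfolding tot_F_iff
        proof (intro conjI ballI impI)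
          fix i assume i: "i \<in> idx n" "int p - 1 < int i"
          have "f i = tot_d (n + 1) ?z i"
          proof (cases "i = p")
            case False
            then have "p < i" using i by simp
            then show ?thesis using dz_high[OF i(1)] Tot.appr_cyc_F[OF f] i(1) by (auto simp: tot_F_iff)
          qed (simp add: dz_p)
          then show "(f \<ominus>\<^bsub>Tot n\<^esub> tot_d (n + 1) ?z) i = \<zero>\<^bsub>term_mod n i\<^esub>"
            using Tot_minus[OF A_c[OF f] dzc i(1)] Tot_apply[OF A_c[OF f] i(1)] a_minus_eq_zero_iff[OF term_mod_module] by simp
        qed (use A_c[OF f] dzc in simp)
        show "f = tot_d (n + 1) ?z \<oplus>\<^bsub>Tot n\<^esub> (f \<ominus>\<^bsub>Tot n\<^esub> tot_d (n + 1) ?z)"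
          using a_minus_eq_iff[OF Tot_module A_c[OF f] dzc, of "f \<ominus>\<^bsub>Tot n\<^esub> tot_d (n + 1) ?z"] A_c[OF f] dzc
          by (simp add: Tot.M.a_comm)
      qed
    next
      assume "f \<in> Tot.appr_bd 2 (int p) n"
      then obtain z g where "z \<in> tot_F (int p + 2 - 1) (n + 1)" and g: "g \<in> tot_F (int p - 1) n"
        and eq: "f = tot_d (n + 1) z \<oplus>\<^bsub>Tot n\<^esub> g" by (rule Tot.appr_bdE)
      then have z: "z \<in> tot_F (int p + 1) (n + 1)" by (simp add: add.commute)
      have zc: "z \<in> carrier (Tot (n + 1))" using z by (simp add: tot_F_iff)
      have gi: "g i = \<zero>\<^bsub>term_mod n i\<^esub>" if "i \<in> idx n" "p \<le> i" for i using g that by (simp add: tot_F_iff)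
      have fi: "f i = tot_d (n + 1) z i" if "i \<in> idx n" "p \<le> i" for i
        using Tot_add[OF that(1), of "tot_d (n + 1) z" g] gi[OF that] Tot_apply[OF Tot.d_Suc_closed[OF zc] that(1)] eq by simp
      have zt: "z (Suc p) \<in> carrier (D (Suc p) q)" "z p \<in> carrier (D p (Suc q))"
        using Tot_apply[OF zc, of "Suc p"] Tot_apply[OF zc, of p] unfolding n1 by auto
      have zp: "z (Suc p) \<in> cycles (D (Suc p)) (dv (Suc p)) q"
      proof (cases q)
        case 0 then show ?thesis using zt by (simp add: vcycles)
      next
        case (Suc q')
        have n': "n = int (Suc p) + int q'" "n + 1 = int (Suc p) + int q' + 1" using Suc by (auto simp: n_def)
        have sp: "Suc p \<in> idx n" unfolding n' by (rule idx_simps)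
        have "f (Suc p) = \<zero>\<^bsub>term_mod n (Suc p)\<^esub>"
          using Tot.appr_cyc_F[OF f] sp by (simp add: tot_F_iff)
        then have d0: "tot_d (n + 1) z (Suc p) = \<zero>\<^bsub>D (Suc p) q'\<^esub>" using fi[OF sp] unfolding n'(1) term_mod_simps by simp
        have "Suc (Suc p) \<in> idx (n + 1)" unfolding n'(2) by (rule idx_simps)
        then have "z (Suc (Suc p)) = \<zero>\<^bsub>term_mod (n + 1) (Suc (Suc p))\<^esub>" using z by (simp add: tot_F_iff)
        then have "z (Suc (Suc p)) = \<zero>\<^bsub>D (Suc (Suc p)) q'\<^esub>" unfolding n'(2) term_mod_simps .
        then show ?thesis
          using d0 zt Suc unfolding n'(2) tot_d_apply by (simp add: vcycles)
      qed
      have "f p = dh (Suc p) q (z (Suc p)) \<oplus>\<^bsub>D p q\<^esub> dv p (Suc q) (z p)"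
        using fi[OF pn order_refl] unfolding n1 tot_d_apply .
      moreover have b: "dv p (Suc q) (z p) \<in> boundaries (D p) (dv p) q" using zt by (simp add: boundaries_def)
      moreover have bc: "dv p (Suc q) (z p) \<in> cycles (D p) (dv p) q" using b vboundaries_subset by blast
      moreover interpret V: module K "V p q" by (rule V_module)
      have "c p q (dv p (Suc q) (z p)) = \<zero>\<^bsub>V p q\<^esub>" using c_ker[OF bc] b by simp
      ultimately have "c p q (f p) = \<delta> (Suc p) q (c (Suc p) q (z (Suc p)))"
        using c_closed[OF dh_vcycles[OF zp]] by (simp add: c_add[OF dh_vcycles[OF zp] bc] \<delta>_c[OF zp])
      then show "c p q (f p) \<in> ?B p" using c_closed[OF zp] unfolding boundaries_def by auto
    qed
    finally show "?B p +>\<^bsub>V p q\<^esub> c p q (f p) = \<zero>\<^bsub>quot_mod ((V p q)\<lparr>carrier := ?Z p\<rparr>) (?B p)\<^esub>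
      \<longleftrightarrow> f \<in> Tot.appr_bd 2 (int p) n"
      unfolding subquot_zero[OF facts] .
  qed
qed

end

section \<open>Alternating sums\<close>

lemma (in abelian_monoid) finsum_Times:
  assumes "finite A" "finite B" "\<And>a b. \<lbrakk>a \<in> A; b \<in> B\<rbrakk> \<Longrightarrow> f (a, b) \<in> carrier G"
  shows "(\<Oplus>p\<in>A \<times> B. f p) = (\<Oplus>a\<in>A. \<Oplus>b\<in>B. f (a, b))"
proof -
  have "A \<times> B = (\<Union>a\<in>A. Pair a ` B)" by auto
  then have "(\<Oplus>p\<in>A \<times> B. f p) = (\<Oplus>a\<in>A. \<Oplus>p\<in>Pair a ` B. f p)"
    using assms by (simp only:) (intro add.finprod_UN_disjoint, auto simp: pairwise_def disjnt_def)
  also have "\<dots> = (\<Oplus>a\<in>A. \<Oplus>b\<in>B. f (a, b))"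
  proof (intro finsum_cong' refl)
    fix a assume "a \<in> A"
    then show "(\<Oplus>p\<in>Pair a ` B. f p) = (\<Oplus>b\<in>B. f (a, b))"
      using assms(3) by (intro finsum_reindex) (auto simp: inj_on_def)
  qed (use assms in \<open>auto intro!: finsum_closed\<close>)
  finally show ?thesis .
qed

lemma alt_sum_Suc:
  assumes "module K M" "\<And>i. i \<le> Suc n \<Longrightarrow> x i \<in> carrier M"
  shows "alt_sum M (Suc n) x = alt_sum M n x \<oplus>\<^bsub>M\<^esub> (if even (Suc n) then x (Suc n) else \<ominus>\<^bsub>M\<^esub> x (Suc n))"
proof -
  interpret M: module K M by fact
  show ?thesis
    using assms(2) alt_sum_closed[OF assms(1), of n x] unfolding alt_sum_def
    by (subst M.M.finsum_Suc) (auto intro: M.M.a_comm)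
qed

lemma alt_sum_uminus:
  assumes "module K M" "\<And>i. i \<le> n \<Longrightarrow> x i \<in> carrier M"
  shows "\<ominus>\<^bsub>M\<^esub> alt_sum M n x = alt_sum M n (\<lambda>i. \<ominus>\<^bsub>M\<^esub> x i)"
  by (rule mod_hom_alt_sum[OF assms(1,1) mod_hom_uminus_fun[OF assms(1,1) mod_hom_id]]) (rule assms(2))

text \<open>The hypothesis on \<open>y j i = d\<^sub>i d\<^sub>j x\<close> is the simplicial identity \<open>d\<^sub>i d\<^sub>j = d\<^sub>j\<^sub>-\<^sub>1 d\<^sub>i\<close> for \<open>i < j\<close>.\<close>

lemma alt_sum_simplicial:
  assumes M: "module K M" and y: "\<And>i j. \<lbrakk>j \<le> Suc n; i \<le> n\<rbrakk> \<Longrightarrow> y j i \<in> carrier M"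
    and simp: "\<And>i j. \<lbrakk>i < j; j \<le> Suc n\<rbrakk> \<Longrightarrow> y j i = y i (j - 1)"
  shows "alt_sum M (Suc n) (\<lambda>j. alt_sum M n (y j)) = \<zero>\<^bsub>M\<^esub>"
proof -
  interpret M: module K M by fact
  define t where "t p = (case p of (j, i) \<Rightarrow> if even (i + j) then y j i else \<ominus>\<^bsub>M\<^esub> y j i)" for p :: "nat \<times> nat"
  have tc: "t (j, i) \<in> carrier M" if "j \<le> Suc n" "i \<le> n" for j i
    using y[OF that] by (simp add: t_def)
  \<comment> \<open>The pairs of faces are split along \<open>j \<le> i\<close>, and
    \<open>m\<close> matches \<open>(j, i)\<close> with \<open>(i + 1, j)\<close>. By the simplicial
    identity both index the same element, with opposite signs.\<close>
  define Q where "Q = {(j, i). j \<le> i \<and> i \<le> n}"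
  define m where "m = (\<lambda>(j, i). (Suc i, j :: nat))"
  have Q_sub: "Q \<subseteq> {..n} \<times> {..n}" by (auto simp: Q_def)
  have fQ: "finite Q" by (rule finite_subset[OF Q_sub]) simp
  have S: "{..Suc n} \<times> {..n} = m ` Q \<union> Q" and disj: "m ` Q \<inter> Q = {}"
  proof -
    have "(j, i) \<in> m ` Q" if "i < j" "j \<le> Suc n" for i j
      using that by (intro image_eqI[of _ _ "(i, j - 1)"]) (auto simp: m_def Q_def)
    then show "{..Suc n} \<times> {..n} = m ` Q \<union> Q" by (fastforce simp: m_def Q_def)
  qed (auto simp: m_def Q_def)
  have inj: "inj_on m Q" by (auto simp: inj_on_def m_def)
  have mQ: "t (m q) \<in> carrier M" "t q \<in> carrier M" "t (m q) \<oplus>\<^bsub>M\<^esub> t q = \<zero>\<^bsub>M\<^esub>" if "q \<in> Q" for q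
  proof -
    obtain j i where q: "q = (j, i)" "j \<le> i" "i \<le> n" using \<open>q \<in> Q\<close> by (auto simp: Q_def)
    then show "t (m q) \<in> carrier M" "t q \<in> carrier M" using tc by (auto simp: m_def)
    show "t (m q) \<oplus>\<^bsub>M\<^esub> t q = \<zero>\<^bsub>M\<^esub>"
      using q simp[of j "Suc i"] y[of j i] by (simp add: t_def m_def add.commute M.M.l_neg M.M.r_neg)
  qed
  have "alt_sum M (Suc n) (\<lambda>j. alt_sum M n (y j)) = (\<Oplus>\<^bsub>M\<^esub>j\<in>{..Suc n}. \<Oplus>\<^bsub>M\<^esub>i\<in>{..n}. t (j, i))"
    unfolding alt_sum_def[of M "Suc n"]
  proof (intro M.M.finsum_cong' refl)
    fix j assume j: "j \<in> {..Suc n}"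
    show "(if even j then alt_sum M n (y j) else \<ominus>\<^bsub>M\<^esub> alt_sum M n (y j)) = (\<Oplus>\<^bsub>M\<^esub>i\<in>{..n}. t (j, i))"
    proof (cases "even j")
      case True
      then show ?thesis using j tc y by (auto simp: alt_sum_def t_def intro!: M.M.finsum_cong')
    next
      case False
      then have "\<ominus>\<^bsub>M\<^esub> alt_sum M n (y j) = (\<Oplus>\<^bsub>M\<^esub>i\<in>{..n}. t (j, i))"
        using j tc y unfolding alt_sum_uminus[OF M y[of j]]
        by (subst alt_sum_uminus[OF M y]) (auto simp: alt_sum_def t_def intro!: M.M.finsum_cong')
      then show ?thesis using False by simp
    qed
  qed (use tc in \<open>auto intro!: M.M.finsum_closed\<close>)
  also have "\<dots> = (\<Oplus>\<^bsub>M\<^esub>p\<in>{..Suc n} \<times> {..n}. t p)"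
    by (rule M.M.finsum_Times[symmetric]) (auto intro: tc)
  also have "\<dots> = (\<Oplus>\<^bsub>M\<^esub>p\<in>m ` Q. t p) \<oplus>\<^bsub>M\<^esub> (\<Oplus>\<^bsub>M\<^esub>p\<in>Q. t p)"
    unfolding S using fQ disj mQ by (intro M.M.finsum_Un_disjoint) auto
  also have "(\<Oplus>\<^bsub>M\<^esub>p\<in>m ` Q. t p) = (\<Oplus>\<^bsub>M\<^esub>q\<in>Q. t (m q))"
    using mQ inj by (intro M.M.finsum_reindex) auto
  also have "\<dots> \<oplus>\<^bsub>M\<^esub> (\<Oplus>\<^bsub>M\<^esub>p\<in>Q. t p) = (\<Oplus>\<^bsub>M\<^esub>q\<in>Q. t (m q) \<oplus>\<^bsub>M\<^esub> t q)"
    using mQ by (intro M.M.finsum_addf[symmetric]) auto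
  also have "\<dots> = \<zero>\<^bsub>M\<^esub>" by (rule M.M.add.finprod_one_eqI[simplified]) (simp add: mQ)
  finally show ?thesis .
qed

section \<open>The bar complex\<close>

locale kg_module = G: group G + module K X
  for G :: "('g, 'y) monoid_scheme" and K :: "('k, 'z) ring_scheme" and X :: "('k, 'x) module" +
  fixes \<rho> :: "'g \<Rightarrow> 'x \<Rightarrow> 'x"
  assumes act_hom: "g \<in> carrier G \<Longrightarrow> \<rho> g \<in> mod_hom K X X"
    and act_mult: "\<lbrakk>g \<in> carrier G; h \<in> carrier G; x \<in> carrier X\<rbrakk> \<Longrightarrow> \<rho> (g \<otimes>\<^bsub>G\<^esub> h) x = \<rho> g (\<rho> h x)"
    and act_one: "x \<in> carrier X \<Longrightarrow> \<rho> \<one>\<^bsub>G\<^esub> x = x"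

definition bar_gen :: "('g, 'y) monoid_scheme \<Rightarrow> ('k, 'x) module \<Rightarrow> nat \<Rightarrow> 'g list \<Rightarrow> 'x \<Rightarrow> ('g list \<Rightarrow> 'x)" where
  "bar_gen G X p = dsum_inj (bar_words G p) (\<lambda>_. X)"

text \<open>One formula for all faces, entry by entry: \<open>i = 0\<close> shifts every entry, and
  \<open>i = p\<close> keeps all but the last. The simplicial identity then becomes a comparison of
  entries.\<close>

definition face_word :: "('g, 'y) monoid_scheme \<Rightarrow> nat \<Rightarrow> nat \<Rightarrow> 'g list \<Rightarrow> 'g list" where
  "face_word G p i w = map (\<lambda>k. if Suc k < i then w ! k else if Suc k = i then w ! k \<otimes>\<^bsub>G\<^esub> w ! Suc k else w ! Suc k) [0..<p - 1]"

lemma bar_words_iff: "w \<in> bar_words G p \<longleftrightarrow> length w = p \<and> (\<forall>i<p. w ! i \<in> carrier G)"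
  by (auto simp: bar_words_def set_conv_nth)

lemma bar_face_eq:
  assumes "length w = Suc p" "i \<le> Suc p"
  shows "bar_face G \<rho> (Suc p) i w x = (face_word G (Suc p) i w, if i = Suc p then \<rho> (w ! p) x else x)"
proof -
  consider "i = 0" | "i = Suc p" | "0 < i" "i < Suc p" using assms(2) by linarith
  then show ?thesis
  proof cases
    case 1
    then have "tl w = face_word G (Suc p) i w"
      using assms by (intro nth_equalityI) (auto simp: face_word_def nth_tl)
    then show ?thesis using 1 by (simp add: bar_face_def)
  next
    case 2
    then have "butlast w = face_word G (Suc p) i w"
      using assms by (intro nth_equalityI) (auto simp: face_word_def nth_butlast)
    moreover have "last w = w ! p" using assms by (subst last_conv_nth) auto
    ultimately show ?thesis using 2 by (simp add: bar_face_def)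
  next
    case 3
    then have "take (i - 1) w @ [w ! (i - 1) \<otimes>\<^bsub>G\<^esub> w ! i] @ drop (Suc i) w = face_word G (Suc p) i w"
      using assms by (intro nth_equalityI) (auto simp: face_word_def nth_append nth_Cons' less_diff_conv)
    then show ?thesis using 3 by (simp add: bar_face_def)
  qed
qed

context kg_module
begin

lemma X_module: "module K X" by unfold_locales

lemmas act_closed = mod_hom_closed[OF act_hom]

abbreviation "bar \<equiv> bar_chain G X"
abbreviation "gen \<equiv> bar_gen G X"
abbreviation "words \<equiv> bar_words G"
abbreviation "bd \<equiv> bar_boundary G X \<rho>"

lemma bar_module: "module K (bar p)"
  unfolding bar_chain_def by (rule dsum_module[OF R.is_cring X_module])

lemma gen_hom: "w \<in> words p \<Longrightarrow> gen p w \<in> mod_hom K X (bar p)"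
  unfolding bar_chain_def bar_gen_def by (rule dsum_inj_hom[OF R.is_cring X_module])

lemmas gen_closed = mod_hom_closed[OF gen_hom]

lemma bar_apply_hom: "w \<in> words p \<Longrightarrow> (\<lambda>f. f w) \<in> mod_hom K (bar p) X"
  unfolding bar_chain_def by (rule dsum_apply_hom[OF R.is_cring X_module])

lemma gen_apply: "v \<in> words p \<Longrightarrow> gen p w x v = (if v = w then x else \<zero>\<^bsub>X\<^esub>)"
  by (simp add: bar_gen_def dsum_inj_def)

lemma bar_hom_eq:
  assumes "module K N" "h \<in> mod_hom K (bar p) N" "h' \<in> mod_hom K (bar p) N"
    and "\<And>w x. \<lbrakk>w \<in> words p; x \<in> carrier X\<rbrakk> \<Longrightarrow> h (gen p w x) = h' (gen p w x)"
    and "f \<in> carrier (bar p)"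
  shows "h f = h' f"
  using assms(2-) unfolding bar_chain_def bar_gen_def
  by (rule dsum_hom_eq[OF R.is_cring X_module assms(1)])

lemma face_word_closed: "\<lbrakk>w \<in> words (Suc p); i \<le> Suc p\<rbrakk> \<Longrightarrow> face_word G (Suc p) i w \<in> words p"
  by (auto simp: bar_words_iff face_word_def)

definition face_gen :: "nat \<Rightarrow> nat \<Rightarrow> 'g list \<Rightarrow> 'x \<Rightarrow> ('g list \<Rightarrow> 'x)" where
  "face_gen p i w x = gen p (face_word G (Suc p) i w) (if i = Suc p then \<rho> (w ! p) x else x)"

lemma face_gen_hom: "\<lbrakk>w \<in> words (Suc p); i \<le> Suc p\<rbrakk> \<Longrightarrow> face_gen p i w \<in> mod_hom K X (bar p)"
  unfolding face_gen_def
  using mod_hom_comp[OF act_hom gen_hom[OF face_word_closed]] gen_hom[OF face_word_closed]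
  by (cases "i = Suc p") (auto simp: bar_words_iff)

lemma bd_gen_hom: "w \<in> words (Suc p) \<Longrightarrow> (\<lambda>x. alt_sum (bar p) (Suc p) (\<lambda>i. face_gen p i w x)) \<in> mod_hom K X (bar p)"
  by (rule mod_hom_alt_sum_fun[OF X_module bar_module face_gen_hom])

lemma alt_sum_face:
  assumes "w \<in> words (Suc p)" "x \<in> carrier X"
  shows "alt_sum (bar (Suc p - 1)) (Suc p) (\<lambda>i. case bar_face G \<rho> (Suc p) i w x of
            (gs', x') \<Rightarrow> dsum_inj (words (Suc p - 1)) (\<lambda>_. X) gs' x') = alt_sum (bar p) (Suc p) (\<lambda>i. face_gen p i w x)"
  using assms mod_hom_closed[OF face_gen_hom]
  by (simp, intro alt_sum_cong[OF bar_module]) (auto simp: bar_face_eq bar_words_iff face_gen_def bar_gen_def)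

lemma
  shows bd_hom: "bd (Suc p) \<in> mod_hom K (bar (Suc p)) (bar p)"
    and bd_gen: "\<lbrakk>w \<in> words (Suc p); x \<in> carrier X\<rbrakk> \<Longrightarrow> bd (Suc p) (gen (Suc p) w x) = alt_sum (bar p) (Suc p) (\<lambda>i. face_gen p i w x)"
proof -
  let ?h = "\<lambda>w x. alt_sum (bar (Suc p - 1)) (Suc p) (\<lambda>i. case bar_face G \<rho> (Suc p) i w x of
            (gs', x') \<Rightarrow> dsum_inj (words (Suc p - 1)) (\<lambda>_. X) gs' x')"
  have h: "?h w \<in> mod_hom K X (bar p)" if "w \<in> words (Suc p)" for w
    by (rule mod_hom_cong[OF X_module alt_sum_face[OF that] bd_gen_hom[OF that]])
  show "bd (Suc p) \<in> mod_hom K (bar (Suc p)) (bar p)"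
    unfolding bar_boundary_def bar_chain_def[of G X "Suc p"]
    using dsum_lift_hom[OF R.is_cring X_module bar_module h] by simp
  assume w: "w \<in> words (Suc p)" and x: "x \<in> carrier X"
  have "bd (Suc p) (gen (Suc p) w x) = ?h w x"
    unfolding bar_boundary_def bar_gen_def
    using dsum_lift_inj[OF R.is_cring X_module bar_module h w x] by simp
  then show "bd (Suc p) (gen (Suc p) w x) = alt_sum (bar p) (Suc p) (\<lambda>i. face_gen p i w x)"
    unfolding alt_sum_face[OF w x] .
qed

text \<open>Entries are compared according to the position of \<open>k\<close> relative to the two
  faces. Associativity enters only for adjacent faces, where both sides multiply the same three
  consecutive entries.\<close>

lemma face_word_face_word:
  assumes w: "w \<in> words (Suc (Suc p))" and ij: "i < j" "j \<le> Suc (Suc p)"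
  shows "face_word G (Suc p) i (face_word G (Suc (Suc p)) j w) = face_word G (Suc p) (j - 1) (face_word G (Suc (Suc p)) i w)"
proof (rule nth_equalityI)
  fix k assume "k < length (face_word G (Suc p) i (face_word G (Suc (Suc p)) j w))"
  then have k: "k < p" by (simp add: face_word_def)
  obtain j' where j': "j = Suc j'" using ij by (cases j) auto
  have f: "face_word G (Suc (Suc p)) m w ! l = (if Suc l < m then w ! l else if Suc l = m then w ! l \<otimes>\<^bsub>G\<^esub> w ! Suc l else w ! Suc l)"
    if "l < Suc p" for l m using that by (simp add: face_word_def del: upt_Suc)
  have c: "w ! k \<in> carrier G" "w ! Suc k \<in> carrier G" "w ! Suc (Suc k) \<in> carrier G"
    using w k by (auto simp: bar_words_iff)
  have e1: "face_word G (Suc p) i (face_word G (Suc (Suc p)) j w) ! k =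
    (let u = face_word G (Suc (Suc p)) j w in if Suc k < i then u ! k else if Suc k = i then u ! k \<otimes>\<^bsub>G\<^esub> u ! Suc k else u ! Suc k)"
   and e2: "face_word G (Suc p) (j - 1) (face_word G (Suc (Suc p)) i w) ! k =
    (let u = face_word G (Suc (Suc p)) i w in if Suc k < j' then u ! k else if Suc k = j' then u ! k \<otimes>\<^bsub>G\<^esub> u ! Suc k else u ! Suc k)"
    using k unfolding face_word_def[of G "Suc p"] by (simp_all add: Let_def j')
  consider "Suc k < i" | "Suc k = i" "Suc k < j'" | "Suc k = i" "Suc k = j'"
    | "i < Suc k" "Suc k < j'" | "i < Suc k" "Suc k = j'" | "i < Suc k" "j' < Suc k"
    using ij j' by linarith
  then show "face_word G (Suc p) i (face_word G (Suc (Suc p)) j w) ! k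
    = face_word G (Suc p) (j - 1) (face_word G (Suc (Suc p)) i w) ! k"
    using k ij c unfolding e1 e2 by cases (simp_all add: f j' Let_def G.m_assoc c)
qed (simp add: face_word_def)

lemma bd_face_gen:
  assumes w: "w \<in> words (Suc (Suc p))" and x: "x \<in> carrier X" and j: "j \<le> Suc (Suc p)"
  shows "bd (Suc p) (face_gen (Suc p) j w x)
    = alt_sum (bar p) (Suc p) (\<lambda>i. face_gen p i (face_word G (Suc (Suc p)) j w) (if j = Suc (Suc p) then \<rho> (w ! Suc p) x else x))"
  unfolding face_gen_def[of "Suc p"]
  using x w by (intro bd_gen face_word_closed w j) (auto simp: bar_words_iff intro: act_closed)

lemma bd_bd:
  assumes "f \<in> carrier (bar (Suc (Suc p)))"
  shows "bd (Suc p) (bd (Suc (Suc p)) f) = \<zero>\<^bsub>bar p\<^esub>"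
proof (rule bar_hom_eq[OF bar_module mod_hom_comp[OF bd_hom bd_hom] mod_hom_const_zero[OF bar_module bar_module] _ assms])
  fix w x assume w: "w \<in> words (Suc (Suc p))" and x: "x \<in> carrier X"
  define x' where "x' j = (if j = Suc (Suc p) then \<rho> (w ! Suc p) x else x)" for j
  define y where "y j = (\<lambda>i. face_gen p i (face_word G (Suc (Suc p)) j w) (x' j))" for j
  have wi: "w ! i \<in> carrier G" if "i < Suc (Suc p)" for i using w that by (auto simp: bar_words_iff)
  have x'c: "x' j \<in> carrier X" for j using x wi by (auto simp: x'_def intro: act_closed)
  have "bd (Suc p) (bd (Suc (Suc p)) (gen (Suc (Suc p)) w x))
    = alt_sum (bar p) (Suc (Suc p)) (\<lambda>j. bd (Suc p) (face_gen (Suc p) j w x))"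
    unfolding bd_gen[OF w x] using mod_hom_closed[OF face_gen_hom[OF w] x]
    by (intro mod_hom_alt_sum[OF bar_module bar_module bd_hom])
  also have "\<dots> = alt_sum (bar p) (Suc (Suc p)) (\<lambda>j. alt_sum (bar p) (Suc p) (y j))"
    using w x by (intro alt_sum_cong[OF bar_module] alt_sum_closed[OF bar_module])
      (auto simp: bd_face_gen y_def x'_def[symmetric] intro!: mod_hom_closed[OF face_gen_hom] face_word_closed x'c)
  also have "\<dots> = \<zero>\<^bsub>bar p\<^esub>"
  proof (rule alt_sum_simplicial[OF bar_module])
    fix i j assume "j \<le> Suc (Suc p)" "i \<le> Suc p"
    then show "y j i \<in> carrier (bar p)"
      unfolding y_def using w by (intro mod_hom_closed[OF face_gen_hom] face_word_closed x'c)
  next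
    fix i j assume ij: "i < j" "j \<le> Suc (Suc p)"
    \<comment> \<open>The acting elements differ in form only for the last two faces, where acting
      twice is compared with acting by the product.\<close>
    have a: "(if i = Suc p then \<rho> (face_word G (Suc (Suc p)) j w ! p) (x' j) else x' j)
      = (if j - 1 = Suc p then \<rho> (face_word G (Suc (Suc p)) i w ! p) (x' i) else x' i)"
      using ij wi x by (auto simp: x'_def face_word_def act_mult simp del: upt_Suc)
    show "y j i = y i (j - 1)"
      unfolding y_def face_gen_def a face_word_face_word[OF w ij] ..
  qed
  finally show "bd (Suc p) (bd (Suc (Suc p)) (gen (Suc (Suc p)) w x)) = \<zero>\<^bsub>bar p\<^esub>" .
qed

end

subsection \<open>Naturality\<close>

definition bar_map :: "('g, 'y) monoid_scheme \<Rightarrow> nat \<Rightarrow> ('a \<Rightarrow> 'b) \<Rightarrow> ('g list \<Rightarrow> 'a) \<Rightarrow> ('g list \<Rightarrow> 'b)" where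
  "bar_map G p h f = (\<lambda>w\<in>bar_words G p. h (f w))"

lemma bar_map_apply: "w \<in> bar_words G p \<Longrightarrow> bar_map G p h f w = h (f w)"
  by (simp add: bar_map_def)

lemma bar_chain_iff:
  assumes "module K X"
  shows "f \<in> carrier (bar_chain G X p) \<longleftrightarrow> f \<in> extensional (bar_words G p) \<and>
    (\<forall>w\<in>bar_words G p. f w \<in> carrier X) \<and> finite {w \<in> bar_words G p. f w \<noteq> \<zero>\<^bsub>X\<^esub>}"
proof -
  interpret module K X by fact
  show ?thesis unfolding bar_chain_def by (rule dsum_carrier_iff[OF R.is_cring assms])
qed

lemma bar_chain_ext:
  "\<lbrakk>module K X; f \<in> carrier (bar_chain G X p); g \<in> carrier (bar_chain G X p); \<And>w. w \<in> bar_words G p \<Longrightarrow> f w = g w\<rbrakk> \<Longrightarrow> f = g"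
  by (rule extensionalityI[of _ "bar_words G p"]) (auto simp: bar_chain_iff)

lemma bar_map_closed:
  assumes "module K X" "module K X'" "h \<in> mod_hom K X X'" "f \<in> carrier (bar_chain G X p)"
  shows "bar_map G p h f \<in> carrier (bar_chain G X' p)"
proof -
  have "finite {w \<in> bar_words G p. f w \<noteq> \<zero>\<^bsub>X\<^esub>}" using assms by (simp add: bar_chain_iff[OF assms(1)])
  then have "finite {w \<in> bar_words G p. bar_map G p h f w \<noteq> \<zero>\<^bsub>X'\<^esub>}"
    by (rule rev_finite_subset) (auto simp: bar_map_apply mod_hom_zero[OF assms(1-3)])
  then show ?thesis
    using assms mod_hom_closed[OF assms(3)] by (auto simp: bar_chain_iff[OF assms(1)] bar_chain_iff[OF assms(2)] bar_map_def)
qed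

lemma bar_map_hom:
  assumes "module K X" "module K X'" "h \<in> mod_hom K X X'"
  shows "bar_map G p h \<in> mod_hom K (bar_chain G X p) (bar_chain G X' p)"
proof -
  interpret module K X by fact
  show ?thesis
    unfolding bar_chain_def[of G X']
  proof (rule mod_hom_dsumI[OF R.is_cring assms(2)])
    show "bar_map G p h f \<in> carrier (dsum (bar_words G p) (\<lambda>_. X'))" if "f \<in> carrier (bar_chain G X p)" for f
      using bar_map_closed[OF assms that] by (simp add: bar_chain_def)
    show "(\<lambda>f. bar_map G p h f w) \<in> mod_hom K (bar_chain G X p) X'" if "w \<in> bar_words G p" for w
      using mod_hom_comp[OF dsum_apply_hom[OF R.is_cring assms(1) that] assms(3)] that
      by (simp add: bar_map_apply bar_chain_def)
    show "module K (bar_chain G X p)" unfolding bar_chain_def by (rule dsum_module[OF R.is_cring assms(1)])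
  qed
qed

lemma bar_map_gen:
  assumes "module K X" "module K X'" "h \<in> mod_hom K X X'"
  shows "bar_map G p h (bar_gen G X p w x) = bar_gen G X' p w (h x)"
  using mod_hom_zero[OF assms] by (auto simp: bar_map_def bar_gen_def dsum_inj_def)

lemma bar_map_id: "\<lbrakk>module K X; f \<in> carrier (bar_chain G X p)\<rbrakk> \<Longrightarrow> bar_map G p (\<lambda>x. x) f = f"
  by (rule extensionalityI[of _ "bar_words G p"]) (auto simp: bar_chain_iff bar_map_def)

text \<open>Exactness of bar chains in the coefficients: preimages are chosen word by word, inside a
  given submodule.\<close>

lemma bar_map_lift:
  assumes X: "module K X" "module K X'" and h: "h \<in> mod_hom K X X'" and L: "submodule L K X"
    and f: "f \<in> carrier (bar_chain G X' p)" "\<And>w. w \<in> bar_words G p \<Longrightarrow> f w \<in> h ` L"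
  obtains g where "g \<in> carrier (bar_chain G X p)" "\<And>w. w \<in> bar_words G p \<Longrightarrow> g w \<in> L" "bar_map G p h g = f"
proof -
  \<comment> \<open>Zero is lifted to zero, as otherwise the lifted chain might have infinite
    support.\<close>
  define s where "s y = (if y = \<zero>\<^bsub>X'\<^esub> then \<zero>\<^bsub>X\<^esub> else (SOME x. x \<in> L \<and> h x = y))" for y
  have s: "s y \<in> L \<and> h (s y) = y" if y: "y \<in> h ` L" for y
  proof (cases "y = \<zero>\<^bsub>X'\<^esub>")
    case True then show ?thesis using submodule_zero[OF L] mod_hom_zero[OF X h] by (simp add: s_def)
  next
    case False
    have "\<exists>x. x \<in> L \<and> h x = y" using y by auto
    from someI_ex[OF this] show ?thesis using False by (simp add: s_def)
  qed
  define g where "g = (\<lambda>w\<in>bar_words G p. s (f w))"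
  have "finite {w \<in> bar_words G p. f w \<noteq> \<zero>\<^bsub>X'\<^esub>}" using f(1) by (simp add: bar_chain_iff[OF X(2)])
  then have "finite {w \<in> bar_words G p. g w \<noteq> \<zero>\<^bsub>X\<^esub>}"
    by (rule rev_finite_subset) (auto simp: g_def s_def)
  then have g: "g \<in> carrier (bar_chain G X p)"
    using s f(2) submodule_subset[OF L] by (auto simp: bar_chain_iff[OF X(1)] g_def)
  have "bar_map G p h g = f"
    using s f(2) by (intro bar_chain_ext[OF X(2) bar_map_closed[OF X h g] f(1)]) (auto simp: bar_map_apply g_def)
  then show ?thesis using that[OF g] s f(2) by (auto simp: g_def)
qed

lemma bar_map_bd:
  assumes "kg_module G K X \<rho>" "kg_module G K X' \<rho>'" and h: "h \<in> mod_hom K X X'"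
    and eq: "\<And>g x. \<lbrakk>g \<in> carrier G; x \<in> carrier X\<rbrakk> \<Longrightarrow> h (\<rho> g x) = \<rho>' g (h x)"
    and f: "f \<in> carrier (bar_chain G X (Suc p))"
  shows "bar_map G p h (bar_boundary G X \<rho> (Suc p) f) = bar_boundary G X' \<rho>' (Suc p) (bar_map G (Suc p) h f)"
proof -
  interpret X: kg_module G K X \<rho> by fact
  interpret X': kg_module G K X' \<rho>' by fact
  note m = X.X_module X'.X_module h
  show ?thesis
  proof (rule X.bar_hom_eq[OF X'.bar_module mod_hom_comp[OF X.bd_hom bar_map_hom[OF m]] mod_hom_comp[OF bar_map_hom[OF m] X'.bd_hom] _ f])
    fix w x assume w: "w \<in> bar_words G (Suc p)" and x: "x \<in> carrier X"
    have "bar_map G p h (X.bd (Suc p) (X.gen (Suc p) w x)) = alt_sum (X'.bar p) (Suc p) (\<lambda>i. bar_map G p h (X.face_gen p i w x))"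
      unfolding X.bd_gen[OF w x] using mod_hom_closed[OF X.face_gen_hom[OF w] x]
      by (intro mod_hom_alt_sum[OF X.bar_module X'.bar_module bar_map_hom[OF m]])
    also have "\<dots> = alt_sum (X'.bar p) (Suc p) (\<lambda>i. X'.face_gen p i w (h x))"
      using w x mod_hom_closed[OF X'.face_gen_hom[OF w] mod_hom_closed[OF h x]]
      by (intro alt_sum_cong[OF X'.bar_module])
         (auto simp: X.face_gen_def X'.face_gen_def bar_map_gen[OF m] eq bar_words_iff)
    also have "\<dots> = X'.bd (Suc p) (bar_map G (Suc p) h (X.gen (Suc p) w x))"
      using X'.bd_gen[OF w mod_hom_closed[OF h x]] by (simp add: bar_map_gen[OF m])
    finally show "bar_map G p h (X.bd (Suc p) (X.gen (Suc p) w x)) = X'.bd (Suc p) (bar_map G (Suc p) h (X.gen (Suc p) w x))" .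
  qed
qed

subsection \<open>Relatively projective modules\<close>

text \<open>The trace condition of \<open>relatively_projective\<close> is a sum over all of
  \<open>G\<close>, which makes sense only with finitely many nonzero terms. Finiteness comes first
  so that \<open>coords\<close> can be a linear map into a direct sum of copies of
  \<open>X\<close>.\<close>

locale finite_coordinates = kg_module G K X \<rho>
  for G :: "('g, 'y) monoid_scheme" and K :: "('k, 'z) ring_scheme" and X :: "('k, 'x) module" and \<rho> +
  fixes e :: "'x \<Rightarrow> 'x"
  assumes e_hom: "e \<in> mod_hom K X X"
    and e_finite: "x \<in> carrier X \<Longrightarrow> finite {g \<in> carrier G. e (\<rho> (inv\<^bsub>G\<^esub> g) x) \<noteq> \<zero>\<^bsub>X\<^esub>}"
begin

definition coords :: "'x \<Rightarrow> 'g \<Rightarrow> 'x" where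
  "coords x = (\<lambda>g\<in>carrier G. e (\<rho> (inv\<^bsub>G\<^esub> g) x))"

abbreviation "GX \<equiv> dsum (carrier G) (\<lambda>_. X)"

lemma GX_module: "module K GX"
  by (rule dsum_module[OF R.is_cring X_module])

lemma coords_hom: "coords \<in> mod_hom K X GX"
proof (rule mod_hom_dsumI[OF R.is_cring X_module])
  fix x assume x: "x \<in> carrier X"
  have "{g \<in> carrier G. coords x g \<noteq> \<zero>\<^bsub>X\<^esub>} = {g \<in> carrier G. e (\<rho> (inv\<^bsub>G\<^esub> g) x) \<noteq> \<zero>\<^bsub>X\<^esub>}"
    by (auto simp: coords_def)
  then show "coords x \<in> carrier GX"
    using e_finite[OF x] mod_hom_closed[OF e_hom] act_closed x
    by (simp add: dsum_carrier_iff[OF R.is_cring X_module]) (simp add: coords_def)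
next
  fix g assume g: "g \<in> carrier G"
  then show "(\<lambda>x. coords x g) \<in> mod_hom K X X"
    using mod_hom_comp[OF act_hom e_hom] by (simp add: coords_def)
qed (rule X_module)

lemmas coords_closed = mod_hom_closed[OF coords_hom]

end

text \<open>
  A linear endomorphism \<open>e\<close> of trace one, i.e. with \<open>\<Sum>\<^sub>g g e(g\<^sup>-\<^sup>1 x) = x\<close>, contracts the bar complex by
  \<open>[w]x \<mapsto> \<Sum>\<^sub>g [w|g] e(g\<^sup>-\<^sup>1 x)\<close>.
\<close>

locale relatively_projective = finite_coordinates G K X \<rho> e
  for G :: "('g, 'y) monoid_scheme" and K :: "('k, 'z) ring_scheme" and X :: "('k, 'x) module" and \<rho> and e +
  assumes e_trace: "x \<in> carrier X \<Longrightarrow> dsum_lift (carrier G) (\<lambda>_. X) X \<rho> (coords x) = x"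
begin

text \<open>The trace sum without the outer \<open>g\<close>. Since \<open>g y\<close> and
  \<open>y\<close> agree in the coinvariants, \<open>orbit_sum x\<close> and \<open>x\<close> have
  the same class there, so an element with zero orbit sum is zero in the coinvariants.\<close>

definition orbit_sum :: "'x \<Rightarrow> 'x" where
  "orbit_sum x = dsum_lift (carrier G) (\<lambda>_. X) X (\<lambda>g y. y) (coords x)"

text \<open>The chain \<open>\<Sum>\<^sub>g [w|g] t\<^sub>g\<close>.\<close>

definition append_chain :: "nat \<Rightarrow> 'g list \<Rightarrow> ('g \<Rightarrow> 'x) \<Rightarrow> ('g list \<Rightarrow> 'x)" where
  "append_chain p w t = dsum_lift (carrier G) (\<lambda>_. X) (bar (Suc p)) (\<lambda>g. gen (Suc p) (w @ [g])) t"

lemma append_word: "\<lbrakk>w \<in> words p; g \<in> carrier G\<rbrakk> \<Longrightarrow> w @ [g] \<in> words (Suc p)"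
  by (auto simp: bar_words_def)

lemma butlast_word: "w \<in> words (Suc p) \<Longrightarrow> butlast w \<in> words p"
  by (auto simp: bar_words_def dest: in_set_butlastD)

lemma last_word: "w \<in> words (Suc p) \<Longrightarrow> last w \<in> carrier G"
  by (cases w rule: rev_cases) (auto simp: bar_words_def)

lemma append_chain_hom: "w \<in> words p \<Longrightarrow> append_chain p w \<in> mod_hom K GX (bar (Suc p))"
  unfolding append_chain_def by (rule dsum_lift_hom[OF R.is_cring X_module bar_module gen_hom[OF append_word]])

lemma append_chain_inj:
  "\<lbrakk>w \<in> words p; g \<in> carrier G; y \<in> carrier X\<rbrakk> \<Longrightarrow>
     append_chain p w (dsum_inj (carrier G) (\<lambda>_. X) g y) = gen (Suc p) (w @ [g]) y"
  unfolding append_chain_def by (rule dsum_lift_inj[OF R.is_cring X_module bar_module gen_hom[OF append_word]])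

lemma GX_hom_eq:
  assumes "module K N" "h \<in> mod_hom K GX N" "h' \<in> mod_hom K GX N"
    and "\<And>g y. \<lbrakk>g \<in> carrier G; y \<in> carrier X\<rbrakk> \<Longrightarrow> h (dsum_inj (carrier G) (\<lambda>_. X) g y) = h' (dsum_inj (carrier G) (\<lambda>_. X) g y)"
    and "t \<in> carrier GX"
  shows "h t = h' t"
  by (rule dsum_hom_eq[OF R.is_cring X_module assms])

lemma append_chain_apply:
  assumes w: "w \<in> words p" and v: "v \<in> words (Suc p)" and t: "t \<in> carrier GX"
  shows "append_chain p w t v = (if butlast v = w then t (last v) else \<zero>\<^bsub>X\<^esub>)"
proof (rule GX_hom_eq[OF X_module mod_hom_comp[OF append_chain_hom[OF w] bar_apply_hom[OF v]] _ _ t])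
  show "(\<lambda>t. if butlast v = w then t (last v) else \<zero>\<^bsub>X\<^esub>) \<in> mod_hom K GX X"
    using dsum_apply_hom[OF R.is_cring X_module last_word[OF v]] mod_hom_const_zero[OF GX_module X_module]
    by (cases "butlast v = w") simp_all
  fix g y assume g: "g \<in> carrier G" "y \<in> carrier X"
  have "v = w @ [g] \<longleftrightarrow> butlast v = w \<and> last v = g"
    using v by (auto simp: bar_words_def) (metis append_butlast_last_id list.size(3) nat.simps(3))
  then show "append_chain p w (dsum_inj (carrier G) (\<lambda>_. X) g y) v
    = (if butlast v = w then dsum_inj (carrier G) (\<lambda>_. X) g y (last v) else \<zero>\<^bsub>X\<^esub>)"
    using g last_word[OF v] by (auto simp: append_chain_inj[OF w] gen_apply[OF v] dsum_inj_apply[OF R.is_cring X_module])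
qed

text \<open>Given by its values, so that no sum has to be formed: a word of length
  \<open>p + 1\<close> is \<open>w @ [g]\<close> for a unique \<open>w\<close> and \<open>g\<close>.
  On generators it becomes the sum over \<open>g\<close>, by \<open>contraction_gen\<close>.\<close>

definition contraction :: "nat \<Rightarrow> ('g list \<Rightarrow> 'x) \<Rightarrow> ('g list \<Rightarrow> 'x)" where
  "contraction p f = (\<lambda>v\<in>words (Suc p). coords (f (butlast v)) (last v))"

lemma contraction_hom: "contraction p \<in> mod_hom K (bar p) (bar (Suc p))"
  unfolding bar_chain_def[of G X "Suc p"]
proof (rule mod_hom_dsumI[OF R.is_cring X_module])
  fix f assume f: "f \<in> carrier (bar p)"
  let ?W = "{w \<in> words p. f w \<noteq> \<zero>\<^bsub>X\<^esub>}"
  have fW: "finite ?W" using f by (simp add: bar_chain_iff[OF X_module])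
  have fc: "f w \<in> carrier X" if "w \<in> words p" for w using f that by (simp add: bar_chain_iff[OF X_module])
  have "finite (\<Union>w\<in>?W. (\<lambda>g. w @ [g]) ` {g \<in> carrier G. coords (f w) g \<noteq> \<zero>\<^bsub>X\<^esub>})"
  proof (intro finite_UN_I fW finite_imageI)
    fix w assume "w \<in> ?W"
    then show "finite {g \<in> carrier G. coords (f w) g \<noteq> \<zero>\<^bsub>X\<^esub>}"
      using coords_closed[OF fc] by (simp add: dsum_carrier_iff[OF R.is_cring X_module])
  qed
  moreover have "{v \<in> words (Suc p). contraction p f v \<noteq> \<zero>\<^bsub>X\<^esub>} \<subseteq> (\<Union>w\<in>?W. (\<lambda>g. w @ [g]) ` {g \<in> carrier G. coords (f w) g \<noteq> \<zero>\<^bsub>X\<^esub>})"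
  proof
    fix v assume "v \<in> {v \<in> words (Suc p). contraction p f v \<noteq> \<zero>\<^bsub>X\<^esub>}"
    then have v: "v \<in> words (Suc p)" "coords (f (butlast v)) (last v) \<noteq> \<zero>\<^bsub>X\<^esub>" by (auto simp: contraction_def)
    have "coords \<zero>\<^bsub>X\<^esub> (last v) = \<zero>\<^bsub>X\<^esub>"
      using mod_hom_zero[OF X_module GX_module coords_hom] last_word[OF v(1)] by (simp add: dsum_def)
    then have "butlast v \<in> ?W" using v butlast_word by auto
    moreover have "v = butlast v @ [last v]" using v(1) by (cases v rule: rev_cases) (auto simp: bar_words_def)
    ultimately show "v \<in> (\<Union>w\<in>?W. (\<lambda>g. w @ [g]) ` {g \<in> carrier G. coords (f w) g \<noteq> \<zero>\<^bsub>X\<^esub>})"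
      using v last_word[OF v(1)] by blast
  qed
  ultimately have "finite {v \<in> words (Suc p). contraction p f v \<noteq> \<zero>\<^bsub>X\<^esub>}" by (rule finite_subset[rotated])
  then show "contraction p f \<in> carrier (dsum (words (Suc p)) (\<lambda>_. X))"
    using dsum_apply_closed[OF R.is_cring X_module coords_closed[OF fc[OF butlast_word]] last_word]
    by (simp add: dsum_carrier_iff[OF R.is_cring X_module]) (simp add: contraction_def)
next
  fix v assume v: "v \<in> words (Suc p)"
  then show "(\<lambda>f. contraction p f v) \<in> mod_hom K (bar p) X"
    using mod_hom_comp[OF mod_hom_comp[OF bar_apply_hom[OF butlast_word[OF v]] coords_hom]
        dsum_apply_hom[OF R.is_cring X_module last_word[OF v]]] by (simp add: contraction_def)
qed (rule bar_module)

lemma contraction_gen: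
  assumes w: "w \<in> words p" and x: "x \<in> carrier X"
  shows "contraction p (gen p w x) = append_chain p w (coords x)"
proof (rule bar_chain_ext[OF X_module mod_hom_closed[OF contraction_hom gen_closed[OF w x]]
      mod_hom_closed[OF append_chain_hom[OF w] coords_closed[OF x]]])
  fix v assume v: "v \<in> words (Suc p)"
  have "coords \<zero>\<^bsub>X\<^esub> (last v) = \<zero>\<^bsub>X\<^esub>"
    using mod_hom_zero[OF X_module GX_module coords_hom] last_word[OF v] by (simp add: dsum_def)
  then show "contraction p (gen p w x) v = append_chain p w (coords x) v"
    using v by (simp add: contraction_def append_chain_apply[OF w v coords_closed[OF x]] gen_apply[OF butlast_word])
qed

text \<open>Substituting \<open>a g\<close> for the summation variable undoes the action of
  \<open>a\<close>. This matches the last face of \<open>[w]x\<close>, which acts on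
  \<open>x\<close>, with the face of \<open>[w|g]\<close> that multiplies its last two
  letters.\<close>

lemma coords_act:
  assumes "a \<in> carrier G" "x \<in> carrier X" "g \<in> carrier G"
  shows "coords (\<rho> a x) (a \<otimes>\<^bsub>G\<^esub> g) = coords x g"
proof -
  have "\<rho> (inv\<^bsub>G\<^esub> (a \<otimes>\<^bsub>G\<^esub> g)) (\<rho> a x) = \<rho> (inv\<^bsub>G\<^esub> g) x"
    using assms by (simp add: act_mult[symmetric] G.inv_mult_group G.m_assoc)
  then show ?thesis using assms by (simp add: coords_def)
qed

text \<open>Of the \<open>p + 3\<close> faces of \<open>[w|g] e(g\<^sup>-\<^sup>1 x)\<close>, summed
  over \<open>g\<close>, the first \<open>p + 2\<close> give the contraction of the faces of
  \<open>[w]x\<close>. The last one gives \<open>[w]x\<close> itself by the trace condition, with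
  positive sign exactly for even \<open>p\<close>.\<close>

lemma bd_contraction_gen:
  assumes w: "w \<in> words (Suc p)" and x: "x \<in> carrier X"
  shows "bd (Suc (Suc p)) (contraction (Suc p) (gen (Suc p) w x))
    = contraction p (bd (Suc p) (gen (Suc p) w x)) \<oplus>\<^bsub>bar (Suc p)\<^esub>
      (if even p then gen (Suc p) w x else \<ominus>\<^bsub>bar (Suc p)\<^esub> gen (Suc p) w x)"
proof -
  define wb where "wb = butlast w"
  define a where "a = w ! p"
  have lw: "length w = Suc p" using w by (simp add: bar_words_iff)
  have wb: "wb \<in> words p" and a: "a \<in> carrier G" using w butlast_word by (auto simp: wb_def a_def bar_words_iff)
  \<comment> \<open>The \<open>i\<close>-th face of the sum of \<open>[w|g] t(g)\<close> for an
    arbitrary family \<open>t\<close>. It is linear in \<open>t\<close>, so the boundary formula can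
    be checked on families with a single nonzero member before \<open>t = coords x\<close> is
    inserted.\<close>
  define \<Phi> where "\<Phi> i t = (if i \<le> p then append_chain p (face_word G (Suc p) i w) t
      else if i = Suc p then dsum_lift (carrier G) (\<lambda>_. X) (bar (Suc p)) (\<lambda>g. gen (Suc p) (wb @ [a \<otimes>\<^bsub>G\<^esub> g])) t
      else gen (Suc p) w (dsum_lift (carrier G) (\<lambda>_. X) X \<rho> t))" for i t
  have \<Phi>_hom: "\<Phi> i \<in> mod_hom K GX (bar (Suc p))" for i
  proof -
    consider "i \<le> p" | "i = Suc p" | "Suc p < i" by linarith
    then show ?thesis
    proof cases
      case 1 then show ?thesis using append_chain_hom[OF face_word_closed[OF w]] by (simp add: \<Phi>_def[abs_def])
    next
      case 2 then show ?thesis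
        using dsum_lift_hom[OF R.is_cring X_module bar_module gen_hom[OF append_word[OF wb G.m_closed[OF a]]]]
        by (simp add: \<Phi>_def[abs_def])
    next
      case 3 then show ?thesis
        using mod_hom_comp[OF dsum_lift_hom[OF R.is_cring X_module X_module act_hom] gen_hom[OF w]]
        by (simp add: \<Phi>_def[abs_def])
    qed
  qed
  have "bd (Suc (Suc p)) (append_chain (Suc p) w t) = alt_sum (bar (Suc p)) (Suc (Suc p)) (\<lambda>i. \<Phi> i t)"
    if t: "t \<in> carrier GX" for t
  proof (rule GX_hom_eq[OF bar_module mod_hom_comp[OF append_chain_hom[OF w] bd_hom]
        mod_hom_alt_sum_fun[OF GX_module bar_module \<Phi>_hom] _ t])
    fix g y assume g: "g \<in> carrier G" and y: "y \<in> carrier X"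
    have "face_gen (Suc p) i (w @ [g]) y = \<Phi> i (dsum_inj (carrier G) (\<lambda>_. X) g y)" if i: "i \<le> Suc (Suc p)" for i
    proof -
      consider "i \<le> p" | "i = Suc p" | "i = Suc (Suc p)" using i by linarith
      then show ?thesis
      proof cases
        case 1
        then have "face_word G (Suc (Suc p)) i (w @ [g]) = face_word G (Suc p) i w @ [g]"
          using lw by (intro nth_equalityI) (auto simp: face_word_def nth_append less_Suc_eq)
        then show ?thesis using 1 append_chain_inj[OF face_word_closed[OF w] g y] by (simp add: \<Phi>_def face_gen_def)
      next
        case 2
        have "face_word G (Suc (Suc p)) i (w @ [g]) = wb @ [a \<otimes>\<^bsub>G\<^esub> g]"
          using lw 2 by (intro nth_equalityI) (auto simp: face_word_def nth_append less_Suc_eq wb_def a_def nth_butlast)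
        then show ?thesis
          using 2 dsum_lift_inj[OF R.is_cring X_module bar_module gen_hom[OF append_word[OF wb G.m_closed[OF a]]] g y]
          by (simp add: \<Phi>_def face_gen_def)
      next
        case 3
        have "face_word G (Suc (Suc p)) i (w @ [g]) = w"
          using lw 3 by (intro nth_equalityI) (auto simp: face_word_def nth_append less_Suc_eq)
        then show ?thesis
          using 3 lw dsum_lift_inj[OF R.is_cring X_module X_module act_hom g y] by (simp add: \<Phi>_def face_gen_def nth_append)
      qed
    qed
    then have "alt_sum (bar (Suc p)) (Suc (Suc p)) (\<lambda>i. face_gen (Suc p) i (w @ [g]) y)
      = alt_sum (bar (Suc p)) (Suc (Suc p)) (\<lambda>i. \<Phi> i (dsum_inj (carrier G) (\<lambda>_. X) g y))"
      using mod_hom_closed[OF \<Phi>_hom dsum_inj_closed[OF R.is_cring X_module g y]]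
      by (intro alt_sum_cong[OF bar_module])
    then show "bd (Suc (Suc p)) (append_chain (Suc p) w (dsum_inj (carrier G) (\<lambda>_. X) g y))
      = alt_sum (bar (Suc p)) (Suc (Suc p)) (\<lambda>i. \<Phi> i (dsum_inj (carrier G) (\<lambda>_. X) g y))"
      by (simp only: append_chain_inj[OF w g y] bd_gen[OF append_word[OF w g] y])
  qed
  from this[OF coords_closed[OF x]]
  have "bd (Suc (Suc p)) (contraction (Suc p) (gen (Suc p) w x))
    = alt_sum (bar (Suc p)) (Suc (Suc p)) (\<lambda>i. \<Phi> i (coords x))"
    by (simp add: contraction_gen[OF w x])
  also have "\<dots> = alt_sum (bar (Suc p)) (Suc p) (\<lambda>i. \<Phi> i (coords x)) \<oplus>\<^bsub>bar (Suc p)\<^esub>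
    (if even (Suc (Suc p)) then \<Phi> (Suc (Suc p)) (coords x) else \<ominus>\<^bsub>bar (Suc p)\<^esub> \<Phi> (Suc (Suc p)) (coords x))"
    by (rule alt_sum_Suc[OF bar_module mod_hom_closed[OF \<Phi>_hom coords_closed[OF x]]])
  also have "\<Phi> (Suc (Suc p)) (coords x) = gen (Suc p) w x"
    using e_trace[OF x] by (simp add: \<Phi>_def)
  also have "alt_sum (bar (Suc p)) (Suc p) (\<lambda>i. \<Phi> i (coords x)) = contraction p (bd (Suc p) (gen (Suc p) w x))"
  proof -
    have "contraction p (bd (Suc p) (gen (Suc p) w x)) = alt_sum (bar (Suc p)) (Suc p) (\<lambda>i. contraction p (face_gen p i w x))"
      unfolding bd_gen[OF w x] using mod_hom_closed[OF face_gen_hom[OF w] x]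
      by (intro mod_hom_alt_sum[OF bar_module bar_module contraction_hom])
    also have "\<dots> = alt_sum (bar (Suc p)) (Suc p) (\<lambda>i. \<Phi> i (coords x))"
    proof (rule alt_sum_cong[OF bar_module])
      fix i assume i: "i \<le> Suc p"
      show "contraction p (face_gen p i w x) = \<Phi> i (coords x)"
      proof (cases "i = Suc p")
        case False
        then show ?thesis
          using i by (simp add: face_gen_def \<Phi>_def contraction_gen[OF face_word_closed[OF w] x])
      next
        case True
        have fw: "face_word G (Suc p) i w = wb"
          using lw True by (intro nth_equalityI) (auto simp: face_word_def wb_def nth_butlast)
        \<comment> \<open>For the multiplying face a word that extends \<open>wb\<close> by one
          letter is hit by exactly one \<open>g\<close>, namely the inverse of \<open>a\<close>
          times that letter.\<close>
        have S2: "dsum_lift (carrier G) (\<lambda>_. X) (bar (Suc p)) (\<lambda>g. gen (Suc p) (wb @ [a \<otimes>\<^bsub>G\<^esub> g])) t v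
          = (if butlast v = wb then t (inv\<^bsub>G\<^esub> a \<otimes>\<^bsub>G\<^esub> last v) else \<zero>\<^bsub>X\<^esub>)"
          if v: "v \<in> words (Suc p)" and t: "t \<in> carrier GX" for v t
        proof (rule GX_hom_eq[OF X_module mod_hom_comp[OF dsum_lift_hom[OF R.is_cring X_module bar_module gen_hom[OF append_word[OF wb G.m_closed[OF a]]]] bar_apply_hom[OF v]] _ _ t])
          have ac: "inv\<^bsub>G\<^esub> a \<otimes>\<^bsub>G\<^esub> last v \<in> carrier G" using a last_word[OF v] by simp
          show "(\<lambda>t. if butlast v = wb then t (inv\<^bsub>G\<^esub> a \<otimes>\<^bsub>G\<^esub> last v) else \<zero>\<^bsub>X\<^esub>) \<in> mod_hom K GX X"
            using dsum_apply_hom[OF R.is_cring X_module ac] mod_hom_const_zero[OF GX_module X_module]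
            by (cases "butlast v = wb") simp_all
          fix g y assume g: "g \<in> carrier G" "y \<in> carrier X"
          have "v = wb @ [a \<otimes>\<^bsub>G\<^esub> g] \<longleftrightarrow> butlast v = wb \<and> last v = a \<otimes>\<^bsub>G\<^esub> g"
            using v by (auto simp: bar_words_def) (metis append_butlast_last_id list.size(3) nat.simps(3))
          moreover have "last v = a \<otimes>\<^bsub>G\<^esub> g \<longleftrightarrow> inv\<^bsub>G\<^esub> a \<otimes>\<^bsub>G\<^esub> last v = g"
            using a g(1) last_word[OF v] by (metis G.inv_solve_left)
          ultimately show "dsum_lift (carrier G) (\<lambda>_. X) (bar (Suc p)) (\<lambda>g. gen (Suc p) (wb @ [a \<otimes>\<^bsub>G\<^esub> g])) (dsum_inj (carrier G) (\<lambda>_. X) g y) v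
            = (if butlast v = wb then dsum_inj (carrier G) (\<lambda>_. X) g y (inv\<^bsub>G\<^esub> a \<otimes>\<^bsub>G\<^esub> last v) else \<zero>\<^bsub>X\<^esub>)"
            using g ac by (auto simp: dsum_lift_inj[OF R.is_cring X_module bar_module gen_hom[OF append_word[OF wb G.m_closed[OF a]]]]
                gen_apply[OF v] dsum_inj_apply[OF R.is_cring X_module])
        qed
        have ax: "\<rho> a x \<in> carrier X" by (rule act_closed[OF a x])
        have "append_chain p wb (coords (\<rho> a x)) = \<Phi> i (coords x)"
        proof (rule bar_chain_ext[OF X_module mod_hom_closed[OF append_chain_hom[OF wb] coords_closed[OF ax]]
              mod_hom_closed[OF \<Phi>_hom coords_closed[OF x]]])
          fix v assume v: "v \<in> words (Suc p)"
          have "coords (\<rho> a x) (last v) = coords x (inv\<^bsub>G\<^esub> a \<otimes>\<^bsub>G\<^esub> last v)"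
            using coords_act[OF a x, of "inv\<^bsub>G\<^esub> a \<otimes>\<^bsub>G\<^esub> last v"] a last_word[OF v] by (simp add: G.m_assoc[symmetric])
          then show "append_chain p wb (coords (\<rho> a x)) v = \<Phi> i (coords x) v"
            using True by (simp add: append_chain_apply[OF wb v coords_closed[OF ax]] \<Phi>_def S2[OF v coords_closed[OF x]])
        qed
        then show ?thesis
          using True contraction_gen[OF wb ax] by (simp add: face_gen_def fw[unfolded True] a_def)
      qed
    qed (rule mod_hom_closed[OF \<Phi>_hom coords_closed[OF x]])
    finally show ?thesis by simp
  qed
  finally show ?thesis by simp
qed

lemma bd_contraction:
  assumes f: "f \<in> carrier (bar (Suc p))"
  shows "bd (Suc (Suc p)) (contraction (Suc p) f)
    = contraction p (bd (Suc p) f) \<oplus>\<^bsub>bar (Suc p)\<^esub> (if even p then f else \<ominus>\<^bsub>bar (Suc p)\<^esub> f)"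
proof (rule bar_hom_eq[OF bar_module mod_hom_comp[OF contraction_hom bd_hom] _ bd_contraction_gen f])
  show "(\<lambda>f. contraction p (bd (Suc p) f) \<oplus>\<^bsub>bar (Suc p)\<^esub> (if even p then f else \<ominus>\<^bsub>bar (Suc p)\<^esub> f))
    \<in> mod_hom K (bar (Suc p)) (bar (Suc p))"
    using mod_hom_id mod_hom_uminus_fun[OF bar_module bar_module mod_hom_id]
    by (intro mod_hom_add_fun bar_module mod_hom_comp[OF bd_hom contraction_hom]) (cases "even p"; simp)
qed

lemma bar_exact_Suc:
  assumes f: "f \<in> carrier (bar (Suc p))" and 0: "bd (Suc p) f = \<zero>\<^bsub>bar p\<^esub>"
  shows "f \<in> bd (Suc (Suc p)) ` carrier (bar (Suc (Suc p)))"
proof -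
  interpret B: module K "bar q" for q by (rule bar_module)
  have c: "contraction (Suc p) f \<in> carrier (bar (Suc (Suc p)))" using mod_hom_closed[OF contraction_hom f] .
  have "bd (Suc (Suc p)) (contraction (Suc p) f) = (if even p then f else \<ominus>\<^bsub>bar (Suc p)\<^esub> f)"
    using f by (simp add: bd_contraction 0 mod_hom_zero[OF bar_module bar_module contraction_hom])
  moreover have "bd (Suc (Suc p)) (\<ominus>\<^bsub>bar (Suc (Suc p))\<^esub> contraction (Suc p) f) = \<ominus>\<^bsub>bar (Suc p)\<^esub> bd (Suc (Suc p)) (contraction (Suc p) f)"
    by (rule mod_hom_uminus[OF bar_module bar_module bd_hom c])
  ultimately show ?thesis using c f
    by (cases "even p") (auto intro: rev_image_eqI[of "contraction (Suc p) f"] rev_image_eqI[of "\<ominus>\<^bsub>bar (Suc (Suc p))\<^esub> contraction (Suc p) f"])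
qed

lemma words_0: "words 0 = {[]}"
  by (auto simp: bar_words_def)

lemma bar_0_gen: "f \<in> carrier (bar 0) \<Longrightarrow> f = gen 0 [] (f [])"
  by (rule extensionalityI[of _ "words 0"]) (auto simp: bar_chain_iff[OF X_module] bar_gen_def dsum_inj_def words_0)

lemma bd_gen_0:
  assumes "g \<in> carrier G" "x \<in> carrier X"
  shows "bd (Suc 0) (gen (Suc 0) [g] x) = gen 0 [] x \<ominus>\<^bsub>bar 0\<^esub> gen 0 [] (\<rho> g x)"
proof -
  have w: "[g] \<in> words (Suc 0)" using assms by (simp add: bar_words_def)
  have "[] \<in> words 0" by (simp add: words_0)
  note c = gen_closed[OF this assms(2)] gen_closed[OF this act_closed[OF assms]]
  interpret B: module K "bar 0" by (rule bar_module)
  show ?thesis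
    using mod_hom_closed[OF face_gen_hom[OF w] assms(2)] c
    by (simp add: bd_gen[OF w assms(2)] alt_sum_Suc[OF bar_module] a_minus_def face_gen_def face_word_def)
       (simp add: alt_sum_def)
qed

text \<open>The boundary of the sum of \<open>[g] e(g\<^sup>-\<^sup>1 x)\<close> is
  \<open>orbit_sum x\<close> minus the trace sum, which is \<open>x\<close>. If the orbit sum
  vanishes, \<open>x\<close> is therefore a boundary.\<close>

lemma bar_exact_zero:
  assumes f: "f \<in> carrier (bar 0)" and 0: "orbit_sum (f []) = \<zero>\<^bsub>X\<^esub>"
  shows "f \<in> bd (Suc 0) ` carrier (bar (Suc 0))"
proof -
  interpret B: module K "bar q" for q by (rule bar_module)
  have nil: "[] \<in> words 0" by (simp add: words_0)
  have x: "f [] \<in> carrier X" using f nil by (simp add: bar_chain_iff[OF X_module])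
  have "bd (Suc 0) (append_chain 0 [] t) = gen 0 [] (dsum_lift (carrier G) (\<lambda>_. X) X (\<lambda>g y. y) t)
    \<ominus>\<^bsub>bar 0\<^esub> gen 0 [] (dsum_lift (carrier G) (\<lambda>_. X) X \<rho> t)" if t: "t \<in> carrier GX" for t
  proof (rule GX_hom_eq[OF bar_module mod_hom_comp[OF append_chain_hom[OF nil] bd_hom] _ _ t])
    show "(\<lambda>t. gen 0 [] (dsum_lift (carrier G) (\<lambda>_. X) X (\<lambda>g y. y) t) \<ominus>\<^bsub>bar 0\<^esub> gen 0 [] (dsum_lift (carrier G) (\<lambda>_. X) X \<rho> t))
      \<in> mod_hom K GX (bar 0)"
      unfolding a_minus_def
      by (intro mod_hom_add_fun mod_hom_uminus_fun GX_module bar_module mod_hom_comp[OF _ gen_hom[OF nil]]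
          dsum_lift_hom[OF R.is_cring X_module X_module] mod_hom_id act_hom)
    fix g y assume "g \<in> carrier G" "y \<in> carrier X"
    then show "bd (Suc 0) (append_chain 0 [] (dsum_inj (carrier G) (\<lambda>_. X) g y))
      = gen 0 [] (dsum_lift (carrier G) (\<lambda>_. X) X (\<lambda>g y. y) (dsum_inj (carrier G) (\<lambda>_. X) g y))
        \<ominus>\<^bsub>bar 0\<^esub> gen 0 [] (dsum_lift (carrier G) (\<lambda>_. X) X \<rho> (dsum_inj (carrier G) (\<lambda>_. X) g y))"
      by (simp add: append_chain_inj[OF nil] bd_gen_0 dsum_lift_inj[OF R.is_cring X_module X_module mod_hom_id]
          dsum_lift_inj[OF R.is_cring X_module X_module act_hom])
  qed
  from this[OF coords_closed[OF x]]
  have eq: "bd (Suc 0) (append_chain 0 [] (coords (f []))) = \<ominus>\<^bsub>bar 0\<^esub> f"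
    using 0 e_trace[OF x] f bar_0_gen[OF f] mod_hom_zero[OF X_module bar_module gen_hom[OF nil]]
    by (simp add: orbit_sum_def a_minus_def)
  have c: "append_chain 0 [] (coords (f [])) \<in> carrier (bar (Suc 0))"
    by (rule mod_hom_closed[OF append_chain_hom[OF nil] coords_closed[OF x]])
  show ?thesis
    using eq c f by (intro image_eqI[of _ _ "\<ominus>\<^bsub>bar (Suc 0)\<^esub> append_chain 0 [] (coords (f []))"])
      (simp_all add: mod_hom_uminus[OF bar_module bar_module bd_hom])
qed

end

section \<open>Complexes with a group action\<close>

lemma uminus_eq_zero_iff:
  assumes "module K M" "x \<in> carrier M"
  shows "\<ominus>\<^bsub>M\<^esub> x = \<zero>\<^bsub>M\<^esub> \<longleftrightarrow> x = \<zero>\<^bsub>M\<^esub>"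
proof -
  interpret M: module K M by fact
  have "\<ominus>\<^bsub>M\<^esub> \<zero>\<^bsub>M\<^esub> = \<zero>\<^bsub>M\<^esub>" by (rule M.M.minus_equality) simp_all
  then show ?thesis using M.M.minus_minus[OF assms(2)] by metis
qed

lemma bar_chain_submodule:
  assumes "module K X" "submodule Z K X"
  shows "bar_chain G (X\<lparr>carrier := Z\<rparr>) p
    = (bar_chain G X p)\<lparr>carrier := {f \<in> carrier (bar_chain G X p). \<forall>w\<in>bar_words G p. f w \<in> Z}\<rparr>"
  using submodule_subset[OF assms(2)] unfolding bar_chain_def dsum_def by (auto simp: PiE_iff)

lemma kg_submodule:
  assumes "kg_module G K X \<rho>" and Z: "submodule Z K X" and \<rho>: "\<And>g x. \<lbrakk>g \<in> carrier G; x \<in> Z\<rbrakk> \<Longrightarrow> \<rho> g x \<in> Z"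
  shows "kg_module G K (X\<lparr>carrier := Z\<rparr>) \<rho>"
proof -
  interpret kg_module G K X \<rho> by fact
  have Zc: "\<And>x. x \<in> Z \<Longrightarrow> x \<in> carrier X" using submodule_subset[OF Z] by auto
  show ?thesis
  proof (intro kg_module.intro kg_module_axioms.intro G.is_group submodule_module[OF X_module Z])
    fix g assume "g \<in> carrier G"
    then show "\<rho> g \<in> mod_hom K (X\<lparr>carrier := Z\<rparr>) (X\<lparr>carrier := Z\<rparr>)"
      using \<rho> by (intro mod_hom_restrict_cod mod_hom_restrict_dom act_hom Z) auto
  qed (auto simp: act_mult act_one Zc)
qed

text \<open>Naturality for the inclusion. An argument is required since the boundary over the
  submodule is formed in another record, with its own sums and negatives.\<close>

lemma bar_boundary_submodule:
  assumes kg: "kg_module G K X \<rho>" and Z: "submodule Z K X" and \<rho>: "\<And>g x. \<lbrakk>g \<in> carrier G; x \<in> Z\<rbrakk> \<Longrightarrow> \<rho> g x \<in> Z"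
    and f: "f \<in> carrier (bar_chain G (X\<lparr>carrier := Z\<rparr>) (Suc p))"
  shows "bar_boundary G (X\<lparr>carrier := Z\<rparr>) \<rho> (Suc p) f = bar_boundary G X \<rho> (Suc p) f"
proof -
  interpret X: kg_module G K X \<rho> by fact
  interpret Z: kg_module G K "X\<lparr>carrier := Z\<rparr>" \<rho> by (rule kg_submodule[OF kg Z \<rho>])
  have f': "f \<in> carrier (bar_chain G X (Suc p))"
    using f unfolding bar_chain_submodule[OF X.X_module Z] by simp
  have "bar_map G p (\<lambda>x. x) (Z.bd (Suc p) f) = X.bd (Suc p) (bar_map G (Suc p) (\<lambda>x. x) f)"
    by (rule bar_map_bd[OF Z.kg_module_axioms kg submodule_inclusion[OF Z] refl f])
  then show ?thesis
    by (simp only: bar_map_id[OF X.X_module f'] bar_map_id[OF Z.X_module mod_hom_closed[OF Z.bd_hom f]])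
qed

section \<open>Equivariant complexes, and their homology as \<open>KG\<close>-modules\<close>

locale kg_complex =
  fixes G :: "('g, 'y) monoid_scheme" and K :: "('k, 'z) ring_scheme"
    and X :: "nat \<Rightarrow> ('k, 'x) module" and bdX :: "nat \<Rightarrow> 'x \<Rightarrow> 'x" and \<rho> :: "nat \<Rightarrow> 'g \<Rightarrow> 'x \<Rightarrow> 'x"
  assumes kg: "kg_module G K (X q) (\<rho> q)"
    and bdX_hom: "bdX (Suc q) \<in> mod_hom K (X (Suc q)) (X q)"
    and bdX_bdX: "x \<in> carrier (X (Suc (Suc q))) \<Longrightarrow> bdX (Suc q) (bdX (Suc (Suc q)) x) = \<zero>\<^bsub>X q\<^esub>"
    and bdX_act: "\<lbrakk>g \<in> carrier G; x \<in> carrier (X (Suc q))\<rbrakk> \<Longrightarrow> bdX (Suc q) (\<rho> (Suc q) g x) = \<rho> q g (bdX (Suc q) x)"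
begin

sublocale X: kg_module G K "X q" "\<rho> q" for q by (rule kg)

abbreviation "Z \<equiv> cycles X bdX"
abbreviation "B \<equiv> boundaries X bdX"
abbreviation "H \<equiv> homology X bdX"
abbreviation "actH q g \<equiv> homology_map X bdX q (\<rho> q g)"

lemma Z_eq: "Z q = {x \<in> carrier (X q). q = 0 \<or> bdX q x = \<zero>\<^bsub>X (q - 1)\<^esub>}"
  by (auto simp: cycles_def a_kernel_def')

lemma Z_submodule: "submodule (Z q) K (X q)"
  using submodule_kernel[OF X.X_module X.X_module bdX_hom] submodule_carrier[OF X.X_module]
  unfolding Z_eq by (cases q) auto

lemma B_submodule: "submodule (B q) K (X q)"
  unfolding boundaries_def by (rule submodule_image[OF X.X_module X.X_module bdX_hom submodule_carrier[OF X.X_module]])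

lemma B_subset: "B q \<subseteq> Z q"
  unfolding Z_eq boundaries_def using mod_hom_closed[OF bdX_hom] bdX_bdX by (cases q) auto

lemmas H_facts = X.X_module Z_submodule B_submodule B_subset

lemma H_module: "module K (H q)"
  unfolding homology_def by (rule subquot_module[OF H_facts])

lemma H_proj: "(\<lambda>x. B q +>\<^bsub>X q\<^esub> x) \<in> mod_hom K ((X q)\<lparr>carrier := Z q\<rparr>) (H q)"
  unfolding homology_def by (rule subquot_proj[OF H_facts])

lemma H_carrier: "carrier (H q) = (\<lambda>x. B q +>\<^bsub>X q\<^esub> x) ` Z q"
  unfolding homology_def by (rule subquot_carrier[OF H_facts])

lemma H_zero_iff: "x \<in> Z q \<Longrightarrow> B q +>\<^bsub>X q\<^esub> x = \<zero>\<^bsub>H q\<^esub> \<longleftrightarrow> x \<in> B q"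
  using subquot_eq_zero_iff[OF H_facts] unfolding homology_def subquot_zero[OF H_facts] .

lemma act_Z:
  assumes g: "g \<in> carrier G" and x: "x \<in> Z q" shows "\<rho> q g x \<in> Z q"
proof (cases q)
  case 0 then show ?thesis using x X.act_closed[OF g] by (simp add: Z_eq)
next
  case (Suc q')
  then show ?thesis
    using x X.act_closed[OF g] mod_hom_zero[OF X.X_module X.X_module X.act_hom[OF g]]
    by (simp add: Z_eq bdX_act[OF g])
qed

lemma act_B: "\<lbrakk>g \<in> carrier G; x \<in> B q\<rbrakk> \<Longrightarrow> \<rho> q g x \<in> B q"
  unfolding boundaries_def using X.act_closed by (auto simp: bdX_act[symmetric])

lemma H_act_proj: "g \<in> carrier G \<Longrightarrow> (\<lambda>x. B q +>\<^bsub>X q\<^esub> \<rho> q g x) \<in> mod_hom K ((X q)\<lparr>carrier := Z q\<rparr>) (H q)"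
  using act_Z by (intro mod_hom_comp[OF _ H_proj] mod_hom_restrict_cod mod_hom_restrict_dom X.act_hom Z_submodule) auto

lemma H_act_B: "\<lbrakk>g \<in> carrier G; x \<in> B q\<rbrakk> \<Longrightarrow> B q +>\<^bsub>X q\<^esub> \<rho> q g x = \<zero>\<^bsub>H q\<^esub>"
  using H_zero_iff[of "\<rho> q g x" q] act_B B_subset by blast

lemma
  assumes g: "g \<in> carrier G"
  shows actH_hom: "actH q g \<in> mod_hom K (H q) (H q)"
    and actH_coset: "x \<in> Z q \<Longrightarrow> actH q g (B q +>\<^bsub>X q\<^esub> x) = B q +>\<^bsub>X q\<^esub> \<rho> q g x"
proof -
  have "quot_lift (\<lambda>x. B q +>\<^bsub>X q\<^esub> \<rho> q g x) \<in> mod_hom K (quot_mod ((X q)\<lparr>carrier := Z q\<rparr>) (B q)) (H q)"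
    by (rule subquot_lift(1)[OF H_facts H_module H_act_proj[OF g] H_act_B[OF g]])
  then show "actH q g \<in> mod_hom K (H q) (H q)"
    unfolding homology_map_def homology_def[of X bdX q, symmetric] .
  show "x \<in> Z q \<Longrightarrow> actH q g (B q +>\<^bsub>X q\<^esub> x) = B q +>\<^bsub>X q\<^esub> \<rho> q g x"
    unfolding homology_map_def by (rule subquot_lift(2)[OF H_facts H_module H_act_proj[OF g] H_act_B[OF g]])
qed

lemma kg_H: "kg_module G K (H q) (actH q)"
proof (intro kg_module.intro kg_module_axioms.intro X.G.is_group H_module actH_hom)
  fix g h x assume gh: "g \<in> carrier G" "h \<in> carrier G" and "x \<in> carrier (H q)"
  then obtain z where z: "z \<in> Z q" "x = B q +>\<^bsub>X q\<^esub> z" by (auto simp: H_carrier)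
  then have "z \<in> carrier (X q)" using submodule_subset[OF Z_submodule] by auto
  then show "actH q (g \<otimes>\<^bsub>G\<^esub> h) x = actH q g (actH q h x)"
    using gh z by (simp add: actH_coset act_Z X.act_mult)
next
  fix x assume "x \<in> carrier (H q)"
  then obtain z where z: "z \<in> Z q" "x = B q +>\<^bsub>X q\<^esub> z" by (auto simp: H_carrier)
  then have "z \<in> carrier (X q)" using submodule_subset[OF Z_submodule] by auto
  then show "actH q \<one>\<^bsub>G\<^esub> x = x" using z by (simp add: actH_coset X.act_one)
qed

sublocale H: kg_module G K "H q" "actH q" for q by (rule kg_H)

section \<open>The double complex of bar complexes\<close>

definition bc :: "nat \<Rightarrow> nat \<Rightarrow> ('k, 'g list \<Rightarrow> 'x) module" where
  "bc p q = bar_chain G (X q) p"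

definition bc_h :: "nat \<Rightarrow> nat \<Rightarrow> ('g list \<Rightarrow> 'x) \<Rightarrow> ('g list \<Rightarrow> 'x)" where
  "bc_h p q = bar_boundary G (X q) (\<rho> q) p"

text \<open>Entrywise maps commute with the bar boundary; the sign in odd columns turns this into
  the anticommuting squares of a double complex.\<close>

definition bc_v :: "nat \<Rightarrow> nat \<Rightarrow> ('g list \<Rightarrow> 'x) \<Rightarrow> ('g list \<Rightarrow> 'x)" where
  "bc_v p q f = (if even p then bar_map G p (bdX q) f else \<ominus>\<^bsub>bc p (q - 1)\<^esub> bar_map G p (bdX q) f)"

lemma bc_module: "module K (bc p q)"
  unfolding bc_def by (rule X.bar_module)

sublocale bc: module K "bc p q" for p q by (rule bc_module)

lemma bc_map_hom: "bar_map G p (bdX (Suc q)) \<in> mod_hom K (bc p (Suc q)) (bc p q)"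
  unfolding bc_def by (rule bar_map_hom[OF X.X_module X.X_module bdX_hom])

lemma bc_ext:
  "\<lbrakk>f \<in> carrier (bc p q); g \<in> carrier (bc p q); \<And>w. w \<in> bar_words G p \<Longrightarrow> f w = g w\<rbrakk> \<Longrightarrow> f = g"
  unfolding bc_def by (rule bar_chain_ext[OF X.X_module])

lemma bc_zero: "w \<in> bar_words G p \<Longrightarrow> \<zero>\<^bsub>bc p q\<^esub> w = \<zero>\<^bsub>X q\<^esub>"
  by (simp add: bc_def bar_chain_def dsum_def)

lemma bc_iff: "f \<in> carrier (bc p q) \<longleftrightarrow> f \<in> extensional (bar_words G p) \<and>
    (\<forall>w\<in>bar_words G p. f w \<in> carrier (X q)) \<and> finite {w \<in> bar_words G p. f w \<noteq> \<zero>\<^bsub>X q\<^esub>}"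
  unfolding bc_def by (rule bar_chain_iff[OF X.X_module])

lemma bc_map_map:
  assumes f: "f \<in> carrier (bc p (Suc (Suc q)))"
  shows "bar_map G p (bdX (Suc q)) (bar_map G p (bdX (Suc (Suc q))) f) = \<zero>\<^bsub>bc p q\<^esub>"
proof (rule bc_ext)
  show "bar_map G p (bdX (Suc q)) (bar_map G p (bdX (Suc (Suc q))) f) \<in> carrier (bc p q)"
    by (rule mod_hom_closed[OF bc_map_hom mod_hom_closed[OF bc_map_hom f]])
  fix w assume "w \<in> bar_words G p"
  then show "bar_map G p (bdX (Suc q)) (bar_map G p (bdX (Suc (Suc q))) f) w = \<zero>\<^bsub>bc p q\<^esub> w"
    using f bdX_bdX by (simp add: bar_map_apply bc_zero bc_iff)
qed (rule bc.M.zero_closed)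

lemma bc_map_h:
  assumes "f \<in> carrier (bc (Suc p) (Suc q))"
  shows "bar_map G p (bdX (Suc q)) (bc_h (Suc p) (Suc q) f) = bc_h (Suc p) q (bar_map G (Suc p) (bdX (Suc q)) f)"
  unfolding bc_h_def
proof (rule bar_map_bd)
  show "f \<in> carrier (bar_chain G (X (Suc q)) (Suc p))" using assms by (simp add: bc_def)
qed (rule kg bdX_hom | simp add: bdX_act)+

lemma bc_v_hom: "bc_v p (Suc q) \<in> mod_hom K (bc p (Suc q)) (bc p q)"
  using bc_map_hom mod_hom_uminus_fun[OF bc_module bc_module bc_map_hom]
  by (cases "even p") (simp_all add: bc_v_def[abs_def])

lemma bc_h_hom: "bc_h (Suc p) q \<in> mod_hom K (bc (Suc p) q) (bc p q)"
  unfolding bc_def bc_h_def by (rule X.bd_hom)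

sublocale bc: double_complex K bc bc_h bc_v
proof (rule double_complex.intro)
  fix p q f
  show "bc_h (Suc p) q (bc_h (Suc (Suc p)) q f) = \<zero>\<^bsub>bc p q\<^esub>" if "f \<in> carrier (bc (Suc (Suc p)) q)"
    using that unfolding bc_h_def bc_def by (rule X.bd_bd)
  show "bc_v p (Suc q) (bc_v p (Suc (Suc q)) f) = \<zero>\<^bsub>bc p q\<^esub>" if f: "f \<in> carrier (bc p (Suc (Suc q)))"
    using bc_map_map[OF f] mod_hom_closed[OF bc_map_hom f] mod_hom_closed[OF bc_map_hom mod_hom_closed[OF bc_map_hom f]]
    by (simp add: bc_v_def mod_hom_uminus[OF bc_module bc_module bc_map_hom])
  show "bc_h (Suc p) q (bc_v (Suc p) (Suc q) f) \<oplus>\<^bsub>bc p q\<^esub> bc_v p (Suc q) (bc_h (Suc p) (Suc q) f) = \<zero>\<^bsub>bc p q\<^esub>"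
    if f: "f \<in> carrier (bc (Suc p) (Suc q))"
    using mod_hom_closed[OF bc_map_hom f] mod_hom_closed[OF bc_h_hom mod_hom_closed[OF bc_map_hom f]]
    by (simp add: bc_v_def bc_map_h[OF f] mod_hom_uminus[OF bc_module bc_module bc_h_hom] bc.M.l_neg bc.M.r_neg)
qed (rule bc_module bc_h_hom bc_v_hom)+

lemma bc_v_zero_iff:
  assumes f: "f \<in> carrier (bc p (Suc q))"
  shows "bc_v p (Suc q) f = \<zero>\<^bsub>bc p q\<^esub> \<longleftrightarrow> (\<forall>w\<in>bar_words G p. bdX (Suc q) (f w) = \<zero>\<^bsub>X q\<^esub>)"
proof -
  have c: "bar_map G p (bdX (Suc q)) f \<in> carrier (bc p q)" by (rule mod_hom_closed[OF bc_map_hom f])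
  have "bc_v p (Suc q) f = \<zero>\<^bsub>bc p q\<^esub> \<longleftrightarrow> bar_map G p (bdX (Suc q)) f = \<zero>\<^bsub>bc p q\<^esub>"
  proof (cases "even p")
    case False
    then show ?thesis by (simp add: bc_v_def uminus_eq_zero_iff[OF bc_module c])
  qed (simp add: bc_v_def)
  also have "\<dots> \<longleftrightarrow> (\<forall>w\<in>bar_words G p. bar_map G p (bdX (Suc q)) f w = \<zero>\<^bsub>bc p q\<^esub> w)"
    using bc_ext[OF c bc.M.zero_closed] by auto
  finally show ?thesis by (simp add: bar_map_apply bc_zero)
qed

text \<open>The sign does not affect kernels, and an entrywise map kills a bar chain iff it kills
  each of its values.\<close>

lemma bc_cycles: "cycles (bc p) (bc_v p) q = {f \<in> carrier (bc p q). \<forall>w\<in>bar_words G p. f w \<in> Z q}"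
proof (cases q)
  case 0 then show ?thesis by (auto simp: cycles_def bc_iff)
next
  case (Suc q')
  then show ?thesis
    using bc_v_zero_iff[of _ p q'] unfolding bc.vcycles Z_eq by (auto simp: bc_iff)
qed

text \<open>Values in \<open>B q\<close> lift to a bar chain by \<open>bar_map_lift\<close>; in odd
  columns the lift is negated to absorb the sign.\<close>

lemma bc_boundaries: "boundaries (bc p) (bc_v p) q = {f \<in> carrier (bc p q). \<forall>w\<in>bar_words G p. f w \<in> B q}"
proof (intro equalityI subsetI)
  fix f assume "f \<in> boundaries (bc p) (bc_v p) q"
  then obtain g where g: "g \<in> carrier (bc p (Suc q))" "f = bc_v p (Suc q) g" by (auto simp: boundaries_def)
  have m: "bar_map G p (bdX (Suc q)) g w \<in> B q" if "w \<in> bar_words G p" for w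
    using g that by (auto simp: bar_map_apply boundaries_def bc_iff)
  have "f w \<in> B q" if w: "w \<in> bar_words G p" for w
  proof (cases "even p")
    case True then show ?thesis using m[OF w] g by (simp add: bc_v_def)
  next
    case False
    have "f w = \<ominus>\<^bsub>X q\<^esub> bar_map G p (bdX (Suc q)) g w"
      using False g mod_hom_uminus[OF bc_module X.X_module _ mod_hom_closed[OF bc_map_hom g(1)]]
        X.bar_apply_hom[OF w, of q]
      by (simp add: bc_v_def bc_def)
    then show ?thesis using submodule_uminus[OF B_submodule m[OF w]] by simp
  qed
  then show "f \<in> {f \<in> carrier (bc p q). \<forall>w\<in>bar_words G p. f w \<in> B q}"
    using g mod_hom_closed[OF bc_v_hom] by blast
next
  fix f assume f: "f \<in> {f \<in> carrier (bc p q). \<forall>w\<in>bar_words G p. f w \<in> B q}"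
  then have f': "f \<in> carrier (bar_chain G (X q) p)"
    "\<And>w. w \<in> bar_words G p \<Longrightarrow> f w \<in> bdX (Suc q) ` carrier (X (Suc q))"
    unfolding bc_def boundaries_def by auto
  obtain g where g: "g \<in> carrier (bc p (Suc q))" "bar_map G p (bdX (Suc q)) g = f"
    by (rule bar_map_lift[OF X.X_module X.X_module bdX_hom submodule_carrier[OF X.X_module] f', folded bc_def])
  have "bc_v p (Suc q) (if even p then g else \<ominus>\<^bsub>bc p (Suc q)\<^esub> g) = f"
    using g f by (simp add: bc_v_def mod_hom_uminus[OF bc_module bc_module bc_map_hom])
  then show "f \<in> boundaries (bc p) (bc_v p) q"
    using g(1) unfolding boundaries_def
    by (intro image_eqI[of f _ "if even p then g else \<ominus>\<^bsub>bc p (Suc q)\<^esub> g"]) simp_all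
qed

text \<open>Bar chains over \<open>H q\<close> serve as the model of vertical homology in
  \<open>second_page\<close>: kernels, images and quotients are formed word by word, and the induced
  horizontal map is the bar boundary by naturality of passing to classes.\<close>

lemma second_page_bc:
  "mod_isomorphic K (bc.Tot.page 2 (int p) (int q)) (group_homology G (H q) (actH q) p)"
proof -
  let ?c = "\<lambda>p q. bar_map G p (\<lambda>x. B q +>\<^bsub>X q\<^esub> x)"
  note Zm = submodule_module[OF X.X_module Z_submodule]
  \<comment> \<open>The vertical cycles are the bar chains over the \<open>KG\<close>-module
    \<open>Z q\<close>, to which naturality along the class map from \<open>Z q\<close> to
    \<open>H q\<close> applies.\<close>
  have restr: "(bc p q)\<lparr>carrier := cycles (bc p) (bc_v p) q\<rparr> = bar_chain G ((X q)\<lparr>carrier := Z q\<rparr>) p" for p q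
    unfolding bar_chain_submodule[OF X.X_module Z_submodule] bc_cycles unfolding bc_def ..
  then have cyc_eq: "cycles (bc p) (bc_v p) q = carrier (bar_chain G ((X q)\<lparr>carrier := Z q\<rparr>) p)" for p q
    by (metis module.select_convs partial_object.select_convs(1) partial_object.update_convs(1) partial_object.surjective)
  have "mod_isomorphic K (bc.Tot.page 2 (int p) (int q))
    (homology (\<lambda>p. bar_chain G (H q) p) (\<lambda>p. bar_boundary G (H q) (actH q) p) p)"
  proof (rule bc.second_page[where c = ?c])
    fix p q
    show "module K (bar_chain G (H q) p)" by (rule H.bar_module)
    show "?c p q \<in> mod_hom K ((bc p q)\<lparr>carrier := cycles (bc p) (bc_v p) q\<rparr>) (bar_chain G (H q) p)"
      unfolding restr by (rule bar_map_hom[OF Zm H_module H_proj])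
    show "?c p q ` cycles (bc p) (bc_v p) q = carrier (bar_chain G (H q) p)"
    proof (intro equalityI subsetI)
      fix v assume v: "v \<in> carrier (bar_chain G (H q) p)"
      have "v w \<in> (\<lambda>x. B q +>\<^bsub>X q\<^esub> x) ` Z q" if "w \<in> bar_words G p" for w
        using v that unfolding bar_chain_iff[OF H_module] H_carrier by blast
      then obtain g where "g \<in> carrier (bar_chain G ((X q)\<lparr>carrier := Z q\<rparr>) p)" "?c p q g = v"
        by (rule_tac bar_map_lift[OF Zm H_module H_proj submodule_carrier[OF Zm] v]) auto
      then show "v \<in> ?c p q ` cycles (bc p) (bc_v p) q" unfolding cyc_eq by auto
    qed (use mod_hom_closed[OF bar_map_hom[OF Zm H_module H_proj]] in \<open>auto simp: cyc_eq\<close>)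
    show "bar_boundary G (H q) (actH q) (Suc p) \<in> mod_hom K (bar_chain G (H q) (Suc p)) (bar_chain G (H q) p)"
      by (rule H.bd_hom)
  next
    fix p q f assume f: "f \<in> cycles (bc p) (bc_v p) q"
    have "?c p q f = \<zero>\<^bsub>bar_chain G (H q) p\<^esub> \<longleftrightarrow> (\<forall>w\<in>bar_words G p. ?c p q f w = \<zero>\<^bsub>bar_chain G (H q) p\<^esub> w)"
    proof -
      interpret V: module K "bar_chain G (H q) p" by (rule H.bar_module)
      have "?c p q f \<in> carrier (bar_chain G (H q) p)"
        using f unfolding cyc_eq by (rule mod_hom_closed[OF bar_map_hom[OF Zm H_module H_proj]])
      from bar_chain_ext[OF H_module this V.M.zero_closed] show ?thesis by auto
    qed
    also have "\<dots> \<longleftrightarrow> (\<forall>w\<in>bar_words G p. f w \<in> B q)"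
    proof (intro ball_cong refl)
      fix w assume w: "w \<in> bar_words G p"
      then have "f w \<in> Z q" using f unfolding bc_cycles by blast
      then show "?c p q f w = \<zero>\<^bsub>bar_chain G (H q) p\<^esub> w \<longleftrightarrow> f w \<in> B q"
        using H_zero_iff[of "f w" q] w by (simp add: bar_map_apply bar_chain_def dsum_def)
    qed
    finally show "?c p q f = \<zero>\<^bsub>bar_chain G (H q) p\<^esub> \<longleftrightarrow> f \<in> boundaries (bc p) (bc_v p) q"
      using f unfolding bc_boundaries bc_cycles by simp
  next
    fix p q f assume "f \<in> cycles (bc (Suc p)) (bc_v (Suc p)) q"
    then have f: "f \<in> carrier (bar_chain G ((X q)\<lparr>carrier := Z q\<rparr>) (Suc p))" unfolding cyc_eq .
    have "?c p q (bar_boundary G ((X q)\<lparr>carrier := Z q\<rparr>) (\<rho> q) (Suc p) f) = bar_boundary G (H q) (actH q) (Suc p) (?c (Suc p) q f)"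
      using kg_submodule[OF kg Z_submodule act_Z]
      by (intro bar_map_bd[OF _ kg_H H_proj _ f]) (auto simp: actH_coset)
    moreover have "bar_boundary G ((X q)\<lparr>carrier := Z q\<rparr>) (\<rho> q) (Suc p) f = bar_boundary G (X q) (\<rho> q) (Suc p) f"
      by (rule bar_boundary_submodule[OF kg Z_submodule act_Z f])
    ultimately show "bar_boundary G (H q) (actH q) (Suc p) (?c (Suc p) q f) = ?c p q (bc_h (Suc p) q f)"
      unfolding bc_h_def by simp
  qed
  then show ?thesis by (simp add: group_homology_def)
qed

end

text \<open>\<open>Y q\<close> stands for the coinvariants of \<open>X q\<close>:
  \<open>\<epsilon>\<close> is onto and invariant. That its kernel is no larger than it should be is
  expressed by vanishing orbit sums, the form in which \<open>bar_exact_zero\<close> consumes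
  it.\<close>

locale kg_resolution = kg_complex G K X bdX \<rho>
  for G :: "('g, 'y) monoid_scheme" and K :: "('k, 'z) ring_scheme"
    and X :: "nat \<Rightarrow> ('k, 'x) module" and bdX :: "nat \<Rightarrow> 'x \<Rightarrow> 'x" and \<rho> :: "nat \<Rightarrow> 'g \<Rightarrow> 'x \<Rightarrow> 'x" +
  fixes Y :: "nat \<Rightarrow> ('k, 'b) module" and dY :: "nat \<Rightarrow> 'b \<Rightarrow> 'b" and \<epsilon> :: "nat \<Rightarrow> 'x \<Rightarrow> 'b" and e :: "nat \<Rightarrow> 'x \<Rightarrow> 'x"
  assumes projective: "relatively_projective G K (X q) (\<rho> q) (e q)"
    and Y_module: "module K (Y n)"
    and dY_hom: "dY (Suc n) \<in> mod_hom K (Y (Suc n)) (Y n)"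
    and \<epsilon>_hom: "\<epsilon> q \<in> mod_hom K (X q) (Y q)"
    and \<epsilon>_surj: "\<epsilon> q ` carrier (X q) = carrier (Y q)"
    and \<epsilon>_bdX: "x \<in> carrier (X (Suc q)) \<Longrightarrow> \<epsilon> q (bdX (Suc q) x) = dY (Suc q) (\<epsilon> (Suc q) x)"
    and \<epsilon>_act: "\<lbrakk>g \<in> carrier G; x \<in> carrier (X q)\<rbrakk> \<Longrightarrow> \<epsilon> q (\<rho> q g x) = \<epsilon> q x"
    and \<epsilon>_kernel: "\<lbrakk>x \<in> carrier (X q); \<epsilon> q x = \<zero>\<^bsub>Y q\<^esub>\<rbrakk> \<Longrightarrow>
      relatively_projective.orbit_sum G (X q) (\<rho> q) (e q) x = \<zero>\<^bsub>X q\<^esub>"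
begin

sublocale P: relatively_projective G K "X q" "\<rho> q" "e q" for q by (rule projective)

lemma \<epsilon>_bar_hom: "(\<lambda>f. \<epsilon> q (f [])) \<in> mod_hom K (bc 0 q) (Y q)"
  using mod_hom_comp[OF X.bar_apply_hom[of "[]" 0 q] \<epsilon>_hom] unfolding bc_def by (simp add: P.words_0)

sublocale bc: augmented_double_complex K bc bc_h bc_v Y dY "\<lambda>q f. \<epsilon> q (f [])"
proof (intro augmented_double_complex.intro augmented_double_complex_axioms.intro bc.double_complex_axioms Y_module dY_hom \<epsilon>_bar_hom)
  fix q
  have nil: "[] \<in> bar_words G 0" by (simp add: P.words_0)
  show "(\<lambda>f. \<epsilon> q (f [])) ` carrier (bc 0 q) = carrier (Y q)"
  proof (intro equalityI subsetI)
    fix y assume "y \<in> carrier (Y q)"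
    then obtain x where x: "x \<in> carrier (X q)" "y = \<epsilon> q x" unfolding \<epsilon>_surj[symmetric] by auto
    show "y \<in> (\<lambda>f. \<epsilon> q (f [])) ` carrier (bc 0 q)"
      using X.gen_closed[OF nil x(1)] X.gen_apply[OF nil, of q "[]" x] x(2)
      by (intro image_eqI[of _ _ "bar_gen G (X q) 0 [] x"]) (simp_all add: bc_def)
  qed (use mod_hom_closed[OF \<epsilon>_bar_hom] in auto)
  fix f
  show "\<epsilon> q (bc_v 0 (Suc q) f []) = dY (Suc q) (\<epsilon> (Suc q) (f []))" if f: "f \<in> carrier (bc 0 (Suc q))"
    using f nil by (simp add: bc_v_def bar_map_apply \<epsilon>_bdX bc_iff)
  show "\<epsilon> q (bc_h (Suc 0) q f []) = \<zero>\<^bsub>Y q\<^esub>" if f: "f \<in> carrier (bc (Suc 0) q)"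
  proof -
    interpret Y: module K "Y q" by (rule Y_module)
    show ?thesis
    proof (rule X.bar_hom_eq[OF Y_module mod_hom_comp[OF bc_h_hom \<epsilon>_bar_hom, unfolded bc_def] mod_hom_const_zero[OF X.bar_module Y_module] _ f[unfolded bc_def]])
      fix w x assume w: "w \<in> bar_words G (Suc 0)" and x: "x \<in> carrier (X q)"
      then obtain g where g: "w = [g]" "g \<in> carrier G" by (auto simp: bar_words_def length_Suc_conv)
      have gx: "\<rho> q g x \<in> carrier (X q)" by (rule X.act_closed[OF g(2) x])
      have "bc_h (Suc 0) q (bar_gen G (X q) (Suc 0) w x) [] = x \<ominus>\<^bsub>X q\<^esub> \<rho> q g x"
        using mod_hom_minus[OF X.bar_module X.X_module X.bar_apply_hom[OF nil] X.gen_closed[OF nil x] X.gen_closed[OF nil gx]]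
          X.gen_apply[OF nil]
        unfolding bc_h_def g(1) P.bd_gen_0[OF g(2) x] by simp
      then show "\<epsilon> q (bc_h (Suc 0) q (bar_gen G (X q) (Suc 0) w x) []) = \<zero>\<^bsub>Y q\<^esub>"
        using x gx g(2) mod_hom_closed[OF \<epsilon>_hom]
        by (simp add: mod_hom_minus[OF X.X_module Y_module \<epsilon>_hom] \<epsilon>_act a_minus_eq_zero_iff[OF Y_module])
    qed
  qed
  show "f \<in> bc_h (Suc 0) q ` carrier (bc (Suc 0) q)" if f: "f \<in> carrier (bc 0 q)" and 0: "\<epsilon> q (f []) = \<zero>\<^bsub>Y q\<^esub>"
  proof -
    have "P.orbit_sum q (f []) = \<zero>\<^bsub>X q\<^esub>"
      using f nil 0 by (intro \<epsilon>_kernel) (auto simp: bc_iff)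
    then show ?thesis using P.bar_exact_zero f unfolding bc_h_def bc_def by blast
  qed
  show "f \<in> bc_h (Suc (Suc p)) q ` carrier (bc (Suc (Suc p)) q)"
    if "f \<in> carrier (bc (Suc p) q)" "bc_h (Suc p) q f = \<zero>\<^bsub>bc p q\<^esub>" for p
    using that unfolding bc_h_def bc_def by (rule P.bar_exact_Suc)
qed

theorem spectral_sequence_exists:
  "\<exists>(E :: nat \<Rightarrow> int \<Rightarrow> int \<Rightarrow> ('k, ('g list \<Rightarrow> 'x set) set) module) d.
    spectral_sequence K E d \<and> first_quadrant E \<and>
    (\<forall>p q. mod_isomorphic K (E 2 (int p) (int q)) (group_homology G (H q) (actH q) p)) \<and>
    converges_to K E (homology Y dY)"
proof -
  note ss = bc.Tot.spectral_sequence_page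
  \<comment> \<open>Pages off the first quadrant are trivial and embed anywhere; inside it the
    embedding is the isomorphism with group homology.\<close>
  have inj: "\<exists>f :: (nat \<Rightarrow> 'g list \<Rightarrow> 'x) set \<Rightarrow> ('g list \<Rightarrow> 'x set) set. inj_on f (carrier (bc.Tot.page 2 p q))" for p q :: int
  proof (cases "p < 0 \<or> q < 0")
    case True
    then have "carrier (bc.Tot.page 2 p q) = {\<zero>\<^bsub>bc.Tot.page 2 p q\<^esub>}"
      using bc.Tot.first_quadrant_page unfolding first_quadrant_def by auto
    then show ?thesis by (intro exI[of _ "\<lambda>_. {}"]) simp
  next
    case False
    then obtain p' q' where "p = int p'" "q = int q'" by (metis nonneg_int_cases not_less)
    then show ?thesis
      using second_page_bc[of p' q'] unfolding mod_isomorphic_def bij_betw_def by blast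
  qed
  obtain E :: "nat \<Rightarrow> int \<Rightarrow> int \<Rightarrow> ('k, ('g list \<Rightarrow> 'x set) set) module" and d
    where E: "spectral_sequence K E d" "\<And>r p q. 2 \<le> r \<Longrightarrow> mod_isomorphic K (bc.Tot.page r p q) (E r p q)"
    using spectral_sequence_transport[OF ss inj] by blast
  have "mod_isomorphic K (E 2 (int p) (int q)) (group_homology G (H q) (actH q) p)" for p q
    by (rule mod_isomorphic_trans[OF mod_isomorphic_sym[OF spectral_sequence.page_module[OF ss]
        spectral_sequence.page_module[OF E(1)] E(2)] second_page_bc]) simp_all
  moreover have "first_quadrant E" by (rule first_quadrant_isomorphic[OF ss E bc.Tot.first_quadrant_page])
  moreover have "converges_to K E (homology Y dY)" by (rule converges_to_isomorphic[OF ss E bc.converges_Tot])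
  ultimately show ?thesis using E(1) by blast
qed

end

section \<open>Multilinear maps\<close>

lemma multilin_comp:
  assumes "multilin K M Ns N h" "g \<in> mod_hom K N P"
  shows "multilin K M Ns P (\<lambda>m cs. g (h m cs))"
  by (rule multilinI) (rule mod_hom_comp[OF multilin_left[OF assms(1)] assms(2)] mod_hom_comp[OF multilin_right[OF assms(1)] assms(2)]; assumption)+

lemma multilin_slot_left:
  assumes "multilin K M' Ns' N h" "L \<in> mod_hom K P M'" "cs \<in> listset (map carrier Ns')"
  shows "(\<lambda>c. h (L c) cs) \<in> mod_hom K P N"
  using mod_hom_comp[OF assms(2) multilin_left[OF assms(1,3)]] .

lemma multilin_slot_right:
  assumes "multilin K M' Ns' N h" "m \<in> carrier M'" "cs \<in> listset (map carrier Ns')" "i < length Ns'"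
    and "L \<in> mod_hom K P (Ns' ! i)"
  shows "(\<lambda>c. h m (cs[i := L c])) \<in> mod_hom K P N"
  using mod_hom_comp[OF assms(5) multilin_right[OF assms(1-4)]] .

lemma multilin_alt_sum:
  assumes "\<And>i. i < length Ns \<Longrightarrow> module K (Ns ! i)" "module K M" "module K N"
    and "\<And>i. i \<le> n \<Longrightarrow> multilin K M Ns N (h i)"
  shows "multilin K M Ns N (\<lambda>m cs. alt_sum N n (\<lambda>i. h i m cs))"
proof (rule multilinI)
  show "(\<lambda>m. alt_sum N n (\<lambda>i. h i m cs)) \<in> mod_hom K M N" if "cs \<in> listset (map carrier Ns)" for cs
    by (rule mod_hom_alt_sum_fun[OF assms(2,3) multilin_left[OF assms(4) that]])
  fix m cs j assume m: "m \<in> carrier M" and cs: "cs \<in> listset (map carrier Ns)" and j: "j < length Ns"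
  show "(\<lambda>c. alt_sum N n (\<lambda>i. h i m (cs[j := c]))) \<in> mod_hom K (Ns ! j) N"
    by (rule mod_hom_alt_sum_fun[OF assms(1)[OF j] assms(3) multilin_right[OF assms(4) m cs j]])
qed

lemma map_upt_update:
  assumes "j < n" "length cs = n"
  shows "map (\<lambda>i. L i (cs[j := c] ! i)) [0..<n] = (map (\<lambda>i. L i (cs ! i)) [0..<n])[j := L j c]"
  using assms by (intro nth_equalityI) (auto simp: nth_list_update)

text \<open>Pullback along one linear map per slot. Translation, projection and lifting of tuples
  are all of this shape.\<close>

lemma multilin_map:
  assumes h: "multilin K M' Ns' N h" and len: "length Ns = n" "length Ns' = n"
    and L0: "L0 \<in> mod_hom K M M'" and L: "\<And>i. i < n \<Longrightarrow> L i \<in> mod_hom K (Ns ! i) (Ns' ! i)"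
  shows "multilin K M Ns N (\<lambda>m cs. h (L0 m) (map (\<lambda>i. L i (cs ! i)) [0..<n]))"
proof (rule multilinI)
  have map_closed: "map (\<lambda>i. L i (cs ! i)) [0..<n] \<in> listset (map carrier Ns')" if "cs \<in> listset (map carrier Ns)" for cs
    using that mod_hom_closed[OF L] len by (auto simp: listset_iff)
  show "(\<lambda>m. h (L0 m) (map (\<lambda>i. L i (cs ! i)) [0..<n])) \<in> mod_hom K M N" if "cs \<in> listset (map carrier Ns)" for cs
    by (rule multilin_slot_left[OF h L0 map_closed[OF that]])
  fix m cs j assume m: "m \<in> carrier M" and cs: "cs \<in> listset (map carrier Ns)" and j: "j < length Ns"
  have "length cs = n" using cs len by (simp add: listset_iff)
  then show "(\<lambda>c. h (L0 m) (map (\<lambda>i. L i (cs[j := c] ! i)) [0..<n])) \<in> mod_hom K (Ns ! j) N"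
    using j len by (simp add: map_upt_update multilin_slot_right[OF h mod_hom_closed[OF L0 m] map_closed[OF cs] _ L])
qed

lemma multilin_zero_slot:
  assumes h: "multilin K M Ns N h" and m: "m \<in> carrier M" and cs: "cs \<in> listset (map carrier Ns)"
    and i: "i < length Ns" "cs ! i = \<zero>\<^bsub>Ns ! i\<^esub>" and mods: "module K (Ns ! i)" "module K N"
  shows "h m cs = \<zero>\<^bsub>N\<^esub>"
proof -
  have "cs = cs[i := \<zero>\<^bsub>Ns ! i\<^esub>]" using i by (metis list_update_id)
  then show ?thesis using mod_hom_zero[OF mods multilin_right[OF h m cs i(1)]] by simp
qed

lemma multilin_dsumI:
  assumes K: "cring K" and X: "\<And>j. j \<in> I \<Longrightarrow> module K (X j)"
    and M: "module K M" and Ns: "\<And>i. i < length Ns \<Longrightarrow> module K (Ns ! i)"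
    and closed: "\<And>m cs. \<lbrakk>m \<in> carrier M; cs \<in> listset (map carrier Ns)\<rbrakk> \<Longrightarrow> h m cs \<in> carrier (dsum I X)"
    and comp: "\<And>j. j \<in> I \<Longrightarrow> multilin K M Ns (X j) (\<lambda>m cs. h m cs j)"
  shows "multilin K M Ns (dsum I X) h"
proof (rule multilinI)
  fix cs assume cs: "cs \<in> listset (map carrier Ns)"
  show "(\<lambda>m. h m cs) \<in> mod_hom K M (dsum I X)"
    by (rule mod_hom_dsumI[OF K X closed[OF _ cs] multilin_left[OF comp cs] M])
  fix m i assume m: "m \<in> carrier M" and i: "i < length Ns"
  show "(\<lambda>c. h m (cs[i := c])) \<in> mod_hom K (Ns ! i) (dsum I X)"
    by (rule mod_hom_dsumI[OF K X closed[OF m listset_update[OF cs]] multilin_right[OF comp m cs i] Ns[OF i]])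
qed

lemma multilin_zero:
  assumes "module K M" "\<And>i. i < length Ns \<Longrightarrow> module K (Ns ! i)" "module K N"
  shows "multilin K M Ns N (\<lambda>m cs. \<zero>\<^bsub>N\<^esub>)"
  by (intro multilinI mod_hom_const_zero[OF assms(1,3)] mod_hom_const_zero[OF assms(2,3)])

section \<open>The Hochschild-Mitchell complex\<close>

lemma bilinear_map_left: "\<lbrakk>bilinear_map K U V W f; u \<in> carrier U\<rbrakk> \<Longrightarrow> f u \<in> mod_hom K V W"
  unfolding bilinear_map_def by blast

lemma bilinear_map_right: "\<lbrakk>bilinear_map K U V W f; v \<in> carrier V\<rbrakk> \<Longrightarrow> (\<lambda>u. f u v) \<in> mod_hom K U W"
  unfolding bilinear_map_def by blast

lemma bilinear_map_closed: "\<lbrakk>bilinear_map K U V W f; u \<in> carrier U; v \<in> carrier V\<rbrakk> \<Longrightarrow> f u v \<in> carrier W"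
  using mod_hom_closed[OF bilinear_map_left] by fastforce

section \<open>Generators and faces of Hochschild-Mitchell chains\<close>

definition HM_gens :: "('o, 'k, 'c) kcat \<Rightarrow> ('o, 'k, 'c, 'm) bimod \<Rightarrow> nat \<Rightarrow> ('o list \<times> 'm \<times> 'c list) set" where
  "HM_gens C M n = {(xs, m, cs). xs \<in> HM_seqs C n \<and> m \<in> carrier (HM_coeff M xs) \<and> cs \<in> listset (map carrier (HM_homs C xs))}"

text \<open>With \<open>face_homs\<close> and \<open>face_coeff\<close> this gives one entrywise
  description of all faces: the object at position \<open>i\<close> is dropped, and the two
  morphisms next to it are composed or, at an end of the sequence, the single neighbour acts on the
  coefficient.\<close>

definition face_seq :: "nat \<Rightarrow> nat \<Rightarrow> 'o list \<Rightarrow> 'o list" where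
  "face_seq n i xs = map (\<lambda>k. xs ! (if k < i then k else Suc k)) [0..<n]"

definition face_homs :: "('o, 'k, 'c) kcat \<Rightarrow> nat \<Rightarrow> nat \<Rightarrow> 'o list \<Rightarrow> 'c list \<Rightarrow> 'c list" where
  "face_homs C n i xs cs = map (\<lambda>k. if Suc k < i then cs ! k
     else if Suc k = i then Cmp C (xs ! k) (xs ! Suc k) (xs ! Suc (Suc k)) (cs ! k) (cs ! Suc k)
     else cs ! Suc k) [0..<n - 1]"

definition face_coeff :: "('o, 'k, 'c, 'm) bimod \<Rightarrow> nat \<Rightarrow> nat \<Rightarrow> 'o list \<Rightarrow> 'm \<Rightarrow> 'c list \<Rightarrow> 'm" where
  "face_coeff M n i xs m cs = (if i = 0 then Ract M (xs ! n) (xs ! 0) (xs ! 1) m (cs ! 0)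
     else if i = n then Lact M (xs ! (n - 1)) (xs ! n) (xs ! 0) (cs ! (n - 1)) m else m)"

lemma HM_face_eq:
  assumes "length xs = Suc (Suc n)" "length cs = Suc n" "i \<le> Suc n"
  shows "HM_face C M (Suc n) i (xs, m, cs)
    = (face_seq (Suc n) i xs, face_coeff M (Suc n) i xs m cs, face_homs C (Suc n) i xs cs)"
proof -
  have last_hd: "last xs = xs ! Suc n" "hd xs = xs ! 0" "last cs = cs ! n" "hd cs = cs ! 0"
    using assms last_conv_nth[of xs] last_conv_nth[of cs] hd_conv_nth[of xs] hd_conv_nth[of cs] by fastforce+
  consider "i = 0" | "i = Suc n" | "0 < i" "i < Suc n" using assms(3) by linarith
  then show ?thesis
  proof cases
    case 1
    have "tl xs = face_seq (Suc n) 0 xs" "tl cs = face_homs C (Suc n) 0 xs cs"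
      using assms by (auto intro!: nth_equalityI simp: face_seq_def face_homs_def nth_tl simp del: upt_Suc)
    then show ?thesis using 1 last_hd by (simp add: HM_face_def face_coeff_def)
  next
    case 2
    have "butlast xs = face_seq (Suc n) (Suc n) xs" "butlast cs = face_homs C (Suc n) (Suc n) xs cs"
      using assms by (auto intro!: nth_equalityI simp: face_seq_def face_homs_def nth_butlast simp del: upt_Suc)
    then show ?thesis using 2 last_hd by (simp add: HM_face_def face_coeff_def)
  next
    case 3
    have "take i xs @ drop (Suc i) xs = face_seq (Suc n) i xs"
      using assms 3 by (intro nth_equalityI) (auto simp: face_seq_def nth_append simp del: upt_Suc)
    moreover have "take (i - 1) cs @ [Cmp C (xs ! (i - 1)) (xs ! i) (xs ! Suc i) (cs ! (i - 1)) (cs ! i)] @ drop (Suc i) cs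
      = face_homs C (Suc n) i xs cs"
      using assms 3 by (intro nth_equalityI)
        (auto simp: face_homs_def nth_append nth_Cons' less_diff_conv simp del: upt_Suc)
    ultimately show ?thesis using 3 by (simp add: HM_face_def face_coeff_def)
  qed
qed

lemma face_seq_nth [simp]: "k < n \<Longrightarrow> face_seq n i xs ! k = xs ! (if k < i then k else Suc k)"
  by (simp add: face_seq_def)

lemma face_homs_nth: "Suc k < n \<Longrightarrow> face_homs C n i xs cs ! k = (if Suc k < i then cs ! k
     else if Suc k = i then Cmp C (xs ! k) (xs ! Suc k) (xs ! Suc (Suc k)) (cs ! k) (cs ! Suc k)
     else cs ! Suc k)"
  by (simp add: face_homs_def)

lemma length_face_seq [simp]: "length (face_seq n i xs) = n"
  by (simp add: face_seq_def)

lemma length_face_homs [simp]: "length (face_homs C n i xs cs) = n - 1"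
  by (simp add: face_homs_def)

lemma HM_seqs_iff: "xs \<in> HM_seqs C n \<longleftrightarrow> length xs = Suc n \<and> (\<forall>i\<le>n. xs ! i \<in> Ob C)"
  by (auto simp: HM_seqs_def subset_eq all_set_conv_all_nth less_Suc_eq_le)

lemma HM_coeff_nth: "length xs = Suc n \<Longrightarrow> HM_coeff M xs = Bim M (xs ! n) (xs ! 0)"
  using last_conv_nth[of xs] hd_conv_nth[of xs] by (fastforce simp: HM_coeff_def)

lemma length_HM_homs [simp]: "length (HM_homs C xs) = length xs - 1"
  by (simp add: HM_homs_def)

lemma HM_homs_nth: "Suc i < length xs \<Longrightarrow> HM_homs C xs ! i = Hom C (xs ! i) (xs ! Suc i)"
  by (simp add: HM_homs_def)

lemma HM_homs_listset:
  "length xs = Suc n \<Longrightarrow> cs \<in> listset (map carrier (HM_homs C xs)) \<longleftrightarrow>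
     length cs = n \<and> (\<forall>i<n. cs ! i \<in> carrier (Hom C (xs ! i) (xs ! Suc i)))"
  by (auto simp: listset_iff HM_homs_nth)

lemma HM_gens_iff: "(xs, m, cs) \<in> HM_gens C M n \<longleftrightarrow> length xs = Suc n \<and> (\<forall>i\<le>n. xs ! i \<in> Ob C) \<and>
   m \<in> carrier (Bim M (xs ! n) (xs ! 0)) \<and> length cs = n \<and> (\<forall>i<n. cs ! i \<in> carrier (Hom C (xs ! i) (xs ! Suc i)))"
  by (auto simp: HM_gens_def HM_seqs_iff HM_coeff_nth HM_homs_listset)

text \<open>What it takes to define the chains and the boundary. Leaving associativity to
  \<open>hm_complex\<close> lets the quotient category be an instance at once; its boundary squares
  to zero because \<open>eps\<close> maps onto its chains.\<close>

locale hm_data =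
  fixes K :: "('k, 'z) ring_scheme" and C :: "('o, 'k, 'c) kcat" and M :: "('o, 'k, 'c, 'm) bimod"
  assumes K: "cring K"
    and Hom_module: "\<lbrakk>y \<in> Ob C; x \<in> Ob C\<rbrakk> \<Longrightarrow> module K (Hom C y x)"
    and Cmp_bilinear: "\<lbrakk>z \<in> Ob C; y \<in> Ob C; x \<in> Ob C\<rbrakk>
      \<Longrightarrow> bilinear_map K (Hom C z y) (Hom C y x) (Hom C z x) (Cmp C z y x)"
    and Bim_module: "\<lbrakk>y \<in> Ob C; x \<in> Ob C\<rbrakk> \<Longrightarrow> module K (Bim M y x)"
    and Lact_bilinear: "\<lbrakk>z \<in> Ob C; y \<in> Ob C; x \<in> Ob C\<rbrakk>
      \<Longrightarrow> bilinear_map K (Hom C z y) (Bim M y x) (Bim M z x) (Lact M z y x)"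
    and Ract_bilinear: "\<lbrakk>y \<in> Ob C; x \<in> Ob C; u \<in> Ob C\<rbrakk>
      \<Longrightarrow> bilinear_map K (Bim M y x) (Hom C x u) (Bim M y u) (Ract M y x u)"
begin

abbreviation "chain \<equiv> HM_chain K C M"
abbreviation "gen \<equiv> HM_gen K C M"
abbreviation "hbd \<equiv> HM_boundary K C M"

lemma coeff_module: "xs \<in> HM_seqs C n \<Longrightarrow> module K (HM_coeff M xs)"
  by (auto simp: HM_seqs_iff HM_coeff_nth intro: Bim_module)

lemma homs_module: "\<lbrakk>xs \<in> HM_seqs C n; i < length (HM_homs C xs)\<rbrakk> \<Longrightarrow> module K (HM_homs C xs ! i)"
  by (auto simp: HM_seqs_iff HM_homs_nth intro: Hom_module)

lemma summand_module: "xs \<in> HM_seqs C n \<Longrightarrow> module K (HM_summand K C M xs)"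
  unfolding HM_summand_def by (rule tensor_module[OF K coeff_module homs_module])

lemma chain_module: "module K (chain n)"
  unfolding HM_chain_def by (rule dsum_module[OF K summand_module])

lemma gen_multilin:
  assumes xs: "xs \<in> HM_seqs C n"
  shows "multilin K (HM_coeff M xs) (HM_homs C xs) (chain n) (\<lambda>m cs. gen n (xs, m, cs))"
proof -
  have "multilin K (HM_coeff M xs) (HM_homs C xs) (HM_summand K C M xs) (pure_tensor K (HM_coeff M xs) (HM_homs C xs))"
    unfolding HM_summand_def by (rule pure_tensor_multilin[OF K coeff_module[OF xs] homs_module[OF xs]])
  moreover have "dsum_inj (HM_seqs C n) (HM_summand K C M) xs \<in> mod_hom K (HM_summand K C M xs) (chain n)"
    unfolding HM_chain_def by (rule dsum_inj_hom[OF K summand_module xs])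
  ultimately show ?thesis unfolding HM_gen_def by (simp add: multilin_comp)
qed

lemma gen_closed: "t \<in> HM_gens C M n \<Longrightarrow> gen n t \<in> carrier (chain n)"
  using multilin_closed[OF gen_multilin] by (auto simp: HM_gens_def)

lemma chain_spanning: "spanning K (chain n) (gen n ` HM_gens C M n)"
proof -
  have "spanning K (chain n) {dsum_inj (HM_seqs C n) (HM_summand K C M) xs y | xs y. xs \<in> HM_seqs C n \<and>
      y \<in> {pure_tensor K (HM_coeff M xs) (HM_homs C xs) m cs | m cs.
        m \<in> carrier (HM_coeff M xs) \<and> cs \<in> listset (map carrier (HM_homs C xs))}}"
    unfolding HM_chain_def
    by (rule dsum_spanning_gens[OF K summand_module],
        assumption, unfold HM_summand_def, rule tensor_spanning[OF K coeff_module homs_module])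
  moreover have "{dsum_inj (HM_seqs C n) (HM_summand K C M) xs y | xs y. xs \<in> HM_seqs C n \<and>
      y \<in> {pure_tensor K (HM_coeff M xs) (HM_homs C xs) m cs | m cs.
        m \<in> carrier (HM_coeff M xs) \<and> cs \<in> listset (map carrier (HM_homs C xs))}} = gen n ` HM_gens C M n"
    unfolding HM_gens_def HM_gen_def image_def by fastforce
  ultimately show ?thesis by simp
qed

lemma chain_hom_eq:
  assumes "module K N" "h \<in> mod_hom K (chain n) N" "g \<in> mod_hom K (chain n) N"
    and "\<And>t. t \<in> HM_gens C M n \<Longrightarrow> h (gen n t) = g (gen n t)" "x \<in> carrier (chain n)"
  shows "h x = g x"
  by (rule spanning_hom_eq[OF chain_spanning chain_module assms(1-3)]) (use assms(4,5) in auto)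

context
  fixes N :: "('k, 'b) module" and h n
  assumes N: "module K N"
    and h: "\<And>xs. xs \<in> HM_seqs C n \<Longrightarrow> multilin K (HM_coeff M xs) (HM_homs C xs) N (\<lambda>m cs. h (xs, m, cs))"
begin

private lemma lift_hom: "xs \<in> HM_seqs C n \<Longrightarrow>
    tensor_lift K (HM_coeff M xs) (HM_homs C xs) N (\<lambda>m cs. h (xs, m, cs)) \<in> mod_hom K (HM_summand K C M xs) N"
  unfolding HM_summand_def by (rule tensor_lift_hom[OF K coeff_module homs_module N h])

lemma HM_lift_hom: "HM_lift K C M n N h \<in> mod_hom K (chain n) N"
  unfolding HM_lift_def HM_chain_def by (rule dsum_lift_hom[OF K summand_module N lift_hom])

lemma HM_lift_gen:
  assumes "t \<in> HM_gens C M n"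
  shows "HM_lift K C M n N h (gen n t) = h t"
proof -
  obtain xs m cs where t: "t = (xs, m, cs)" by (cases t)
  then have *: "xs \<in> HM_seqs C n" "m \<in> carrier (HM_coeff M xs)" "cs \<in> listset (map carrier (HM_homs C xs))"
    using assms by (auto simp: HM_gens_def)
  have "pure_tensor K (HM_coeff M xs) (HM_homs C xs) m cs \<in> carrier (HM_summand K C M xs)"
    unfolding HM_summand_def using * by (intro pure_tensor_closed[OF K coeff_module homs_module])
  then have "HM_lift K C M n N h (gen n t)
    = tensor_lift K (HM_coeff M xs) (HM_homs C xs) N (\<lambda>m cs. h (xs, m, cs)) (pure_tensor K (HM_coeff M xs) (HM_homs C xs) m cs)"
    unfolding HM_lift_def HM_gen_def t prod.case
    using dsum_lift_inj[OF K summand_module N lift_hom *(1)] by simp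
  also have "\<dots> = h t"
    unfolding t by (rule tensor_lift_pure[OF K coeff_module[OF *(1)] homs_module[OF *(1)] N h[OF *(1)] *(2,3)])
  finally show ?thesis .
qed

end

lemma face_closed:
  assumes t: "(xs, m, cs) \<in> HM_gens C M (Suc n)" and i: "i \<le> Suc n"
  shows "(face_seq (Suc n) i xs, face_coeff M (Suc n) i xs m cs, face_homs C (Suc n) i xs cs) \<in> HM_gens C M n"
proof -
  have xs: "\<And>i. i \<le> Suc n \<Longrightarrow> xs ! i \<in> Ob C" and m: "m \<in> carrier (Bim M (xs ! Suc n) (xs ! 0))"
    and cs: "\<And>i. i < Suc n \<Longrightarrow> cs ! i \<in> carrier (Hom C (xs ! i) (xs ! Suc i))"
    using t by (auto simp: HM_gens_iff)
  have "face_homs C (Suc n) i xs cs ! k \<in> carrier (Hom C (face_seq (Suc n) i xs ! k) (face_seq (Suc n) i xs ! Suc k))"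
    if k: "k < n" for k
  proof -
    consider "Suc k < i" | "Suc k = i" | "i < Suc k" by linarith
    then show ?thesis
      using k cs[of k] cs[of "Suc k"] bilinear_map_closed[OF Cmp_bilinear[OF xs[of k] xs[of "Suc k"] xs[of "Suc (Suc k)"]]]
      by cases (auto simp: face_homs_nth)
  qed
  moreover have "face_coeff M (Suc n) i xs m cs \<in> carrier (Bim M (face_seq (Suc n) i xs ! n) (face_seq (Suc n) i xs ! 0))"
  proof -
    consider "i = 0" | "i = Suc n" | "0 < i" "i < Suc n" using i by linarith
    then show ?thesis
      using m cs[of 0] cs[of n] bilinear_map_closed[OF Ract_bilinear[OF xs[of "Suc n"] xs[of 0] xs[of "Suc 0"]]]
        bilinear_map_closed[OF Lact_bilinear[OF xs[of n] xs[of "Suc n"] xs[of 0]]]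
      by cases (auto simp: face_coeff_def)
  qed
  ultimately show ?thesis using xs by (auto simp: HM_gens_iff)
qed

text \<open>Changing one slot of a tuple changes one slot of its face, through a linear map: an
  action on the coefficient, a composition with a fixed neighbour, or the identity.\<close>

lemma face_multilin:
  assumes xs: "xs \<in> HM_seqs C (Suc n)" and i: "i \<le> Suc n"
  shows "multilin K (HM_coeff M xs) (HM_homs C xs) (chain n) (\<lambda>m cs. gen n (HM_face C M (Suc n) i (xs, m, cs)))"
proof (rule multilinI)
  have lx: "length xs = Suc (Suc n)" and ob: "\<And>i. i \<le> Suc n \<Longrightarrow> xs ! i \<in> Ob C" using xs by (auto simp: HM_seqs_iff)
  let ?xs = "face_seq (Suc n) i xs"
  have xs': "?xs \<in> HM_seqs C n" using ob by (auto simp: HM_seqs_iff)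
  note g = gen_multilin[OF xs']
  have mem: "HM_coeff M xs = Bim M (xs ! Suc n) (xs ! 0)" "HM_coeff M ?xs = Bim M (?xs ! n) (?xs ! 0)"
    by (simp_all add: HM_coeff_nth[OF lx] HM_coeff_nth[of ?xs n])
  have closed: "face_coeff M (Suc n) i xs m cs \<in> carrier (HM_coeff M ?xs)"
    "face_homs C (Suc n) i xs cs \<in> listset (map carrier (HM_homs C ?xs))"
    if "m \<in> carrier (HM_coeff M xs)" "cs \<in> listset (map carrier (HM_homs C xs))" for m cs
    using face_closed[of xs m cs n i] that xs i by (auto simp: HM_gens_def)
  have zero: "\<zero>\<^bsub>HM_coeff M xs\<^esub> \<in> carrier (HM_coeff M xs)"
    using submodule_zero[OF submodule_carrier[OF coeff_module[OF xs]]] .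
  {
    fix cs assume cs: "cs \<in> listset (map carrier (HM_homs C xs))"
    have lc: "length cs = Suc n" and hc: "\<And>i. i < Suc n \<Longrightarrow> cs ! i \<in> carrier (Hom C (xs ! i) (xs ! Suc i))"
      using cs by (auto simp: HM_homs_listset[OF lx])
    have L: "(\<lambda>m. face_coeff M (Suc n) i xs m cs) \<in> mod_hom K (HM_coeff M xs) (HM_coeff M ?xs)"
    proof -
      consider "i = 0" | "i = Suc n" | "0 < i" "i < Suc n" using i by linarith
      then show ?thesis
      proof cases
        case 1
        then show ?thesis unfolding mem
          using bilinear_map_right[OF Ract_bilinear[OF ob[of "Suc n"] ob[of 0] ob[of "Suc 0"]] hc[of 0]] by (simp add: face_coeff_def)
      next
        case 2
        then show ?thesis unfolding mem
          using bilinear_map_left[OF Lact_bilinear[OF ob[of n] ob[of "Suc n"] ob[of 0]] hc[of n]] by (simp add: face_coeff_def)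
      next
        case 3
        then show ?thesis unfolding mem using mod_hom_id by (simp add: face_coeff_def)
      qed
    qed
    show "(\<lambda>m. gen n (HM_face C M (Suc n) i (xs, m, cs))) \<in> mod_hom K (HM_coeff M xs) (chain n)"
      unfolding HM_face_eq[OF lx lc i] by (rule multilin_slot_left[OF g L closed(2)[OF zero cs]])
    fix m j assume m: "m \<in> carrier (HM_coeff M xs)" and "j < length (HM_homs C xs)"
    then have j: "j < Suc n" using lx by simp
    have m': "m \<in> carrier (Bim M (xs ! Suc n) (xs ! 0))" using m mem by simp
    have dom: "HM_homs C xs ! j = Hom C (xs ! j) (xs ! Suc j)" using j lx by (simp add: HM_homs_nth)
    have eq: "HM_face C M (Suc n) i (xs, m, cs[j := c])
      = (?xs, face_coeff M (Suc n) i xs m (cs[j := c]), face_homs C (Suc n) i xs (cs[j := c]))" for c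
      using lc by (intro HM_face_eq[OF lx _ i]) simp
    have slot: "(\<lambda>c. gen n (HM_face C M (Suc n) i (xs, m, cs[j := c]))) \<in> mod_hom K (HM_homs C xs ! j) (chain n)"
      if "\<And>c. face_coeff M (Suc n) i xs m (cs[j := c]) = face_coeff M (Suc n) i xs m cs"
        "\<And>c. face_homs C (Suc n) i xs (cs[j := c]) = (face_homs C (Suc n) i xs cs)[j' := L c]" "j' < n"
        "L \<in> mod_hom K (Hom C (xs ! j) (xs ! Suc j)) (Hom C (?xs ! j') (?xs ! Suc j'))" for j' L
      unfolding eq that(1,2) dom
      using that(3,4) by (intro multilin_slot_right[OF g closed[OF m cs]]) (simp_all add: HM_homs_nth)
    have upd: "face_homs C (Suc n) i xs (cs[j := c]) = (face_homs C (Suc n) i xs cs)[j' := L]"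
      if "\<And>k. k < n \<Longrightarrow> k \<noteq> j' \<Longrightarrow> face_homs C (Suc n) i xs (cs[j := c]) ! k = face_homs C (Suc n) i xs cs ! k"
        "j' < n" "face_homs C (Suc n) i xs (cs[j := c]) ! j' = L" for c j' L
      using that by (intro nth_equalityI) (auto simp: nth_list_update)
    \<comment> \<open>In \<open>a\<close> and \<open>b\<close> the slot is absorbed by the
      coefficient; in \<open>d\<close> and \<open>e\<close> it is the left or right factor of the
      composite at the dropped object; in \<open>c\<close> and \<open>f\<close> it lies to one side
      and is copied.\<close>
    consider (a) "i = 0" "j = 0" | (b) "i = Suc n" "j = n" | (c) "Suc j < i" "j < n" | (d) "Suc j = i" "j < n" | (e) "j = i" "0 < i"
      | (f) "i < j" using j i by linarith
    then show "(\<lambda>c. gen n (HM_face C M (Suc n) i (xs, m, cs[j := c]))) \<in> mod_hom K (HM_homs C xs ! j) (chain n)"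
    proof cases
      case a
      have fh: "face_homs C (Suc n) i xs (cs[j := c]) = face_homs C (Suc n) i xs cs" for c
        using a by (intro nth_equalityI) (auto simp: face_homs_nth)
      have fc: "face_coeff M (Suc n) i xs m (cs[j := c]) = Ract M (xs ! Suc n) (xs ! 0) (xs ! 1) m c" for c
        using a lc by (simp add: face_coeff_def)
      show ?thesis unfolding eq fh fc
      proof (rule multilin_slot_left[OF g _ closed(2)[OF m cs]])
        show "Ract M (xs ! Suc n) (xs ! 0) (xs ! 1) m \<in> mod_hom K (HM_homs C xs ! j) (HM_coeff M ?xs)"
          unfolding dom mem using bilinear_map_left[OF Ract_bilinear[OF ob[of "Suc n"] ob[of 0] ob[of "Suc 0"]] m'] a by simp
      qed
    next
      case b
      have fh: "face_homs C (Suc n) i xs (cs[j := c]) = face_homs C (Suc n) i xs cs" for c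
        using b by (intro nth_equalityI) (auto simp: face_homs_nth)
      have fc: "face_coeff M (Suc n) i xs m (cs[j := c]) = Lact M (xs ! n) (xs ! Suc n) (xs ! 0) c m" for c
        using b lc by (simp add: face_coeff_def)
      show ?thesis unfolding eq fh fc
      proof (rule multilin_slot_left[OF g _ closed(2)[OF m cs]])
        show "(\<lambda>c. Lact M (xs ! n) (xs ! Suc n) (xs ! 0) c m) \<in> mod_hom K (HM_homs C xs ! j) (HM_coeff M ?xs)"
          unfolding dom mem using bilinear_map_right[OF Lact_bilinear[OF ob[of n] ob[of "Suc n"] ob[of 0]] m'] b by simp
      qed
    next
      case c
      show ?thesis
      proof (rule slot[where j' = j and L = "\<lambda>c. c"])
        show "face_coeff M (Suc n) i xs m (cs[j := c]) = face_coeff M (Suc n) i xs m cs" for c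
          using c by (auto simp: face_coeff_def)
        show "face_homs C (Suc n) i xs (cs[j := c]) = (face_homs C (Suc n) i xs cs)[j := c]" for c
          using c lc by (intro upd) (auto simp: face_homs_nth nth_list_update)
      qed (use c mod_hom_id in auto)
    next
      case d
      show ?thesis
      proof (rule slot[where j' = j and L = "\<lambda>c. Cmp C (xs ! j) (xs ! Suc j) (xs ! Suc (Suc j)) c (cs ! Suc j)"])
        show "face_coeff M (Suc n) i xs m (cs[j := c]) = face_coeff M (Suc n) i xs m cs" for c
          using d by (auto simp: face_coeff_def)
        show "face_homs C (Suc n) i xs (cs[j := c])
          = (face_homs C (Suc n) i xs cs)[j := Cmp C (xs ! j) (xs ! Suc j) (xs ! Suc (Suc j)) c (cs ! Suc j)]" for c
          using d lc by (intro upd) (auto simp: face_homs_nth nth_list_update)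
        show "(\<lambda>c. Cmp C (xs ! j) (xs ! Suc j) (xs ! Suc (Suc j)) c (cs ! Suc j))
          \<in> mod_hom K (Hom C (xs ! j) (xs ! Suc j)) (Hom C (?xs ! j) (?xs ! Suc j))"
          using bilinear_map_right[OF Cmp_bilinear[OF ob[of j] ob[of "Suc j"] ob[of "Suc (Suc j)"]] hc[of "Suc j"]] d by auto
      qed (use d in auto)
    next
      case e
      then obtain j0 where j0: "j = Suc j0" by (cases j) auto
      show ?thesis
      proof (rule slot[where j' = j0 and L = "Cmp C (xs ! j0) (xs ! j) (xs ! Suc j) (cs ! j0)"])
        show "face_coeff M (Suc n) i xs m (cs[j := c]) = face_coeff M (Suc n) i xs m cs" for c
          using e j by (auto simp: face_coeff_def)
        show "face_homs C (Suc n) i xs (cs[j := c])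
          = (face_homs C (Suc n) i xs cs)[j0 := Cmp C (xs ! j0) (xs ! j) (xs ! Suc j) (cs ! j0) c]" for c
          using e lc j j0 by (intro upd) (auto simp: face_homs_nth nth_list_update)
        show "Cmp C (xs ! j0) (xs ! j) (xs ! Suc j) (cs ! j0) \<in> mod_hom K (Hom C (xs ! j) (xs ! Suc j)) (Hom C (?xs ! j0) (?xs ! Suc j0))"
          using bilinear_map_left[OF Cmp_bilinear[OF ob[of j0] ob[of "Suc j0"] ob[of "Suc (Suc j0)"]] hc[of j0]] e j j0 by auto
      qed (use j j0 in auto)
    next
      case f
      then obtain j0 where j0: "j = Suc j0" by (cases j) auto
      show ?thesis
      proof (rule slot[where j' = j0 and L = "\<lambda>c. c"])
        show "face_coeff M (Suc n) i xs m (cs[j := c]) = face_coeff M (Suc n) i xs m cs" for c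
          using f j by (auto simp: face_coeff_def)
        show "face_homs C (Suc n) i xs (cs[j := c]) = (face_homs C (Suc n) i xs cs)[j0 := c]" for c
          using f lc j j0 by (intro upd) (auto simp: face_homs_nth nth_list_update)
      qed (use f j j0 mod_hom_id in auto)
    qed
  }
qed

lemma bd_multilin:
  assumes xs: "xs \<in> HM_seqs C (Suc n)"
  shows "multilin K (HM_coeff M xs) (HM_homs C xs) (chain n)
    (\<lambda>m cs. alt_sum (chain n) (Suc n) (\<lambda>i. gen n (HM_face C M (Suc n) i (xs, m, cs))))"
  by (rule multilin_alt_sum[OF homs_module[OF xs] coeff_module[OF xs] chain_module face_multilin[OF xs]])

lemma hbd_hom: "hbd (Suc n) \<in> mod_hom K (chain (Suc n)) (chain n)"
  unfolding HM_boundary_def using HM_lift_hom[OF chain_module bd_multilin] by simp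

lemma hbd_gen: "t \<in> HM_gens C M (Suc n) \<Longrightarrow>
    hbd (Suc n) (gen (Suc n) t) = alt_sum (chain n) (Suc n) (\<lambda>i. gen n (HM_face C M (Suc n) i t))"
  unfolding HM_boundary_def using HM_lift_gen[OF chain_module bd_multilin] by simp

lemma HM_face_closed: "\<lbrakk>t \<in> HM_gens C M (Suc n); i \<le> Suc n\<rbrakk> \<Longrightarrow> HM_face C M (Suc n) i t \<in> HM_gens C M n"
proof (cases t)
  fix xs m cs assume *: "t \<in> HM_gens C M (Suc n)" "i \<le> Suc n" "t = (xs, m, cs)"
  then have "length xs = Suc (Suc n)" "length cs = Suc n" by (simp_all add: HM_gens_iff)
  then show ?thesis using face_closed[of xs m cs n i] * by (simp add: HM_face_eq)
qed

end

locale hm_complex = hm_data K C M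
  for K :: "('k, 'z) ring_scheme" and C :: "('o, 'k, 'c) kcat" and M :: "('o, 'k, 'c, 'm) bimod" +
  assumes Cmp_assoc: "\<lbrakk>w \<in> Ob C; z \<in> Ob C; y \<in> Ob C; x \<in> Ob C;
        e \<in> carrier (Hom C w z); d \<in> carrier (Hom C z y); c \<in> carrier (Hom C y x)\<rbrakk>
      \<Longrightarrow> Cmp C w y x (Cmp C w z y e d) c = Cmp C w z x e (Cmp C z y x d c)"
    and Lact_assoc: "\<lbrakk>w \<in> Ob C; z \<in> Ob C; y \<in> Ob C; x \<in> Ob C;
        d \<in> carrier (Hom C w z); c \<in> carrier (Hom C z y); m \<in> carrier (Bim M y x)\<rbrakk>
      \<Longrightarrow> Lact M w y x (Cmp C w z y d c) m = Lact M w z x d (Lact M z y x c m)"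
    and Ract_assoc: "\<lbrakk>y \<in> Ob C; x \<in> Ob C; u \<in> Ob C; v \<in> Ob C;
        m \<in> carrier (Bim M y x); c \<in> carrier (Hom C x u); d \<in> carrier (Hom C u v)\<rbrakk>
      \<Longrightarrow> Ract M y x v m (Cmp C x u v c d) = Ract M y u v (Ract M y x u m c) d"
    and Lact_Ract: "\<lbrakk>z \<in> Ob C; y \<in> Ob C; x \<in> Ob C; u \<in> Ob C;
        c \<in> carrier (Hom C z y); m \<in> carrier (Bim M y x); d \<in> carrier (Hom C x u)\<rbrakk>
      \<Longrightarrow> Ract M z x u (Lact M z y x c m) d = Lact M z y u c (Ract M y x u m d)"
begin

text \<open>An axiom enters only where the two faces meet: associativity of composition for adjacent
  inner faces, associativity of an action for two faces at the same end, and compatibility of the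
  two actions for the opposite end faces.\<close>

lemma face_face:
  assumes t: "t \<in> HM_gens C M (Suc (Suc n))" and ij: "i < j" "j \<le> Suc (Suc n)"
  shows "HM_face C M (Suc n) i (HM_face C M (Suc (Suc n)) j t) = HM_face C M (Suc n) (j - 1) (HM_face C M (Suc (Suc n)) i t)"
proof -
  obtain xs m cs where t_eq: "t = (xs, m, cs)" by (cases t)
  have lx: "length xs = Suc (Suc (Suc n))" and ob: "\<And>i. i \<le> Suc (Suc n) \<Longrightarrow> xs ! i \<in> Ob C"
    and m: "m \<in> carrier (Bim M (xs ! Suc (Suc n)) (xs ! 0))"
    and lc: "length cs = Suc (Suc n)" and hc: "\<And>i. i < Suc (Suc n) \<Longrightarrow> cs ! i \<in> carrier (Hom C (xs ! i) (xs ! Suc i))"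
    using t unfolding t_eq by (auto simp: HM_gens_iff)
  obtain j' where j': "j = Suc j'" using ij by (cases j) auto
  let ?N = "Suc (Suc n)"
  have seq: "face_seq (Suc n) i (face_seq ?N j xs) = face_seq (Suc n) j' (face_seq ?N i xs)"
    using ij j' by (intro nth_equalityI) auto
  have homs: "face_homs C (Suc n) i (face_seq ?N j xs) (face_homs C ?N j xs cs)
    = face_homs C (Suc n) j' (face_seq ?N i xs) (face_homs C ?N i xs cs)"
  proof (rule nth_equalityI)
    fix k assume "k < length (face_homs C (Suc n) i (face_seq ?N j xs) (face_homs C ?N j xs cs))"
    then have k: "k < n" by simp
    have assoc: "Cmp C (xs ! k) (xs ! Suc (Suc k)) (xs ! Suc (Suc (Suc k)))
        (Cmp C (xs ! k) (xs ! Suc k) (xs ! Suc (Suc k)) (cs ! k) (cs ! Suc k)) (cs ! Suc (Suc k))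
      = Cmp C (xs ! k) (xs ! Suc k) (xs ! Suc (Suc (Suc k))) (cs ! k)
        (Cmp C (xs ! Suc k) (xs ! Suc (Suc k)) (xs ! Suc (Suc (Suc k))) (cs ! Suc k) (cs ! Suc (Suc k)))"
      using k by (intro Cmp_assoc ob hc) auto
    consider "Suc k < i" | "Suc k = i" "Suc k < j'" | "Suc k = i" "Suc k = j'"
      | "i < Suc k" "Suc k < j'" | "i < Suc k" "Suc k = j'" | "i < Suc k" "j' < Suc k"
      using ij j' by linarith
    then show "face_homs C (Suc n) i (face_seq ?N j xs) (face_homs C ?N j xs cs) ! k
      = face_homs C (Suc n) j' (face_seq ?N i xs) (face_homs C ?N i xs cs) ! k"
      using k ij assoc by cases (simp_all add: face_homs_nth j')
  qed simp
  have coeff: "face_coeff M (Suc n) i (face_seq ?N j xs) (face_coeff M ?N j xs m cs) (face_homs C ?N j xs cs)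
    = face_coeff M (Suc n) j' (face_seq ?N i xs) (face_coeff M ?N i xs m cs) (face_homs C ?N i xs cs)"
  proof -
    have R: "Ract M (xs ! ?N) (xs ! 0) (xs ! Suc (Suc 0)) m (Cmp C (xs ! 0) (xs ! Suc 0) (xs ! Suc (Suc 0)) (cs ! 0) (cs ! Suc 0))
      = Ract M (xs ! ?N) (xs ! Suc 0) (xs ! Suc (Suc 0)) (Ract M (xs ! ?N) (xs ! 0) (xs ! Suc 0) m (cs ! 0)) (cs ! Suc 0)"
      by (intro Ract_assoc ob hc m) auto
    have L: "Lact M (xs ! n) (xs ! ?N) (xs ! 0) (Cmp C (xs ! n) (xs ! Suc n) (xs ! ?N) (cs ! n) (cs ! Suc n)) m
      = Lact M (xs ! n) (xs ! Suc n) (xs ! 0) (cs ! n) (Lact M (xs ! Suc n) (xs ! ?N) (xs ! 0) (cs ! Suc n) m)"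
      by (intro Lact_assoc ob hc m) auto
    have LR: "Ract M (xs ! Suc n) (xs ! 0) (xs ! Suc 0) (Lact M (xs ! Suc n) (xs ! ?N) (xs ! 0) (cs ! Suc n) m) (cs ! 0)
      = Lact M (xs ! Suc n) (xs ! ?N) (xs ! Suc 0) (cs ! Suc n) (Ract M (xs ! ?N) (xs ! 0) (xs ! Suc 0) m (cs ! 0))"
      by (intro Lact_Ract ob hc m) auto
    consider "i = 0" "j' = 0" | "i = 0" "0 < j'" "j' < Suc n" | "i = 0" "j' = Suc n"
      | "0 < i" "j' < Suc n" | "0 < i" "i < Suc n" "j' = Suc n" | "i = Suc n" "j' = Suc n"
      using ij j' by linarith
    then show ?thesis
      using R L LR ij by cases (simp_all add: face_coeff_def face_homs_nth j')
  qed
  show ?thesis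
    using ij seq homs coeff unfolding t_eq by (simp add: HM_face_eq lx lc j')
qed

lemma hbd_hbd:
  assumes "x \<in> carrier (chain (Suc (Suc n)))"
  shows "hbd (Suc n) (hbd (Suc (Suc n)) x) = \<zero>\<^bsub>chain n\<^esub>"
proof (rule chain_hom_eq[OF chain_module mod_hom_comp[OF hbd_hom hbd_hom] mod_hom_const_zero[OF chain_module chain_module] _ assms])
  fix t assume t: "t \<in> HM_gens C M (Suc (Suc n))"
  have "hbd (Suc n) (hbd (Suc (Suc n)) (gen (Suc (Suc n)) t))
    = alt_sum (chain n) (Suc (Suc n)) (\<lambda>j. hbd (Suc n) (gen (Suc n) (HM_face C M (Suc (Suc n)) j t)))"
    unfolding hbd_gen[OF t] by (rule mod_hom_alt_sum[OF chain_module chain_module hbd_hom gen_closed[OF HM_face_closed[OF t]]])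
  also have "\<dots> = alt_sum (chain n) (Suc (Suc n))
      (\<lambda>j. alt_sum (chain n) (Suc n) (\<lambda>i. gen n (HM_face C M (Suc n) i (HM_face C M (Suc (Suc n)) j t))))"
    by (intro alt_sum_cong[OF chain_module] alt_sum_closed[OF chain_module] hbd_gen gen_closed HM_face_closed t)
  also have "\<dots> = \<zero>\<^bsub>chain n\<^esub>"
    by (intro alt_sum_simplicial[OF chain_module] gen_closed HM_face_closed t) (simp_all only: face_face[OF t])
  finally show "hbd (Suc n) (hbd (Suc (Suc n)) (gen (Suc (Suc n)) t)) = \<zero>\<^bsub>chain n\<^esub>" .
qed

end

section \<open>Coinvariants\<close>

lemma finsum_regular_mod:
  assumes "cring K" "finite I" "f \<in> I \<rightarrow> carrier K"
  shows "(\<Oplus>\<^bsub>regular_mod K\<^esub>i\<in>I. f i) = (\<Oplus>\<^bsub>K\<^esub>i\<in>I. f i)"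
proof -
  interpret K: cring K by fact
  interpret R: module K "regular_mod K" by (rule regular_mod_module[OF assms(1)])
  have r: "carrier (regular_mod K) = carrier K" "\<zero>\<^bsub>regular_mod K\<^esub> = \<zero>\<^bsub>K\<^esub>" "\<And>x y. x \<oplus>\<^bsub>regular_mod K\<^esub> y = x \<oplus>\<^bsub>K\<^esub> y"
    by (simp_all add: regular_mod_def)
  show ?thesis
    using assms(2,3) by (induction I rule: finite_induct) (auto simp: r Pi_def)
qed

text \<open>The augmentation is the linear extension of the constant map one on \<open>G\<close>, so
  statements about it may be checked on group elements.\<close>

lemma augmentation_free_lift:
  assumes "cring K" "a \<in> carrier (free_mod K (carrier G))"
  shows "augmentation K G a = free_lift K (carrier G) (regular_mod K) (\<lambda>_. \<one>\<^bsub>K\<^esub>) a"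
proof -
  interpret K: cring K by fact
  have ac: "a g \<in> carrier K" if "g \<in> carrier G" for g
    using dsum_apply_closed[OF assms(1) regular_mod_module[OF assms(1)] _ that] assms(2)
    unfolding free_mod_def by (auto simp: regular_mod_def)
  have "free_lift K (carrier G) (regular_mod K) (\<lambda>_. \<one>\<^bsub>K\<^esub>) a
    = (\<Oplus>\<^bsub>K\<^esub>g\<in>{g \<in> carrier G. a g \<noteq> \<zero>\<^bsub>K\<^esub>}. a g \<otimes>\<^bsub>K\<^esub> \<one>\<^bsub>K\<^esub>)"
    unfolding free_lift_def dsum_lift_def using ac assms(2)
    by (subst finsum_regular_mod[OF assms(1), symmetric]) (auto simp: regular_mod_def free_mod_def dsum_def)
  also have "\<dots> = augmentation K G a"
    unfolding augmentation_def using ac by (intro K.finsum_cong') auto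
  finally show ?thesis by simp
qed

context kg_module
begin

abbreviation "aug \<equiv> aug_ideal_mult K G X \<rho>"

lemma group_alg_act_hom: "x \<in> carrier X \<Longrightarrow> (\<lambda>a. group_alg_act K G X \<rho> a x) \<in> mod_hom K (free_mod K (carrier G)) X"
  unfolding group_alg_act_def by (rule free_lift_hom[OF R.is_cring X_module act_closed])

lemma aug_gens_subset:
  "{group_alg_act K G X \<rho> a x | a x. a \<in> carrier (free_mod K (carrier G)) \<and> augmentation K G a = \<zero>\<^bsub>K\<^esub> \<and> x \<in> carrier X}
    \<subseteq> carrier X"
  using mod_hom_closed[OF group_alg_act_hom] by auto

lemma aug_submodule: "submodule aug K X"
  unfolding aug_ideal_mult_def by (rule submodule_mod_span[OF X_module aug_gens_subset])

text \<open>For invariant \<open>h\<close> and \<open>a\<close> in the group algebra,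
  \<open>h (a x)\<close> is the augmentation of \<open>a\<close> times \<open>h x\<close>, as one
  sees on group elements. Hence \<open>h\<close> kills the generators of the submodule.\<close>

lemma aug_kill:
  assumes N: "module K N" and h: "h \<in> mod_hom K X N"
    and inv: "\<And>g x. \<lbrakk>g \<in> carrier G; x \<in> carrier X\<rbrakk> \<Longrightarrow> h (\<rho> g x) = h x" and x: "x \<in> aug"
  shows "h x = \<zero>\<^bsub>N\<^esub>"
proof -
  interpret N: module K N by (rule N)
  have "h (group_alg_act K G X \<rho> a x) = augmentation K G a \<odot>\<^bsub>N\<^esub> h x"
    if a: "a \<in> carrier (free_mod K (carrier G))" and x: "x \<in> carrier X" for a x
  proof -
    have hx: "h x \<in> carrier N" by (rule mod_hom_closed[OF h x])
    have one: "\<one>\<^bsub>K\<^esub> \<in> carrier (regular_mod K)" by (simp add: regular_mod_def)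
    have "h (group_alg_act K G X \<rho> a x) = free_lift K (carrier G) (regular_mod K) (\<lambda>_. \<one>\<^bsub>K\<^esub>) a \<odot>\<^bsub>N\<^esub> h x"
    proof (rule spanning_hom_eq[OF free_spanning[OF R.is_cring] free_mod_module[OF R.is_cring] N
          mod_hom_comp[OF group_alg_act_hom[OF x] h]
          mod_hom_comp[OF free_lift_hom[OF R.is_cring regular_mod_module[OF R.is_cring] one] mod_hom_smult_left[OF N hx]] _ a])
      fix b assume "b \<in> free_gen K (carrier G) ` carrier G"
      then obtain g where g: "g \<in> carrier G" "b = free_gen K (carrier G) g" by auto
      show "h (group_alg_act K G X \<rho> b x) = free_lift K (carrier G) (regular_mod K) (\<lambda>_. \<one>\<^bsub>K\<^esub>) b \<odot>\<^bsub>N\<^esub> h x"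
        unfolding g(2) group_alg_act_def
        using free_lift_gen[where h = "\<lambda>g. \<rho> g x", OF R.is_cring X_module act_closed[OF _ x] g(1)]
          free_lift_gen[OF R.is_cring regular_mod_module[OF R.is_cring] one g(1)] inv[OF g(1) x] hx by simp
    qed
    then show ?thesis by (simp add: augmentation_free_lift[OF R.is_cring a])
  qed
  then have "{group_alg_act K G X \<rho> a x | a x. a \<in> carrier (free_mod K (carrier G)) \<and> augmentation K G a = \<zero>\<^bsub>K\<^esub> \<and> x \<in> carrier X}
    \<subseteq> {x \<in> carrier X. h x = \<zero>\<^bsub>N\<^esub>}"
    using mod_hom_closed[OF group_alg_act_hom] mod_hom_closed[OF h] by auto
  from mod_span_least[OF X_module aug_gens_subset submodule_kernel[OF X_module N h] this]
  show ?thesis using x unfolding aug_ideal_mult_def by auto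
qed

text \<open>Apply the element \<open>g - 1\<close> of the group algebra, whose augmentation is
  zero.\<close>

lemma aug_diff:
  assumes g: "g \<in> carrier G" and x: "x \<in> carrier X"
  shows "\<rho> g x \<ominus>\<^bsub>X\<^esub> x \<in> aug"
proof -
  note cr = R.is_cring
  interpret F: module K "free_mod K (carrier G)" by (rule free_mod_module[OF cr])
  have one: "\<one>\<^bsub>K\<^esub> \<in> carrier (regular_mod K)" by (simp add: regular_mod_def)
  let ?a = "free_gen K (carrier G) g \<ominus>\<^bsub>free_mod K (carrier G)\<^esub> free_gen K (carrier G) \<one>\<^bsub>G\<^esub>"
  note c = free_gen_closed[OF cr g] free_gen_closed[OF cr G.one_closed]
  have a: "?a \<in> carrier (free_mod K (carrier G))" using c by simp
  have "group_alg_act K G X \<rho> ?a x = \<rho> g x \<ominus>\<^bsub>X\<^esub> x"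
    using mod_hom_minus[OF free_mod_module[OF cr] X_module group_alg_act_hom[OF x] c]
      free_lift_gen[where h = "\<lambda>g. \<rho> g x", OF cr X_module act_closed[OF _ x]] g x
    by (simp add: group_alg_act_def act_one)
  moreover have "augmentation K G ?a = \<zero>\<^bsub>K\<^esub>"
  proof -
    have "augmentation K G ?a = \<zero>\<^bsub>regular_mod K\<^esub>"
      unfolding augmentation_free_lift[OF cr a]
        mod_hom_minus[OF free_mod_module[OF cr] regular_mod_module[OF cr] free_lift_hom[OF cr regular_mod_module[OF cr] one] c]
        free_lift_gen[OF cr regular_mod_module[OF cr] one g] free_lift_gen[OF cr regular_mod_module[OF cr] one G.one_closed]
      using a_minus_eq_zero_iff[OF regular_mod_module[OF cr] one one] by simp
    then show ?thesis by (simp add: regular_mod_def)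
  qed
  ultimately have "\<rho> g x \<ominus>\<^bsub>X\<^esub> x \<in> {group_alg_act K G X \<rho> a x | a x.
      a \<in> carrier (free_mod K (carrier G)) \<and> augmentation K G a = \<zero>\<^bsub>K\<^esub> \<and> x \<in> carrier X}"
    using a x by (intro CollectI exI[of _ ?a] exI[of _ x]) auto
  then show ?thesis unfolding aug_ideal_mult_def using mod_span_superset[OF X_module aug_gens_subset] by auto
qed

end

text \<open>Composition in the quotient category is a nested \<open>quot_lift\<close>. Killing
  \<open>J\<close> in the second argument makes the inner value well defined, and killing
  \<open>I\<close> in the first then makes that value independent of the representative
  \<open>x\<close>.\<close>

lemma quot_bilinear:
  assumes X: "module K X" and Y: "module K Y" and N: "module K N"
    and I: "submodule I K X" and J: "submodule J K Y" and F: "bilinear_map K X Y N F"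
    and I0: "\<And>x y. \<lbrakk>x \<in> I; y \<in> carrier Y\<rbrakk> \<Longrightarrow> F x y = \<zero>\<^bsub>N\<^esub>"
    and J0: "\<And>x y. \<lbrakk>x \<in> carrier X; y \<in> J\<rbrakk> \<Longrightarrow> F x y = \<zero>\<^bsub>N\<^esub>"
  shows quot_bilinear_coset: "\<lbrakk>x \<in> carrier X; y \<in> carrier Y\<rbrakk> \<Longrightarrow>
      quot_lift (\<lambda>x. quot_lift (F x) (J +>\<^bsub>Y\<^esub> y)) (I +>\<^bsub>X\<^esub> x) = F x y"
    and quot_bilinear_map: "bilinear_map K (quot_mod X I) (quot_mod Y J) N (\<lambda>A B. quot_lift (\<lambda>x. quot_lift (F x) B) A)"
proof -
  have inner: "quot_lift (F x) (J +>\<^bsub>Y\<^esub> y) = F x y" if "x \<in> carrier X" "y \<in> carrier Y" for x y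
    by (rule quot_lift_hom_coset[OF Y J N bilinear_map_left[OF F that(1)] J0[OF that(1)] that(2)])
  have outer: "quot_lift (\<lambda>x. quot_lift (F x) (J +>\<^bsub>Y\<^esub> y)) (I +>\<^bsub>X\<^esub> x) = F x y" if xy: "x \<in> carrier X" "y \<in> carrier Y" for x y
  proof -
    have "quot_lift (\<lambda>x. quot_lift (F x) (J +>\<^bsub>Y\<^esub> y)) (I +>\<^bsub>X\<^esub> x) = quot_lift (F x) (J +>\<^bsub>Y\<^esub> y)"
    proof (rule quot_lift_coset[OF X I xy(1)])
      fix x' assume x': "x' \<in> carrier X" "x' \<ominus>\<^bsub>X\<^esub> x \<in> I"
      have "F x' y \<ominus>\<^bsub>N\<^esub> F x y = \<zero>\<^bsub>N\<^esub>"
        using mod_hom_minus[OF X N bilinear_map_right[OF F xy(2)] x'(1) xy(1)] I0[OF x'(2) xy(2)] by simp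
      then show "quot_lift (F x') (J +>\<^bsub>Y\<^esub> y) = quot_lift (F x) (J +>\<^bsub>Y\<^esub> y)"
        using inner x'(1) xy a_minus_eq_zero_iff[OF N] bilinear_map_closed[OF F] by simp
    qed
    then show ?thesis using inner xy by simp
  qed
  then show "\<lbrakk>x \<in> carrier X; y \<in> carrier Y\<rbrakk> \<Longrightarrow>
      quot_lift (\<lambda>x. quot_lift (F x) (J +>\<^bsub>Y\<^esub> y)) (I +>\<^bsub>X\<^esub> x) = F x y" .
  interpret X: module K X by (rule X)
  interpret Y: module K Y by (rule Y)
  show "bilinear_map K (quot_mod X I) (quot_mod Y J) N (\<lambda>A B. quot_lift (\<lambda>x. quot_lift (F x) B) A)"
    unfolding bilinear_map_def
  proof (intro conjI ballI)
    fix A assume "A \<in> carrier (quot_mod X I)"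
    then obtain x where x: "x \<in> carrier X" "A = I +>\<^bsub>X\<^esub> x" by (auto simp: quot_mod_carrier[OF X I])
    show "(\<lambda>B. quot_lift (\<lambda>x. quot_lift (F x) B) A) \<in> mod_hom K (quot_mod Y J) N"
      by (rule mod_homI) (auto simp: quot_mod_carrier[OF Y J] quot_mod_add[OF Y J] quot_mod_smult[OF Y J] x outer
          bilinear_map_closed[OF F] mod_hom_add[OF bilinear_map_left[OF F x(1)]] mod_hom_smult[OF bilinear_map_left[OF F x(1)]])
  next
    fix B assume "B \<in> carrier (quot_mod Y J)"
    then obtain y where y: "y \<in> carrier Y" "B = J +>\<^bsub>Y\<^esub> y" by (auto simp: quot_mod_carrier[OF Y J])
    show "(\<lambda>A. quot_lift (\<lambda>x. quot_lift (F x) B) A) \<in> mod_hom K (quot_mod X I) N"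
      by (rule mod_homI) (auto simp: quot_mod_carrier[OF X I] quot_mod_add[OF X I] quot_mod_smult[OF X I] y outer
          bilinear_map_closed[OF F] mod_hom_add[OF bilinear_map_right[OF F y(1)]] mod_hom_smult[OF bilinear_map_right[OF F y(1)]])
  qed
qed

text \<open>With \<open>g\<close> fixed the sum runs over a fixed finite support, so linearity in
  the parameter \<open>d\<close> is that of a finite sum of linear maps.\<close>

lemma dsum_lift_param_hom:
  assumes "cring K" "\<And>i. i \<in> I \<Longrightarrow> module K (X i)" "module K P" "module K N" "g \<in> carrier (dsum I X)"
    and "\<And>i x. \<lbrakk>i \<in> I; x \<in> carrier (X i)\<rbrakk> \<Longrightarrow> (\<lambda>d. h d i x) \<in> mod_hom K P N"
  shows "(\<lambda>d. dsum_lift I X N (h d) g) \<in> mod_hom K P N"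
  unfolding dsum_lift_def
proof (rule mod_hom_finsum_fun[OF assms(3,4)])
  show "finite {i \<in> I. g i \<noteq> \<zero>\<^bsub>X i\<^esub>}" using assms(5) by (simp add: dsum_def)
  fix i assume "i \<in> {i \<in> I. g i \<noteq> \<zero>\<^bsub>X i\<^esub>}"
  then show "(\<lambda>d. h d i (g i)) \<in> mod_hom K P N" using assms(5) by (intro assms(6)) (auto simp: dsum_def)
qed

section \<open>The quotient category\<close>

locale galois = A: free_category_action K G C \<phi> \<psi> + C: k_category K C
  for K :: "('k, 'z) ring_scheme" and G :: "('g, 'y) monoid_scheme"
    and C :: "('o, 'k, 'c) kcat" and \<phi> :: "'g \<Rightarrow> 'o \<Rightarrow> 'o" and \<psi> :: "'g \<Rightarrow> 'o \<Rightarrow> 'o \<Rightarrow> 'c \<Rightarrow> 'c" +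
  assumes K: "cring K"
begin

abbreviation "orb \<equiv> orbit G \<phi>"
abbreviation "B \<equiv> quot_cat K G C \<phi> \<psi>"

lemma act_Ob [simp]: "\<lbrakk>s \<in> carrier G; x \<in> Ob C\<rbrakk> \<Longrightarrow> \<phi> s x \<in> Ob C"
  using A.element_image by blast

lemma act_mult: "\<lbrakk>s \<in> carrier G; t \<in> carrier G; x \<in> Ob C\<rbrakk> \<Longrightarrow> \<phi> (s \<otimes>\<^bsub>G\<^esub> t) x = \<phi> s (\<phi> t x)"
  by (rule A.composition_rule)

lemma act_one [simp]: "x \<in> Ob C \<Longrightarrow> \<phi> \<one>\<^bsub>G\<^esub> x = x"
  using A.id_eq_one by (metis restrict_apply')

lemma act_inv: "\<lbrakk>s \<in> carrier G; x \<in> Ob C\<rbrakk> \<Longrightarrow> \<phi> (inv\<^bsub>G\<^esub> s) (\<phi> s x) = x"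
  by (simp add: act_mult[symmetric])

lemma act_inv2: "\<lbrakk>s \<in> carrier G; x \<in> Ob C\<rbrakk> \<Longrightarrow> \<phi> s (\<phi> (inv\<^bsub>G\<^esub> s) x) = x"
  by (simp add: act_mult[symmetric])

lemma act_eq_iff:
  assumes "s \<in> carrier G" "t \<in> carrier G" "x \<in> Ob C"
  shows "\<phi> s x = \<phi> t x \<longleftrightarrow> s = t"
proof
  assume "\<phi> s x = \<phi> t x"
  then have "\<phi> (inv\<^bsub>G\<^esub> t \<otimes>\<^bsub>G\<^esub> s) x = x" using assms by (simp add: act_mult act_inv)
  then have "inv\<^bsub>G\<^esub> t \<otimes>\<^bsub>G\<^esub> s = \<one>\<^bsub>G\<^esub>" using assms by (intro A.free) auto
  then have "t = s" using assms by (metis A.inv_closed A.inv_equality A.inv_inv)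
  then show "s = t" by simp
qed simp

lemma orb_iff: "y \<in> orb x \<longleftrightarrow> (\<exists>s\<in>carrier G. y = \<phi> s x)"
  by (auto simp: orbit_def)

lemma orb_self [simp]: "x \<in> Ob C \<Longrightarrow> x \<in> orb x"
  by (rule A.orbit_refl)

lemma orb_act_in [simp]: "s \<in> carrier G \<Longrightarrow> \<phi> s x \<in> orb x"
  by (auto simp: orb_iff)

lemma orb_Ob: "\<lbrakk>x \<in> Ob C; y \<in> orb x\<rbrakk> \<Longrightarrow> y \<in> Ob C"
  by (auto simp: orb_iff)

lemma orb_act [simp]:
  assumes "s \<in> carrier G" "x \<in> Ob C" shows "orb (\<phi> s x) = orb x"
proof (intro equalityI subsetI)
  fix y assume "y \<in> orb (\<phi> s x)"
  then show "y \<in> orb x" using assms by (auto simp: orb_iff act_mult[symmetric])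
next
  fix y assume "y \<in> orb x"
  then obtain t where t: "t \<in> carrier G" "y = \<phi> t x" by (auto simp: orb_iff)
  then have "y = \<phi> (t \<otimes>\<^bsub>G\<^esub> inv\<^bsub>G\<^esub> s) (\<phi> s x)" using assms by (simp add: act_mult act_inv)
  then show "y \<in> orb (\<phi> s x)" using t assms by (auto simp: orb_iff)
qed

lemma orb_eq: "\<lbrakk>x \<in> Ob C; y \<in> orb x\<rbrakk> \<Longrightarrow> orb y = orb x"
  by (auto simp: orb_iff)

lemma Ob_B: "Ob B = orb ` Ob C"
  by (auto simp: quot_cat_def orbits_def)

lemma orb_Ob_B [simp]: "x \<in> Ob C \<Longrightarrow> orb x \<in> Ob B"
  by (simp add: Ob_B)

lemma Ob_B_sub: "\<lbrakk>u \<in> Ob B; x \<in> u\<rbrakk> \<Longrightarrow> x \<in> Ob C \<and> orb x = u"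
proof -
  assume "u \<in> Ob B" "x \<in> u"
  then obtain y where "y \<in> Ob C" "u = orb y" "x \<in> orb y" by (auto simp: Ob_B)
  then show ?thesis using orb_eq[of y x] orb_Ob[of y x] by simp
qed

lemma Ob_B_act: "\<lbrakk>u \<in> Ob B; x \<in> u; s \<in> carrier G\<rbrakk> \<Longrightarrow> \<phi> s x \<in> u"
  using Ob_B_sub[of u x] orb_act_in[of s x] by simp

text \<open>The connecting element of \<open>orbit_comp\<close>; freeness of the action makes it
  unique.\<close>

definition tr :: "'o \<Rightarrow> 'o \<Rightarrow> 'g" where
  "tr x y = (THE s. s \<in> carrier G \<and> \<phi> s x = y)"

lemma tr_act: "\<lbrakk>s \<in> carrier G; x \<in> Ob C\<rbrakk> \<Longrightarrow> tr x (\<phi> s x) = s"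
  unfolding tr_def by (rule the_equality) (auto simp: act_eq_iff)

lemma tr_self [simp]: "x \<in> Ob C \<Longrightarrow> tr x x = \<one>\<^bsub>G\<^esub>"
  using tr_act[of "\<one>\<^bsub>G\<^esub>" x] by simp

lemma
  assumes "x \<in> Ob C" "y \<in> orb x"
  shows tr_closed: "tr x y \<in> carrier G" and tr_eq: "\<phi> (tr x y) x = y"
  using assms tr_act by (auto simp: orb_iff)

lemma tr_act_left:
  assumes "x \<in> Ob C" "y \<in> orb x" "s \<in> carrier G"
  shows "tr (\<phi> s x) y = tr x y \<otimes>\<^bsub>G\<^esub> inv\<^bsub>G\<^esub> s"
proof -
  have "\<phi> (tr x y \<otimes>\<^bsub>G\<^esub> inv\<^bsub>G\<^esub> s) (\<phi> s x) = y"
    using assms tr_closed[OF assms(1,2)] by (simp add: act_mult act_inv tr_eq)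
  then show ?thesis
    using tr_act[of "tr x y \<otimes>\<^bsub>G\<^esub> inv\<^bsub>G\<^esub> s" "\<phi> s x"] assms tr_closed[OF assms(1,2)] by simp
qed

lemma tr_act_right:
  assumes "x \<in> Ob C" "y \<in> orb x" "s \<in> carrier G"
  shows "tr x (\<phi> s y) = s \<otimes>\<^bsub>G\<^esub> tr x y"
  using tr_act[of "s \<otimes>\<^bsub>G\<^esub> tr x y" x] assms tr_closed[OF assms(1,2)] by (simp add: act_mult tr_eq)

lemmas mor_closed = mod_hom_closed[OF A.mor_linear]

section \<open>Sums of morphism spaces over pairs of orbits, and their classes\<close>

abbreviation "HomC \<equiv> \<lambda>(y, x). Hom C y x"
abbreviation "OH \<equiv> orbit_hom C"
abbreviation "oi \<equiv> orbit_inj C"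
abbreviation "oact \<equiv> orbit_hom_act C \<phi> \<psi>"

lemma HomC_module: "\<lbrakk>v \<in> Ob B; u \<in> Ob B; p \<in> v \<times> u\<rbrakk> \<Longrightarrow> module K (HomC p)"
  by (cases p) (auto dest: Ob_B_sub intro!: C.Hom_module)

lemma OH_module: "\<lbrakk>v \<in> Ob B; u \<in> Ob B\<rbrakk> \<Longrightarrow> module K (OH v u)"
  unfolding orbit_hom_def by (rule dsum_module[OF K HomC_module])

lemma oi_hom: "\<lbrakk>v \<in> Ob B; u \<in> Ob B; y \<in> v; x \<in> u\<rbrakk> \<Longrightarrow> oi v u y x \<in> mod_hom K (Hom C y x) (OH v u)"
  using dsum_inj_hom[where I = "v \<times> u" and X = HomC and i = "(y, x)", OF K HomC_module]
  unfolding orbit_hom_def orbit_inj_def by simp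

lemmas oi_closed = mod_hom_closed[OF oi_hom]

lemma OH_hom_eq:
  assumes "v \<in> Ob B" "u \<in> Ob B" "module K N" "h \<in> mod_hom K (OH v u) N" "g \<in> mod_hom K (OH v u) N"
    and "\<And>y x c. \<lbrakk>y \<in> v; x \<in> u; c \<in> carrier (Hom C y x)\<rbrakk> \<Longrightarrow> h (oi v u y x c) = g (oi v u y x c)"
    and "f \<in> carrier (OH v u)"
  shows "h f = g f"
proof (rule dsum_hom_eq[where I = "v \<times> u" and X = HomC, OF K HomC_module[OF assms(1,2)] assms(3)])
  fix p c assume "p \<in> v \<times> u" "c \<in> carrier (HomC p)"
  then show "h (dsum_inj (v \<times> u) HomC p c) = g (dsum_inj (v \<times> u) HomC p c)"
    using assms(6)[unfolded orbit_inj_def] by (cases p) auto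
qed (use assms(4,5,7) in \<open>auto simp: orbit_hom_def\<close>)

context
  fixes v u and N :: "('k, 'b) module" and h
  assumes vu: "v \<in> Ob B" "u \<in> Ob B" and N: "module K N"
    and h: "\<And>y x. \<lbrakk>y \<in> v; x \<in> u\<rbrakk> \<Longrightarrow> h (y, x) \<in> mod_hom K (Hom C y x) N"
begin

private lemma h': "p \<in> v \<times> u \<Longrightarrow> h p \<in> mod_hom K (HomC p) N"
  using h by (cases p) auto

lemma OH_lift_hom: "dsum_lift (v \<times> u) HomC N h \<in> mod_hom K (OH v u) N"
  unfolding orbit_hom_def by (rule dsum_lift_hom[OF K HomC_module[OF vu] N h'])

lemma OH_lift_oi: "\<lbrakk>y \<in> v; x \<in> u; c \<in> carrier (Hom C y x)\<rbrakk> \<Longrightarrow> dsum_lift (v \<times> u) HomC N h (oi v u y x c) = h (y, x) c"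
  unfolding orbit_inj_def
  using dsum_lift_inj[where I = "v \<times> u" and X = HomC and i = "(y, x)" and x = c, OF K HomC_module[OF vu] N h'] by simp

end

lemma oact_step_hom:
  assumes "v \<in> Ob B" "u \<in> Ob B" "s \<in> carrier G" "y \<in> v" "x \<in> u"
  shows "(\<lambda>c. oi v u (\<phi> s y) (\<phi> s x) (\<psi> s y x c)) \<in> mod_hom K (Hom C y x) (OH v u)"
  using assms Ob_B_sub by (intro mod_hom_comp[OF A.mor_linear oi_hom] Ob_B_act) auto

lemma oact_hom: "\<lbrakk>v \<in> Ob B; u \<in> Ob B; s \<in> carrier G\<rbrakk> \<Longrightarrow> oact v u s \<in> mod_hom K (OH v u) (OH v u)"
  unfolding orbit_hom_act_def using OH_lift_hom[OF _ _ OH_module] oact_step_hom by simp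

lemma oact_oi: "\<lbrakk>v \<in> Ob B; u \<in> Ob B; s \<in> carrier G; y \<in> v; x \<in> u; c \<in> carrier (Hom C y x)\<rbrakk>
    \<Longrightarrow> oact v u s (oi v u y x c) = oi v u (\<phi> s y) (\<phi> s x) (\<psi> s y x c)"
  unfolding orbit_hom_act_def using OH_lift_oi[OF _ _ OH_module] oact_step_hom by simp

lemma kg_OH:
  assumes vu: "v \<in> Ob B" "u \<in> Ob B"
  shows "kg_module G K (OH v u) (oact v u)"
proof (intro kg_module.intro kg_module_axioms.intro A.is_group OH_module oact_hom vu)
  note m = OH_module[OF vu]
  fix g h f assume gh: "g \<in> carrier G" "h \<in> carrier G" and f: "f \<in> carrier (OH v u)"
  show "oact v u (g \<otimes>\<^bsub>G\<^esub> h) f = oact v u g (oact v u h f)"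
  proof (rule OH_hom_eq[OF vu m oact_hom[OF vu] mod_hom_comp[OF oact_hom[OF vu] oact_hom[OF vu]] _ f])
    fix y x c assume c: "y \<in> v" "x \<in> u" "c \<in> carrier (Hom C y x)"
    then show "oact v u (g \<otimes>\<^bsub>G\<^esub> h) (oi v u y x c) = oact v u g (oact v u h (oi v u y x c))"
      using vu gh Ob_B_sub[OF vu(1) c(1)] Ob_B_sub[OF vu(2) c(2)]
      by (simp add: oact_oi Ob_B_act mor_closed A.mor_mult act_mult)
  qed (use gh in auto)
next
  fix f assume f: "f \<in> carrier (OH v u)"
  show "oact v u \<one>\<^bsub>G\<^esub> f = f"
  proof (rule OH_hom_eq[OF vu OH_module[OF vu] oact_hom[OF vu] mod_hom_id _ f])
    fix y x c assume c: "y \<in> v" "x \<in> u" "c \<in> carrier (Hom C y x)"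
    then show "oact v u \<one>\<^bsub>G\<^esub> (oi v u y x c) = oi v u y x c"
      using vu Ob_B_sub[OF vu(1) c(1)] Ob_B_sub[OF vu(2) c(2)] by (simp add: oact_oi A.mor_one)
  qed simp
qed

abbreviation "augOH v u \<equiv> aug_ideal_mult K G (OH v u) (oact v u)"
abbreviation "cl v u \<equiv> orbit_class K G C \<phi> \<psi> v u"

lemma Hom_B: "Hom B v u = quot_mod (OH v u) (augOH v u)"
  by (simp add: quot_cat_def coinvariants_def)

lemma augOH_submodule: "\<lbrakk>v \<in> Ob B; u \<in> Ob B\<rbrakk> \<Longrightarrow> submodule (augOH v u) K (OH v u)"
  by (rule kg_module.aug_submodule[OF kg_OH])

lemma Hom_B_module: "\<lbrakk>v \<in> Ob B; u \<in> Ob B\<rbrakk> \<Longrightarrow> module K (Hom B v u)"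
  unfolding Hom_B by (rule quot_mod_module[OF OH_module augOH_submodule])

lemma cl_hom: "\<lbrakk>v \<in> Ob B; u \<in> Ob B\<rbrakk> \<Longrightarrow> cl v u \<in> mod_hom K (OH v u) (Hom B v u)"
  using quot_mod_proj[OF OH_module augOH_submodule, of v u] unfolding Hom_B orbit_class_def[abs_def] by simp

lemma cl_surj: "\<lbrakk>v \<in> Ob B; u \<in> Ob B\<rbrakk> \<Longrightarrow> cl v u ` carrier (OH v u) = carrier (Hom B v u)"
  using quot_mod_carrier[OF OH_module augOH_submodule, of v u] unfolding Hom_B orbit_class_def[abs_def] by simp

lemma cl_act:
  assumes vu: "v \<in> Ob B" "u \<in> Ob B" and s: "s \<in> carrier G" and f: "f \<in> carrier (OH v u)"
  shows "cl v u (oact v u s f) = cl v u f"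
  unfolding orbit_class_def
  using coset_eq_iff[OF OH_module[OF vu] augOH_submodule[OF vu] mod_hom_closed[OF oact_hom[OF vu s] f] f]
    kg_module.aug_diff[OF kg_OH[OF vu] s f] by simp

abbreviation "mc \<equiv> mor_class K G C \<phi> \<psi>"

lemma mc_eq: "mc y x c = cl (orb y) (orb x) (oi (orb y) (orb x) y x c)"
  by (simp add: mor_class_def)

lemma mc_hom: "\<lbrakk>y \<in> Ob C; x \<in> Ob C\<rbrakk> \<Longrightarrow> mc y x \<in> mod_hom K (Hom C y x) (Hom B (orb y) (orb x))"
  using mod_hom_comp[OF oi_hom cl_hom, of "orb y" "orb x" y x] by (simp add: mc_eq[abs_def])

lemmas mc_closed = mod_hom_closed[OF mc_hom]

lemma mc_act:
  assumes "s \<in> carrier G" "y \<in> Ob C" "x \<in> Ob C" "c \<in> carrier (Hom C y x)"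
  shows "mc (\<phi> s y) (\<phi> s x) (\<psi> s y x c) = mc y x c"
  using cl_act[of "orb y" "orb x" s "oi (orb y) (orb x) y x c"] assms oact_oi[of "orb y" "orb x" s y x c]
    oi_closed[of "orb y" "orb x" y x c] by (simp add: mc_eq)

text \<open>Every morphism between members of the two orbits has a translate that ends at the given
  \<open>y\<close>, with the same class. With the end fixed, lifts of composable morphisms can be
  chained together.\<close>

lemma Hom_B_spanning:
  assumes y: "y \<in> Ob C" and u: "u \<in> Ob B"
  shows "spanning K (Hom B (orb y) u) {mc y x c | x c. x \<in> u \<and> c \<in> carrier (Hom C y x)}"
proof -
  have v: "orb y \<in> Ob B" using y by simp
  have "spanning K (OH (orb y) u) {dsum_inj (orb y \<times> u) HomC p c | p c. p \<in> orb y \<times> u \<and> c \<in> carrier (HomC p)}"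
    unfolding orbit_hom_def by (rule dsum_spanning[OF K HomC_module[OF v u]])
  from spanning_image[OF this OH_module[OF v u] Hom_B_module[OF v u] cl_hom[OF v u] cl_surj[OF v u]]
  have sp: "spanning K (Hom B (orb y) u) (cl (orb y) u ` {dsum_inj (orb y \<times> u) HomC p c | p c. p \<in> orb y \<times> u \<and> c \<in> carrier (HomC p)})" .
  have "cl (orb y) u ` {dsum_inj (orb y \<times> u) HomC p c | p c. p \<in> orb y \<times> u \<and> c \<in> carrier (HomC p)}
    \<subseteq> {mc y x c | x c. x \<in> u \<and> c \<in> carrier (Hom C y x)}"
  proof
    fix z assume "z \<in> cl (orb y) u ` {dsum_inj (orb y \<times> u) HomC p c | p c. p \<in> orb y \<times> u \<and> c \<in> carrier (HomC p)}"
    then obtain y' x c where c: "y' \<in> orb y" "x \<in> u" "c \<in> carrier (Hom C y' x)" "z = cl (orb y) u (oi (orb y) u y' x c)"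
      by (auto simp: orbit_inj_def)
    have y': "y' \<in> Ob C" "orb y' = orb y" using orb_Ob[OF y c(1)] orb_eq[OF y c(1)] by auto
    have x: "x \<in> Ob C" "orb x = u" using Ob_B_sub[OF u c(2)] by auto
    have yy: "y \<in> orb y'" using y y' by simp
    define s where "s = tr y' y"
    have s: "s \<in> carrier G" "\<phi> s y' = y" using tr_closed[OF y'(1) yy] tr_eq[OF y'(1) yy] by (auto simp: s_def)
    have "z = mc y' x c" using c x y' by (simp add: mc_eq)
    also have "\<dots> = mc y (\<phi> s x) (\<psi> s y' x c)" using mc_act[OF s(1) y'(1) x(1) c(3)] s by simp
    finally show "z \<in> {mc y x c | x c. x \<in> u \<and> c \<in> carrier (Hom C y x)}"
      using mor_closed[OF s(1) y'(1) x(1) c(3)] s Ob_B_act[OF u c(2) s(1)] by auto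
  qed
  moreover have "{mc y x c | x c. x \<in> u \<and> c \<in> carrier (Hom C y x)} \<subseteq> carrier (Hom B (orb y) u)"
  proof
    fix z assume "z \<in> {mc y x c | x c. x \<in> u \<and> c \<in> carrier (Hom C y x)}"
    then obtain x c where c: "x \<in> u" "c \<in> carrier (Hom C y x)" "z = mc y x c" by auto
    then show "z \<in> carrier (Hom B (orb y) u)" using Ob_B_sub[OF u c(1)] mc_closed[OF y _ c(2)] by simp
  qed
  ultimately show ?thesis by (rule spanning_mono[OF sp])
qed

subsection \<open>Composition\<close>

text \<open>The summand of \<open>orbit_comp\<close> for one morphism in each factor;
  \<open>oinner\<close> below extends it linearly in the second factor. Through these
  \<open>orbit_comp\<close> is analysed one variable at a time.\<close>

definition oterm :: "'o set \<Rightarrow> 'o set \<Rightarrow> 'o \<Rightarrow> 'o \<Rightarrow> 'o \<Rightarrow> 'o \<Rightarrow> 'c \<Rightarrow> 'c \<Rightarrow> ('o \<times> 'o \<Rightarrow> 'c)" where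
  "oterm w u z y' y x d c = oi w u (\<phi> (tr y' y) z) x (Cmp C (\<phi> (tr y' y) z) y x (\<psi> (tr y' y) z y' d) c)"

abbreviation "oc \<equiv> orbit_comp G C \<phi> \<psi>"

context
  fixes w v u
  assumes w: "w \<in> Ob B" and v: "v \<in> Ob B" and u: "u \<in> Ob B"
begin

private lemma trv:
  assumes "y' \<in> v" "y \<in> v"
  shows "tr y' y \<in> carrier G" "\<phi> (tr y' y) y' = y"
  using tr_closed[of y' y] tr_eq[of y' y] Ob_B_sub[OF v assms(1)] assms(2) by auto

lemma oterm_hom_right:
  assumes "z \<in> w" "y' \<in> v" "y \<in> v" "x \<in> u" "d \<in> carrier (Hom C z y')"
  shows "oterm w u z y' y x d \<in> mod_hom K (Hom C y x) (OH w u)"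
proof -
  note t = trv[OF assms(2,3)]
  have z: "\<phi> (tr y' y) z \<in> w" "\<phi> (tr y' y) z \<in> Ob C" "z \<in> Ob C" "x \<in> Ob C" "y \<in> Ob C" "y' \<in> Ob C"
    using Ob_B_act[OF w assms(1) t(1)] Ob_B_sub[OF w assms(1)] Ob_B_sub[OF u assms(4)] Ob_B_sub[OF v assms(3)] Ob_B_sub[OF v assms(2)] t
    by auto
  have "\<psi> (tr y' y) z y' d \<in> carrier (Hom C (\<phi> (tr y' y) z) y)"
    using mor_closed[OF t(1) z(3,6) assms(5)] t by simp
  then show ?thesis
    unfolding oterm_def[abs_def]
    by (rule mod_hom_comp[OF bilinear_map_left[OF C.Cmp_bilinear[OF z(2,5,4)]] oi_hom[OF w u z(1) assms(4)]])
qed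

lemma oterm_hom_left:
  assumes "z \<in> w" "y' \<in> v" "y \<in> v" "x \<in> u" "c \<in> carrier (Hom C y x)"
  shows "(\<lambda>d. oterm w u z y' y x d c) \<in> mod_hom K (Hom C z y') (OH w u)"
proof -
  note t = trv[OF assms(2,3)]
  have z: "\<phi> (tr y' y) z \<in> w" "\<phi> (tr y' y) z \<in> Ob C" "z \<in> Ob C" "x \<in> Ob C" "y \<in> Ob C" "y' \<in> Ob C"
    using Ob_B_act[OF w assms(1) t(1)] Ob_B_sub[OF w assms(1)] Ob_B_sub[OF u assms(4)] Ob_B_sub[OF v assms(3)] Ob_B_sub[OF v assms(2)] t
    by auto
  have "\<psi> (tr y' y) z y' \<in> mod_hom K (Hom C z y') (Hom C (\<phi> (tr y' y) z) y)"
    using A.mor_linear[OF t(1) z(3,6)] t by simp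
  from mod_hom_comp[OF mod_hom_comp[OF this bilinear_map_right[OF C.Cmp_bilinear[OF z(2,5,4)] assms(5)]] oi_hom[OF w u z(1) assms(4)]]
  show ?thesis unfolding oterm_def .
qed

definition oinner :: "'o \<Rightarrow> 'o \<Rightarrow> 'c \<Rightarrow> ('o \<times> 'o \<Rightarrow> 'c) \<Rightarrow> ('o \<times> 'o \<Rightarrow> 'c)" where
  "oinner z y' d = dsum_lift (v \<times> u) HomC (OH w u) (\<lambda>(y, x). oterm w u z y' y x d)"

lemma oinner_hom_right: "\<lbrakk>z \<in> w; y' \<in> v; d \<in> carrier (Hom C z y')\<rbrakk> \<Longrightarrow> oinner z y' d \<in> mod_hom K (OH v u) (OH w u)"
  unfolding oinner_def using OH_lift_hom[OF v u OH_module[OF w u]] oterm_hom_right by simp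

lemma oinner_oi: "\<lbrakk>z \<in> w; y' \<in> v; d \<in> carrier (Hom C z y'); y \<in> v; x \<in> u; c \<in> carrier (Hom C y x)\<rbrakk>
    \<Longrightarrow> oinner z y' d (oi v u y x c) = oterm w u z y' y x d c"
  unfolding oinner_def using OH_lift_oi[OF v u OH_module[OF w u]] oterm_hom_right by simp

lemma oinner_hom_left:
  assumes "z \<in> w" "y' \<in> v" "g \<in> carrier (OH v u)"
  shows "(\<lambda>d. oinner z y' d g) \<in> mod_hom K (Hom C z y') (OH w u)"
  unfolding oinner_def
proof (rule dsum_lift_param_hom[OF K HomC_module[OF v u] _ OH_module[OF w u] assms(3)[unfolded orbit_hom_def]])
  show "module K (Hom C z y')" using Ob_B_sub[OF w assms(1)] Ob_B_sub[OF v assms(2)] C.Hom_module by blast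
  fix p c assume "p \<in> v \<times> u" "c \<in> carrier (HomC p)"
  then show "(\<lambda>d. (case p of (y, x) \<Rightarrow> oterm w u z y' y x d) c) \<in> mod_hom K (Hom C z y') (OH w u)"
    using oterm_hom_left[OF assms(1,2)] by (cases p) auto
qed

lemma oc_eq: "oc w v u f g = dsum_lift (w \<times> v) HomC (OH w u) (\<lambda>(z, y') d. oinner z y' d g) f"
  unfolding orbit_comp_def oinner_def oterm_def tr_def Let_def by simp

lemma oc_hom_left: "g \<in> carrier (OH v u) \<Longrightarrow> (\<lambda>f. oc w v u f g) \<in> mod_hom K (OH w v) (OH w u)"
  unfolding oc_eq using OH_lift_hom[OF w v OH_module[OF w u], of "\<lambda>(z, y') d. oinner z y' d g"] oinner_hom_left
  by (simp add: case_prod_beta)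

lemma oc_oi_left: "\<lbrakk>z \<in> w; y' \<in> v; d \<in> carrier (Hom C z y'); g \<in> carrier (OH v u)\<rbrakk>
    \<Longrightarrow> oc w v u (oi w v z y' d) g = oinner z y' d g"
  unfolding oc_eq using OH_lift_oi[OF w v OH_module[OF w u], of "\<lambda>(z, y') d. oinner z y' d g"] oinner_hom_left
  by (simp add: case_prod_beta)

lemma oc_hom_right:
  assumes "f \<in> carrier (OH w v)"
  shows "oc w v u f \<in> mod_hom K (OH v u) (OH w u)"
  unfolding oc_eq[abs_def]
proof (rule dsum_lift_param_hom[OF K HomC_module[OF w v] OH_module[OF v u] OH_module[OF w u] assms[unfolded orbit_hom_def]])
  fix p d assume "p \<in> w \<times> v" "d \<in> carrier (HomC p)"
  then show "(\<lambda>g. (case p of (z, y') \<Rightarrow> \<lambda>d. oinner z y' d g) d) \<in> mod_hom K (OH v u) (OH w u)"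
    using oinner_hom_right by (cases p) auto
qed

text \<open>Translating the left factor by \<open>s\<close> multiplies the connecting element on the
  right by the inverse of \<open>s\<close>, and the two cancel. The composites agree even before
  passing to classes.\<close>

lemma oc_act_left:
  assumes s: "s \<in> carrier G" and f: "f \<in> carrier (OH w v)" and g: "g \<in> carrier (OH v u)"
  shows "oc w v u (oact w v s f) g = oc w v u f g"
proof (rule OH_hom_eq[OF w v OH_module[OF w u] mod_hom_comp[OF oact_hom[OF w v s] oc_hom_left[OF g]] oc_hom_left[OF g] _ f])
  fix z y' d assume d: "z \<in> w" "y' \<in> v" "d \<in> carrier (Hom C z y')"
  have zy: "z \<in> Ob C" "y' \<in> Ob C" using Ob_B_sub[OF w d(1)] Ob_B_sub[OF v d(2)] by auto
  note sd = Ob_B_act[OF w d(1) s] Ob_B_act[OF v d(2) s] mor_closed[OF s zy d(3)]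
  have "oinner (\<phi> s z) (\<phi> s y') (\<psi> s z y' d) g = oinner z y' d g"
  proof (rule OH_hom_eq[OF v u OH_module[OF w u] oinner_hom_right[OF sd] oinner_hom_right[OF d] _ g])
    fix y x c assume c: "y \<in> v" "x \<in> u" "c \<in> carrier (Hom C y x)"
    note t = trv[OF d(2) c(1)]
    have "y \<in> orb y'" using Ob_B_sub[OF v d(2)] c(1) by simp
    then have tr: "tr (\<phi> s y') y = tr y' y \<otimes>\<^bsub>G\<^esub> inv\<^bsub>G\<^esub> s" using zy s by (simp add: tr_act_left)
    have ts: "tr y' y \<otimes>\<^bsub>G\<^esub> inv\<^bsub>G\<^esub> s \<in> carrier G" using t s by simp
    have "\<phi> (tr y' y \<otimes>\<^bsub>G\<^esub> inv\<^bsub>G\<^esub> s) (\<phi> s z) = \<phi> (tr y' y) z"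
      using t s zy by (simp add: act_mult act_inv)
    moreover have "\<psi> (tr y' y \<otimes>\<^bsub>G\<^esub> inv\<^bsub>G\<^esub> s) (\<phi> s z) (\<phi> s y') (\<psi> s z y' d) = \<psi> (tr y' y) z y' d"
      using A.mor_mult[OF ts s zy d(3)] t s by (simp add: A.m_assoc)
    ultimately show "oinner (\<phi> s z) (\<phi> s y') (\<psi> s z y' d) (oi v u y x c) = oinner z y' d (oi v u y x c)"
      unfolding oinner_oi[OF sd c] oinner_oi[OF d c] oterm_def tr by simp
  qed
  then show "oc w v u (oact w v s (oi w v z y' d)) g = oc w v u (oi w v z y' d) g"
    by (simp add: oact_oi[OF w v s d] oc_oi_left[OF sd g] oc_oi_left[OF d g])
qed

text \<open>Translating the right factor by \<open>s\<close> multiplies the connecting element on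
  the left by \<open>s\<close>, so each elementary composite is translated by \<open>s\<close>. This
  is why the equation is one of classes.\<close>

lemma oc_act_right:
  assumes s: "s \<in> carrier G" and f: "f \<in> carrier (OH w v)" and g: "g \<in> carrier (OH v u)"
  shows "cl w u (oc w v u f (oact v u s g)) = cl w u (oc w v u f g)"
proof (rule OH_hom_eq[OF w v Hom_B_module[OF w u] mod_hom_comp[OF oc_hom_left[OF mod_hom_closed[OF oact_hom[OF v u s] g]] cl_hom[OF w u]]
      mod_hom_comp[OF oc_hom_left[OF g] cl_hom[OF w u]] _ f])
  fix z y' d assume d: "z \<in> w" "y' \<in> v" "d \<in> carrier (Hom C z y')"
  have zy: "z \<in> Ob C" "y' \<in> Ob C" using Ob_B_sub[OF w d(1)] Ob_B_sub[OF v d(2)] by auto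
  have "cl w u (oinner z y' d (oact v u s g)) = cl w u (oinner z y' d g)"
  proof (rule OH_hom_eq[OF v u Hom_B_module[OF w u] mod_hom_comp[OF mod_hom_comp[OF oact_hom[OF v u s] oinner_hom_right[OF d]] cl_hom[OF w u]]
        mod_hom_comp[OF oinner_hom_right[OF d] cl_hom[OF w u]] _ g])
    fix y x c assume c: "y \<in> v" "x \<in> u" "c \<in> carrier (Hom C y x)"
    have yx: "y \<in> Ob C" "x \<in> Ob C" using Ob_B_sub[OF v c(1)] Ob_B_sub[OF u c(2)] by auto
    note sc = Ob_B_act[OF v c(1) s] Ob_B_act[OF u c(2) s] mor_closed[OF s yx c(3)]
    note t = trv[OF d(2) c(1)]
    have "y \<in> orb y'" using Ob_B_sub[OF v d(2)] c(1) by simp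
    then have tr: "tr y' (\<phi> s y) = s \<otimes>\<^bsub>G\<^esub> tr y' y" using zy s by (simp add: tr_act_right)
    let ?z = "\<phi> (tr y' y) z" and ?d = "\<psi> (tr y' y) z y' d"
    have z: "?z \<in> w" "?z \<in> Ob C" using Ob_B_act[OF w d(1) t(1)] t zy by auto
    have dc: "?d \<in> carrier (Hom C ?z y)" using mor_closed[OF t(1) zy d(3)] t by simp
    have e: "Cmp C ?z y x ?d c \<in> carrier (Hom C ?z x)"
      by (rule bilinear_map_closed[OF C.Cmp_bilinear[OF z(2) yx] dc c(3)])
    have "\<psi> (s \<otimes>\<^bsub>G\<^esub> tr y' y) z y' d = \<psi> s ?z y ?d"
      using A.mor_mult[OF s t(1) zy d(3)] t by simp
    then have "oterm w u z y' (\<phi> s y) (\<phi> s x) d (\<psi> s y x c) = oi w u (\<phi> s ?z) (\<phi> s x) (\<psi> s ?z x (Cmp C ?z y x ?d c))"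
      unfolding oterm_def tr using s t zy by (simp add: act_mult A.mor_Cmp[OF s z(2) yx dc c(3)])
    also have "\<dots> = oact w u s (oterm w u z y' y x d c)"
      unfolding oterm_def using oact_oi[OF w u s z(1) c(2) e] by simp
    finally show "cl w u (oinner z y' d (oact v u s (oi v u y x c))) = cl w u (oinner z y' d (oi v u y x c))"
      using cl_act[OF w u s mod_hom_closed[OF oterm_hom_right[OF d(1,2) c(1,2) d(3)] c(3)]]
      by (simp add: oact_oi[OF v u s c] oinner_oi[OF d sc] oinner_oi[OF d c])
  qed
  then show "cl w u (oc w v u (oi w v z y' d) (oact v u s g)) = cl w u (oc w v u (oi w v z y' d) g)"
    by (simp add: oc_oi_left[OF d] g mod_hom_closed[OF oact_hom[OF v u s] g])
qed

private lemma clc_bilinear: "bilinear_map K (OH w v) (OH v u) (Hom B w u) (\<lambda>f g. cl w u (oc w v u f g))"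
  unfolding bilinear_map_def
  using mod_hom_comp[OF oc_hom_left cl_hom[OF w u]] mod_hom_comp[OF oc_hom_right cl_hom[OF w u]] by blast

private lemma clc_left: "\<lbrakk>f \<in> augOH w v; g \<in> carrier (OH v u)\<rbrakk> \<Longrightarrow> cl w u (oc w v u f g) = \<zero>\<^bsub>Hom B w u\<^esub>"
  by (rule kg_module.aug_kill[OF kg_OH[OF w v] Hom_B_module[OF w u] bilinear_map_right[OF clc_bilinear]])
     (simp_all add: oc_act_left)

private lemma clc_right: "\<lbrakk>f \<in> carrier (OH w v); g \<in> augOH v u\<rbrakk> \<Longrightarrow> cl w u (oc w v u f g) = \<zero>\<^bsub>Hom B w u\<^esub>"
  by (rule kg_module.aug_kill[OF kg_OH[OF v u] Hom_B_module[OF w u] bilinear_map_left[OF clc_bilinear]])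
     (simp_all add: oc_act_right)

lemma Cmp_B_bilinear: "bilinear_map K (Hom B w v) (Hom B v u) (Hom B w u) (Cmp B w v u)"
  using quot_bilinear_map[OF OH_module[OF w v] OH_module[OF v u] Hom_B_module[OF w u] augOH_submodule[OF w v] augOH_submodule[OF v u]
      clc_bilinear clc_left clc_right]
  unfolding Hom_B by (simp add: quot_cat_def)

lemma Cmp_B_cl:
  assumes f: "f \<in> carrier (OH w v)" and g: "g \<in> carrier (OH v u)"
  shows "Cmp B w v u (cl w v f) (cl v u g) = cl w u (oc w v u f g)"
  using quot_bilinear_coset[OF OH_module[OF w v] OH_module[OF v u] Hom_B_module[OF w u] augOH_submodule[OF w v] augOH_submodule[OF v u]
      clc_bilinear clc_left clc_right f g]
  by (simp add: quot_cat_def orbit_class_def)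

end

text \<open>For composable morphisms the connecting element \<open>tr y y\<close> is one. This is
  the functoriality of the covering, through which the lifted bimodule inherits its axioms.\<close>

lemma Cmp_B_mc:
  assumes "z \<in> Ob C" "y \<in> Ob C" "x \<in> Ob C" "d \<in> carrier (Hom C z y)" "c \<in> carrier (Hom C y x)"
  shows "Cmp B (orb z) (orb y) (orb x) (mc z y d) (mc y x c) = mc z x (Cmp C z y x d c)"
proof -
  have o: "orb z \<in> Ob B" "orb y \<in> Ob B" "orb x \<in> Ob B" using assms by auto
  have i: "oi (orb z) (orb y) z y d \<in> carrier (OH (orb z) (orb y))" "oi (orb y) (orb x) y x c \<in> carrier (OH (orb y) (orb x))"
    using assms by (auto intro!: oi_closed)
  show ?thesis
    unfolding mc_eq Cmp_B_cl[OF o i] using assms o i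
    by (simp add: oc_oi_left[OF o] oinner_oi[OF o] oterm_def A.mor_one)
qed

end

section \<open>The chain complexes of a Galois covering\<close>

text \<open>A tree of bounded depth with finite branching has finitely many branches. It bounds the
  number of lifts of a generator: after the first object, each next object has finitely many
  options.\<close>

lemma finite_paths:
  assumes "finite A" "\<And>i y. finite (S i y)"
  shows "finite {xs. length xs = Suc n \<and> xs ! 0 \<in> A \<and> (\<forall>i<n. xs ! Suc i \<in> S i (xs ! i))}"
proof (induction n)
  case 0
  have "{xs. length xs = Suc 0 \<and> xs ! 0 \<in> A \<and> (\<forall>i<0. xs ! Suc i \<in> S i (xs ! i))} \<subseteq> (\<lambda>x. [x]) ` A"
    by (auto simp: length_Suc_conv)
  then show ?case using assms(1) finite_surj by blast
next
  case (Suc n)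
  let ?P = "{xs. length xs = Suc n \<and> xs ! 0 \<in> A \<and> (\<forall>i<n. xs ! Suc i \<in> S i (xs ! i))}"
  have "{xs. length xs = Suc (Suc n) \<and> xs ! 0 \<in> A \<and> (\<forall>i<Suc n. xs ! Suc i \<in> S i (xs ! i))}
    \<subseteq> (\<Union>xs\<in>?P. (\<lambda>x. xs @ [x]) ` S n (xs ! n))"
  proof
    fix xs assume "xs \<in> {xs. length xs = Suc (Suc n) \<and> xs ! 0 \<in> A \<and> (\<forall>i<Suc n. xs ! Suc i \<in> S i (xs ! i))}"
    then have l: "length xs = Suc (Suc n)" and xs: "xs ! 0 \<in> A" "\<And>i. i < Suc n \<Longrightarrow> xs ! Suc i \<in> S i (xs ! i)" by auto
    then have "butlast xs \<in> ?P" by (auto simp: nth_butlast)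
    moreover have "xs ! Suc n \<in> S n (butlast xs ! n)" using l xs(2)[of n] by (simp add: nth_butlast)
    moreover have "xs = butlast xs @ [xs ! Suc n]"
      using l by (metis append_butlast_last_id diff_Suc_1 last_conv_nth list.size(3) nat.simps(3))
    ultimately show "xs \<in> (\<Union>xs\<in>?P. (\<lambda>x. xs @ [x]) ` S n (xs ! n))" by blast
  qed
  moreover have "finite (\<Union>xs\<in>?P. (\<lambda>x. xs @ [x]) ` S n (xs ! n))" using Suc assms(2) by blast
  ultimately show ?case by (rule finite_subset)
qed

locale galois_bimodule = galois K G C \<phi> \<psi> + M: bimodule K "quot_cat K G C \<phi> \<psi>" M
  for K :: "('k, 'z) ring_scheme" and G :: "('g, 'y) monoid_scheme"
    and C :: "('o, 'k, 'c) kcat" and \<phi> :: "'g \<Rightarrow> 'o \<Rightarrow> 'o" and \<psi> :: "'g \<Rightarrow> 'o \<Rightarrow> 'o \<Rightarrow> 'c \<Rightarrow> 'c"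
    and M :: "('o set, 'k, ('o \<times> 'o \<Rightarrow> 'c) set, 'm) bimod"
begin

abbreviation "LM \<equiv> lift_bimod K G C \<phi> \<psi> M"

lemma LM_simps [simp]:
  "Bim LM y x = Bim M (orb y) (orb x)"
  "Lact LM z y x c = Lact M (orb z) (orb y) (orb x) (mc z y c)"
  "Ract LM y x u m c = Ract M (orb y) (orb x) (orb u) m (mc x u c)"
  by (simp_all add: lift_bimod_def)

sublocale Y: hm_data K B M
  by (intro hm_data.intro K Hom_B_module Cmp_B_bilinear M.Bim_module M.Lact_bilinear M.Ract_bilinear)

lemma LM_Lact_bilinear:
  assumes "z \<in> Ob C" "y \<in> Ob C" "x \<in> Ob C"
  shows "bilinear_map K (Hom C z y) (Bim LM y x) (Bim LM z x) (Lact LM z y x)"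
proof -
  note b = M.Lact_bilinear[OF orb_Ob_B[OF assms(1)] orb_Ob_B[OF assms(2)] orb_Ob_B[OF assms(3)]]
  show ?thesis
    unfolding bilinear_map_def
    using bilinear_map_left[OF b mc_closed[OF assms(1,2)]] mod_hom_comp[OF mc_hom[OF assms(1,2)] bilinear_map_right[OF b]]
    by simp
qed

lemma LM_Ract_bilinear:
  assumes "y \<in> Ob C" "x \<in> Ob C" "u \<in> Ob C"
  shows "bilinear_map K (Bim LM y x) (Hom C x u) (Bim LM y u) (Ract LM y x u)"
proof -
  note b = M.Ract_bilinear[OF orb_Ob_B[OF assms(1)] orb_Ob_B[OF assms(2)] orb_Ob_B[OF assms(3)]]
  show ?thesis
    unfolding bilinear_map_def
    using bilinear_map_right[OF b mc_closed[OF assms(2,3)]] mod_hom_comp[OF mc_hom[OF assms(2,3)] bilinear_map_left[OF b]]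
    by (simp add: lift_bimod_def)
qed

sublocale X: hm_complex K C LM
proof (intro hm_complex.intro hm_data.intro hm_complex_axioms.intro K C.Hom_module C.Cmp_bilinear C.Cmp_assoc)
  show "module K (Bim LM y x)" if "y \<in> Ob C" "x \<in> Ob C" for y x
    using M.Bim_module that by simp
qed (simp_all only: LM_Lact_bilinear LM_Ract_bilinear,
  simp_all add: Cmp_B_mc[symmetric] M.Lact_assoc M.Ract_assoc M.Lact_Ract mc_closed)

section \<open>The group action and the projection on generators\<close>

definition tgen :: "nat \<Rightarrow> 'g \<Rightarrow> 'o list \<times> 'm \<times> 'c list \<Rightarrow> 'o list \<times> 'm \<times> 'c list" where
  "tgen n s = (\<lambda>(xs, m, cs). (map (\<phi> s) xs, m, map (\<lambda>i. \<psi> s (xs ! i) (xs ! Suc i) (cs ! i)) [0..<n]))"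

definition pgen :: "nat \<Rightarrow> 'o list \<times> 'm \<times> 'c list \<Rightarrow> 'o set list \<times> 'm \<times> ('o \<times> 'o \<Rightarrow> 'c) set list" where
  "pgen n = (\<lambda>(xs, m, cs). (map orb xs, m, map (\<lambda>i. mc (xs ! i) (xs ! Suc i) (cs ! i)) [0..<n]))"

lemma tgen_closed: "\<lbrakk>s \<in> carrier G; t \<in> HM_gens C LM n\<rbrakk> \<Longrightarrow> tgen n s t \<in> HM_gens C LM n"
  by (cases t) (auto simp: HM_gens_iff tgen_def mor_closed)

lemma pgen_closed: "t \<in> HM_gens C LM n \<Longrightarrow> pgen n t \<in> HM_gens B M n"
  by (cases t) (auto simp: HM_gens_iff pgen_def mc_closed)

lemma coeff_LM: "xs \<in> HM_seqs C n \<Longrightarrow> HM_coeff LM xs = HM_coeff M (map orb xs)"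
  by (simp add: HM_seqs_iff HM_coeff_nth[of _ n])

lemma seqs_act: "\<lbrakk>s \<in> carrier G; xs \<in> HM_seqs C n\<rbrakk> \<Longrightarrow> map (\<phi> s) xs \<in> HM_seqs C n"
  by (auto simp: HM_seqs_iff)

lemma seqs_orb: "xs \<in> HM_seqs C n \<Longrightarrow> map orb xs \<in> HM_seqs B n"
  by (auto simp: HM_seqs_iff)

lemma coeff_act:
  assumes "s \<in> carrier G" "xs \<in> HM_seqs C n" shows "HM_coeff LM (map (\<phi> s) xs) = HM_coeff LM xs"
proof -
  have "map (\<lambda>x. orb (\<phi> s x)) xs = map orb xs"
    using assms by (intro map_cong refl orb_act) (auto simp: HM_seqs_def)
  then show ?thesis
    unfolding coeff_LM[OF assms(2)] coeff_LM[OF seqs_act[OF assms]] map_map comp_def by (rule arg_cong)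
qed

abbreviation "act n s \<equiv> HM_chain_act K C LM \<phi> \<psi> n s"

lemma tgen_multilin:
  assumes s: "s \<in> carrier G" and xs: "xs \<in> HM_seqs C n"
  shows "multilin K (HM_coeff LM xs) (HM_homs C xs) (X.chain n) (\<lambda>m cs. X.gen n (tgen n s (xs, m, cs)))"
proof -
  note g = X.gen_multilin[OF seqs_act[OF s xs], unfolded coeff_act[OF s xs]]
  have l: "length xs = Suc n" "\<And>i. i \<le> n \<Longrightarrow> xs ! i \<in> Ob C" using xs by (auto simp: HM_seqs_iff)
  have "multilin K (HM_coeff LM xs) (HM_homs C xs) (X.chain n)
    (\<lambda>m cs. X.gen n (map (\<phi> s) xs, m, map (\<lambda>i. \<psi> s (xs ! i) (xs ! Suc i) (cs ! i)) [0..<n]))"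
    using l s by (intro multilin_map[OF g _ _ mod_hom_id]) (auto simp: HM_homs_nth intro!: A.mor_linear)
  then show ?thesis by (simp add: tgen_def)
qed

lemma act_def': "act n s = HM_lift K C LM n (X.chain n) (\<lambda>t. X.gen n (tgen n s t))"
  unfolding HM_chain_act_def tgen_def by (intro arg_cong[of _ _ "HM_lift K C LM n (X.chain n)"]) (auto simp: fun_eq_iff)

lemma act_hom: "s \<in> carrier G \<Longrightarrow> act n s \<in> mod_hom K (X.chain n) (X.chain n)"
  unfolding act_def' by (rule X.HM_lift_hom[OF X.chain_module tgen_multilin])

lemma act_gen: "\<lbrakk>s \<in> carrier G; t \<in> HM_gens C LM n\<rbrakk> \<Longrightarrow> act n s (X.gen n t) = X.gen n (tgen n s t)"
  unfolding act_def' by (rule X.HM_lift_gen[OF X.chain_module tgen_multilin])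

lemma tgen_mult:
  assumes "s \<in> carrier G" "s' \<in> carrier G" "t \<in> HM_gens C LM n"
  shows "tgen n (s \<otimes>\<^bsub>G\<^esub> s') t = tgen n s (tgen n s' t)"
proof -
  obtain xs m cs where t: "t = (xs, m, cs)" by (cases t)
  have l: "length xs = Suc n" "\<And>i. i \<le> n \<Longrightarrow> xs ! i \<in> Ob C" "length cs = n"
    "\<And>i. i < n \<Longrightarrow> cs ! i \<in> carrier (Hom C (xs ! i) (xs ! Suc i))"
    using assms(3) unfolding t by (auto simp: HM_gens_iff)
  then show ?thesis
    using assms(1,2) unfolding t
    by (auto simp: tgen_def A.mor_mult in_set_conv_nth act_mult less_Suc_eq_le)
qed

lemma tgen_one: "t \<in> HM_gens C LM n \<Longrightarrow> tgen n \<one>\<^bsub>G\<^esub> t = t"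
proof -
  assume *: "t \<in> HM_gens C LM n"
  obtain xs m cs where t: "t = (xs, m, cs)" by (cases t)
  have l: "length xs = Suc n" "\<And>i. i \<le> n \<Longrightarrow> xs ! i \<in> Ob C" "length cs = n"
    "\<And>i. i < n \<Longrightarrow> cs ! i \<in> carrier (Hom C (xs ! i) (xs ! Suc i))"
    using * unfolding t by (auto simp: HM_gens_iff)
  then show ?thesis
    unfolding t tgen_def by (auto intro!: nth_equalityI simp: A.mor_one)
qed

lemma kg_chain: "kg_module G K (X.chain n) (act n)"
proof (intro kg_module.intro kg_module_axioms.intro A.is_group X.chain_module act_hom)
  fix g h x assume gh: "g \<in> carrier G" "h \<in> carrier G" and x: "x \<in> carrier (X.chain n)"
  show "act n (g \<otimes>\<^bsub>G\<^esub> h) x = act n g (act n h x)"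
    by (rule X.chain_hom_eq[OF X.chain_module act_hom mod_hom_comp[OF act_hom act_hom] _ x])
       (use gh in \<open>simp_all add: act_gen tgen_closed tgen_mult\<close>)
next
  fix x assume x: "x \<in> carrier (X.chain n)"
  show "act n \<one>\<^bsub>G\<^esub> x = x"
    by (rule X.chain_hom_eq[OF X.chain_module act_hom mod_hom_id _ x])
       (simp_all add: act_gen tgen_one)
qed

text \<open>For inner faces the action respects composition. For end faces a morphism and its
  translate have the same class, hence act in the same way on the coefficient.\<close>

lemma tgen_face:
  assumes s: "s \<in> carrier G" and t: "t \<in> HM_gens C LM (Suc n)" and i: "i \<le> Suc n"
  shows "HM_face C LM (Suc n) i (tgen (Suc n) s t) = tgen n s (HM_face C LM (Suc n) i t)"
proof -
  obtain xs m cs where t_eq: "t = (xs, m, cs)" by (cases t)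
  have l: "length xs = Suc (Suc n)" "length cs = Suc n" and ob: "\<And>i. i \<le> Suc n \<Longrightarrow> xs ! i \<in> Ob C"
    and hc: "\<And>i. i < Suc n \<Longrightarrow> cs ! i \<in> carrier (Hom C (xs ! i) (xs ! Suc i))"
    using t unfolding t_eq by (auto simp: HM_gens_iff)
  let ?cs = "map (\<lambda>i. \<psi> s (xs ! i) (xs ! Suc i) (cs ! i)) [0..<Suc n]"
  have cs_nth: "?cs ! k = \<psi> s (xs ! k) (xs ! Suc k) (cs ! k)" if "k < Suc n" for k
    using that by (simp del: upt_Suc)
  have seq: "face_seq (Suc n) i (map (\<phi> s) xs) = map (\<phi> s) (face_seq (Suc n) i xs)"
    using l by (intro nth_equalityI) auto
  have coeff: "face_coeff LM (Suc n) i (map (\<phi> s) xs) m ?cs = face_coeff LM (Suc n) i xs m cs"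
    using l s ob hc by (simp add: face_coeff_def cs_nth mc_act del: upt_Suc)
  have homs: "face_homs C (Suc n) i (map (\<phi> s) xs) ?cs
    = map (\<lambda>k. \<psi> s (face_seq (Suc n) i xs ! k) (face_seq (Suc n) i xs ! Suc k) (face_homs C (Suc n) i xs cs ! k)) [0..<n]"
  proof (rule nth_equalityI)
    fix k assume "k < length (face_homs C (Suc n) i (map (\<phi> s) xs) ?cs)"
    then have k: "k < n" by simp
    consider "Suc k < i" | "Suc k = i" | "i < Suc k" by linarith
    then show "face_homs C (Suc n) i (map (\<phi> s) xs) ?cs ! k
      = map (\<lambda>k. \<psi> s (face_seq (Suc n) i xs ! k) (face_seq (Suc n) i xs ! Suc k) (face_homs C (Suc n) i xs cs ! k)) [0..<n] ! k"
      using k l ob hc s by cases (auto simp: face_homs_nth cs_nth A.mor_Cmp simp del: upt_Suc)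
  qed simp
  have "length ?cs = Suc n" by simp
  then have "HM_face C LM (Suc n) i (map (\<phi> s) xs, m, ?cs)
    = (face_seq (Suc n) i (map (\<phi> s) xs), face_coeff LM (Suc n) i (map (\<phi> s) xs) m ?cs, face_homs C (Suc n) i (map (\<phi> s) xs) ?cs)"
    using l i by (intro HM_face_eq) auto
  then show ?thesis
    unfolding t_eq HM_face_eq[OF l i] tgen_def prod.case seq coeff homs .
qed

lemma hbd_act:
  assumes s: "s \<in> carrier G" and x: "x \<in> carrier (X.chain (Suc n))"
  shows "X.hbd (Suc n) (act (Suc n) s x) = act n s (X.hbd (Suc n) x)"
proof (rule X.chain_hom_eq[OF X.chain_module mod_hom_comp[OF act_hom[OF s] X.hbd_hom] mod_hom_comp[OF X.hbd_hom act_hom[OF s]] _ x])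
  fix t assume t: "t \<in> HM_gens C LM (Suc n)"
  have "act n s (X.hbd (Suc n) (X.gen (Suc n) t)) = alt_sum (X.chain n) (Suc n) (\<lambda>i. act n s (X.gen n (HM_face C LM (Suc n) i t)))"
    unfolding X.hbd_gen[OF t]
    by (rule mod_hom_alt_sum[OF X.chain_module X.chain_module act_hom[OF s] X.gen_closed[OF X.HM_face_closed[OF t]]])
  also have "\<dots> = alt_sum (X.chain n) (Suc n) (\<lambda>i. X.gen n (HM_face C LM (Suc n) i (tgen (Suc n) s t)))"
    by (rule alt_sum_cong[OF X.chain_module])
       (simp_all add: act_gen[OF s] X.HM_face_closed t tgen_face[OF s t] tgen_closed[OF s] X.gen_closed)
  also have "\<dots> = X.hbd (Suc n) (act (Suc n) s (X.gen (Suc n) t))"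
    by (simp add: act_gen[OF s t] X.hbd_gen tgen_closed[OF s t])
  finally show "X.hbd (Suc n) (act (Suc n) s (X.gen (Suc n) t)) = act n s (X.hbd (Suc n) (X.gen (Suc n) t))" by simp
qed

subsection \<open>The projection to the complex of the quotient category\<close>

definition eps :: "nat \<Rightarrow> ('o, 'k, 'c, 'm) hm_chain \<Rightarrow> ('o set, 'k, ('o \<times> 'o \<Rightarrow> 'c) set, 'm) hm_chain" where
  "eps n = HM_lift K C LM n (Y.chain n) (\<lambda>t. Y.gen n (pgen n t))"

lemma pgen_multilin:
  assumes xs: "xs \<in> HM_seqs C n"
  shows "multilin K (HM_coeff LM xs) (HM_homs C xs) (Y.chain n) (\<lambda>m cs. Y.gen n (pgen n (xs, m, cs)))"
proof -
  note g = Y.gen_multilin[OF seqs_orb[OF xs], folded coeff_LM[OF xs]]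
  have l: "length xs = Suc n" "\<And>i. i \<le> n \<Longrightarrow> xs ! i \<in> Ob C" using xs by (auto simp: HM_seqs_iff)
  have "multilin K (HM_coeff LM xs) (HM_homs C xs) (Y.chain n)
    (\<lambda>m cs. Y.gen n (map orb xs, m, map (\<lambda>i. mc (xs ! i) (xs ! Suc i) (cs ! i)) [0..<n]))"
    using l by (intro multilin_map[OF g _ _ mod_hom_id]) (auto simp: HM_homs_nth intro!: mc_hom)
  then show ?thesis by (simp add: pgen_def)
qed

lemma eps_hom: "eps n \<in> mod_hom K (X.chain n) (Y.chain n)"
  unfolding eps_def by (rule X.HM_lift_hom[OF Y.chain_module pgen_multilin])

lemma eps_gen: "t \<in> HM_gens C LM n \<Longrightarrow> eps n (X.gen n t) = Y.gen n (pgen n t)"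
  unfolding eps_def by (rule X.HM_lift_gen[OF Y.chain_module pgen_multilin])

text \<open>The end faces agree by the definition of the actions on the lifted bimodule, the inner
  ones by functoriality of the covering.\<close>

lemma pgen_face:
  assumes t: "t \<in> HM_gens C LM (Suc n)" and i: "i \<le> Suc n"
  shows "HM_face B M (Suc n) i (pgen (Suc n) t) = pgen n (HM_face C LM (Suc n) i t)"
proof -
  obtain xs m cs where t_eq: "t = (xs, m, cs)" by (cases t)
  have l: "length xs = Suc (Suc n)" "length cs = Suc n" and ob: "\<And>i. i \<le> Suc n \<Longrightarrow> xs ! i \<in> Ob C"
    and hc: "\<And>i. i < Suc n \<Longrightarrow> cs ! i \<in> carrier (Hom C (xs ! i) (xs ! Suc i))"
    using t unfolding t_eq by (auto simp: HM_gens_iff)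
  let ?cs = "map (\<lambda>i. mc (xs ! i) (xs ! Suc i) (cs ! i)) [0..<Suc n]"
  have cs_nth: "?cs ! k = mc (xs ! k) (xs ! Suc k) (cs ! k)" if "k < Suc n" for k
    using that by (simp del: upt_Suc)
  have seq: "face_seq (Suc n) i (map orb xs) = map orb (face_seq (Suc n) i xs)"
    using l by (intro nth_equalityI) auto
  have coeff: "face_coeff M (Suc n) i (map orb xs) m ?cs = face_coeff LM (Suc n) i xs m cs"
    using l by (simp add: face_coeff_def cs_nth del: upt_Suc)
  have homs: "face_homs B (Suc n) i (map orb xs) ?cs
    = map (\<lambda>k. mc (face_seq (Suc n) i xs ! k) (face_seq (Suc n) i xs ! Suc k) (face_homs C (Suc n) i xs cs ! k)) [0..<n]"
  proof (rule nth_equalityI)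
    fix k assume "k < length (face_homs B (Suc n) i (map orb xs) ?cs)"
    then have k: "k < n" by simp
    consider "Suc k < i" | "Suc k = i" | "i < Suc k" by linarith
    then show "face_homs B (Suc n) i (map orb xs) ?cs ! k
      = map (\<lambda>k. mc (face_seq (Suc n) i xs ! k) (face_seq (Suc n) i xs ! Suc k) (face_homs C (Suc n) i xs cs ! k)) [0..<n] ! k"
      using k l ob hc by cases (auto simp: face_homs_nth cs_nth Cmp_B_mc simp del: upt_Suc)
  qed simp
  have "length ?cs = Suc n" by simp
  then have "HM_face B M (Suc n) i (map orb xs, m, ?cs)
    = (face_seq (Suc n) i (map orb xs), face_coeff M (Suc n) i (map orb xs) m ?cs, face_homs B (Suc n) i (map orb xs) ?cs)"
    using l i by (intro HM_face_eq) auto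
  then show ?thesis
    unfolding t_eq HM_face_eq[OF l i] pgen_def prod.case seq coeff homs .
qed

lemma eps_hbd:
  assumes x: "x \<in> carrier (X.chain (Suc n))"
  shows "eps n (X.hbd (Suc n) x) = Y.hbd (Suc n) (eps (Suc n) x)"
proof (rule X.chain_hom_eq[OF Y.chain_module mod_hom_comp[OF X.hbd_hom eps_hom] mod_hom_comp[OF eps_hom Y.hbd_hom] _ x])
  fix t assume t: "t \<in> HM_gens C LM (Suc n)"
  have "eps n (X.hbd (Suc n) (X.gen (Suc n) t)) = alt_sum (Y.chain n) (Suc n) (\<lambda>i. eps n (X.gen n (HM_face C LM (Suc n) i t)))"
    unfolding X.hbd_gen[OF t]
    by (rule mod_hom_alt_sum[OF X.chain_module Y.chain_module eps_hom X.gen_closed[OF X.HM_face_closed[OF t]]])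
  also have "\<dots> = alt_sum (Y.chain n) (Suc n) (\<lambda>i. Y.gen n (HM_face B M (Suc n) i (pgen (Suc n) t)))"
    by (rule alt_sum_cong[OF Y.chain_module])
       (simp_all add: eps_gen X.HM_face_closed t pgen_face[OF t] pgen_closed Y.gen_closed)
  also have "\<dots> = Y.hbd (Suc n) (eps (Suc n) (X.gen (Suc n) t))"
    by (simp add: eps_gen[OF t] Y.hbd_gen pgen_closed[OF t])
  finally show "eps n (X.hbd (Suc n) (X.gen (Suc n) t)) = Y.hbd (Suc n) (eps (Suc n) (X.gen (Suc n) t))" .
qed

lemma pgen_tgen:
  assumes s: "s \<in> carrier G" and t: "t \<in> HM_gens C LM n" shows "pgen n (tgen n s t) = pgen n t"
proof -
  obtain xs m cs where t_eq: "t = (xs, m, cs)" by (cases t)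
  have l: "length xs = Suc n" "length cs = n" and ob: "\<And>i. i \<le> n \<Longrightarrow> xs ! i \<in> Ob C"
    and hc: "\<And>i. i < n \<Longrightarrow> cs ! i \<in> carrier (Hom C (xs ! i) (xs ! Suc i))"
    using t unfolding t_eq by (auto simp: HM_gens_iff)
  have "map (\<lambda>x. orb (\<phi> s x)) xs = map orb xs"
    using l(1) ob s by (intro nth_equalityI) auto
  then show ?thesis
    using l ob hc s unfolding t_eq pgen_def tgen_def by (simp add: mc_act comp_def)
qed

lemma eps_act:
  assumes s: "s \<in> carrier G" and x: "x \<in> carrier (X.chain n)" shows "eps n (act n s x) = eps n x"
  by (rule X.chain_hom_eq[OF Y.chain_module mod_hom_comp[OF act_hom[OF s] eps_hom] eps_hom _ x])
     (simp add: act_gen[OF s] eps_gen tgen_closed[OF s] pgen_tgen[OF s])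

text \<open>Lift the factors of a generator one after the other, starting from the first object.\<close>

lemma eps_surj_aux:
  assumes "i \<le> n" "(us, m, fs) \<in> HM_gens B M n" "length xs = Suc i" "\<And>k. k \<le> i \<Longrightarrow> xs ! k \<in> Ob C \<and> orb (xs ! k) = us ! k"
    and "length cs = i" "\<And>k. k < i \<Longrightarrow> cs ! k \<in> carrier (Hom C (xs ! k) (xs ! Suc k)) \<and> fs ! k = mc (xs ! k) (xs ! Suc k) (cs ! k)"
  shows "Y.gen n (us, m, fs) \<in> eps n ` carrier (X.chain n)"
  using assms
proof (induction "n - i" arbitrary: i xs cs fs)
  case 0
  then have i: "i = n" by simp
  have lu: "length us = Suc n" "length fs = n" and m: "m \<in> carrier (Bim M (us ! n) (us ! 0))"
    using 0(3) by (auto simp: HM_gens_iff)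
  have t: "(xs, m, cs) \<in> HM_gens C LM n"
    using 0 i m by (auto simp: HM_gens_iff)
  have us: "map orb xs = us" using 0(4,5) lu i by (intro nth_equalityI) auto
  have fs: "map (\<lambda>k. mc (xs ! k) (xs ! Suc k) (cs ! k)) [0..<n] = fs"
    using 0(7) lu i by (intro nth_equalityI) auto
  have "eps n (X.gen n (xs, m, cs)) = Y.gen n (us, m, fs)"
    using eps_gen[OF t] by (simp add: pgen_def us fs)
  then show ?case using X.gen_closed[OF t] by (metis imageI)
next
  case (Suc d)
  then have i: "i < n" by simp
  have lu: "length us = Suc n" "length fs = n" and ub: "\<And>k. k \<le> n \<Longrightarrow> us ! k \<in> Ob B"
    and m: "m \<in> carrier (Bim M (us ! n) (us ! 0))" and fs: "\<And>k. k < n \<Longrightarrow> fs ! k \<in> carrier (Hom B (us ! k) (us ! Suc k))"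
    using Suc.prems(2) by (auto simp: HM_gens_iff)
  have usq: "us \<in> HM_seqs B n" using lu ub by (auto simp: HM_seqs_iff)
  have mc': "m \<in> carrier (HM_coeff M us)" using m lu by (simp add: HM_coeff_nth[of us n])
  have fs': "fs \<in> listset (map carrier (HM_homs B us))" using fs lu by (simp add: HM_homs_listset[of us n])
  have xi: "xs ! i \<in> Ob C" "orb (xs ! i) = us ! i" using Suc.prems(4)[of i] by auto
  have hi: "HM_homs B us ! i = Hom B (us ! i) (us ! Suc i)" using i lu by (simp add: HM_homs_nth)
  have H: "(\<lambda>f. Y.gen n (us, m, fs[i := f])) \<in> mod_hom K (Hom B (us ! i) (us ! Suc i)) (Y.chain n)"
    using multilin_right[OF Y.gen_multilin[OF usq] mc' fs', of i] i lu hi by simp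
  note Hm = Hom_B_module[OF ub[of i] ub[of "Suc i"]]
  \<comment> \<open>Those \<open>f\<close> that may be put into slot \<open>i\<close> with the
    generator still a value of \<open>eps\<close> form a submodule. By \<open>Hom_B_spanning\<close>
    it is enough to treat classes of morphisms of \<open>C\<close> that end at the object
    \<open>xs ! i\<close> already chosen, and such a morphism prolongs the partial lift.\<close>
  let ?P = "{f \<in> carrier (Hom B (us ! i) (us ! Suc i)). Y.gen n (us, m, fs[i := f]) \<in> eps n ` carrier (X.chain n)}"
  have "submodule ?P K (Hom B (us ! i) (us ! Suc i))"
    using i by (intro submodule_preimage[OF Hm Y.chain_module H]
        submodule_image[OF X.chain_module Y.chain_module eps_hom submodule_carrier[OF X.chain_module]]) auto
  moreover have "{mc (xs ! i) x c | x c. x \<in> us ! Suc i \<and> c \<in> carrier (Hom C (xs ! i) x)} \<subseteq> ?P"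
  proof
    fix f assume "f \<in> {mc (xs ! i) x c | x c. x \<in> us ! Suc i \<and> c \<in> carrier (Hom C (xs ! i) x)}"
    then obtain x c where x: "x \<in> us ! Suc i" "c \<in> carrier (Hom C (xs ! i) x)" "f = mc (xs ! i) x c" by auto
    have xo: "x \<in> Ob C" "orb x = us ! Suc i" using Ob_B_sub[OF ub x(1)] i by auto
    have f: "f \<in> carrier (Hom B (us ! i) (us ! Suc i))" using mc_closed[OF xi(1) xo(1) x(2)] x(3) xi xo by simp
    have "Y.gen n (us, m, fs[i := f]) \<in> eps n ` carrier (X.chain n)"
    proof (rule Suc.hyps(1)[of "Suc i" "fs[i := f]" "xs @ [x]" "cs @ [c]"])
      show "(us, m, fs[i := f]) \<in> HM_gens B M n"
      proof -
        have "fs[i := f] ! k \<in> carrier (Hom B (us ! k) (us ! Suc k))" if "k < n" for k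
          using that fs f lu by (cases "k = i") auto
        then show ?thesis using lu ub m by (simp add: HM_gens_iff)
      qed
      show "(xs @ [x]) ! k \<in> Ob C \<and> orb ((xs @ [x]) ! k) = us ! k" if "k \<le> Suc i" for k
        using that Suc.prems(3,4) xo by (cases "k = Suc i") (auto simp: nth_append)
      show "(cs @ [c]) ! k \<in> carrier (Hom C ((xs @ [x]) ! k) ((xs @ [x]) ! Suc k)) \<and>
          fs[i := f] ! k = mc ((xs @ [x]) ! k) ((xs @ [x]) ! Suc k) ((cs @ [c]) ! k)" if "k < Suc i" for k
        using that Suc.prems(3,5,6) x i lu by (cases "k = i") (auto simp: nth_append)
    qed (use Suc.hyps(2) Suc.prems(3,5) i in auto)
    then show "f \<in> ?P" using f by simp
  qed
  ultimately have "carrier (Hom B (us ! i) (us ! Suc i)) \<subseteq> ?P"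
    using spanningD[OF Hom_B_spanning[OF xi(1) ub[of "Suc i"], unfolded xi(2)]] i by simp
  then have "Y.gen n (us, m, fs[i := fs ! i]) \<in> eps n ` carrier (X.chain n)" using fs[OF i] by blast
  then show ?case by simp
qed

lemma eps_surj: "eps n ` carrier (X.chain n) = carrier (Y.chain n)"
proof (rule spanning_hom_surj[OF Y.chain_spanning X.chain_module Y.chain_module eps_hom])
  show "Y.gen n ` HM_gens B M n \<subseteq> eps n ` carrier (X.chain n)"
  proof
    fix z assume "z \<in> Y.gen n ` HM_gens B M n"
    then obtain us m fs where t: "(us, m, fs) \<in> HM_gens B M n" "z = Y.gen n (us, m, fs)" by auto
    then have "us ! 0 \<in> Ob B" by (auto simp: HM_gens_iff)
    then obtain x where "x \<in> Ob C" "orb x = us ! 0" by (auto simp: Ob_B)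
    then show "z \<in> eps n ` carrier (X.chain n)"
      unfolding t(2) using t(1) by (intro eps_surj_aux[where xs = "[x]" and cs = "[]" and i = 0]) auto
  qed
qed

subsection \<open>Orbit representatives\<close>

definition rep :: "'o set \<Rightarrow> 'o" where
  "rep u = (SOME x. x \<in> u)"

definition Rep :: "'o set" where
  "Rep = rep ` Ob B"

text \<open>The coordinate of \<open>x\<close> in its orbit, which the chosen representative
  identifies with \<open>G\<close>.\<close>

definition ge :: "'o \<Rightarrow> 'g" where
  "ge x = tr (rep (orb x)) x"

lemma rep_in: "u \<in> Ob B \<Longrightarrow> rep u \<in> u"
  unfolding rep_def by (rule someI_ex) (auto simp: Ob_B intro: orb_self)

lemma Rep_eq: "\<lbrakk>x \<in> Rep\<rbrakk> \<Longrightarrow> x = rep (orb x)"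
  using rep_in Ob_B_sub by (auto simp: Rep_def)

lemma
  assumes "x \<in> Ob C"
  shows rep_orb: "rep (orb x) \<in> Ob C" "x \<in> orb (rep (orb x))" "orb (rep (orb x)) = orb x"
  using Ob_B_sub[OF orb_Ob_B[OF assms] rep_in[OF orb_Ob_B[OF assms]]] assms by auto

lemma ge_closed: "x \<in> Ob C \<Longrightarrow> ge x \<in> carrier G"
  unfolding ge_def by (rule tr_closed[OF rep_orb(1,2)])

lemma ge_eq: "x \<in> Ob C \<Longrightarrow> \<phi> (ge x) (rep (orb x)) = x"
  unfolding ge_def by (rule tr_eq[OF rep_orb(1,2)])

lemma ge_inv: "x \<in> Ob C \<Longrightarrow> \<phi> (inv\<^bsub>G\<^esub> (ge x)) x = rep (orb x)"
  using act_inv[OF ge_closed rep_orb(1)] ge_eq by metis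

lemma Rep_act_iff:
  assumes g: "g \<in> carrier G" and x: "x \<in> Ob C"
  shows "\<phi> (inv\<^bsub>G\<^esub> g) x \<in> Rep \<longleftrightarrow> g = ge x"
proof
  assume "\<phi> (inv\<^bsub>G\<^esub> g) x \<in> Rep"
  then have "\<phi> (inv\<^bsub>G\<^esub> g) x = rep (orb x)" using Rep_eq g x by fastforce
  then have "\<phi> g (rep (orb x)) = \<phi> (ge x) (rep (orb x))" using act_inv2[OF g x] ge_eq[OF x] by simp
  then show "g = ge x" using act_eq_iff[OF g ge_closed[OF x] rep_orb(1)[OF x]] by simp
next
  assume "g = ge x"
  then show "\<phi> (inv\<^bsub>G\<^esub> g) x \<in> Rep" using ge_inv[OF x] x by (simp add: Rep_def)
qed

text \<open>
  As \<open>G\<close> acts freely, exactly one translate of a tuple of objects starts at a representative.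
  Hence the restriction to the tuples starting at a representative has trace one.
\<close>

definition trunc :: "nat \<Rightarrow> ('o, 'k, 'c, 'm) hm_chain \<Rightarrow> ('o, 'k, 'c, 'm) hm_chain" where
  "trunc n f = (\<lambda>xs\<in>HM_seqs C n. if xs ! 0 \<in> Rep then f xs else \<zero>\<^bsub>HM_summand K C LM xs\<^esub>)"

lemma trunc_hom: "trunc n \<in> mod_hom K (X.chain n) (X.chain n)"
  unfolding HM_chain_def
proof (rule mod_hom_dsumI[OF K X.summand_module _ _ dsum_module[OF K X.summand_module]])
  note d = dsum_carrier_iff[OF K X.summand_module]
  fix f assume f: "f \<in> carrier (dsum (HM_seqs C n) (HM_summand K C LM))"
  have "{xs \<in> HM_seqs C n. trunc n f xs \<noteq> \<zero>\<^bsub>HM_summand K C LM xs\<^esub>} \<subseteq> {xs \<in> HM_seqs C n. f xs \<noteq> \<zero>\<^bsub>HM_summand K C LM xs\<^esub>}"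
    by (auto simp: trunc_def split: if_splits)
  moreover have "\<forall>xs\<in>HM_seqs C n. trunc n f xs \<in> carrier (HM_summand K C LM xs)"
    using f submodule_zero[OF submodule_carrier[OF X.summand_module]] by (auto simp: trunc_def d)
  moreover have "trunc n f \<in> extensional (HM_seqs C n)" by (simp add: trunc_def)
  ultimately show "trunc n f \<in> carrier (dsum (HM_seqs C n) (HM_summand K C LM))"
    using f by (auto simp: d intro: finite_subset)
next
  fix xs assume xs: "xs \<in> HM_seqs C n"
  show "(\<lambda>f. trunc n f xs) \<in> mod_hom K (dsum (HM_seqs C n) (HM_summand K C LM)) (HM_summand K C LM xs)"
    using xs dsum_apply_hom[OF K X.summand_module xs]
      mod_hom_const_zero[OF dsum_module[OF K X.summand_module] X.summand_module[OF xs]]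
    by (cases "xs ! 0 \<in> Rep") (simp_all add: trunc_def)
qed

lemma trunc_gen:
  assumes t: "t \<in> HM_gens C LM n"
  shows "trunc n (X.gen n t) = (if fst t ! 0 \<in> Rep then X.gen n t else \<zero>\<^bsub>X.chain n\<^esub>)"
proof -
  obtain xs m cs where "t = (xs, m, cs)" by (cases t)
  moreover have "X.gen n t \<in> extensional (HM_seqs C n)"
    using X.gen_closed[OF t] unfolding HM_chain_def by (simp add: dsum_carrier_iff[OF K X.summand_module])
  ultimately show ?thesis
    by (auto simp: trunc_def HM_gen_def HM_chain_def dsum_inj_def dsum_def fun_eq_iff)
qed

text \<open>The unique translate of the generator \<open>t\<close> that starts at a
  representative.\<close>

definition std :: "nat \<Rightarrow> 'o list \<times> 'm \<times> 'c list \<Rightarrow> 'o list \<times> 'm \<times> 'c list" where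
  "std n t = tgen n (inv\<^bsub>G\<^esub> (ge (fst t ! 0))) t"

lemma hd_Ob: "t \<in> HM_gens C LM n \<Longrightarrow> fst t ! 0 \<in> Ob C"
  by (cases t) (auto simp: HM_gens_iff)

lemma std_closed: "t \<in> HM_gens C LM n \<Longrightarrow> std n t \<in> HM_gens C LM n"
  unfolding std_def by (intro tgen_closed A.inv_closed ge_closed hd_Ob)

lemma act_std:
  assumes t: "t \<in> HM_gens C LM n" shows "act n (ge (fst t ! 0)) (X.gen n (std n t)) = X.gen n t"
proof -
  note g = ge_closed[OF hd_Ob[OF t]]
  show ?thesis
    using act_gen[OF g std_closed[OF t]] tgen_mult[OF g A.inv_closed[OF g] t] tgen_one[OF t] g
    by (simp add: std_def)
qed

lemma trunc_act_gen:
  assumes t: "t \<in> HM_gens C LM n" and g: "g \<in> carrier G"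
  shows "trunc n (act n (inv\<^bsub>G\<^esub> g) (X.gen n t)) = (if g = ge (fst t ! 0) then X.gen n (std n t) else \<zero>\<^bsub>X.chain n\<^esub>)"
proof -
  have "fst (tgen n (inv\<^bsub>G\<^esub> g) t) ! 0 = \<phi> (inv\<^bsub>G\<^esub> g) (fst t ! 0)"
    using t by (cases t) (auto simp: tgen_def HM_gens_iff)
  then show ?thesis
    using Rep_act_iff[OF g hd_Ob[OF t]] g
    by (simp add: act_gen[OF _ t] trunc_gen[OF tgen_closed[OF _ t]] std_def)
qed

sublocale fc: finite_coordinates G K "X.chain n" "act n" "trunc n" for n
proof (intro finite_coordinates.intro finite_coordinates_axioms.intro kg_chain trunc_hom)
  fix x assume x: "x \<in> carrier (X.chain n)"
  show "finite {g \<in> carrier G. trunc n (act n (inv\<^bsub>G\<^esub> g) x) \<noteq> \<zero>\<^bsub>X.chain n\<^esub>}"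
  proof (rule spanning_finite_support[OF X.chain_spanning X.chain_module X.chain_module _ _ x])
    show "(\<lambda>x. trunc n (act n (inv\<^bsub>G\<^esub> g) x)) \<in> mod_hom K (X.chain n) (X.chain n)" if "g \<in> carrier G" for g
      using that by (intro mod_hom_comp[OF act_hom trunc_hom]) simp
    fix y assume "y \<in> X.gen n ` HM_gens C LM n"
    then obtain t where t: "t \<in> HM_gens C LM n" "y = X.gen n t" by auto
    have "{g \<in> carrier G. trunc n (act n (inv\<^bsub>G\<^esub> g) y) \<noteq> \<zero>\<^bsub>X.chain n\<^esub>} \<subseteq> {ge (fst t ! 0)}"
      using t(2) trunc_act_gen[OF t(1)] by (auto split: if_splits)
    then show "finite {g \<in> carrier G. trunc n (act n (inv\<^bsub>G\<^esub> g) y) \<noteq> \<zero>\<^bsub>X.chain n\<^esub>}"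
      by (rule finite_subset) simp
  qed
qed

lemma coords_gen:
  assumes t: "t \<in> HM_gens C LM n"
  shows "fc.coords n (X.gen n t) = dsum_inj (carrier G) (\<lambda>_. X.chain n) (ge (fst t ! 0)) (X.gen n (std n t))"
  using trunc_act_gen[OF t] unfolding fc.coords_def dsum_inj_def by (intro restrict_ext)

sublocale rp: relatively_projective G K "X.chain n" "act n" "trunc n" for n
proof (intro relatively_projective.intro relatively_projective_axioms.intro fc.finite_coordinates_axioms)
  fix x assume x: "x \<in> carrier (X.chain n)"
  have lift: "dsum_lift (carrier G) (\<lambda>_. X.chain n) (X.chain n) (act n) \<in> mod_hom K (fc.GX n) (X.chain n)"
    by (rule dsum_lift_hom[OF K X.chain_module X.chain_module act_hom])
  show "dsum_lift (carrier G) (\<lambda>_. X.chain n) (X.chain n) (act n) (fc.coords n x) = x"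
  proof (rule X.chain_hom_eq[OF X.chain_module mod_hom_comp[OF fc.coords_hom lift] mod_hom_id _ x])
    fix t assume t: "t \<in> HM_gens C LM n"
    show "dsum_lift (carrier G) (\<lambda>_. X.chain n) (X.chain n) (act n) (fc.coords n (X.gen n t)) = X.gen n t"
      unfolding coords_gen[OF t]
      using dsum_lift_inj[where h = "act n" and X = "\<lambda>_. X.chain n", OF K X.chain_module X.chain_module act_hom ge_closed[OF hd_Ob[OF t]] X.gen_closed[OF std_closed[OF t]]]
        act_std[OF t] by simp
  qed
qed

lemma orbit_sum_hom: "rp.orbit_sum n \<in> mod_hom K (X.chain n) (X.chain n)"
  unfolding rp.orbit_sum_def[abs_def]
  by (rule mod_hom_comp[OF fc.coords_hom dsum_lift_hom[OF K X.chain_module X.chain_module mod_hom_id]])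

text \<open>Among the translates of \<open>t\<close> only \<open>std n t\<close> survives
  truncation, so the sum reduces to one term.\<close>

lemma orbit_sum_gen:
  assumes t: "t \<in> HM_gens C LM n" shows "rp.orbit_sum n (X.gen n t) = X.gen n (std n t)"
  unfolding rp.orbit_sum_def coords_gen[OF t]
  using dsum_lift_inj[where h = "\<lambda>g y. y" and X = "\<lambda>_. X.chain n", OF K X.chain_module X.chain_module mod_hom_id ge_closed[OF hd_Ob[OF t]] X.gen_closed[OF std_closed[OF t]]]
  by simp

subsection \<open>Unique lifting of morphisms\<close>

text \<open>With the end \<open>y\<close> fixed, the classes of morphisms from the orbit of
  \<open>x\<close> to that of \<open>y\<close> decompose into the spaces \<open>Hom C y x'\<close>
  for \<open>x'\<close> in the orbit of \<open>x\<close>. This map reads off the component at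
  \<open>x\<close>: each summand is translated so as to end at \<open>y\<close> and is kept iff it
  then starts at \<open>x\<close>.\<close>

definition cmp0 :: "'o \<Rightarrow> 'o \<Rightarrow> ('o \<times> 'o \<Rightarrow> 'c) \<Rightarrow> 'c" where
  "cmp0 y x = dsum_lift (orb y \<times> orb x) HomC (Hom C y x)
     (\<lambda>(y0, x0) c. if \<phi> (tr y0 y) x0 = x then \<psi> (tr y0 y) y0 x0 c else \<zero>\<^bsub>Hom C y x\<^esub>)"

definition cmp :: "'o \<Rightarrow> 'o \<Rightarrow> ('o \<times> 'o \<Rightarrow> 'c) set \<Rightarrow> 'c" where
  "cmp y x = quot_lift (cmp0 y x)"

context
  fixes y x
  assumes y: "y \<in> Ob C" and x: "x \<in> Ob C"
begin

private lemma yx: "orb y \<in> Ob B" "orb x \<in> Ob B" "module K (Hom C y x)"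
  using y x C.Hom_module by auto

private lemma tr_y:
  assumes "y0 \<in> orb y"
  shows "y0 \<in> Ob C" "tr y0 y \<in> carrier G" "\<phi> (tr y0 y) y0 = y" "y \<in> orb y0"
proof -
  show y0: "y0 \<in> Ob C" by (rule orb_Ob[OF y assms])
  show "y \<in> orb y0" using orb_eq[OF y assms] y by simp
  then show "tr y0 y \<in> carrier G" "\<phi> (tr y0 y) y0 = y" using tr_closed tr_eq y0 by auto
qed

private lemma step_hom:
  assumes "y0 \<in> orb y" "x0 \<in> orb x"
  shows "(case (y0, x0) of (y0, x0) \<Rightarrow> \<lambda>c. if \<phi> (tr y0 y) x0 = x then \<psi> (tr y0 y) y0 x0 c else \<zero>\<^bsub>Hom C y x\<^esub>)
    \<in> mod_hom K (Hom C y0 x0) (Hom C y x)"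
proof -
  note t = tr_y[OF assms(1)]
  have x0: "x0 \<in> Ob C" by (rule orb_Ob[OF x assms(2)])
  show ?thesis
    using A.mor_linear[OF t(2,1) x0] mod_hom_const_zero[OF C.Hom_module[OF t(1) x0] yx(3)] t(3)
    by (cases "\<phi> (tr y0 y) x0 = x") auto
qed

lemma cmp0_hom: "cmp0 y x \<in> mod_hom K (OH (orb y) (orb x)) (Hom C y x)"
  unfolding cmp0_def by (rule OH_lift_hom[OF yx step_hom])

lemma cmp0_oi:
  assumes "y0 \<in> orb y" "x0 \<in> orb x" "c \<in> carrier (Hom C y0 x0)"
  shows "cmp0 y x (oi (orb y) (orb x) y0 x0 c) = (if \<phi> (tr y0 y) x0 = x then \<psi> (tr y0 y) y0 x0 c else \<zero>\<^bsub>Hom C y x\<^esub>)"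
  unfolding cmp0_def by (subst OH_lift_oi[OF yx step_hom assms]) simp_all

text \<open>The same cancellation as in \<open>oc_act_left\<close>; by invariance the component
  depends on the class only.\<close>

lemma cmp0_act:
  assumes s: "s \<in> carrier G" and f: "f \<in> carrier (OH (orb y) (orb x))"
  shows "cmp0 y x (oact (orb y) (orb x) s f) = cmp0 y x f"
proof (rule OH_hom_eq[OF yx mod_hom_comp[OF oact_hom[OF yx(1,2) s] cmp0_hom] cmp0_hom _ f])
  fix y0 x0 c assume c: "y0 \<in> orb y" "x0 \<in> orb x" "c \<in> carrier (Hom C y0 x0)"
  note t = tr_y[OF c(1)]
  have x0: "x0 \<in> Ob C" by (rule orb_Ob[OF x c(2)])
  note sc = Ob_B_act[OF yx(1) c(1) s] Ob_B_act[OF yx(2) c(2) s] mor_closed[OF s t(1) x0 c(3)]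
  have tr: "tr (\<phi> s y0) y = tr y0 y \<otimes>\<^bsub>G\<^esub> inv\<^bsub>G\<^esub> s" by (rule tr_act_left[OF t(1,4) s])
  have ts: "tr y0 y \<otimes>\<^bsub>G\<^esub> inv\<^bsub>G\<^esub> s \<in> carrier G" using t s by simp
  have "\<phi> (tr y0 y \<otimes>\<^bsub>G\<^esub> inv\<^bsub>G\<^esub> s) (\<phi> s x0) = \<phi> (tr y0 y) x0"
    using t s x0 by (simp add: act_mult act_inv)
  moreover have "\<psi> (tr y0 y \<otimes>\<^bsub>G\<^esub> inv\<^bsub>G\<^esub> s) (\<phi> s y0) (\<phi> s x0) (\<psi> s y0 x0 c) = \<psi> (tr y0 y) y0 x0 c"
    using A.mor_mult[OF ts s t(1) x0 c(3)] t s by (simp add: A.m_assoc)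
  ultimately show "cmp0 y x (oact (orb y) (orb x) s (oi (orb y) (orb x) y0 x0 c)) = cmp0 y x (oi (orb y) (orb x) y0 x0 c)"
    by (simp add: oact_oi[OF yx(1,2) s c] cmp0_oi[OF sc] cmp0_oi[OF c] tr)
qed

private lemma cmp0_aug: "f \<in> augOH (orb y) (orb x) \<Longrightarrow> cmp0 y x f = \<zero>\<^bsub>Hom C y x\<^esub>"
  by (rule kg_module.aug_kill[OF kg_OH[OF yx(1,2)] yx(3) cmp0_hom]) (simp_all add: cmp0_act)

lemma cmp_hom: "cmp y x \<in> mod_hom K (Hom B (orb y) (orb x)) (Hom C y x)"
  unfolding cmp_def Hom_B
  by (rule quot_lift_hom[OF OH_module[OF yx(1,2)] augOH_submodule[OF yx(1,2)] yx(3) cmp0_hom cmp0_aug])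

lemma cmp_mc:
  assumes "y0 \<in> orb y" "x0 \<in> orb x" "c \<in> carrier (Hom C y0 x0)"
  shows "cmp y x (mc y0 x0 c) = (if \<phi> (tr y0 y) x0 = x then \<psi> (tr y0 y) y0 x0 c else \<zero>\<^bsub>Hom C y x\<^esub>)"
proof -
  have "oi (orb y) (orb x) y0 x0 c \<in> carrier (OH (orb y) (orb x))" by (rule oi_closed[OF yx(1,2) assms])
  then have "cmp y x (cl (orb y) (orb x) (oi (orb y) (orb x) y0 x0 c)) = cmp0 y x (oi (orb y) (orb x) y0 x0 c)"
    unfolding cmp_def orbit_class_def
    by (intro quot_lift_hom_coset[OF OH_module[OF yx(1,2)] augOH_submodule[OF yx(1,2)] yx(3) cmp0_hom cmp0_aug])
  then show ?thesis using orb_eq[OF y assms(1)] orb_eq[OF x assms(2)] cmp0_oi[OF assms] by (simp add: mc_eq)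
qed

end

text \<open>The class of a morphism ending at \<open>y\<close> has at most one nonzero component,
  and such classes span.\<close>

lemma cmp_finite:
  assumes y: "y \<in> Ob C" and u: "u \<in> Ob B" and f: "f \<in> carrier (Hom B (orb y) u)"
  shows "finite {x \<in> u. cmp y x f \<noteq> \<zero>\<^bsub>Hom C y x\<^esub>}"
proof (rule spanning_finite_support[OF Hom_B_spanning[OF y u] Hom_B_module[OF orb_Ob_B[OF y] u] _ _ _ f])
  show "module K (Hom C y x)" if "x \<in> u" for x using Ob_B_sub[OF u that] y C.Hom_module by blast
  show "cmp y x \<in> mod_hom K (Hom B (orb y) u) (Hom C y x)" if "x \<in> u" for x
    using cmp_hom[OF y] Ob_B_sub[OF u that] by auto
  fix z assume "z \<in> {mc y x c | x c. x \<in> u \<and> c \<in> carrier (Hom C y x)}"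
  then obtain x1 c where z: "z = mc y x1 c" "x1 \<in> u" "c \<in> carrier (Hom C y x1)" by auto
  have x1: "x1 \<in> Ob C" "orb x1 = u" using Ob_B_sub[OF u z(2)] by auto
  have "{x \<in> u. cmp y x z \<noteq> \<zero>\<^bsub>Hom C y x\<^esub>} \<subseteq> {x1}"
    using Ob_B_sub[OF u] cmp_mc[OF y _ orb_self[OF y] _ z(3)] x1 z y by (auto split: if_splits)
  then show "finite {x \<in> u. cmp y x z \<noteq> \<zero>\<^bsub>Hom C y x\<^esub>}" by (rule finite_subset) simp
qed

definition lift_tensor :: "nat \<Rightarrow> 'm \<Rightarrow> ('o \<times> 'o \<Rightarrow> 'c) set list \<Rightarrow> 'o list \<Rightarrow> ('m \<times> 'c list \<Rightarrow> 'k) set" where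
  "lift_tensor n m fs xs = pure_tensor K (HM_coeff LM xs) (HM_homs C xs) m (map (\<lambda>i. cmp (xs ! i) (xs ! Suc i) (fs ! i)) [0..<n])"

text \<open>The sum of the lifts of a generator that start at a representative.\<close>

definition lift_gen :: "nat \<Rightarrow> 'o set list \<times> 'm \<times> ('o \<times> 'o \<Rightarrow> 'c) set list \<Rightarrow> ('o, 'k, 'c, 'm) hm_chain" where
  "lift_gen n = (\<lambda>(us, m, fs). \<lambda>xs\<in>HM_seqs C n.
     if xs ! 0 \<in> Rep \<and> map orb xs = us then lift_tensor n m fs xs else \<zero>\<^bsub>HM_summand K C LM xs\<^esub>)"

lemma lift_tensor_multilin:
  assumes xs: "xs \<in> HM_seqs C n"
  shows "multilin K (HM_coeff M (map orb xs)) (HM_homs B (map orb xs)) (HM_summand K C LM xs) (\<lambda>m fs. lift_tensor n m fs xs)"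
proof -
  have l: "length xs = Suc n" "\<And>i. i \<le> n \<Longrightarrow> xs ! i \<in> Ob C" using xs by (auto simp: HM_seqs_iff)
  show ?thesis
    unfolding lift_tensor_def HM_summand_def coeff_LM[OF xs, symmetric]
    using l by (intro multilin_map[OF pure_tensor_multilin[OF K X.coeff_module[OF xs] X.homs_module[OF xs]] _ _ mod_hom_id])
      (auto simp: HM_homs_nth intro!: cmp_hom)
qed

lemma lift_tensor_zero:
  assumes xs: "xs \<in> HM_seqs C n" and m: "m \<in> carrier (HM_coeff M (map orb xs))" and fs: "fs \<in> listset (map carrier (HM_homs B (map orb xs)))"
    and i: "i < n" "cmp (xs ! i) (xs ! Suc i) (fs ! i) = \<zero>\<^bsub>Hom C (xs ! i) (xs ! Suc i)\<^esub>"
  shows "lift_tensor n m fs xs = \<zero>\<^bsub>HM_summand K C LM xs\<^esub>"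
proof -
  have l: "length xs = Suc n" "\<And>i. i \<le> n \<Longrightarrow> xs ! i \<in> Ob C" using xs by (auto simp: HM_seqs_iff)
  have "map (\<lambda>i. cmp (xs ! i) (xs ! Suc i) (fs ! i)) [0..<n] \<in> listset (map carrier (HM_homs C xs))"
    using fs l mod_hom_closed[OF cmp_hom] by (simp add: HM_homs_listset[of _ n])
  then show ?thesis
    unfolding lift_tensor_def HM_summand_def
    using l m i X.homs_module[OF xs, of i]
    by (intro multilin_zero_slot[OF pure_tensor_multilin[OF K X.coeff_module[OF xs] X.homs_module[OF xs]], where i = i])
       (simp_all add: coeff_LM[OF xs] HM_homs_nth X.summand_module[OF xs, unfolded HM_summand_def coeff_LM[OF xs]])
qed

lemma lift_gen_multilin:
  assumes us: "us \<in> HM_seqs B n"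
  shows "multilin K (HM_coeff M us) (HM_homs B us) (X.chain n) (\<lambda>m fs. lift_gen n (us, m, fs))"
  unfolding HM_chain_def
proof (rule multilin_dsumI[OF K X.summand_module Y.coeff_module[OF us] Y.homs_module[OF us]])
  show comp: "multilin K (HM_coeff M us) (HM_homs B us) (HM_summand K C LM xs) (\<lambda>m fs. lift_gen n (us, m, fs) xs)"
    if xs: "xs \<in> HM_seqs C n" for xs
    using lift_tensor_multilin[OF xs] multilin_zero[OF Y.coeff_module[OF us] Y.homs_module[OF us] X.summand_module[OF xs]] xs
    by (cases "xs ! 0 \<in> Rep \<and> map orb xs = us") (auto simp: lift_gen_def)
  fix m fs assume m: "m \<in> carrier (HM_coeff M us)" and fs: "fs \<in> listset (map carrier (HM_homs B us))"
  have lu: "length us = Suc n" "\<And>i. i \<le> n \<Longrightarrow> us ! i \<in> Ob B" using us by (auto simp: HM_seqs_iff)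
  \<comment> \<open>The possible continuations of a lift after \<open>y\<close> at position
    \<open>i\<close>. The conditions on \<open>i\<close> and \<open>y\<close> sit inside the set so
    that it is finite for all \<open>i\<close> and \<open>y\<close>, as \<open>finite_paths\<close>
    requires.\<close>
  define S where "S i y = {x \<in> us ! Suc i. i < n \<and> y \<in> Ob C \<and> orb y = us ! i \<and> cmp y x (fs ! i) \<noteq> \<zero>\<^bsub>Hom C y x\<^esub>}" for i y
  have fin: "finite (S i y)" for i y
  proof (cases "i < n \<and> y \<in> Ob C \<and> orb y = us ! i")
    case True
    then have "fs ! i \<in> carrier (Hom B (orb y) (us ! Suc i))" using fs lu by (simp add: HM_homs_listset[of us n])
    from cmp_finite[OF _ _ this] show ?thesis using True lu by (simp add: S_def)
  next
    case False then show ?thesis by (auto simp: S_def)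
  qed
  have "{xs \<in> HM_seqs C n. lift_gen n (us, m, fs) xs \<noteq> \<zero>\<^bsub>HM_summand K C LM xs\<^esub>}
    \<subseteq> {xs. length xs = Suc n \<and> xs ! 0 \<in> {rep (us ! 0)} \<and> (\<forall>i<n. xs ! Suc i \<in> S i (xs ! i))}"
  proof
    fix xs assume "xs \<in> {xs \<in> HM_seqs C n. lift_gen n (us, m, fs) xs \<noteq> \<zero>\<^bsub>HM_summand K C LM xs\<^esub>}"
    then have xs: "xs \<in> HM_seqs C n" and *: "xs ! 0 \<in> Rep" "map orb xs = us" and nz: "lift_tensor n m fs xs \<noteq> \<zero>\<^bsub>HM_summand K C LM xs\<^esub>"
      by (auto simp: lift_gen_def split: if_splits)
    have l: "length xs = Suc n" "\<And>i. i \<le> n \<Longrightarrow> xs ! i \<in> Ob C" using xs by (auto simp: HM_seqs_iff)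
    have o: "orb (xs ! i) = us ! i" if "i \<le> n" for i using that l unfolding *(2)[symmetric] by simp
    have "xs ! Suc i \<in> S i (xs ! i)" if "i < n" for i
      using that lift_tensor_zero[OF xs, of m fs i] m fs nz l o[of i] o[of "Suc i"] orb_self[of "xs ! Suc i"]
      unfolding *(2) S_def by auto
    moreover have "xs ! 0 = rep (us ! 0)" using Rep_eq[OF *(1)] o[of 0] by simp
    ultimately show "xs \<in> {xs. length xs = Suc n \<and> xs ! 0 \<in> {rep (us ! 0)} \<and> (\<forall>i<n. xs ! Suc i \<in> S i (xs ! i))}"
      using l by simp
  qed
  then have "finite {xs \<in> HM_seqs C n. lift_gen n (us, m, fs) xs \<noteq> \<zero>\<^bsub>HM_summand K C LM xs\<^esub>}"
    by (rule finite_subset) (rule finite_paths[OF _ fin], simp)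
  moreover have "lift_gen n (us, m, fs) \<in> extensional (HM_seqs C n)" by (simp add: lift_gen_def)
  ultimately show "lift_gen n (us, m, fs) \<in> carrier (dsum (HM_seqs C n) (HM_summand K C LM))"
    using multilin_closed[OF comp m fs] by (simp add: dsum_carrier_iff[OF K X.summand_module])
qed

text \<open>Unique lifting: a tuple over the same orbits that starts at the representative, but is
  not the tuple of objects of \<open>std n t\<close>, has a vanishing component and contributes
  nothing.\<close>

lemma lift_gen_pgen:
  assumes t: "t \<in> HM_gens C LM n" shows "lift_gen n (pgen n t) = X.gen n (std n t)"
proof -
  obtain xs m cs where t_eq: "t = (xs, m, cs)" by (cases t)
  have l: "length xs = Suc n" "length cs = n" and ob: "\<And>i. i \<le> n \<Longrightarrow> xs ! i \<in> Ob C"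
    and hc: "\<And>i. i < n \<Longrightarrow> cs ! i \<in> carrier (Hom C (xs ! i) (xs ! Suc i))"
    using t unfolding t_eq by (auto simp: HM_gens_iff)
  define g where "g = inv\<^bsub>G\<^esub> (ge (xs ! 0))"
  have g: "g \<in> carrier G" using ge_closed ob by (simp add: g_def)
  have g0: "\<phi> g (xs ! 0) = rep (orb (xs ! 0))" using ge_inv ob by (simp add: g_def)
  let ?xs = "map (\<phi> g) xs" and ?cs = "map (\<lambda>i. \<psi> g (xs ! i) (xs ! Suc i) (cs ! i)) [0..<n]"
  let ?fs = "map (\<lambda>i. mc (xs ! i) (xs ! Suc i) (cs ! i)) [0..<n]"
  have std: "std n t = (?xs, m, ?cs)" by (simp add: t_eq std_def tgen_def g_def)
  have xs': "?xs \<in> HM_seqs C n" using l ob g by (simp add: HM_seqs_iff)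
  have orbs: "map orb ?xs = map orb xs" using l ob g by (intro nth_equalityI) auto
  have R: "?xs ! 0 \<in> Rep" using g0 l ob by (simp add: Rep_def)
  have pg: "m \<in> carrier (HM_coeff M (map orb xs))" "?fs \<in> listset (map carrier (HM_homs B (map orb xs)))"
    using pgen_closed[OF t] unfolding t_eq pgen_def HM_gens_def by auto
  have cmp_eq: "cmp y x (mc (xs ! i) (xs ! Suc i) (cs ! i))
    = (if \<phi> g (xs ! Suc i) = x then \<psi> g (xs ! i) (xs ! Suc i) (cs ! i) else \<zero>\<^bsub>Hom C y x\<^esub>)"
    if "i < n" "y = \<phi> g (xs ! i)" "x \<in> Ob C" "orb x = orb (xs ! Suc i)" for i x y
  proof -
    have o: "xs ! i \<in> orb y" "xs ! Suc i \<in> orb x" "y \<in> Ob C" using that ob[of i] ob[of "Suc i"] g by auto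
    show ?thesis
      using cmp_mc[OF o(3) that(3) o(1,2) hc[OF that(1)]] tr_act[OF g ob[of i]] that by simp
  qed
  have eq: "lift_gen n (pgen n t) zs = X.gen n (std n t) zs" if zs: "zs \<in> HM_seqs C n" for zs
  proof (cases "zs ! 0 \<in> Rep \<and> map orb zs = map orb xs")
    case True
    have lz: "length zs = Suc n" "\<And>i. i \<le> n \<Longrightarrow> zs ! i \<in> Ob C" using zs by (auto simp: HM_seqs_iff)
    have oz: "orb (zs ! i) = orb (xs ! i)" if "i \<le> n" for i
      using that True lz l by (metis less_Suc_eq_le nth_map)
    have z0: "zs ! 0 = ?xs ! 0" using Rep_eq[of "zs ! 0"] True oz[of 0] g0 l by simp
    have lhs: "lift_gen n (pgen n t) zs = lift_tensor n m ?fs zs"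
      using True zs by (simp add: lift_gen_def pgen_def t_eq)
    show ?thesis
    proof (cases "zs = ?xs")
      case zs_eq: True
      have lifts: "map (\<lambda>i. cmp (zs ! i) (zs ! Suc i) (?fs ! i)) [0..<n] = ?cs"
        using l ob g unfolding zs_eq by (intro map_cong refl) (simp add: cmp_eq)
      then show ?thesis
        unfolding lhs lift_tensor_def std lifts using zs zs_eq by (simp add: HM_gen_def dsum_inj_def)
    next
      case False
      \<comment> \<open>A place where \<open>zs\<close> departs from the standard lift: the end of
        the \<open>i\<close>-th morphism is right and its source is wrong, so the component of its
        class there is zero.\<close>
      have "\<exists>i<n. zs ! i = ?xs ! i \<and> zs ! Suc i \<noteq> ?xs ! Suc i"
      proof (rule ccontr)
        assume no: "\<not> ?thesis"
        have "zs ! i = ?xs ! i" if "i \<le> n" for i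
          using that by (induction i) (use z0 no in auto)
        then show False using False lz l by (metis length_map less_Suc_eq_le nth_equalityI)
      qed
      then obtain i where i: "i < n" "zs ! i = ?xs ! i" "zs ! Suc i \<noteq> ?xs ! Suc i" by blast
      have z: "cmp (zs ! i) (zs ! Suc i) (?fs ! i) = \<zero>\<^bsub>Hom C (zs ! i) (zs ! Suc i)\<^esub>"
        using i l lz oz[of "Suc i"] cmp_eq[of i "zs ! i" "zs ! Suc i"] by auto
      have "lift_tensor n m ?fs zs = \<zero>\<^bsub>HM_summand K C LM zs\<^esub>"
        by (intro lift_tensor_zero[OF zs _ _ i(1) z]) (simp_all add: pg True)
      then show ?thesis using lhs zs False by (simp add: std HM_gen_def dsum_inj_def)
    qed
  next
    case False
    then have "zs \<noteq> ?xs" using R orbs by metis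
    then show ?thesis
      using zs False unfolding std by (auto simp: lift_gen_def pgen_def t_eq HM_gen_def dsum_inj_def simp del: map_map)
  qed
  show ?thesis
  proof (rule extensionalityI[OF _ _ eq])
    show "lift_gen n (pgen n t) \<in> extensional (HM_seqs C n)" by (simp add: lift_gen_def pgen_def t_eq)
    show "X.gen n (std n t) \<in> extensional (HM_seqs C n)" unfolding std by (simp add: HM_gen_def dsum_inj_def)
  qed
qed

text \<open>The orbit sum of a chain factors through \<open>eps\<close>.\<close>

lemma eps_kernel:
  assumes x: "x \<in> carrier (X.chain n)" and z: "eps n x = \<zero>\<^bsub>Y.chain n\<^esub>"
  shows "rp.orbit_sum n x = \<zero>\<^bsub>X.chain n\<^esub>"
proof -
  have lift: "HM_lift K B M n (X.chain n) (lift_gen n) \<in> mod_hom K (Y.chain n) (X.chain n)"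
    by (rule Y.HM_lift_hom[OF X.chain_module lift_gen_multilin])
  have "rp.orbit_sum n x = HM_lift K B M n (X.chain n) (lift_gen n) (eps n x)"
  proof (rule X.chain_hom_eq[OF X.chain_module orbit_sum_hom mod_hom_comp[OF eps_hom lift] _ x])
    fix t assume t: "t \<in> HM_gens C LM n"
    show "rp.orbit_sum n (X.gen n t) = HM_lift K B M n (X.chain n) (lift_gen n) (eps n (X.gen n t))"
      by (simp add: orbit_sum_gen[OF t] eps_gen[OF t] Y.HM_lift_gen[OF X.chain_module lift_gen_multilin pgen_closed[OF t]] lift_gen_pgen[OF t])
  qed
  then show ?thesis using z mod_hom_zero[OF Y.chain_module X.chain_module lift] by simp
qed

sublocale res: kg_resolution G K X.chain X.hbd act Y.chain Y.hbd eps trunc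
  by (intro kg_resolution.intro kg_resolution_axioms.intro kg_complex.intro kg_chain X.hbd_hom X.hbd_hbd hbd_act
      rp.relatively_projective_axioms Y.chain_module Y.hbd_hom eps_hom eps_surj eps_hbd eps_act eps_kernel)

end

theorem theorem3p10:
  fixes K :: "('k, 'z) ring_scheme"
    and G :: "('g, 'y) monoid_scheme"
    and C :: "('o, 'k, 'c) kcat"
    and \<phi> :: "'g \<Rightarrow> 'o \<Rightarrow> 'o"
    and \<psi> :: "'g \<Rightarrow> 'o \<Rightarrow> 'o \<Rightarrow> 'c \<Rightarrow> 'c"
    and M :: "('o set, 'k, ('o \<times> 'o \<Rightarrow> 'c) set, 'm) bimod"
  assumes "field K"
    and "k_category K C"
    and "free_category_action K G C \<phi> \<psi>"
    and "bimodule K (quot_cat K G C \<phi> \<psi>) M"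
  shows "\<exists>(E :: nat \<Rightarrow> int \<Rightarrow> int \<Rightarrow> ('k, ('g, 'o, 'k, 'c, 'm) page_elem) module) d.
    spectral_sequence K E d \<and> first_quadrant E \<and>
    (\<forall>p q. mod_isomorphic K (E 2 (int p) (int q))
       (group_homology G (HM_homology K C (lift_bimod K G C \<phi> \<psi> M) q)
         (HM_homology_act K C (lift_bimod K G C \<phi> \<psi> M) \<phi> \<psi> q) p)) \<and>
    converges_to K E (HM_homology K (quot_cat K G C \<phi> \<psi>) M)"
proof -
  have "cring K" using assms(1) by (simp add: field_def domain_def)
  then interpret galois_bimodule K G C \<phi> \<psi> M
    using assms by (intro galois_bimodule.intro galois.intro galois_axioms.intro)
  show ?thesis
    using res.spectral_sequence_exists unfolding HM_homology_def HM_homology_act_def[abs_def] .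
qed

end
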